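(* Let $k$ be a positive integer. For all integers $n\ge k$, all prime powers $q$, all unipotent characters $\chi$ of $\mathrm{SL}_n(q)$, and all regular semisimple elements $g\in \mathrm{SL}_n(q)$ whose characteristic polynomial is a product of exactly $k$ irreducible factors in $\mathbb{F}_q[t]$, we have $$|\chi(g)|\le k!.$$ Moreover, this upper bound is sharp: for every positive integer $k$ there exist $n\ge k$, a prime power $q$, a unipotent character $\chi$ of $\mathrm{SL}_n(q)$, and a regular semisimple element $g\in \mathrm{SL}_n(q)$ whose characteristic polynomial is a product of exactly $k$ irreducible factors in $\mathbb{F}_q[t]$, such that $|\chi(g)|=k!$.
   Context: $\mathrm{SL}_n(q)=\mathrm{SL}_n(\mathbb{F}_q)$. An element of $\mathrm{SL}_n(q)$ is regular semisimple if its characteristic polynomial has $n$ distinct roots in an algebraic closure of $\mathbb{F}_q$. The unipotent characters of $\mathrm{SL}_n(q)$ are the irreducible complex characters that occur as constituents of the Deligne–Lusztig virtual characters $R_T^1$ attached to the trivial characters of maximal tori $T$; for $\mathrm{SL}_n(q)$ these are exactly the irreducible constituents of the permutation character $\mathrm{Ind}_B^{\mathrm{SL}_n(q)}(1)$, where $B$ is the subgroup of upper triangular matrices. *)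

theory Defs
  imports
    "HOL-Algebra.Algebraic_Closure"
    "HOL-Number_Theory.Prime_Powers"
    "Jordan_Normal_Form.VS_Connect"
begin

section \<open>Matrices over a ring given by a carrier\<close>

text \<open>
  The sharpness claim quantifies existentially over the field, so a finite field cannot be a type
  here; it is a ring record of HOL-Algebra. The type of matrices is the one of
  Jordan_Normal_Form, which puts no class constraint on its entries, but the arithmetic of that
  entry is tied to type classes and has to be restated for the operations of a ring record.
\<close>

definition mat_mult_over :: "('a, 'm) ring_scheme \<Rightarrow> 'a mat \<Rightarrow> 'a mat \<Rightarrow> 'a mat" where
  "mat_mult_over R A B = mat (dim_row A) (dim_col B)
     (\<lambda>(i, j). \<Oplus>\<^bsub>R\<^esub>k\<in>{0..<dim_row B}. A $$ (i, k) \<otimes>\<^bsub>R\<^esub> B $$ (k, j))"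

definition one_mat_over :: "('a, 'm) ring_scheme \<Rightarrow> nat \<Rightarrow> 'a mat" where
  "one_mat_over R n = mat n n (\<lambda>(i, j). if i = j then \<one>\<^bsub>R\<^esub> else \<zero>\<^bsub>R\<^esub>)"

definition det_over :: "('a, 'm) ring_scheme \<Rightarrow> 'a mat \<Rightarrow> 'a" where
  "det_over R A = (\<Oplus>\<^bsub>R\<^esub>\<sigma>\<in>{\<sigma>. \<sigma> permutes {0..<dim_row A}}.
     if evenperm \<sigma> then \<Otimes>\<^bsub>R\<^esub>i\<in>{0..<dim_row A}. A $$ (i, \<sigma> i)
     else \<ominus>\<^bsub>R\<^esub> (\<Otimes>\<^bsub>R\<^esub>i\<in>{0..<dim_row A}. A $$ (i, \<sigma> i)))"

definition char_poly_over :: "('a, 'm) ring_scheme \<Rightarrow> 'a mat \<Rightarrow> 'a list" where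
  "char_poly_over R A = det_over (poly_ring R) (mat (dim_row A) (dim_row A)
     (\<lambda>(i, j). (if i = j then X\<^bsub>R\<^esub> else \<zero>\<^bsub>poly_ring R\<^esub>)
        \<ominus>\<^bsub>poly_ring R\<^esub> ring.poly_of_const R (A $$ (i, j))))"


section \<open>The special linear group\<close>

definition SL :: "nat \<Rightarrow> ('a, 'm) ring_scheme \<Rightarrow> 'a mat monoid" where
  "SL n F = \<lparr>carrier = {A \<in> carrier_mat n n. elements_mat A \<subseteq> carrier F \<and> det_over F A = \<one>\<^bsub>F\<^esub>},
     monoid.mult = mat_mult_over F, monoid.one = one_mat_over F n\<rparr>"

definition SL_borel :: "nat \<Rightarrow> ('a, 'm) ring_scheme \<Rightarrow> 'a mat set" where
  "SL_borel n F = {A \<in> carrier (SL n F). \<forall>i<n. \<forall>j<i. A $$ (i, j) = \<zero>\<^bsub>F\<^esub>}"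

text \<open>
  The coefficients of the characteristic polynomial are mapped into the algebraic closure by
  \<^term>\<open>ring.indexed_const F\<close>.
\<close>

definition regular_semisimple :: "nat \<Rightarrow> 'a ring \<Rightarrow> 'a mat \<Rightarrow> bool" where
  "regular_semisimple n F g \<longleftrightarrow> g \<in> carrier (SL n F) \<and>
     card {x. ring.is_root (field.alg_closure F)
                (map (ring.indexed_const F) (char_poly_over F g)) x} = n"

definition product_of_irreducibles :: "'a ring \<Rightarrow> nat \<Rightarrow> 'a list \<Rightarrow> bool" where
  "product_of_irreducibles F k p \<longleftrightarrow>
     (\<exists>fs. length fs = k \<and> set fs \<subseteq> carrier (mult_of (poly_ring F)) \<and>
        factors (mult_of (poly_ring F)) fs p)"


section \<open>Complex characters of a finite group\<close>

definition representation :: "('g, 'm) monoid_scheme \<Rightarrow> nat \<Rightarrow> ('g \<Rightarrow> complex mat) \<Rightarrow> bool" where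
  "representation G d \<rho> \<longleftrightarrow> \<rho> \<in> hom G (units_of (ring_mat TYPE(complex) d ()))"

definition irreducible_representation ::
    "('g, 'm) monoid_scheme \<Rightarrow> nat \<Rightarrow> ('g \<Rightarrow> complex mat) \<Rightarrow> bool" where
  "irreducible_representation G d \<rho> \<longleftrightarrow> representation G d \<rho> \<and> d > 0 \<and>
     (\<forall>W. VectorSpace.subspace class_ring W (module_vec TYPE(complex) d) \<and>
          (\<forall>g\<in>carrier G. \<forall>w\<in>W. \<rho> g *\<^sub>v w \<in> W) \<longrightarrow>
        W = {0\<^sub>v d} \<or> W = carrier_vec d)"

definition irreducible_character :: "('g, 'm) monoid_scheme \<Rightarrow> ('g \<Rightarrow> complex) \<Rightarrow> bool" where
  "irreducible_character G \<chi> \<longleftrightarrow> (\<exists>d \<rho>. irreducible_representation G d \<rho> \<and>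
     (\<forall>g\<in>carrier G. \<chi> g = (\<Sum>i<d. \<rho> g $$ (i, i))))"

definition induced_function ::
    "('g, 'm) monoid_scheme \<Rightarrow> 'g set \<Rightarrow> ('g \<Rightarrow> complex) \<Rightarrow> 'g \<Rightarrow> complex" where
  "induced_function G H \<phi> g =
     (\<Sum>x | x \<in> carrier G \<and> inv\<^bsub>G\<^esub> x \<otimes>\<^bsub>G\<^esub> g \<otimes>\<^bsub>G\<^esub> x \<in> H. \<phi> (inv\<^bsub>G\<^esub> x \<otimes>\<^bsub>G\<^esub> g \<otimes>\<^bsub>G\<^esub> x))
       / of_nat (card H)"

definition class_inner ::
    "('g, 'm) monoid_scheme \<Rightarrow> ('g \<Rightarrow> complex) \<Rightarrow> ('g \<Rightarrow> complex) \<Rightarrow> complex" where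
  "class_inner G \<phi> \<psi> = (\<Sum>g\<in>carrier G. \<phi> g * cnj (\<psi> g)) / of_nat (Coset.order G)"

definition irreducible_constituent ::
    "('g, 'm) monoid_scheme \<Rightarrow> ('g \<Rightarrow> complex) \<Rightarrow> ('g \<Rightarrow> complex) \<Rightarrow> bool" where
  "irreducible_constituent G \<chi> \<psi> \<longleftrightarrow> irreducible_character G \<chi> \<and> class_inner G \<psi> \<chi> \<noteq> 0"

text \<open>
  For the special linear groups the constituents of the Deligne--Lusztig characters of trivial
  characters of maximal tori are the constituents of the permutation character on the cosets of
  the upper triangular subgroup.
\<close>

definition unipotent_character :: "nat \<Rightarrow> ('a, 'm) ring_scheme \<Rightarrow> ('a mat \<Rightarrow> complex) \<Rightarrow> bool" where
  "unipotent_character n F \<chi> \<longleftrightarrow>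
     irreducible_constituent (SL n F) \<chi> (induced_function (SL n F) (SL_borel n F) (\<lambda>_. 1))"

end

theory Submission
  imports Defs "HOL-Library.Poly_Mapping" "HOL-Library.Function_Algebras"
    "HOL-Computational_Algebra.Formal_Power_Series" "HOL-Number_Theory.Residues"
    "HOL-Number_Theory.Pocklington" "Jordan_Normal_Form.DL_Rank"
    "Jordan_Normal_Form.Spectral_Radius"
begin

text \<open>
  Let \<open>h\<^sub>\<mu>(g)\<close> be the number of flags of type \<open>\<mu>\<close> fixed by \<open>g\<close>. The inner product of \<open>h\<^sub>\<mu>\<close> and \<open>h\<^sub>\<nu>\<close>
  counts orbits on pairs of flags, that is, matrices of natural numbers with margins \<open>\<mu>\<close> and \<open>\<nu>\<close>. By the
  identities of Jacobi and Cauchy the Jacobi--Trudi alternants \<open>\<chi>\<^sub>\<beta> = \<Sum>\<sigma>. sign \<sigma> h\<^bsub>\<beta> - \<sigma>\<^esub>\<close> with distinct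
  \<open>\<beta>\<close> have norm 1, and every constituent of the permutation character on complete flags has nonzero
  inner product with one of them, hence the same absolute values.

  If \<open>g\<close> is regular semisimple, the space is the direct sum of the kernels of the irreducible factors,
  the invariant subspaces are the partial sums, and \<open>h\<^sub>\<mu>(g)\<close> counts the ways to distribute the factors
  over the steps of the flag. In the alternant this amounts to the removal of rim hooks whose lengths are
  the degrees, in the form of beads moved down an abacus. With the largest of \<open>k\<close> degrees \<open>d\<close> removed
  first, there are at most \<open>n / d \<le> k\<close> choices, which gives \<open>k!\<close> by induction. If all degrees are
  \<open>D \<ge> k\<close>, the rectangle with \<open>k\<close> rows of length \<open>D\<close> attains the bound. An element of this kind is the
  companion matrix of a product of polynomials \<open>t\<^sup>D - a\<close> for a prime \<open>D\<close>, over a prime field of order 1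
  modulo \<open>D\<close>.
\<close>

section \<open>Fillings and alternants\<close>

text \<open>The irreducible characters are never constructed. Two facts about an irreducible
  character and an alternant suffice: their inner product is an integer, because that with a
  permutation character is a sum of dimensions of spaces fixed by stabilizers, and the alternant has
  norm 0 or 1. If the integer is nonzero, the alternant is the irreducible character up to a factor
  of absolute value 1. Orbits on pairs of flags are as for GL, since rescaling one basis vector
  corrects a determinant and moves no flag spanned by the basis. For a regular semisimple element
  the distinct roots only bound \<open>n\<close> by the sum of the degrees, and each kernel is only
  known to be nonzero; counting elements turns this into the direct sum decomposition. In the sharp
  example the determinant prescribes the product of the constants \<open>a\<close>, while none of
  them may be a \<open>D\<close>-th power. As powers of a generator, all but one have exponent 1
  modulo \<open>D\<close>, and the exponent of the last is then \<open>-(k - 1)\<close>;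
  \<open>2 \<le> k < D\<close> keeps it away from 0 and 1.\<close>

fun fillings :: "nat \<Rightarrow> nat list \<Rightarrow> (nat \<Rightarrow> int) \<Rightarrow> int" where
  "fillings m [] \<mu> = (if \<forall>i<m. \<mu> i = 0 then 1 else 0)"
| "fillings m (d # ds) \<mu> = (\<Sum>i<m. fillings m ds (\<mu>(i := \<mu> i - int d)))"

text \<open>For \<open>f = fillings m ds\<close> this is the coefficient of \<open>x^\<beta>\<close>
  in the Vandermonde alternant times the product of the power sums \<open>p_d\<close>, hence by
  Frobenius, up to sign, a value of a symmetric group character, or 0. The entries of
  \<open>\<beta>\<close> are beads, the parts of a partition shifted by 0, ..., m - 1; the term of
  the identity undoes the shift. Arguments are integers because the other terms may leave the
  nonnegative range.\<close>

definition alternate :: "nat \<Rightarrow> ((nat \<Rightarrow> int) \<Rightarrow> 'a::comm_ring_1) \<Rightarrow> (nat \<Rightarrow> int) \<Rightarrow> 'a" where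
  "alternate m f \<beta> = (\<Sum>\<sigma> | \<sigma> permutes {..<m}. of_int (sign \<sigma>) * f (\<lambda>i. \<beta> i - int (\<sigma> i)))"

lemma fillings_permute:
  assumes "\<pi> permutes {..<m}"
  shows "fillings m ds (\<mu> \<circ> \<pi>) = fillings m ds \<mu>"
proof (induction ds arbitrary: \<mu>)
  case Nil
  have "(\<forall>i<m. \<mu> (\<pi> i) = 0) \<longleftrightarrow> (\<forall>i<m. \<mu> i = 0)"
    using permutes_in_image[OF assms] permutes_surj[OF assms] by (metis lessThan_iff surjD)
  then show ?case by simp
next
  case (Cons d ds)
  have upd: "(\<mu> \<circ> \<pi>)(i := \<mu> (\<pi> i) - int d) = (\<mu>(\<pi> i := \<mu> (\<pi> i) - int d)) \<circ> \<pi>" for i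
    using permutes_inj[OF assms] by (auto simp: fun_eq_iff inj_def)
  then have "fillings m (d # ds) (\<mu> \<circ> \<pi>) = (\<Sum>i<m. fillings m ds (\<mu>(\<pi> i := \<mu> (\<pi> i) - int d)))"
    by (simp only: fillings.simps comp_apply) (simp only: upd Cons)
  also have "\<dots> = (\<Sum>i<m. fillings m ds (\<mu>(i := \<mu> i - int d)))"
    by (rule sum.reindex_bij_betw[OF permutes_imp_bij[OF assms]])
  finally show ?case by (simp only: fillings.simps)
qed

lemma fillings_eq_0_if_negative: "i < m \<Longrightarrow> \<mu> i < 0 \<Longrightarrow> fillings m ds \<mu> = 0"
proof (induction ds arbitrary: \<mu>)
  case (Cons d ds)
  show ?case by (simp, intro sum.neutral ballI Cons.IH) (use Cons.prems in auto)
qed auto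

lemma fillings_eq_0_if_sum_neq:
  "(\<Sum>i<m. \<mu> i) \<noteq> int (sum_list ds) \<Longrightarrow> fillings m ds \<mu> = 0"
proof (induction ds arbitrary: \<mu>)
  case (Cons d ds)
  show ?case
  proof (simp, intro sum.neutral ballI Cons.IH)
    fix i assume i: "i \<in> {..<m}"
    have "(\<Sum>j<m. (\<mu>(i := \<mu> i - int d)) j) = (\<Sum>j<m. \<mu> j - (if j = i then int d else 0))"
      by (intro sum.cong) auto
    also have "\<dots> = (\<Sum>j<m. \<mu> j) - int d"
      using i by (simp add: sum_subtractf)
    finally show "(\<Sum>j<m. (\<mu>(i := \<mu> i - int d)) j) \<noteq> int (sum_list ds)"
      using Cons.prems by simp
  qed
qed (auto intro: ccontr)

text \<open>The Murnaghan-Nakayama rule: multiplication by \<open>p_d\<close> raises one exponent by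
  \<open>d\<close>, so on the side of coefficients one bead moves down by \<open>d\<close>. The
  beads are not sorted again, which keeps the signs implicit.\<close>

lemma alternate_fillings_Cons:
  "alternate m (fillings m (d # ds)) \<beta> = (\<Sum>i<m. alternate m (fillings m ds) (\<beta>(i := \<beta> i - int d)))"
proof -
  have *: "(\<lambda>j. \<beta> j - int (\<sigma> j))(i := \<beta> i - int (\<sigma> i) - int d) =
      (\<lambda>j. (\<beta>(i := \<beta> i - int d)) j - int (\<sigma> j))" for \<sigma> i
    by auto
  show ?thesis
    unfolding alternate_def fillings.simps sum_distrib_left * by (rule sum.swap)
qed

lemma alternate_cong:
  assumes "\<And>\<mu> \<nu>. (\<And>i. i < m \<Longrightarrow> \<mu> i = \<nu> i) \<Longrightarrow> f \<mu> = f \<nu>" "\<And>i. i < m \<Longrightarrow> \<beta> i = \<gamma> i"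
  shows "alternate m f \<beta> = alternate m f \<gamma>"
  unfolding alternate_def by (intro sum.cong refl arg_cong2[where f = "(*)"] assms(1)) (simp add: assms(2))

lemma alternate_permute:
  assumes \<pi>: "\<pi> permutes {..<m}" and f: "\<And>\<mu>. f (\<mu> \<circ> \<pi>) = f \<mu>"
  shows "alternate m f (\<beta> \<circ> \<pi>) = of_int (sign \<pi>) * alternate m f \<beta>"
proof -
  have perm: "permutation \<pi>" using \<pi> permutation_permutes by blast
  have "alternate m f (\<beta> \<circ> \<pi>) =
      (\<Sum>\<sigma> | \<sigma> permutes {..<m}. of_int (sign (\<sigma> \<circ> \<pi>)) * f (\<lambda>i. (\<beta> \<circ> \<pi>) i - int ((\<sigma> \<circ> \<pi>) i)))"
    unfolding alternate_def by (rule sum_permutations_compose_right[OF \<pi>])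
  also have "\<dots> = (\<Sum>\<sigma> | \<sigma> permutes {..<m}. of_int (sign \<pi>) * (of_int (sign \<sigma>) * f (\<lambda>i. \<beta> i - int (\<sigma> i))))"
  proof (intro sum.cong refl)
    fix \<sigma> assume "\<sigma> \<in> {\<sigma>. \<sigma> permutes {..<m}}"
    then have "permutation \<sigma>" using permutation_permutes by blast
    then have s: "sign (\<sigma> \<circ> \<pi>) = sign \<sigma> * sign \<pi>" using perm by (rule sign_compose)
    have "f (\<lambda>i. (\<beta> \<circ> \<pi>) i - int ((\<sigma> \<circ> \<pi>) i)) = f (\<lambda>i. \<beta> i - int (\<sigma> i))"
      using f[of "\<lambda>i. \<beta> i - int (\<sigma> i)"] by (simp add: comp_def)
    then show "of_int (sign (\<sigma> \<circ> \<pi>)) * f (\<lambda>i. (\<beta> \<circ> \<pi>) i - int ((\<sigma> \<circ> \<pi>) i)) =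
      of_int (sign \<pi>) * (of_int (sign \<sigma>) * f (\<lambda>i. \<beta> i - int (\<sigma> i)))"
      by (simp only: s of_int_mult mult_ac)
  qed
  finally show ?thesis by (simp add: alternate_def sum_distrib_left)
qed

lemma alternate_fillings_eq_0_if_not_inj:
  assumes "\<not> inj_on \<beta> {..<m}"
  shows "alternate m (fillings m ds) \<beta> = 0"
proof -
  obtain i j where ij: "i < m" "j < m" "i \<noteq> j" "\<beta> i = \<beta> j"
    using assms by (auto simp: inj_on_def)
  have \<pi>: "transpose i j permutes {..<m}" using ij by (simp add: permutes_swap_id)
  \<comment> \<open>Exchanging the two equal beads fixes \<open>\<beta>\<close> and changes the
    sign, so the value is its own negative.\<close>
  have "\<beta> \<circ> transpose i j = \<beta>" using ij by (auto simp: fun_eq_iff transpose_def)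
  then show ?thesis
    using alternate_permute[OF \<pi>, of "fillings m ds" \<beta>] fillings_permute[OF \<pi>] ij by (simp add: sign_swap_id)
qed

lemma alternate_fillings_eq_0_if_negative:
  assumes "i < m" "\<beta> i < 0"
  shows "alternate m (fillings m ds) \<beta> = 0"
proof -
  have "fillings m ds (\<lambda>j. \<beta> j - int (\<sigma> j)) = 0" for \<sigma>
    by (rule fillings_eq_0_if_negative[OF assms(1)]) (use assms(2) in simp)
  then show ?thesis by (simp add: alternate_def)
qed

section \<open>Beads moved down an abacus\<close>

lemma sum_lessThan_card_le_sum:
  fixes A :: "nat set"
  assumes "finite A"
  shows "\<Sum>{..<card A} \<le> \<Sum>A"
  using assms
proof (induction "card A" arbitrary: A)
  case (Suc c)
  then have ne: "A \<noteq> {}" by auto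
  have "A \<subseteq> {..Max A}" using Suc.prems by auto
  then have "card A \<le> Suc (Max A)" using card_mono[of "{..Max A}" A] by simp
  then have M: "c \<le> Max A" using Suc by simp
  have "card (A - {Max A}) = c" using Suc ne by simp
  then have "\<Sum>{..<c} \<le> \<Sum>(A - {Max A})" using Suc.hyps(1)[of "A - {Max A}"] Suc.prems by auto
  moreover have "\<Sum>A = Max A + \<Sum>(A - {Max A})" using Suc.prems ne by (intro sum.remove) auto
  ultimately show ?case using M Suc.hyps(2)[symmetric] by simp
qed auto

lemma sum_lessThan_le_sum_if_inj:
  fixes \<beta> :: "nat \<Rightarrow> int"
  assumes "inj_on \<beta> {..<m}" "\<And>i. i < m \<Longrightarrow> 0 \<le> \<beta> i"
  shows "(\<Sum>i<m. int i) \<le> (\<Sum>i<m. \<beta> i)"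
proof -
  have inj: "inj_on (nat \<circ> \<beta>) {..<m}"
    using assms by (auto simp: inj_on_def eq_nat_nat_iff)
  have "\<Sum>{..<m} \<le> \<Sum>((nat \<circ> \<beta>) ` {..<m})"
    using sum_lessThan_card_le_sum[of "(nat \<circ> \<beta>) ` {..<m}"] unfolding card_image[OF inj] by simp
  also have "\<dots> = (\<Sum>i<m. nat (\<beta> i))" using sum.reindex[OF inj, of id] by simp
  finally have "int (\<Sum>{..<m}) \<le> int (\<Sum>i<m. nat (\<beta> i))" by linarith
  then show ?thesis using assms(2) by simp
qed

lemma alternate_fillings_le_fact:
  assumes "sorted_wrt (\<ge>) ds" "0 \<notin> set ds" "\<And>i. i < m \<Longrightarrow> 0 \<le> \<beta> i"
    and "(\<Sum>i<m. \<beta> i) = int (sum_list ds) + (\<Sum>i<m. int i)"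
  shows "\<bar>alternate m (fillings m ds) \<beta>\<bar> \<le> fact (length ds)"
  using assms
proof (induction ds arbitrary: \<beta>)
  case Nil
  define S where "S = {\<sigma>. \<sigma> permutes {..<m} \<and> (\<forall>i<m. \<beta> i = int (\<sigma> i))}"
  \<comment> \<open>Without parts left, a term survives only for a permutation that agrees with
    \<open>\<beta>\<close> on \<open>{..<m}\<close>, and there is at most one.\<close>
  have "\<sigma> = \<tau>" if "\<sigma> \<in> S" "\<tau> \<in> S" for \<sigma> \<tau>
  proof
    fix i show "\<sigma> i = \<tau> i"
      using that unfolding S_def by (cases "i < m") (auto simp: permutes_def)
  qed
  then have "card S \<le> 1" by (metis One_nat_def card.infinite card_le_Suc0_iff_eq le_SucI le_zero_eq nle_le)
  have "alternate m (fillings m []) \<beta> = (\<Sum>\<sigma> | \<sigma> permutes {..<m}. if \<sigma> \<in> S then sign \<sigma> else 0)"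
    unfolding alternate_def S_def by (intro sum.cong refl) (auto simp: sign_def)
  also have "\<dots> = sum sign ({\<sigma>. \<sigma> permutes {..<m}} \<inter> S)"
    by (simp add: sum.If_cases finite_permutations)
  also have "{\<sigma>. \<sigma> permutes {..<m}} \<inter> S = S" by (auto simp: S_def)
  finally have "\<bar>alternate m (fillings m []) \<beta>\<bar> \<le> (\<Sum>\<sigma>\<in>S. \<bar>sign \<sigma>\<bar>)" by (simp del: abs_sign fillings.simps)
  also have "\<dots> = int (card S)" by simp
  finally show ?case using \<open>card S \<le> 1\<close> by (simp del: fillings.simps)
next
  case (Cons d ds)
  show ?case
  proof (cases "inj_on \<beta> {..<m}")
    case False
    then show ?thesis using alternate_fillings_eq_0_if_not_inj by (simp del: fillings.simps)
  next
    case inj: True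
    \<comment> \<open>The beads that land on a free nonnegative place when moved by
      \<open>d\<close>. All other moves give a repeated or a negative bead and contribute 0.\<close>
    define R where "R = {i. i < m \<and> int d \<le> \<beta> i \<and> \<beta> i - int d \<notin> \<beta> ` {..<m}}"
    have R: "R \<subseteq> {..<m}" "finite R" by (auto simp: R_def intro: finite_subset[of _ "{..<m}"])
    have sum_upd: "(\<Sum>j<m. (\<beta>(i := \<beta> i - int d)) j) = (\<Sum>j<m. \<beta> j) - int d" if "i < m" for i
    proof -
      have "(\<Sum>j<m. (\<beta>(i := \<beta> i - int d)) j) = (\<Sum>j<m. \<beta> j - (if j = i then int d else 0))"
        by (intro sum.cong) auto
      then show ?thesis using that by (simp add: sum_subtractf)
    qed
    have zero: "alternate m (fillings m ds) (\<beta>(i := \<beta> i - int d)) = 0" if i: "i < m" "i \<notin> R" for i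
    proof (cases "int d \<le> \<beta> i")
      case True
      then obtain j where j: "j < m" "\<beta> j = \<beta> i - int d" using i by (auto simp: R_def)
      have "i \<noteq> j" using j Cons.prems(2) by auto
      then show ?thesis
        using j that by (intro alternate_fillings_eq_0_if_not_inj) (auto simp: inj_on_def)
    next
      case False
      then show ?thesis using that by (intro alternate_fillings_eq_0_if_negative[of i]) auto
    qed
    have le: "\<bar>alternate m (fillings m ds) (\<beta>(i := \<beta> i - int d))\<bar> \<le> fact (length ds)" if "i \<in> R" for i
    proof (rule Cons.IH)
      show "(\<Sum>j<m. (\<beta>(i := \<beta> i - int d)) j) = int (sum_list ds) + (\<Sum>j<m. int j)"
        using sum_upd[of i] that Cons.prems(4) by (simp add: R_def)
    qed (use Cons.prems that in \<open>auto simp: R_def\<close>)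
    have "\<bar>alternate m (fillings m (d # ds)) \<beta>\<bar> \<le>
        (\<Sum>i<m. \<bar>alternate m (fillings m ds) (\<beta>(i := \<beta> i - int d))\<bar>)"
      unfolding alternate_fillings_Cons by (rule sum_abs)
    also have "\<dots> = (\<Sum>i\<in>R. \<bar>alternate m (fillings m ds) (\<beta>(i := \<beta> i - int d))\<bar>)"
      using zero R by (intro sum.mono_neutral_right) auto
    also have "\<dots> \<le> of_nat (card R) * fact (length ds)"
      by (rule sum_bounded_above) (rule le)
    finally have *: "\<bar>alternate m (fillings m (d # ds)) \<beta>\<bar> \<le> of_nat (card R) * fact (length ds)" .
    \<comment> \<open>All beads of R can be moved down by d at once, and the result is still a set of m beads.\<close>
    define \<gamma> where "\<gamma> i = \<beta> i - (if i \<in> R then int d else 0)" for i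
    have "inj_on \<gamma> {..<m}"
    proof (rule inj_onI)
      fix i j assume ij: "i \<in> {..<m}" "j \<in> {..<m}" "\<gamma> i = \<gamma> j"
      have "\<beta> i - int d \<noteq> \<beta> j" if "i \<in> R" "j < m" for i j
        using that by (auto simp: R_def image_iff)
      then have "\<beta> i = \<beta> j" using ij unfolding \<gamma>_def by (fastforce split: if_splits)
      then show "i = j" using inj ij by (auto simp: inj_on_def)
    qed
    moreover have "0 \<le> \<gamma> i" if "i < m" for i
      using that Cons.prems(3) by (auto simp: \<gamma>_def R_def)
    \<comment> \<open>The sum of the moved beads is at least that of the bottom configuration, which
      the beads \<open>\<beta>\<close> exceed by the sum of all parts. So \<open>d * card R\<close>
      is at most this sum, and since \<open>d\<close> is the largest part, at most \<open>d\<close>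
      times the number of parts.\<close>
    ultimately have "(\<Sum>i<m. int i) \<le> (\<Sum>i<m. \<gamma> i)" by (rule sum_lessThan_le_sum_if_inj)
    also have "\<dots> = (\<Sum>i<m. \<beta> i) - int (d * card R)"
      using R by (simp add: \<gamma>_def sum_subtractf sum.If_cases Int_absorb1 Collect_conj_eq[symmetric] lessThan_def)
    finally have "int (d * card R) \<le> int (sum_list (d # ds))" using Cons.prems(4) by simp
    then have "d * card R \<le> sum_list (d # ds)" by linarith
    also have "sum_list (d # ds) \<le> (\<Sum>x\<leftarrow>d # ds. d)"
      using Cons.prems(1) sum_list_mono[of "d # ds" "\<lambda>x. x" "\<lambda>x. d"] by auto
    also have "\<dots> = d * length (d # ds)" by (simp add: sum_list_triv)
    finally have "d * card R \<le> d * length (d # ds)" .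
    then have "card R \<le> length (d # ds)" using Cons.prems(2) by (simp only: mult_le_cancel1) auto
    then have "int (card R) * fact (length ds) \<le> int (length (d # ds)) * fact (length ds)"
      by (intro mult_right_mono) auto
    also have "\<dots> = fact (length (d # ds))" by simp
    finally have "of_nat (card R) * fact (length ds) \<le> (fact (length (d # ds)) :: int)" .
    then show ?thesis using * by linarith
  qed
qed

text \<open>Induction over the set \<open>S\<close> of raised beads. A bead outside \<open>S\<close>
  sits at \<open>i < m \<le> D\<close> and would become negative; a bead of \<open>S\<close> falls
  back to its own place, so no sign ever arises. The beads may be lowered in any order, which gives
  the factorial. The rectangle is the case \<open>S = {..<m}\<close>.\<close>

lemma alternate_fillings_rectangle:
  assumes "m \<le> D" "S \<subseteq> {..<m}"
  shows "alternate m (fillings m (replicate (card S) D)) (\<lambda>i. int i + (if i \<in> S then int D else 0)) = fact (card S)"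
  using assms(2)
proof (induction "card S" arbitrary: S)
  case 0
  have "finite S" using 0 finite_subset by blast
  then have S: "S = {}" using 0 by simp
  have "alternate m (fillings m []) int = (\<Sum>\<sigma> | \<sigma> permutes {..<m}. if \<sigma> = id then sign \<sigma> else 0)"
    unfolding alternate_def
  proof (intro sum.cong refl)
    fix \<sigma> assume "\<sigma> \<in> {\<sigma>. \<sigma> permutes {..<m}}"
    then have "(\<forall>i<m. int i - int (\<sigma> i) = 0) \<longleftrightarrow> \<sigma> = id"
      by (auto simp: permutes_def fun_eq_iff)
    then show "of_int (sign \<sigma>) * fillings m [] (\<lambda>i. int i - int (\<sigma> i)) = (if \<sigma> = id then sign \<sigma> else 0)"
      by simp
  qed
  also have "\<dots> = 1" by (simp add: finite_permutations permutes_id sum.delta)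
  finally show ?case using S by (simp del: fillings.simps)
next
  case (Suc c)
  have fin: "finite S" using Suc finite_subset by blast
  let ?\<beta> = "\<lambda>S i. int i + (if i \<in> S then int D else 0)"
  have "alternate m (fillings m (replicate c D)) ((?\<beta> S)(i := ?\<beta> S i - int D)) =
      (if i \<in> S then fact c else 0)" if i: "i < m" for i
  proof (cases "i \<in> S")
    case True
    have "(?\<beta> S)(i := ?\<beta> S i - int D) = ?\<beta> (S - {i})" using True by (auto simp: fun_eq_iff)
    moreover have "card (S - {i}) = c" using True Suc fin by simp
    ultimately show ?thesis using Suc.hyps(1)[of "S - {i}"] Suc.prems True by auto
  next
    case False
    then show ?thesis
      using i assms(1) by (simp add: alternate_fillings_eq_0_if_negative[of i])
  qed
  then have "alternate m (fillings m (D # replicate c D)) (?\<beta> S) = (\<Sum>i<m. if i \<in> S then fact c else 0)"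
    unfolding alternate_fillings_Cons by (intro sum.cong) auto
  also have "\<dots> = (\<Sum>i\<in>S. fact c)"
    using Suc.prems by (simp add: sum.If_cases Int_absorb1)
  also have "\<dots> = fact (Suc c)" by (simp flip: Suc.hyps(2))
  finally show ?case using Suc.hyps(2)[symmetric] by simp
qed

text \<open>Moves by 1 build up standard tableaux, so the value is positive: a move either keeps the
  beads strictly increasing, or makes a bead meet its neighbour or drop below 0, and then
  contributes 0. This shows later that the alternant of the rectangle has a constituent in common
  with the character on complete flags.\<close>

lemma alternate_fillings_ones_pos:
  assumes "strict_mono_on {..<m} \<beta>" "\<And>i. i < m \<Longrightarrow> 0 \<le> \<beta> i"
    and "(\<Sum>i<m. \<beta> i) = int n + (\<Sum>i<m. int i)"
  shows "0 < alternate m (fillings m (replicate n 1)) \<beta>"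
  using assms
proof (induction n arbitrary: \<beta>)
  case 0
  note nonneg0 = 0(2) and mono0 = 0(1)
  have ge: "int i \<le> \<beta> i" if "i < m" for i
    using that
  proof (induction i)
    case 0
    then show ?case using nonneg0 by simp
  next
    case (Suc i)
    have "\<beta> i < \<beta> (Suc i)" using mono0 Suc.prems by (auto simp: strict_mono_on_def)
    then show ?case using Suc by simp
  qed
  have "(\<Sum>i<m. \<beta> i - int i) = 0" using 0(3) by (simp add: sum_subtractf)
  then have "\<forall>i\<in>{..<m}. \<beta> i - int i = 0" using ge by (subst sum_nonneg_eq_0_iff[symmetric]) auto
  then have "alternate m (fillings m []) \<beta> = alternate m (fillings m []) int"
    by (intro alternate_cong) (auto)
  also have "\<dots> = 1" using alternate_fillings_rectangle[of m m "{}"] by simp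
  finally show ?case by (simp del: fillings.simps)
next
  case (Suc n)
  let ?u = "\<lambda>i. \<beta>(i := \<beta> i - int 1)"
  have ge: "int i \<le> \<beta> i" if "i < m" for i
    using that
  proof (induction i)
    case 0
    then show ?case using Suc.prems(2) by simp
  next
    case (Suc i)
    have "\<beta> i < \<beta> (Suc i)" using Suc.prems(1) \<open>strict_mono_on {..<m} \<beta>\<close> by (auto simp: strict_mono_on_def)
    then show ?case using Suc by simp
  qed
  have sum_upd: "(\<Sum>j<m. ?u i j) = int n + (\<Sum>i<m. int i)" if "i < m" for i
  proof -
    have "(\<Sum>j<m. ?u i j) = (\<Sum>j<m. \<beta> j - (if j = i then 1 else 0))" by (intro sum.cong) auto
    then show ?thesis using that Suc.prems(3) by (simp add: sum_subtractf)
  qed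
  have step: "0 < alternate m (fillings m (replicate n 1)) (?u i)"
    if i: "i < m" "0 < \<beta> i" "\<And>j. Suc j = i \<Longrightarrow> \<beta> j \<noteq> \<beta> i - 1" for i
  proof (rule Suc.IH[OF _ _ sum_upd[OF i(1)]])
    show "strict_mono_on {..<m} (?u i)"
    proof (rule strict_mono_onI)
      fix j k assume jk: "j \<in> {..<m}" "k \<in> {..<m}" "j < k"
      have "\<beta> j < \<beta> k" using jk Suc.prems(1) by (auto simp: strict_mono_on_def)
      moreover have "\<beta> j < \<beta> k - 1" if k: "k = i"
      proof -
        obtain l where l: "i = Suc l" using jk k by (cases i) auto
        have "\<beta> j \<le> \<beta> l" using jk l k i Suc.prems(1) by (cases "j = l") (auto simp: strict_mono_on_def order_le_less)
        moreover have "\<beta> l < \<beta> i" using l i Suc.prems(1) by (auto simp: strict_mono_on_def)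
        ultimately show ?thesis using i(3)[of l] l k by auto
      qed
      ultimately show "?u i j < ?u i k" using jk by auto
    qed
  qed (use Suc.prems(2) i in auto)
  have nonneg: "0 \<le> alternate m (fillings m (replicate n 1)) (?u i)" if i: "i < m" for i
  proof (cases "0 < \<beta> i \<and> (\<forall>j. Suc j = i \<longrightarrow> \<beta> j \<noteq> \<beta> i - 1)")
    case True
    then show ?thesis using step[of i] i by auto
  next
    case False
    then consider "\<beta> i = 0" | j where "Suc j = i" "\<beta> j = \<beta> i - 1" using Suc.prems(2)[OF i] by force
    then show ?thesis
    proof cases
      case 1
      then show ?thesis using i by (simp add: alternate_fillings_eq_0_if_negative[of i])
    next
      case 2
      then have "\<not> inj_on (?u i) {..<m}" using i inj_onD[of "?u i" "{..<m}" i j] by auto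
      then show ?thesis using alternate_fillings_eq_0_if_not_inj by fastforce
    qed
  qed
  have "\<exists>i. i < m \<and> int i < \<beta> i"
  proof (rule ccontr)
    assume "\<not> ?thesis"
    then have "(\<Sum>i<m. \<beta> i) \<le> (\<Sum>i<m. int i)" by (intro sum_mono) force
    then show False using Suc.prems(3) by simp
  qed
  \<comment> \<open>The lowest bead that is above its bottom place can move: its lower neighbour is
    at \<open>i - 1\<close> or below, and \<open>\<beta> i - 1 \<ge> i\<close>.\<close>
  then obtain i where i: "i < m" "int i < \<beta> i" and least: "\<And>j. j < i \<Longrightarrow> \<not> (j < m \<and> int j < \<beta> j)"
    using LeastI_ex[of "\<lambda>i. i < m \<and> int i < \<beta> i"] not_less_Least by blast
  have "0 < alternate m (fillings m (replicate n 1)) (?u i)"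
  proof (rule step[OF i(1)])
    show "0 < \<beta> i" using i by linarith
    fix j assume "Suc j = i"
    then show "\<beta> j \<noteq> \<beta> i - 1" using least[of j] i by auto
  qed
  then have "0 < (\<Sum>i<m. alternate m (fillings m (replicate n 1)) (?u i))"
    using i nonneg by (intro sum_pos2[of _ i]) auto
  then show ?case by (simp add: alternate_fillings_Cons del: fillings.simps)
qed

text \<open>A rearrangement inequality: the gap is half of
  \<open>\<Sum>i<m. (int i - int (\<sigma> i))\<^sup>2\<close>.\<close>

lemma sum_mult_permutation_less:
  assumes "\<sigma> permutes {..<m}" "\<sigma> \<noteq> id"
  shows "(\<Sum>i<m. int i * int (\<sigma> i)) < (\<Sum>i<m. int i * int i)"
proof -
  obtain k where k: "\<sigma> k \<noteq> k" using assms(2) by (auto simp: fun_eq_iff)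
  then have "k < m" using assms(1) by (auto simp: permutes_def)
  have "(\<Sum>i<m. int (\<sigma> i) * int (\<sigma> i)) = (\<Sum>i<m. int i * int i)"
    by (rule sum.reindex_bij_betw[OF permutes_imp_bij[OF assms(1)]])
  then have "(\<Sum>i<m. (int i - int (\<sigma> i))\<^sup>2) = 2 * ((\<Sum>i<m. int i * int i) - (\<Sum>i<m. int i * int (\<sigma> i)))"
    by (simp add: power2_eq_square algebra_simps sum.distrib sum_subtractf sum_distrib_left)
  moreover have "0 < (\<Sum>i<m. (int i - int (\<sigma> i))\<^sup>2)"
    using k \<open>k < m\<close> by (intro sum_pos2[of _ k]) auto
  ultimately have "0 < 2 * ((\<Sum>i<m. int i * int i) - (\<Sum>i<m. int i * int (\<sigma> i)))" by simp
  then show ?thesis by simp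
qed

subsection \<open>Orthonormality of the alternants\<close>

text \<open>A Laurent monomial. Integer exponents make multiplication by a monomial a shift of the
  coefficients that is defined everywhere, which is how a sum over \<open>\<beta> - \<sigma>\<close>
  becomes one coefficient of a product.\<close>

definition monom_exp :: "(nat \<Rightarrow> int) \<Rightarrow> (nat \<Rightarrow> int) \<Rightarrow>\<^sub>0 int" where
  "monom_exp \<mu> = Poly_Mapping.single \<mu> 1"

definition unit_exp :: "nat \<Rightarrow> nat \<Rightarrow> int" where
  "unit_exp l = (\<lambda>i. if i = l then 1 else 0)"

lemma monom_exp_mult: "monom_exp \<mu> * monom_exp \<nu> = monom_exp (\<mu> + \<nu>)"
  by (simp add: monom_exp_def mult_single)

lemma monom_exp_0: "monom_exp 0 = 1"
  by (simp add: monom_exp_def)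

lemma monom_exp_power: "monom_exp (unit_exp l) ^ a = monom_exp (\<lambda>i. if i = l then int a else 0)"
proof (induction a)
  case 0
  have "(\<lambda>i. if i = l then int 0 else 0) = 0" by (auto simp: fun_eq_iff)
  then show ?case using monom_exp_0 by simp
next
  case (Suc a)
  have "unit_exp l + (\<lambda>i. if i = l then int a else 0) = (\<lambda>i. if i = l then int (Suc a) else 0)"
    by (auto simp: fun_eq_iff unit_exp_def)
  then show ?case by (simp add: Suc monom_exp_mult)
qed

lemma monom_exp_prod: "(\<Prod>x\<in>A. monom_exp (\<mu> x)) = monom_exp (\<Sum>x\<in>A. \<mu> x)"
proof (induction A rule: infinite_finite_induct)
  case (insert x A)
  show ?case
    unfolding prod.insert[OF insert(1,2)] sum.insert[OF insert(1,2)] insert(3) monom_exp_mult ..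
qed (simp_all only: prod.infinite sum.infinite prod.empty sum.empty monom_exp_0 not_False_eq_True)

lemma lookup_monom_exp: "Poly_Mapping.lookup (monom_exp \<mu>) \<nu> = (if \<mu> = \<nu> then 1 else 0)"
  by (simp add: monom_exp_def lookup_single when_def)

lemma lookup_monom_exp_mult:
  "Poly_Mapping.lookup (monom_exp \<mu> * P) \<nu> = Poly_Mapping.lookup P (\<nu> - \<mu>)"
proof -
  have *: "(x when \<nu> = \<mu> + q) = (x when q = \<nu> - \<mu>)" for q and x :: int
    by (rule when_cong) (auto simp: fun_eq_iff algebra_simps)
  have **: "(1 when \<mu> = l) * x = (x when l = \<mu>)" for l and x :: int by (auto simp: when_def)
  show ?thesis
    unfolding monom_exp_def lookup_mult lookup_single ** Sum_any_when_equal * ..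
qed

lemma lookup_of_int_mult: "Poly_Mapping.lookup (of_int c * P) \<mu> = c * Poly_Mapping.lookup P \<mu>"
proof -
  have nat: "Poly_Mapping.lookup (of_nat n * P) \<mu> = int n * Poly_Mapping.lookup P \<mu>" for n
    by (induction n) (simp_all add: algebra_simps lookup_add)
  show ?thesis using nat by (cases c rule: int_cases2) simp_all
qed

section \<open>Complete symmetric polynomials and Jacobi's identity\<close>

definition geometric :: "'a::comm_ring_1 \<Rightarrow> 'a fps" where
  "geometric x = Abs_fps (\<lambda>a. x ^ a)"

lemma nth_geometric: "fps_nth (geometric x) a = x ^ a"
  by (simp add: geometric_def)

lemma geometric_mult: "geometric x * (1 - fps_const x * fps_X) = 1"
proof (rule fps_ext)
  fix a show "fps_nth (geometric x * (1 - fps_const x * fps_X)) a = fps_nth 1 a"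
    by (cases a) (simp_all add: geometric_def algebra_simps)
qed

text \<open>The degree \<open>z\<close> is an integer because the determinants below have entries
  \<open>complete_sym m (int (g j) - int r)\<close> of negative degree. The set is then empty and
  the entry 0.\<close>

definition exps :: "nat \<Rightarrow> int \<Rightarrow> (nat \<Rightarrow> int) set" where
  "exps m z = {a. (\<forall>i<m. 0 \<le> a i) \<and> (\<forall>i\<ge>m. a i = 0) \<and> (\<Sum>i<m. a i) = z}"

lemma exps_0: "exps 0 z = (if z = 0 then {0} else {})"
  by (auto simp: exps_def fun_eq_iff)

lemma exps_Suc:
  "exps (Suc m) (int r) = (\<Union>s\<le>r. (\<lambda>a. a + (\<lambda>i. if i = m then int s else 0)) ` exps m (int (r - s)))"
proof (intro equalityI subsetI)
  fix a assume a: "a \<in> exps (Suc m) (int r)"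
  have s0: "0 \<le> a m" using a by (simp add: exps_def)
  have sum: "(\<Sum>i<m. a i) + a m = int r" using a by (simp add: exps_def)
  have "0 \<le> (\<Sum>i<m. a i)" using a by (auto simp: exps_def intro: sum_nonneg)
  then have s: "nat (a m) \<le> r" using sum s0 by linarith
  have "a(m := 0) \<in> exps m (int (r - nat (a m)))"
    using a s s0 sum by (auto simp: exps_def of_nat_diff le_Suc_eq not_less_eq_eq)
  moreover have "a = a(m := 0) + (\<lambda>i. if i = m then int (nat (a m)) else 0)"
    using s0 by (auto simp: fun_eq_iff)
  ultimately show "a \<in> (\<Union>s\<le>r. (\<lambda>a. a + (\<lambda>i. if i = m then int s else 0)) ` exps m (int (r - s)))"
    using s by blast
next
  fix a assume "a \<in> (\<Union>s\<le>r. (\<lambda>a. a + (\<lambda>i. if i = m then int s else 0)) ` exps m (int (r - s)))"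
  then show "a \<in> exps (Suc m) (int r)" by (auto simp: exps_def of_nat_diff)
qed

lemma exps_negative:
  assumes "z < 0"
  shows "exps m z = {}"
proof (rule equals0I)
  fix a assume a: "a \<in> exps m z"
  then have "0 \<le> (\<Sum>i<m. a i)" by (intro sum_nonneg) (auto simp: exps_def)
  then show False using a assms by (simp add: exps_def)
qed

lemma finite_exps: "finite (exps m z)"
proof (cases "z < 0")
  case False
  have "finite (exps m (int r))" for r
  proof (induction m arbitrary: r)
    case (Suc m)
    show ?case unfolding exps_Suc by (intro finite_UN_I finite_imageI Suc.IH finite_atMost)
  qed (simp add: exps_0)
  from this[of "nat z"] show ?thesis using False by simp
qed (simp add: exps_negative)

definition complete_sym :: "nat \<Rightarrow> int \<Rightarrow> (nat \<Rightarrow> int) \<Rightarrow>\<^sub>0 int" where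
  "complete_sym m z = (\<Sum>a\<in>exps m z. monom_exp a)"

lemma complete_sym_0: "complete_sym m 0 = 1"
proof -
  have "exps m 0 = {0}"
  proof (intro equalityI subsetI)
    fix a assume a: "a \<in> exps m 0"
    then have "\<forall>i\<in>{..<m}. a i = 0"
      by (subst sum_nonneg_eq_0_iff[symmetric]) (auto simp: exps_def)
    then show "a \<in> {0}" using a by (auto simp: exps_def fun_eq_iff not_less[symmetric])
  qed (auto simp: exps_def)
  then have "complete_sym m 0 = monom_exp 0" unfolding complete_sym_def by (simp only:) (rule sum.insert[of "{}", simplified sum.empty add_0_right], auto)
  then show ?thesis by (simp only: monom_exp_0)
qed

lemma nth_prod_geometric:
  "fps_nth (\<Prod>l<m. geometric (monom_exp (unit_exp l))) r = complete_sym m (int r)"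
proof (induction m arbitrary: r)
  case 0
  then show ?case using monom_exp_0 by (simp add: complete_sym_def exps_0)
next
  case (Suc m)
  let ?e = "\<lambda>s i. if i = m then int s else 0"
  have inj: "inj_on (\<lambda>a. a + ?e s) A" for s A by (auto simp: inj_on_def)
  have "complete_sym (Suc m) (int r) = (\<Sum>s\<le>r. \<Sum>a\<in>(\<lambda>a. a + ?e s) ` exps m (int (r - s)). monom_exp a)"
    unfolding complete_sym_def exps_Suc
  proof (rule sum.UNION_disjoint)
    have "a m = int s" if "a \<in> (\<lambda>a. a + ?e s) ` exps m (int (r - s))" for a s
      using that by (auto simp: exps_def)
    then show "\<forall>i\<in>{..r}. \<forall>j\<in>{..r}. i \<noteq> j \<longrightarrow>
        (\<lambda>a. a + ?e i) ` exps m (int (r - i)) \<inter> (\<lambda>a. a + ?e j) ` exps m (int (r - j)) = {}"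
      by (metis disjoint_iff of_nat_eq_iff)
  qed (auto intro: finite_exps)
  also have "\<dots> = (\<Sum>s\<le>r. complete_sym m (int (r - s)) * monom_exp (unit_exp m) ^ s)"
    by (simp add: sum.reindex[OF inj] complete_sym_def sum_distrib_right monom_exp_power monom_exp_mult)
  also have "\<dots> = (\<Sum>s\<le>r. complete_sym m (int s) * monom_exp (unit_exp m) ^ (r - s))"
    by (rule sum.reindex_bij_witness[of _ "\<lambda>s. r - s" "\<lambda>s. r - s"]) auto
  finally show ?case
    by (simp add: fps_mult_nth Suc nth_geometric atLeast0AtMost)
qed

lemma nth_prod_linear_eq_0:
  assumes "finite S" "card S < r"
  shows "fps_nth (\<Prod>l\<in>S. 1 - fps_const (x l) * fps_X) r = (0 :: 'a::comm_ring_1)"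
  using assms
proof (induction S arbitrary: r rule: finite_induct)
  case (insert l S)
  then obtain r' where r: "r = Suc r'" by (cases r) auto
  have "fps_nth (\<Prod>l\<in>S. 1 - fps_const (x l) * fps_X) r = 0" "fps_nth (\<Prod>l\<in>S. 1 - fps_const (x l) * fps_X) r' = 0"
    using insert r by auto
  then show ?case using insert r by (simp add: algebra_simps)
qed auto

text \<open>
  Jacobi's identity: the alternant of the exponents g factors through the alternant of 0, ..., m-1,
  because multiplying the generating function of the complete symmetric polynomials by all factors
  1 - x_l t except the i-th leaves the geometric series in x_i.
\<close>

lemma alternant_eq_complete_sym:
  fixes g :: "nat \<Rightarrow> nat"
  defines "x \<equiv> \<lambda>l. monom_exp (unit_exp l)"
  shows "det (mat m m (\<lambda>(i, j). x i ^ g j)) =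
    det (mat m m (\<lambda>(i, j). x i ^ j)) * det (mat m m (\<lambda>(r, j). complete_sym m (int (g j) - int r)))"
proof -
  define E where "E i = (\<Prod>l\<in>{..<m} - {i}. 1 - fps_const (x l) * fps_X)" for i
  define EM where "EM = mat m m (\<lambda>(i, r). fps_nth (E i) r)"
  define HM where "HM g = mat m m (\<lambda>(r, j). complete_sym m (int (g j) - int r))" for g
  have power: "x i ^ a = (\<Sum>r<m. fps_nth (E i) r * complete_sym m (int a - int r))" if i: "i < m" for i a
  proof -
    let ?H = "\<Prod>l<m. geometric (x l)"
    have "E i * ?H = geometric (x i) * (\<Prod>l\<in>{..<m} - {i}. (1 - fps_const (x l) * fps_X) * geometric (x l))"
      using i unfolding E_def by (simp add: prod.remove[of "{..<m}" i] prod.distrib mult_ac)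
    also have "(\<Prod>l\<in>{..<m} - {i}. (1 - fps_const (x l) * fps_X) * geometric (x l)) = 1"
      by (intro prod.neutral ballI) (metis geometric_mult mult.commute)
    finally have "x i ^ a = fps_nth (E i * ?H) a" by (simp add: nth_geometric)
    also have "\<dots> = (\<Sum>r=0..a. fps_nth (E i) r * complete_sym m (int (a - r)))"
      by (simp add: fps_mult_nth nth_prod_geometric x_def)
    \<comment> \<open>The range \<open>r \<le> a\<close> is exchanged for \<open>r < m\<close>:
      beyond \<open>a\<close> the complete symmetric polynomial has negative degree, and beyond
      \<open>m - 1\<close> the polynomial \<open>E i\<close>, a product of \<open>m - 1\<close>
      linear factors, has no coefficient.\<close>
    also have "\<dots> = (\<Sum>r\<in>{..a} \<union> {..<m}. fps_nth (E i) r * complete_sym m (int a - int r))"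
      by (intro sum.mono_neutral_cong_left) (auto simp: of_nat_diff complete_sym_def exps_negative)
    also have "\<dots> = (\<Sum>r<m. fps_nth (E i) r * complete_sym m (int a - int r))"
    proof (intro sum.mono_neutral_right ballI)
      fix r assume r: "r \<in> {..a} \<union> {..<m} - {..<m}"
      have "fps_nth (E i) r = 0"
        unfolding E_def using i r by (intro nth_prod_linear_eq_0) auto
      then show "fps_nth (E i) r * complete_sym m (int a - int r) = 0" by simp
    qed auto
    finally show ?thesis .
  qed
  have factor: "mat m m (\<lambda>(i, j). x i ^ g j) = EM * HM g" for g
    by (rule eq_matI) (auto simp: EM_def HM_def power scalar_prod_def atLeast0LessThan)
  have carr: "EM \<in> carrier_mat m m" "HM g \<in> carrier_mat m m" for g
    by (auto simp: EM_def HM_def)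
  \<comment> \<open>The exponents 0, ..., m - 1 evaluate \<open>det EM\<close>: for them the matrix
    of complete symmetric polynomials is unitriangular, so \<open>det EM\<close> is the Vandermonde
    alternant.\<close>
  have "det (HM (\<lambda>j. j)) = prod_list (diag_mat (HM (\<lambda>j. j)))"
    by (rule det_upper_triangular[OF _ carr(2)])
      (auto simp: HM_def upper_triangular_def complete_sym_def exps_negative)
  also have "diag_mat (HM (\<lambda>j. j)) = map (\<lambda>_. complete_sym m 0) [0..<m]"
    by (auto simp: diag_mat_def HM_def)
  also have "complete_sym m 0 = 1" by (rule complete_sym_0)
  finally have "det (HM (\<lambda>j. j)) = 1" by (simp add: prod_list_replicate map_replicate_const)
  then have "det EM = det (mat m m (\<lambda>(i, j). x i ^ j))"
    unfolding factor[of "\<lambda>j. j"] by (simp add: det_mult[OF carr])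
  then show ?thesis
    unfolding factor[of g] det_mult[OF carr] by (simp add: HM_def)
qed

section \<open>Tables with given margins and Cauchy's identity\<close>

definition tables :: "nat \<Rightarrow> (nat \<Rightarrow> int) \<Rightarrow> (nat \<Rightarrow> int) \<Rightarrow> (nat \<Rightarrow> nat \<Rightarrow> nat) set" where
  "tables m \<mu> \<nu> = {M. (\<forall>i j. \<not> (i < m \<and> j < m) \<longrightarrow> M i j = 0) \<and>
     (\<forall>i<m. (\<Sum>j<m. int (M i j)) = \<mu> i) \<and> (\<forall>j<m. (\<Sum>i<m. int (M i j)) = \<nu> j)}"

text \<open>Column \<open>j\<close> of a table is the exponent vector taken from the factor
  \<open>j\<close>, and the row sums are the exponents of the product.\<close>

lemma lookup_prod_complete_sym:
  "Poly_Mapping.lookup (\<Prod>j<m. complete_sym m (\<nu> j)) (\<lambda>i. if i < m then \<mu> i else 0) =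
    int (card (tables m \<mu> \<nu>))"
proof -
  let ?\<mu> = "\<lambda>i. if i < m then \<mu> i else 0"
  let ?F = "\<Pi>\<^sub>E j\<in>{..<m}. exps m (\<nu> j)"
  let ?P = "{f \<in> ?F. (\<Sum>j<m. f j) = ?\<mu>}"
  have sum_app: "(\<Sum>j<m. f j) i = (\<Sum>j<m. f j i)" for f :: "nat \<Rightarrow> nat \<Rightarrow> int" and i
    by (induction m) auto
  have fin: "finite ?F" by (intro finite_PiE finite_exps) auto
  have "(\<Prod>j<m. complete_sym m (\<nu> j)) = (\<Sum>f\<in>?F. monom_exp (\<Sum>j<m. f j))"
    unfolding complete_sym_def monom_exp_prod[symmetric] by (rule prod_sum_PiE) (auto intro: finite_exps)
  then have "Poly_Mapping.lookup (\<Prod>j<m. complete_sym m (\<nu> j)) ?\<mu> =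
      (\<Sum>f\<in>?F. if (\<Sum>j<m. f j) = ?\<mu> then 1 else 0)"
    by (simp only: lookup_sum lookup_monom_exp)
  also have "\<dots> = int (card ?P)" using fin by (simp add: sum.If_cases Int_def)
  also have "card ?P = card (tables m \<mu> \<nu>)"
  proof (rule bij_betw_same_card[of "\<lambda>f i j. if i < m \<and> j < m then nat (f j i) else 0"],
      rule bij_betwI[where g = "\<lambda>M. \<lambda>j\<in>{..<m}. \<lambda>i. int (M i j)"])
    show "(\<lambda>f i j. if i < m \<and> j < m then nat (f j i) else 0) \<in> ?P \<rightarrow> tables m \<mu> \<nu>"
    proof
      fix f assume f: "f \<in> ?P"
      then have f_in: "\<And>j. j < m \<Longrightarrow> f j \<in> exps m (\<nu> j)" by auto
      then have nonneg: "0 \<le> f j i" if "i < m" "j < m" for i j using that by (auto simp: exps_def)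
      have row: "(\<Sum>j<m. f j i) = \<mu> i" if "i < m" for i
        using f sum_app[of f i] that by auto
      show "(\<lambda>i j. if i < m \<and> j < m then nat (f j i) else 0) \<in> tables m \<mu> \<nu>"
        using nonneg row f_in by (auto simp: tables_def exps_def)
    qed
    show "(\<lambda>M. \<lambda>j\<in>{..<m}. \<lambda>i. int (M i j)) \<in> tables m \<mu> \<nu> \<rightarrow> ?P"
      by (auto simp: tables_def exps_def fun_eq_iff sum_app)
    show "(\<lambda>j\<in>{..<m}. \<lambda>i. int (if i < m \<and> j < m then nat (f j i) else 0)) = f" if "f \<in> ?P" for f
    proof (rule ext, rule ext)
      fix j i
      show "(\<lambda>j\<in>{..<m}. \<lambda>i. int (if i < m \<and> j < m then nat (f j i) else 0)) j i = f j i"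
        using that by (auto simp: exps_def PiE_def Pi_def extensional_def restrict_def)
    qed
    show "(\<lambda>i j. if i < m \<and> j < m then nat ((\<lambda>j\<in>{..<m}. \<lambda>i. int (M i j)) j i) else 0) = M" if "M \<in> tables m \<mu> \<nu>" for M
      using that by (auto simp: tables_def fun_eq_iff)
  qed
  finally show ?thesis .
qed

text \<open>Compare the coefficients of \<open>x^\<beta>\<close> in Jacobi's identity for the
  exponents \<open>\<beta>\<close>. In the alternant only permutations with
  \<open>\<beta> \<circ> \<sigma> = \<beta>\<close> on \<open>{..<m}\<close> contribute, so for
  distinct entries only the identity; two equal entries give two equal columns. In the product, the
  Vandermonde factor yields the outer alternation and the determinant of complete symmetric
  polynomials the inner one.\<close>

lemma alternate_tables:
  assumes "\<And>i. i < m \<Longrightarrow> 0 \<le> \<beta> i"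
  shows "alternate m (\<lambda>\<mu>. alternate m (\<lambda>\<nu>. int (card (tables m \<mu> \<nu>))) \<beta>) \<beta> = (if inj_on \<beta> {..<m} then 1 else 0)"
proof -
  define g where "g i = nat (\<beta> i)" for i
  have g: "\<beta> i = int (g i)" if "i < m" for i using assms that by (simp add: g_def)
  define x where "x l = monom_exp (unit_exp l)" for l
  let ?t = "\<lambda>\<mu> i. if i < m then \<mu> i else (0 :: int)"
  let ?P = "{\<sigma>. \<sigma> permutes {..<m}}"
  have perm_eq: "{\<sigma>. \<sigma> permutes {0..<m}} = ?P" by (simp add: atLeast0LessThan)
  have alt: "det (mat m m (\<lambda>(i, j). x i ^ f j)) = (\<Sum>\<sigma>\<in>?P. of_int (sign \<sigma>) * monom_exp (?t (\<lambda>i. int (f (\<sigma> i)))))"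
    for f :: "nat \<Rightarrow> nat"
  proof -
    have sum_t: "(\<Sum>i<m. (\<lambda>k. if k = i then int (h i) else 0)) = ?t (\<lambda>i. int (h i))" for h :: "nat \<Rightarrow> nat"
    proof
      fix k
      have "(\<Sum>i<m'. (\<lambda>k. if k = i then int (h i) else 0)) k = (if k < m' then int (h k) else 0)" for m'
        by (induction m') auto
      then show "(\<Sum>i<m. (\<lambda>k. if k = i then int (h i) else 0)) k = ?t (\<lambda>i. int (h i)) k" .
    qed
    have mono: "(\<Prod>i<m. x i ^ h i) = monom_exp (?t (\<lambda>i. int (h i)))" for h
      unfolding x_def monom_exp_power monom_exp_prod sum_t ..
    have "det (mat m m (\<lambda>(i, j). x i ^ f j)) =
        (\<Sum>\<sigma>\<in>?P. of_int (sign \<sigma>) * (\<Prod>i<m. x i ^ f (\<sigma> i)))"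
      by (subst det_def'[of _ m]) (auto intro!: sum.cong prod.cong simp: atLeast0LessThan sign_def permutes_in_image)
    then show ?thesis by (simp only: mono)
  qed
  have compl: "det (mat m m (\<lambda>(r, j). complete_sym m (int (g j) - int r))) =
      (\<Sum>\<tau>\<in>?P. of_int (sign \<tau>) * (\<Prod>j<m. complete_sym m (\<beta> j - int (\<tau> j))))"
    by (subst det_col[of _ m]) (auto intro!: sum.cong prod.cong simp: atLeast0LessThan sign_def permutes_in_image g)
  have expand: "det (mat m m (\<lambda>(i, j). x i ^ j)) * det (mat m m (\<lambda>(r, j). complete_sym m (int (g j) - int r))) =
     (\<Sum>\<sigma>\<in>?P. \<Sum>\<tau>\<in>?P. of_int (sign \<sigma> * sign \<tau>) *
       (monom_exp (?t (\<lambda>i. int (\<sigma> i))) * (\<Prod>j<m. complete_sym m (\<beta> j - int (\<tau> j)))))"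
    unfolding alt[of "\<lambda>j. j"] compl sum_product by (simp add: mult_ac)
  have "Poly_Mapping.lookup (det (mat m m (\<lambda>(i, j). x i ^ g j))) (?t \<beta>) =
     (\<Sum>\<sigma>\<in>?P. \<Sum>\<tau>\<in>?P. sign \<sigma> * sign \<tau> *
       Poly_Mapping.lookup (\<Prod>j<m. complete_sym m (\<beta> j - int (\<tau> j))) (?t \<beta> - ?t (\<lambda>i. int (\<sigma> i))))"
    unfolding alternant_eq_complete_sym[of m g, folded x_def] expand
      lookup_sum lookup_of_int_mult lookup_monom_exp_mult ..
  also have "\<dots> = (\<Sum>\<sigma>\<in>?P. \<Sum>\<tau>\<in>?P. sign \<sigma> * sign \<tau> *
       int (card (tables m (\<lambda>i. \<beta> i - int (\<sigma> i)) (\<lambda>j. \<beta> j - int (\<tau> j)))))"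
  proof -
    have "?t \<beta> - ?t (\<lambda>i. int (\<sigma> i)) = ?t (\<lambda>i. \<beta> i - int (\<sigma> i))" for \<sigma> by (auto simp: fun_eq_iff)
    then show ?thesis by (simp only: lookup_prod_complete_sym)
  qed
  also have "\<dots> = alternate m (\<lambda>\<mu>. alternate m (\<lambda>\<nu>. int (card (tables m \<mu> \<nu>))) \<beta>) \<beta>"
    by (simp add: alternate_def sum_distrib_left mult_ac)
  finally have lhs: "alternate m (\<lambda>\<mu>. alternate m (\<lambda>\<nu>. int (card (tables m \<mu> \<nu>))) \<beta>) \<beta> =
     Poly_Mapping.lookup (det (mat m m (\<lambda>(i, j). x i ^ g j))) (?t \<beta>)" ..
  show ?thesis
  proof (cases "inj_on \<beta> {..<m}")
    case True
    have "Poly_Mapping.lookup (det (mat m m (\<lambda>(i, j). x i ^ g j))) (?t \<beta>) =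
      (\<Sum>\<sigma>\<in>?P. sign \<sigma> * (if ?t (\<lambda>i. int (g (\<sigma> i))) = ?t \<beta> then 1 else 0))"
      by (simp add: alt lookup_sum lookup_of_int_mult lookup_monom_exp)
    also have "\<dots> = (\<Sum>\<sigma>\<in>?P. if \<sigma> = id then 1 else 0)"
    proof (intro sum.cong refl)
      fix \<sigma> assume \<sigma>: "\<sigma> \<in> ?P"
      have "?t (\<lambda>i. int (g (\<sigma> i))) = ?t \<beta> \<longleftrightarrow> (\<forall>i<m. \<beta> (\<sigma> i) = \<beta> i)"
        using \<sigma> permutes_in_image[of \<sigma> "{..<m}"] by (auto simp: fun_eq_iff g)
      also have "\<dots> \<longleftrightarrow> (\<forall>i<m. \<sigma> i = i)"
        using True \<sigma> permutes_in_image[of \<sigma> "{..<m}"] by (auto simp: inj_on_def)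
      also have "\<dots> \<longleftrightarrow> \<sigma> = id" using \<sigma> by (auto simp: permutes_def fun_eq_iff)
      finally show "sign \<sigma> * (if ?t (\<lambda>i. int (g (\<sigma> i))) = ?t \<beta> then 1 else 0) = (if \<sigma> = id then 1 else 0)"
        by (auto simp: sign_id)
    qed
    also have "\<dots> = 1" by (simp add: finite_permutations permutes_id)
    finally show ?thesis using True lhs by simp
  next
    case False
    then obtain i j where ij: "i < m" "j < m" "i \<noteq> j" "g i = g j"
      by (auto simp: inj_on_def g_def)
    have "det (mat m m (\<lambda>(i, j). x i ^ g j)) = 0"
      by (rule det_identical_cols[of _ m i j]) (use ij in auto)
    then show ?thesis using False lhs by simp
  qed
qed

section \<open>Complex representations of finite groups\<close>

definition mtrace :: "'a::comm_ring_1 mat \<Rightarrow> 'a" where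
  "mtrace A = (\<Sum>i<dim_row A. A $$ (i, i))"

lemma mtrace_mult_comm:
  assumes "A \<in> carrier_mat n m" "B \<in> carrier_mat m n"
  shows "mtrace (A * B) = mtrace (B * A)"
proof -
  have "mtrace (A * B) = (\<Sum>i<n. \<Sum>k<m. A $$ (i, k) * B $$ (k, i))"
    using assms by (auto simp: mtrace_def scalar_prod_def atLeast0LessThan intro!: sum.cong)
  also have "\<dots> = (\<Sum>k<m. \<Sum>i<n. B $$ (k, i) * A $$ (i, k))"
    by (subst sum.swap) (simp add: mult.commute)
  also have "\<dots> = mtrace (B * A)"
    using assms by (auto simp: mtrace_def scalar_prod_def atLeast0LessThan intro!: sum.cong)
  finally show ?thesis .
qed

lemma mtrace_conjugate:
  assumes "A \<in> carrier_mat n n" "P \<in> carrier_mat n n" "Q \<in> carrier_mat n n" "P * Q = 1\<^sub>m n"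
  shows "mtrace (Q * A * P) = mtrace A"
proof -
  have "mtrace (Q * A * P) = mtrace (P * (Q * A))" using assms by (intro mtrace_mult_comm) auto
  also have "P * (Q * A) = P * Q * A" using assms by (intro assoc_mult_mat[symmetric])
  finally show ?thesis using assms by simp
qed

lemma triangularization:
  fixes A :: "complex mat"
  assumes "A \<in> carrier_mat n n"
  obtains B P Q where "similar_mat_wit A B P Q" "upper_triangular B"
proof -
  obtain as where "char_poly A = (\<Prod>a\<leftarrow>as. [:- a, 1:])"
    using char_poly_factorized[OF assms] by auto
  then show ?thesis
    using schur_decomposition_exists[OF assms] that unfolding similar_mat_def by blast
qed

lemma upper_triangular_mult_diag:
  assumes "A \<in> carrier_mat n n" "B \<in> carrier_mat n n" "upper_triangular A" "upper_triangular B" "i < n"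
  shows "(A * B) $$ (i, i) = A $$ (i, i) * B $$ (i, i)"
proof -
  have "(A * B) $$ (i, i) = (\<Sum>k<n. A $$ (i, k) * B $$ (k, i))"
    using assms by (auto simp: scalar_prod_def atLeast0LessThan intro!: sum.cong)
  also have "\<dots> = (\<Sum>k\<in>{i}. A $$ (i, k) * B $$ (k, i))"
  proof (intro sum.mono_neutral_right ballI)
    fix k assume k: "k \<in> {..<n} - {i}"
    then consider "k < i" | "i < k" by force
    then show "A $$ (i, k) * B $$ (k, i) = 0"
      using k assms by cases (auto simp: upper_triangular_def)
  qed (use assms in auto)
  finally show ?thesis by simp
qed

lemma upper_triangular_mult:
  assumes "A \<in> carrier_mat n n" "B \<in> carrier_mat n n" "upper_triangular A" "upper_triangular B"
  shows "upper_triangular (A * B)"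
proof (rule upper_triangularI)
  fix i j assume ij: "j < i" "i < dim_row (A * B)"
  have "A $$ (i, k) * B $$ (k, j) = 0" if "k < n" for k
    using that ij assms by (cases "k < i") (auto simp: upper_triangular_def)
  then show "(A * B) $$ (i, j) = 0"
    using ij assms by (auto simp: scalar_prod_def)
qed

lemma upper_triangular_pow:
  fixes A :: "'a::comm_ring_1 mat"
  assumes "A \<in> carrier_mat n n" "upper_triangular A"
  shows "upper_triangular (A ^\<^sub>m k) \<and> (\<forall>i<n. (A ^\<^sub>m k) $$ (i, i) = A $$ (i, i) ^ k)"
proof (induction k)
  case (Suc k)
  then show ?case
    using upper_triangular_mult[OF pow_carrier_mat[OF assms(1)] assms(1)] assms
      upper_triangular_mult_diag[OF pow_carrier_mat[OF assms(1)] assms(1)]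
    by (auto simp: mult.commute)
qed (use assms in auto)

text \<open>The diagonal entries of a triangular idempotent satisfy \<open>b * b = b\<close>. The
  application is to the average of a representation over a subgroup, whose trace is the dimension of
  the fixed space.\<close>

lemma mtrace_idempotent:
  fixes A :: "complex mat"
  assumes A: "A \<in> carrier_mat n n" and idem: "A * A = A"
  shows "mtrace A \<in> \<int>"
proof -
  obtain B P Q where sim: "similar_mat_wit A B P Q" and ut: "upper_triangular B"
    using triangularization[OF A] .
  note w = similar_mat_witD2[OF A sim]
  have pow: "A ^\<^sub>m 2 = P * B ^\<^sub>m 2 * Q" using similar_mat_wit_pow[OF sim] similar_mat_witD2[OF pow_carrier_mat[OF A]] by blast
  have sq: "M ^\<^sub>m 2 = M * M" if "M \<in> carrier_mat n n" for M :: "complex mat"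
    using that by (simp add: numeral_2_eq_2)
  have "similar_mat_wit (A * A) (B * B) P Q" using similar_mat_wit_pow[OF sim, of 2] sq[OF A] sq[OF w(5)] by simp
  then have BB: "Q * (A * A) * P = B * B"
    using similar_mat_wit_sym similar_mat_witD2 A by (metis mult_carrier_mat)
  have "Q * A * P = B" using similar_mat_witD2[OF w(5) similar_mat_wit_sym[OF sim]] by simp
  then have "B * B = B" using BB idem by simp
  then have "B $$ (i, i) \<in> \<int>" if "i < n" for i
    using upper_triangular_mult_diag[OF w(5,5) ut ut that] by auto
  then have "mtrace B \<in> \<int>" using w by (auto simp: mtrace_def intro!: Ints_sum)
  moreover have "mtrace A = mtrace B"
    using mtrace_conjugate[of A n P Q] w \<open>Q * A * P = B\<close> A by simp
  ultimately show ?thesis by simp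
qed

text \<open>The eigenvalues are roots of unity, so their inverses, which are the \<open>N\<close>-th
  powers, are their conjugates. With \<open>Suc N\<close> the order of the group this gives the
  value of a character at an inverse.\<close>

lemma mtrace_pow_eq_cnj:
  fixes A :: "complex mat"
  assumes A: "A \<in> carrier_mat n n" and pow: "A ^\<^sub>m Suc N = 1\<^sub>m n"
  shows "mtrace (A ^\<^sub>m N) = cnj (mtrace A)"
proof -
  obtain B P Q where sim: "similar_mat_wit A B P Q" and ut: "upper_triangular B"
    using triangularization[OF A] .
  note w = similar_mat_witD2[OF A sim]
  have QP: "mtrace (A ^\<^sub>m k) = mtrace (B ^\<^sub>m k)" "B ^\<^sub>m k = Q * A ^\<^sub>m k * P" for k
  proof -
    have s: "similar_mat_wit (B ^\<^sub>m k) (A ^\<^sub>m k) Q P"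
      using similar_mat_wit_sym[OF similar_mat_wit_pow[OF sim]] .
    then show "B ^\<^sub>m k = Q * A ^\<^sub>m k * P" using similar_mat_witD2[OF pow_carrier_mat[OF w(5)] s] by simp
    then show "mtrace (A ^\<^sub>m k) = mtrace (B ^\<^sub>m k)"
      using mtrace_conjugate[of "A ^\<^sub>m k" n P Q] w A by simp
  qed
  have diag: "(B ^\<^sub>m k) $$ (i, i) = B $$ (i, i) ^ k" if "i < n" for i k
    using upper_triangular_pow[OF w(5) ut] that by blast
  have "B ^\<^sub>m Suc N = 1\<^sub>m n" using QP(2)[of "Suc N"] pow w by simp
  then have one: "B $$ (i, i) ^ Suc N = 1" if "i < n" for i using diag[of i "Suc N"] that by simp
  have "B $$ (i, i) ^ N = cnj (B $$ (i, i))" if "i < n" for i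
  proof -
    have "cmod (B $$ (i, i)) ^ Suc N = 1 ^ Suc N"
      unfolding norm_power[symmetric] one[OF that] by simp
    then have "cmod (B $$ (i, i)) = 1" by (rule power_eq_imp_eq_base) simp_all
    then have inv: "B $$ (i, i) * cnj (B $$ (i, i)) = 1"
      using complex_norm_square[of "B $$ (i, i)"] by (metis of_real_1 one_power2)
    have "B $$ (i, i) ^ N = B $$ (i, i) ^ N * (B $$ (i, i) * cnj (B $$ (i, i)))" unfolding inv by simp
    also have "\<dots> = B $$ (i, i) ^ Suc N * cnj (B $$ (i, i))" by (simp only: power_Suc mult_ac)
    also have "\<dots> = cnj (B $$ (i, i))" unfolding one[OF that] by simp
    finally show ?thesis .
  qed
  then have "mtrace (B ^\<^sub>m N) = cnj (mtrace B)"
    using w diag by (simp add: mtrace_def)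
  then show ?thesis using QP(1)[of N] QP(1)[of 1] A w by simp
qed

subsection \<open>Representations\<close>

lemma representationI:
  assumes G: "group G"
    and carr: "\<And>g. g \<in> carrier G \<Longrightarrow> \<rho> g \<in> carrier_mat d d"
    and mult: "\<And>g h. g \<in> carrier G \<Longrightarrow> h \<in> carrier G \<Longrightarrow> \<rho> (g \<otimes>\<^bsub>G\<^esub> h) = \<rho> g * \<rho> h"
    and one: "\<rho> \<one>\<^bsub>G\<^esub> = 1\<^sub>m d"
  shows "representation G d \<rho>"
proof -
  interpret group G by fact
  have "\<rho> g \<in> Units (ring_mat TYPE(complex) d ())" if g: "g \<in> carrier G" for g
  proof -
    have "\<rho> (inv\<^bsub>G\<^esub> g) * \<rho> g = 1\<^sub>m d" "\<rho> g * \<rho> (inv\<^bsub>G\<^esub> g) = 1\<^sub>m d"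
      using g mult[of "inv\<^bsub>G\<^esub> g" g] mult[of g "inv\<^bsub>G\<^esub> g"] one by auto
    then show ?thesis
      unfolding Units_def using g carr by (auto simp: ring_mat_def intro!: bexI[of _ "\<rho> (inv\<^bsub>G\<^esub> g)"])
  qed
  then show ?thesis
    unfolding representation_def by (intro homI) (auto simp: units_of_def ring_mat_def mult)
qed

lemma
  assumes G: "group G" and rep: "representation G d \<rho>"
  shows representation_carrier: "g \<in> carrier G \<Longrightarrow> \<rho> g \<in> carrier_mat d d"
    and representation_mult: "g \<in> carrier G \<Longrightarrow> h \<in> carrier G \<Longrightarrow> \<rho> (g \<otimes>\<^bsub>G\<^esub> h) = \<rho> g * \<rho> h"
    and representation_one: "\<rho> \<one>\<^bsub>G\<^esub> = 1\<^sub>m d"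
proof -
  interpret M: ring "ring_mat TYPE(complex) d ()" by (rule ring_mat)
  have U: "group (units_of (ring_mat TYPE(complex) d ()))" by (rule M.units_group)
  have hom: "\<rho> \<in> hom G (units_of (ring_mat TYPE(complex) d ()))" using rep by (simp add: representation_def)
  show "\<rho> g \<in> carrier_mat d d" if "g \<in> carrier G"
    using hom_in_carrier[OF hom that] by (auto simp: units_of_def Units_def ring_mat_def)
  show "\<rho> (g \<otimes>\<^bsub>G\<^esub> h) = \<rho> g * \<rho> h" if "g \<in> carrier G" "h \<in> carrier G"
    using hom_mult[OF hom that] by (simp add: units_of_def ring_mat_def)
  show "\<rho> \<one>\<^bsub>G\<^esub> = 1\<^sub>m d"
    using hom_one[OF hom G U] by (simp add: units_of_def ring_mat_def)
qed

lemma representation_inv: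
  assumes "group G" "representation G d \<rho>" "g \<in> carrier G"
  shows "\<rho> g * \<rho> (inv\<^bsub>G\<^esub> g) = 1\<^sub>m d" "\<rho> (inv\<^bsub>G\<^esub> g) * \<rho> g = 1\<^sub>m d"
proof -
  interpret group G by fact
  show "\<rho> g * \<rho> (inv\<^bsub>G\<^esub> g) = 1\<^sub>m d" "\<rho> (inv\<^bsub>G\<^esub> g) * \<rho> g = 1\<^sub>m d"
    using representation_mult[OF assms(1,2), of g "inv\<^bsub>G\<^esub> g"] representation_mult[OF assms(1,2), of "inv\<^bsub>G\<^esub> g" g]
      representation_one[OF assms(1,2)] assms(3) by auto
qed

lemma representation_pow:
  assumes "group G" "representation G d \<rho>" "g \<in> carrier G"
  shows "\<rho> (g [^]\<^bsub>G\<^esub> (k::nat)) = \<rho> g ^\<^sub>m k"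
proof -
  interpret group G by fact
  show ?thesis
    using representation_mult[OF assms(1,2)] representation_one[OF assms(1,2)]
      representation_carrier[OF assms(1,2,3)] assms(3) by (induction k) auto
qed

lemma mtrace_representation_inv:
  assumes G: "group G" "finite (carrier G)" and rep: "representation G d \<rho>" and g: "g \<in> carrier G"
  shows "mtrace (\<rho> (inv\<^bsub>G\<^esub> g)) = cnj (mtrace (\<rho> g))"
proof -
  interpret group G by fact
  obtain N where N: "Coset.order G = Suc N"
    using order_gt_0_iff_finite G(2) gr0_implies_Suc by blast
  have one: "g [^]\<^bsub>G\<^esub> Suc N = \<one>\<^bsub>G\<^esub>" using pow_order_eq_1[OF g] N by simp
  have "g [^]\<^bsub>G\<^esub> N = inv\<^bsub>G\<^esub> g"
    using one g by (intro inv_equality[symmetric]) auto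
  moreover have "\<rho> g ^\<^sub>m Suc N = 1\<^sub>m d"
    using representation_pow[OF G(1) rep g, of "Suc N"] one representation_one[OF G(1) rep] by simp
  ultimately show ?thesis
    using mtrace_pow_eq_cnj[OF representation_carrier[OF G(1) rep g]] representation_pow[OF G(1) rep g, of N] by metis
qed

definition character_of :: "nat \<Rightarrow> ('g \<Rightarrow> complex mat) \<Rightarrow> 'g \<Rightarrow> complex" where
  "character_of d \<rho> g = (\<Sum>i<d. \<rho> g $$ (i, i))"

lemma character_of_eq_mtrace: "\<rho> g \<in> carrier_mat d d \<Longrightarrow> character_of d \<rho> g = mtrace (\<rho> g)"
  by (simp add: character_of_def mtrace_def)

section \<open>Schur's lemma and orthogonality\<close>

lemma eigenspace_subspace:
  fixes A :: "complex mat"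
  assumes A: "A \<in> carrier_mat d d"
  shows "VectorSpace.subspace class_ring {v \<in> carrier_vec d. A *\<^sub>v v = c \<cdot>\<^sub>v v} (module_vec TYPE(complex) d)"
proof -
  interpret vec_space "TYPE(complex)" d .
  show ?thesis
    unfolding subspace_def
  proof
    show "vectorspace class_ring (module_vec TYPE(complex) d)" by unfold_locales
    show "submodule class_ring {v \<in> carrier_vec d. A *\<^sub>v v = c \<cdot>\<^sub>v v} (module_vec TYPE(complex) d)"
      by unfold_locales
        (use A in \<open>auto simp: module_vec_simps mult_add_distrib_mat_vec smult_add_distrib_vec
          mult_mat_vec smult_smult_assoc mult.commute class_ring_simps\<close>)
  qed
qed

lemma schur_scalar:
  assumes irr: "irreducible_representation G d \<rho>" and A: "A \<in> carrier_mat d d" and G: "group G"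
    and comm: "\<And>g. g \<in> carrier G \<Longrightarrow> \<rho> g * A = A * \<rho> g"
  obtains c where "A = c \<cdot>\<^sub>m 1\<^sub>m d"
proof -
  have rep: "representation G d \<rho>" and d: "d > 0" using irr by (auto simp: irreducible_representation_def)
  obtain c where c: "eigenvalue A c"
    using spectrum_non_empty[OF A] d by (auto simp: spectrum_def)
  then obtain v where v: "v \<in> carrier_vec d" "v \<noteq> 0\<^sub>v d" "A *\<^sub>v v = c \<cdot>\<^sub>v v"
    using A by (auto simp: eigenvalue_def eigenvector_def)
  let ?W = "{v \<in> carrier_vec d. A *\<^sub>v v = c \<cdot>\<^sub>v v}"
  have "\<rho> g *\<^sub>v w \<in> ?W" if g: "g \<in> carrier G" and w: "w \<in> ?W" for g w
  proof -
    note r = representation_carrier[OF G rep g]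
    have "A *\<^sub>v (\<rho> g *\<^sub>v w) = (A * \<rho> g) *\<^sub>v w" using A r w by (intro assoc_mult_mat_vec[symmetric]) auto
    also have "\<dots> = (\<rho> g * A) *\<^sub>v w" using comm[OF g] by simp
    also have "\<dots> = \<rho> g *\<^sub>v (A *\<^sub>v w)" using A r w by (intro assoc_mult_mat_vec) auto
    also have "\<dots> = c \<cdot>\<^sub>v (\<rho> g *\<^sub>v w)" using w r by (auto simp: mult_mat_vec)
    finally show ?thesis using r w by auto
  qed
  then have "?W = {0\<^sub>v d} \<or> ?W = carrier_vec d"
    using irr eigenspace_subspace[OF A, of c] unfolding irreducible_representation_def by blast
  then have W: "?W = carrier_vec d" using v by blast
  have "A = c \<cdot>\<^sub>m 1\<^sub>m d"
  proof (rule eq_matI)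
    fix i j assume ij: "i < dim_row (c \<cdot>\<^sub>m 1\<^sub>m d)" "j < dim_col (c \<cdot>\<^sub>m 1\<^sub>m d)"
    have "unit_vec d j \<in> ?W" using W by auto
    then have "(A *\<^sub>v unit_vec d j) $ i = (c \<cdot>\<^sub>v unit_vec d j) $ i" by simp
    then show "A $$ (i, j) = (c \<cdot>\<^sub>m 1\<^sub>m d) $$ (i, j)" using A ij by auto
  qed (use A in auto)
  then show ?thesis using that by blast
qed

lemma mult_mat_index:
  assumes "A \<in> carrier_mat n m" "B \<in> carrier_mat m k" "a < n" "b < k"
  shows "(A * B) $$ (a, b) = (\<Sum>x<m. A $$ (a, x) * B $$ (x, b))"
  using assms by (auto simp: scalar_prod_def atLeast0LessThan intro!: sum.cong)

text \<open>\<open>M\<close> is the sum of \<open>\<rho> g * E * \<rho> (inv g)\<close> over the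
  group, where \<open>E\<close> is the matrix unit at \<open>(i, j)\<close>. It commutes with the
  representation, hence is a scalar matrix by Schur's lemma, and its trace determines the
  scalar.\<close>

lemma schur_orthogonality:
  assumes irr: "irreducible_representation G d \<rho>" and G: "group G" "finite (carrier G)"
    and ij: "i < d" "j < d" "a < d" "b < d"
  shows "(\<Sum>g\<in>carrier G. \<rho> g $$ (a, i) * \<rho> (inv\<^bsub>G\<^esub> g) $$ (j, b)) =
    (if a = b \<and> i = j then of_nat (card (carrier G)) / of_nat d else 0)"
proof -
  interpret group G by fact
  have rep: "representation G d \<rho>" and d: "d > 0" using irr by (auto simp: irreducible_representation_def)
  note carr = representation_carrier[OF G(1) rep] and mult = representation_mult[OF G(1) rep]
  define M where "M = mat d d (\<lambda>(a, b). \<Sum>g\<in>carrier G. \<rho> g $$ (a, i) * \<rho> (inv\<^bsub>G\<^esub> g) $$ (j, b))"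
  have M: "M \<in> carrier_mat d d" by (simp add: M_def)
  have "\<rho> h * M = M * \<rho> h" if h: "h \<in> carrier G" for h
  proof (rule eq_matI)
    fix a b assume "a < dim_row (M * \<rho> h)" "b < dim_col (M * \<rho> h)"
    then have ab: "a < d" "b < d" using M carr[OF h] by auto
    have bij: "bij_betw (\<lambda>g. h \<otimes>\<^bsub>G\<^esub> g) (carrier G) (carrier G)"
      using h by (intro bij_betwI[where g = "\<lambda>g. inv\<^bsub>G\<^esub> h \<otimes>\<^bsub>G\<^esub> g"]) (auto simp: m_assoc[symmetric])
    have "(\<rho> h * M) $$ (a, b) = (\<Sum>x<d. \<Sum>g\<in>carrier G. \<rho> h $$ (a, x) * \<rho> g $$ (x, i) * \<rho> (inv\<^bsub>G\<^esub> g) $$ (j, b))"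
      using mult_mat_index[OF carr[OF h] M ab] ab by (simp add: M_def sum_distrib_left mult.assoc)
    also have "\<dots> = (\<Sum>g\<in>carrier G. \<rho> (h \<otimes>\<^bsub>G\<^esub> g) $$ (a, i) * \<rho> (inv\<^bsub>G\<^esub> g) $$ (j, b))"
      by (subst sum.swap) (auto simp: mult h mult_mat_index[OF carr[OF h] carr ab(1) ij(1)] sum_distrib_right intro!: sum.cong)
    also have "\<dots> = (\<Sum>g\<in>carrier G. \<rho> (h \<otimes>\<^bsub>G\<^esub> g) $$ (a, i) * \<rho> (inv\<^bsub>G\<^esub> (h \<otimes>\<^bsub>G\<^esub> g) \<otimes>\<^bsub>G\<^esub> h) $$ (j, b))"
      using h by (intro sum.cong refl) (simp add: inv_mult_group m_assoc)
    also have "\<dots> = (\<Sum>g\<in>carrier G. \<rho> g $$ (a, i) * \<rho> (inv\<^bsub>G\<^esub> g \<otimes>\<^bsub>G\<^esub> h) $$ (j, b))"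
      by (rule sum.reindex_bij_betw[OF bij])
    also have "\<dots> = (\<Sum>g\<in>carrier G. \<Sum>x<d. \<rho> g $$ (a, i) * \<rho> (inv\<^bsub>G\<^esub> g) $$ (j, x) * \<rho> h $$ (x, b))"
      using h by (auto simp: mult mult_mat_index[OF carr carr[OF h] ij(2) ab(2)] sum_distrib_left mult.assoc intro!: sum.cong)
    also have "\<dots> = (M * \<rho> h) $$ (a, b)"
      using mult_mat_index[OF M carr[OF h] ab] ab by (subst sum.swap) (simp add: M_def sum_distrib_right)
    finally show "(\<rho> h * M) $$ (a, b) = (M * \<rho> h) $$ (a, b)" .
  qed (use M carr[OF h] in auto)
  then obtain c where c: "M = c \<cdot>\<^sub>m 1\<^sub>m d" using schur_scalar[OF irr M G(1)] by blast
  have "of_nat d * c = (\<Sum>a<d. M $$ (a, a))" using c by simp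
  also have "\<dots> = (\<Sum>g\<in>carrier G. (\<rho> (inv\<^bsub>G\<^esub> g) * \<rho> g) $$ (j, i))"
    unfolding M_def by (simp, subst sum.swap)
      (auto simp: mult_mat_index[OF carr carr ij(2) ij(1)] mult.commute simp del: index_mult_mat intro!: sum.cong)
  also have "\<dots> = of_nat (card (carrier G)) * (if i = j then 1 else 0)"
    using representation_inv(2)[OF G(1) rep] ij by simp
  finally have "c = (if i = j then of_nat (card (carrier G)) / of_nat d else 0)"
    using d by (auto simp: field_simps)
  moreover have "M $$ (a, b) = (if a = b then c else 0)" using c ij by simp
  ultimately show ?thesis using ij by (auto simp: M_def)
qed

lemma irreducible_character_inner_self:
  assumes "irreducible_character G \<chi>" and G: "group G" "finite (carrier G)"
  shows "class_inner G \<chi> \<chi> = 1"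
proof -
  interpret group G by fact
  obtain d \<rho> where irr: "irreducible_representation G d \<rho>"
    and \<chi>: "\<And>g. g \<in> carrier G \<Longrightarrow> \<chi> g = character_of d \<rho> g"
    using assms(1) by (auto simp: irreducible_character_def character_of_def)
  have rep: "representation G d \<rho>" and d: "d > 0" using irr by (auto simp: irreducible_representation_def)
  note carr = representation_carrier[OF G(1) rep]
  have "cnj (\<chi> g) = character_of d \<rho> (inv\<^bsub>G\<^esub> g)" if "g \<in> carrier G" for g
    using mtrace_representation_inv[OF G rep that] that carr by (simp add: \<chi> character_of_eq_mtrace)
  then have "(\<Sum>g\<in>carrier G. \<chi> g * cnj (\<chi> g)) =
      (\<Sum>g\<in>carrier G. \<Sum>a<d. \<Sum>b<d. \<rho> g $$ (a, a) * \<rho> (inv\<^bsub>G\<^esub> g) $$ (b, b))"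
    by (intro sum.cong) (auto simp: \<chi> character_of_def sum_product)
  also have "\<dots> = (\<Sum>a<d. \<Sum>b<d. \<Sum>g\<in>carrier G. \<rho> g $$ (a, a) * \<rho> (inv\<^bsub>G\<^esub> g) $$ (b, b))"
    by (subst sum.swap) (intro sum.cong refl, rule sum.swap)
  also have "\<dots> = (\<Sum>a<d. \<Sum>b<d. if a = b then of_nat (card (carrier G)) / of_nat d else 0)"
    by (intro sum.cong refl) (auto simp: schur_orthogonality[OF irr G])
  also have "\<dots> = of_nat (card (carrier G))" using d by simp
  finally show ?thesis using G(2) one_closed by (auto simp: class_inner_def Coset.order_def card_gt_0_iff)
qed

text \<open>The average of \<open>\<rho>\<close> over \<open>H\<close> is idempotent, being the
  projection to the vectors fixed by \<open>H\<close>; its trace \<open>z\<close> is therefore an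
  integer.\<close>

lemma sum_character_subgroup:
  assumes G: "group G" "finite (carrier G)" and H: "subgroup H G" and rep: "representation G d \<rho>"
  obtains z where "z \<in> \<int>" "(\<Sum>h\<in>H. character_of d \<rho> h) = of_nat (card H) * z"
proof -
  interpret group G by fact
  note carr = representation_carrier[OF G(1) rep] and mult = representation_mult[OF G(1) rep]
  have HG: "h \<in> H \<Longrightarrow> h \<in> carrier G" for h using H subgroup.subset by blast
  have fin: "finite H" using H G(2) by (meson finite_subset subgroup.subset)
  have cH: "card H > 0" using fin subgroup.one_closed[OF H] by (auto simp: card_gt_0_iff)
  define E where "E = mat d d (\<lambda>(a, b). (\<Sum>h\<in>H. \<rho> h $$ (a, b)) / of_nat (card H))"
  have E: "E \<in> carrier_mat d d" by (simp add: E_def)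
  have "E * E = E"
  proof (rule eq_matI)
    fix a b assume "a < dim_row E" "b < dim_col E"
    then have ab: "a < d" "b < d" using E by auto
    have "(E * E) $$ (a, b) = (\<Sum>x<d. \<Sum>h\<in>H. \<Sum>h'\<in>H. \<rho> h $$ (a, x) * \<rho> h' $$ (x, b)) / (of_nat (card H))\<^sup>2"
      using mult_mat_index[OF E E ab] ab by (simp add: E_def sum_product sum_divide_distrib power2_eq_square)
    also have "(\<Sum>x<d. \<Sum>h\<in>H. \<Sum>h'\<in>H. \<rho> h $$ (a, x) * \<rho> h' $$ (x, b)) = (\<Sum>h\<in>H. \<Sum>h'\<in>H. \<Sum>x<d. \<rho> h $$ (a, x) * \<rho> h' $$ (x, b))"
      by (subst sum.swap) (intro sum.cong refl, rule sum.swap)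
    also have "\<dots> = (\<Sum>h\<in>H. \<Sum>h'\<in>H. \<rho> (h \<otimes>\<^bsub>G\<^esub> h') $$ (a, b))"
      by (intro sum.cong refl) (simp add: mult HG mult_mat_index[OF carr carr ab] del: index_mult_mat)
    also have "\<dots> = (\<Sum>h\<in>H. \<Sum>h'\<in>H. \<rho> h' $$ (a, b))"
    proof (rule sum.cong[OF refl])
      fix h assume h: "h \<in> H"
      have "bij_betw (\<lambda>g. h \<otimes>\<^bsub>G\<^esub> g) H H"
        using h subgroup.m_closed[OF H] subgroup.m_inv_closed[OF H] HG
        by (intro bij_betwI[where g = "\<lambda>g. inv\<^bsub>G\<^esub> h \<otimes>\<^bsub>G\<^esub> g"]) (auto simp: m_assoc[symmetric])
      from sum.reindex_bij_betw[OF this] show "(\<Sum>h'\<in>H. \<rho> (h \<otimes>\<^bsub>G\<^esub> h') $$ (a, b)) = (\<Sum>h'\<in>H. \<rho> h' $$ (a, b))" .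
    qed
    finally show "(E * E) $$ (a, b) = E $$ (a, b)"
      using ab cH by (simp add: E_def power2_eq_square)
  qed (use E in auto)
  then have "mtrace E \<in> \<int>" by (rule mtrace_idempotent[OF E])
  moreover have "(\<Sum>h\<in>H. character_of d \<rho> h) = of_nat (card H) * mtrace E"
  proof -
    have "mtrace E = (\<Sum>a<d. \<Sum>h\<in>H. \<rho> h $$ (a, a)) / of_nat (card H)"
      by (simp add: mtrace_def E_def sum_divide_distrib)
    also have "(\<Sum>a<d. \<Sum>h\<in>H. \<rho> h $$ (a, a)) = (\<Sum>h\<in>H. character_of d \<rho> h)"
      unfolding character_of_def by (rule sum.swap)
    finally show ?thesis using cH by simp
  qed
  ultimately show ?thesis using that by blast
qed

lemma irreducible_character_conj_class:
  assumes "irreducible_character G \<chi>" and G: "group G" and g: "g \<in> carrier G" "h \<in> carrier G"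
  shows "\<chi> (h \<otimes>\<^bsub>G\<^esub> g \<otimes>\<^bsub>G\<^esub> inv\<^bsub>G\<^esub> h) = \<chi> g"
proof -
  interpret group G by fact
  obtain d \<rho> where irr: "irreducible_representation G d \<rho>"
    and \<chi>: "\<And>g. g \<in> carrier G \<Longrightarrow> \<chi> g = character_of d \<rho> g"
    using assms(1) by (auto simp: irreducible_character_def character_of_def)
  have rep: "representation G d \<rho>" using irr by (auto simp: irreducible_representation_def)
  note carr = representation_carrier[OF G(1) rep] and mult = representation_mult[OF G(1) rep]
  have "\<chi> (h \<otimes>\<^bsub>G\<^esub> g \<otimes>\<^bsub>G\<^esub> inv\<^bsub>G\<^esub> h) = mtrace (\<rho> (h \<otimes>\<^bsub>G\<^esub> g \<otimes>\<^bsub>G\<^esub> inv\<^bsub>G\<^esub> h))"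
    using g by (subst \<chi>) (auto intro: character_of_eq_mtrace carr)
  also have "\<dots> = mtrace (\<rho> h * \<rho> g * \<rho> (inv\<^bsub>G\<^esub> h))" using g by (simp add: mult)
  also have "\<dots> = mtrace (\<rho> g)"
    using g representation_inv[OF G rep g(2)] by (intro mtrace_conjugate) (auto intro: carr)
  also have "\<dots> = \<chi> g" using g by (simp add: \<chi> character_of_eq_mtrace carr)
  finally show ?thesis .
qed

subsection \<open>Permutation characters\<close>

definition acts_on :: "('g, 'm) monoid_scheme \<Rightarrow> 'x set \<Rightarrow> ('g \<Rightarrow> 'x \<Rightarrow> 'x) \<Rightarrow> bool" where
  "acts_on G \<Omega> act \<longleftrightarrow> (\<forall>g\<in>carrier G. \<forall>x\<in>\<Omega>. act g x \<in> \<Omega>) \<and> (\<forall>x\<in>\<Omega>. act \<one>\<^bsub>G\<^esub> x = x) \<and>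
     (\<forall>g\<in>carrier G. \<forall>h\<in>carrier G. \<forall>x\<in>\<Omega>. act (g \<otimes>\<^bsub>G\<^esub> h) x = act g (act h x))"

definition fixed_count :: "'x set \<Rightarrow> ('g \<Rightarrow> 'x \<Rightarrow> 'x) \<Rightarrow> 'g \<Rightarrow> nat" where
  "fixed_count \<Omega> act g = card {x \<in> \<Omega>. act g x = x}"

definition stab :: "('g, 'm) monoid_scheme \<Rightarrow> ('g \<Rightarrow> 'x \<Rightarrow> 'x) \<Rightarrow> 'x \<Rightarrow> 'g set" where
  "stab G act x = {g \<in> carrier G. act g x = x}"

lemma
  assumes "group G" "acts_on G \<Omega> act" "g \<in> carrier G" "x \<in> \<Omega>"
  shows act_inv_act: "act (inv\<^bsub>G\<^esub> g) (act g x) = x"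
    and act_act_inv: "act g (act (inv\<^bsub>G\<^esub> g) x) = x"
proof -
  interpret group G by fact
  have "act (inv\<^bsub>G\<^esub> g \<otimes>\<^bsub>G\<^esub> g) x = act (inv\<^bsub>G\<^esub> g) (act g x)" "act (g \<otimes>\<^bsub>G\<^esub> inv\<^bsub>G\<^esub> g) x = act g (act (inv\<^bsub>G\<^esub> g) x)"
    using assms(2,3,4) inv_closed[OF assms(3)] unfolding acts_on_def by metis+
  then show "act (inv\<^bsub>G\<^esub> g) (act g x) = x" "act g (act (inv\<^bsub>G\<^esub> g) x) = x"
    using assms(2,3,4) by (auto simp: acts_on_def)
qed

lemma stab_subgroup:
  assumes "group G" "acts_on G \<Omega> act" "x \<in> \<Omega>"
  shows "subgroup (stab G act x) G"
proof -
  interpret group G by fact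
  show ?thesis
    using assms(2,3) act_inv_act[OF assms(1,2) _ assms(3)]
    by (intro subgroupI) (auto simp: stab_def acts_on_def, metis)
qed

lemma card_transporter:
  assumes G: "group G" "finite (carrier G)" and act: "acts_on G \<Omega> act"
    and h: "h \<in> carrier G" "r \<in> \<Omega>" "act h r = x"
  shows "card {g \<in> carrier G. act g r = x} = card (stab G act x)"
proof -
  interpret group G by fact
  have actm: "act (g \<otimes>\<^bsub>G\<^esub> g') y = act g (act g' y)" if "g \<in> carrier G" "g' \<in> carrier G" "y \<in> \<Omega>" for g g' y
    using act that by (auto simp: acts_on_def)
  have x: "x \<in> \<Omega>" using act h by (auto simp: acts_on_def)
  have r: "act (inv\<^bsub>G\<^esub> h) x = r" using act_inv_act[OF G(1) act h(1,2)] h(3) by simp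
  show ?thesis
  proof (rule bij_betw_same_card[of "\<lambda>g. g \<otimes>\<^bsub>G\<^esub> inv\<^bsub>G\<^esub> h"], rule bij_betwI[where g = "\<lambda>g. g \<otimes>\<^bsub>G\<^esub> h"])
    show "(\<lambda>g. g \<otimes>\<^bsub>G\<^esub> inv\<^bsub>G\<^esub> h) \<in> {g \<in> carrier G. act g r = x} \<rightarrow> stab G act x"
      using h x r by (auto simp: stab_def actm)
    show "(\<lambda>g. g \<otimes>\<^bsub>G\<^esub> h) \<in> stab G act x \<rightarrow> {g \<in> carrier G. act g r = x}"
      using h x by (auto simp: stab_def actm)
  qed (use h in \<open>auto simp: stab_def m_assoc\<close>)
qed

text \<open>Orbit counting with weights: for \<open>x\<close> in the orbit of \<open>r\<close> the
  stabilizer of \<open>x\<close> is as large as the set of all \<open>g\<close> with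
  \<open>act g r = x\<close>, so both sides count such triples with weight \<open>f\<close>. For
  \<open>f = 1\<close> this gives the number of orbits, for averages of a character over stabilizers
  an inner product.\<close>

lemma sum_stab_representatives:
  fixes f :: "'x \<Rightarrow> complex"
  assumes G: "group G" "finite (carrier G)" and act: "acts_on G \<Omega> act" and fin: "finite \<Omega>"
    and R: "R \<subseteq> \<Omega>" "\<And>x. x \<in> \<Omega> \<Longrightarrow> \<exists>!r. r \<in> R \<and> (\<exists>g\<in>carrier G. act g r = x)"
    and f: "\<And>g x. g \<in> carrier G \<Longrightarrow> x \<in> \<Omega> \<Longrightarrow> f (act g x) = f x"
  shows "(\<Sum>x\<in>\<Omega>. of_nat (card (stab G act x)) * f x) = of_nat (card (carrier G)) * (\<Sum>r\<in>R. f r)"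
proof -
  have finR: "finite R" using R(1) fin by (rule finite_subset)
  have "(\<Sum>r\<in>R. of_nat (card {g \<in> carrier G. act g r = x}) * f r) = of_nat (card (stab G act x)) * f x"
    if x: "x \<in> \<Omega>" for x
  proof -
    obtain r g where r: "r \<in> R" "g \<in> carrier G" "act g r = x" using R(2)[OF x] by blast
    have "(\<Sum>r\<in>R. of_nat (card {g \<in> carrier G. act g r = x}) * f r) =
        (\<Sum>r\<in>{r}. of_nat (card {g \<in> carrier G. act g r = x}) * f r)"
    proof (intro sum.mono_neutral_right ballI)
      fix s assume "s \<in> R - {r}"
      then have "{g \<in> carrier G. act g s = x} = {}" using R(2)[OF x] r by blast
      then show "of_nat (card {g \<in> carrier G. act g s = x}) * f s = 0" by (simp only: card.empty) simp
    qed (use finR r in auto)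
    also have "\<dots> = of_nat (card (stab G act x)) * f x"
      using card_transporter[OF G act r(2) _ r(3)] r R(1) f[of g r] by auto
    finally show ?thesis .
  qed
  then have "(\<Sum>x\<in>\<Omega>. of_nat (card (stab G act x)) * f x) =
      (\<Sum>x\<in>\<Omega>. \<Sum>r\<in>R. of_nat (card {g \<in> carrier G. act g r = x}) * f r)" by simp
  also have "\<dots> = (\<Sum>r\<in>R. of_nat (\<Sum>x\<in>\<Omega>. card {g \<in> carrier G. act g r = x}) * f r)"
    by (subst sum.swap) (simp add: sum_distrib_right)
  also have "\<dots> = (\<Sum>r\<in>R. of_nat (card (carrier G)) * f r)"
  proof (intro sum.cong refl)
    fix r assume "r \<in> R"
    then have "(\<lambda>g. act g r) ` carrier G \<subseteq> \<Omega>" using R(1) act by (auto simp: acts_on_def)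
    then have "(\<Sum>x\<in>\<Omega>. card {g \<in> carrier G. act g r = x}) = card (carrier G)"
      using sum.group[OF G(2) fin, of "\<lambda>g. act g r" "\<lambda>_. 1 :: nat"] by simp
    then show "of_nat (\<Sum>x\<in>\<Omega>. card {g \<in> carrier G. act g r = x}) * f r = of_nat (card (carrier G)) * f r" by simp
  qed
  finally show ?thesis by (simp add: sum_distrib_left)
qed

lemma sum_fixed_count:
  fixes f :: "'g \<Rightarrow> complex"
  assumes "finite (carrier G)" "finite \<Omega>"
  shows "(\<Sum>g\<in>carrier G. of_nat (fixed_count \<Omega> act g) * f g) = (\<Sum>x\<in>\<Omega>. \<Sum>g\<in>stab G act x. f g)"
proof -
  have "(\<Sum>g\<in>carrier G. of_nat (fixed_count \<Omega> act g) * f g) = (\<Sum>g\<in>carrier G. \<Sum>x\<in>\<Omega>. if act g x = x then f g else 0)"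
    using assms by (intro sum.cong refl) (simp add: fixed_count_def sum.If_cases Int_def)
  also have "\<dots> = (\<Sum>x\<in>\<Omega>. \<Sum>g\<in>carrier G. if act g x = x then f g else 0)" by (rule sum.swap)
  also have "\<dots> = (\<Sum>x\<in>\<Omega>. \<Sum>g\<in>stab G act x. f g)"
    using assms by (intro sum.cong[OF refl]) (simp add: stab_def sum.inter_filter[symmetric])
  finally show ?thesis .
qed

lemma exists_representatives:
  assumes G: "group G" and act: "acts_on G \<Omega> act"
  obtains R where "R \<subseteq> \<Omega>" "\<And>x. x \<in> \<Omega> \<Longrightarrow> \<exists>!r. r \<in> R \<and> (\<exists>g\<in>carrier G. act g r = x)"
proof -
  interpret group G by fact
  define orb where "orb x = {act g x | g. g \<in> carrier G}" for x
  \<comment> \<open>The choice depends on the orbit as a set only, so all points of an orbit get the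
    same representative.\<close>
  define rp where "rp x = (SOME y. y \<in> orb x)" for x
  have actm: "act (g \<otimes>\<^bsub>G\<^esub> g') y = act g (act g' y)" if "g \<in> carrier G" "g' \<in> carrier G" "y \<in> \<Omega>" for g g' y
    using act that by (auto simp: acts_on_def)
  have self: "x \<in> orb x" if "x \<in> \<Omega>" for x
  proof -
    have "x = act \<one>\<^bsub>G\<^esub> x" using act that by (simp add: acts_on_def)
    then show ?thesis unfolding orb_def by blast
  qed
  have rp: "rp x \<in> orb x" if "x \<in> \<Omega>" for x unfolding rp_def using self[OF that] by (rule someI)
  have orb_act: "orb (act g x) = orb x" if "g \<in> carrier G" "x \<in> \<Omega>" for g x
  proof (intro equalityI subsetI)
    fix y assume "y \<in> orb (act g x)"
    then obtain h where "h \<in> carrier G" "y = act h (act g x)" by (auto simp: orb_def)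
    then show "y \<in> orb x" using that actm by (auto simp: orb_def intro!: exI[of _ "h \<otimes>\<^bsub>G\<^esub> g"])
  next
    fix y assume "y \<in> orb x"
    then obtain h where h: "h \<in> carrier G" "y = act h x" by (auto simp: orb_def)
    have "y = act (h \<otimes>\<^bsub>G\<^esub> inv\<^bsub>G\<^esub> g) (act g x)"
      using h that act_inv_act[OF G act that] actm[of h "inv\<^bsub>G\<^esub> g" "act g x"] act by (auto simp: acts_on_def)
    then show "y \<in> orb (act g x)" using h that by (auto simp: orb_def)
  qed
  have sub: "orb x \<subseteq> \<Omega>" if "x \<in> \<Omega>" for x using act that by (auto simp: orb_def acts_on_def)
  show ?thesis
  proof (rule that[of "rp ` \<Omega>"])
    show "rp ` \<Omega> \<subseteq> \<Omega>" using rp sub by blast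
    fix x assume x: "x \<in> \<Omega>"
    obtain g where g: "g \<in> carrier G" "rp x = act g x" using rp[OF x] by (auto simp: orb_def)
    show "\<exists>!r. r \<in> rp ` \<Omega> \<and> (\<exists>g\<in>carrier G. act g r = x)"
    proof (rule ex1I[of _ "rp x"])
      show "rp x \<in> rp ` \<Omega> \<and> (\<exists>g\<in>carrier G. act g (rp x) = x)"
      proof -
        have "rp x \<in> rp ` \<Omega>" using x by blast
        moreover have "act (inv\<^bsub>G\<^esub> g) (rp x) = x" using g act_inv_act[OF G act g(1) x] by simp
        ultimately show ?thesis using g(1) by blast
      qed
      fix r assume r: "r \<in> rp ` \<Omega> \<and> (\<exists>g\<in>carrier G. act g r = x)"
      then obtain y h where y: "y \<in> \<Omega>" "r = rp y" "h \<in> carrier G" "act h r = x" by blast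
      obtain k where k: "k \<in> carrier G" "r = act k y" using rp[OF y(1)] y(2) by (auto simp: orb_def)
      have "orb x = orb r" using orb_act[OF y(3), of r] y sub rp by blast
      also have "orb r = orb y" using orb_act[OF k(1) y(1)] k(2) by simp
      finally have "rp x = rp y" by (simp add: rp_def)
      then show "r = rp x" using y by simp
    qed
  qed
qed

text \<open>Frobenius reciprocity orbit by orbit: the values of \<open>cnj \<circ> \<chi>\<close> on
  the stabilizer of \<open>x\<close> add up to its order times an integer \<open>z x\<close>, points
  of one orbit have conjugate stabilizers and the same integer, and the inner product is the sum of
  \<open>z r\<close> over representatives.\<close>

lemma irreducible_character_fixed_count_inner:
  assumes \<chi>: "irreducible_character G \<chi>" and G: "group G" "finite (carrier G)"
    and act: "acts_on G \<Omega> act" and fin: "finite \<Omega>"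
  shows "class_inner G (\<lambda>g. of_nat (fixed_count \<Omega> act g)) \<chi> \<in> \<int>"
proof -
  interpret group G by fact
  obtain d \<rho> where irr: "irreducible_representation G d \<rho>"
    and \<chi>_eq: "\<And>g. g \<in> carrier G \<Longrightarrow> \<chi> g = character_of d \<rho> g"
    using \<chi> by (auto simp: irreducible_character_def character_of_def)
  have rep: "representation G d \<rho>" using irr by (auto simp: irreducible_representation_def)
  define z where "z x = (\<Sum>g\<in>stab G act x. cnj (\<chi> g)) / of_nat (card (stab G act x))" for x
  have sg: "subgroup (stab G act x) G" if "x \<in> \<Omega>" for x using stab_subgroup[OF G(1) act that] .
  have pos: "card (stab G act x) > 0" if "x \<in> \<Omega>" for x
    using subgroup.one_closed[OF sg[OF that]] G(2) by (auto simp: card_gt_0_iff stab_def)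
  have z: "z x \<in> \<int>" if x: "x \<in> \<Omega>" for x
  proof -
    obtain w where w: "w \<in> \<int>" "(\<Sum>h\<in>stab G act x. character_of d \<rho> h) = of_nat (card (stab G act x)) * w"
      using sum_character_subgroup[OF G sg[OF x] rep] .
    have "(\<Sum>g\<in>stab G act x. cnj (\<chi> g)) = cnj (\<Sum>g\<in>stab G act x. character_of d \<rho> g)"
      unfolding cnj_sum by (intro sum.cong refl arg_cong[of _ _ cnj] \<chi>_eq) (auto simp: stab_def)
    then have "z x = cnj w" using pos[OF x] by (simp add: z_def w(2))
    then show ?thesis using w(1) by (auto elim!: Ints_cases)
  qed
  have z_act: "z (act h x) = z x" if h: "h \<in> carrier G" and x: "x \<in> \<Omega>" for h x
  proof -
    have actm: "act (g \<otimes>\<^bsub>G\<^esub> g') y = act g (act g' y)" if "g \<in> carrier G" "g' \<in> carrier G" "y \<in> \<Omega>" for g g' y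
      using act that by (auto simp: acts_on_def)
    have hx: "act h x \<in> \<Omega>" using act h x by (auto simp: acts_on_def)
    have cancel: "inv\<^bsub>G\<^esub> h \<otimes>\<^bsub>G\<^esub> (h \<otimes>\<^bsub>G\<^esub> g) = g" "h \<otimes>\<^bsub>G\<^esub> (inv\<^bsub>G\<^esub> h \<otimes>\<^bsub>G\<^esub> g) = g" if "g \<in> carrier G" for g
      using h that by (simp_all add: m_assoc[symmetric])
    have bij: "bij_betw (\<lambda>g. h \<otimes>\<^bsub>G\<^esub> g \<otimes>\<^bsub>G\<^esub> inv\<^bsub>G\<^esub> h) (stab G act x) (stab G act (act h x))"
    proof (rule bij_betwI[where g = "\<lambda>g. inv\<^bsub>G\<^esub> h \<otimes>\<^bsub>G\<^esub> g \<otimes>\<^bsub>G\<^esub> h"])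
      show "(\<lambda>g. h \<otimes>\<^bsub>G\<^esub> g \<otimes>\<^bsub>G\<^esub> inv\<^bsub>G\<^esub> h) \<in> stab G act x \<rightarrow> stab G act (act h x)"
        using h x hx act_inv_act[OF G(1) act h x] by (auto simp: stab_def actm)
      show "(\<lambda>g. inv\<^bsub>G\<^esub> h \<otimes>\<^bsub>G\<^esub> g \<otimes>\<^bsub>G\<^esub> h) \<in> stab G act (act h x) \<rightarrow> stab G act x"
        using h x hx act_inv_act[OF G(1) act h x] by (auto simp: stab_def actm)
    qed (use h in \<open>auto simp: stab_def m_assoc cancel\<close>)
    have "(\<Sum>g\<in>stab G act (act h x). cnj (\<chi> g)) = (\<Sum>g\<in>stab G act x. cnj (\<chi> (h \<otimes>\<^bsub>G\<^esub> g \<otimes>\<^bsub>G\<^esub> inv\<^bsub>G\<^esub> h)))"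
      by (rule sum.reindex_bij_betw[OF bij, symmetric])
    also have "\<dots> = (\<Sum>g\<in>stab G act x. cnj (\<chi> g))"
      using irreducible_character_conj_class[OF \<chi> G(1) _ h] by (intro sum.cong) (auto simp: stab_def)
    finally show ?thesis using bij_betw_same_card[OF bij] by (simp add: z_def)
  qed
  obtain R where R: "R \<subseteq> \<Omega>" "\<And>x. x \<in> \<Omega> \<Longrightarrow> \<exists>!r. r \<in> R \<and> (\<exists>g\<in>carrier G. act g r = x)"
    using exists_representatives[OF G(1) act] by blast
  have "(\<Sum>g\<in>carrier G. of_nat (fixed_count \<Omega> act g) * cnj (\<chi> g)) = (\<Sum>x\<in>\<Omega>. of_nat (card (stab G act x)) * z x)"
    unfolding sum_fixed_count[OF G(2) fin] using pos by (intro sum.cong) (auto simp: z_def)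
  also have "\<dots> = of_nat (card (carrier G)) * (\<Sum>r\<in>R. z r)"
  proof (rule sum_stab_representatives[OF G act fin R(1)])
    show "\<exists>!r. r \<in> R \<and> (\<exists>g\<in>carrier G. act g r = x)" if "x \<in> \<Omega>" for x using R(2)[OF that] .
    show "z (act g x) = z x" if "g \<in> carrier G" "x \<in> \<Omega>" for g x using z_act[OF that] .
  qed
  finally have "class_inner G (\<lambda>g. of_nat (fixed_count \<Omega> act g)) \<chi> = (\<Sum>r\<in>R. z r)"
    using G(2) one_closed by (auto simp: class_inner_def Coset.order_def card_gt_0_iff)
  then show ?thesis using z R(1) by (auto intro!: Ints_sum)
qed

subsection \<open>Reducing a representation\<close>

text \<open>
  Q inverts P, and the vectors P v with v supported on J form the subspace W. The maximal such J is
  found by exchanging one column of P at a time.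
\<close>

lemma subspace_adapted_matrix:
  assumes W: "VectorSpace.subspace class_ring W (module_vec TYPE(complex) d)"
  obtains J P Q where "J \<subseteq> {..<d}" "P \<in> carrier_mat d d" "Q \<in> carrier_mat d d" "P * Q = 1\<^sub>m d" "Q * P = 1\<^sub>m d"
    "W = {P *\<^sub>v v | v. v \<in> carrier_vec d \<and> (\<forall>i<d. i \<notin> J \<longrightarrow> v $ i = 0)}"
proof -
  interpret vec_space "TYPE(complex)" d .
  interpret W: submodule class_ring W "module_vec TYPE(complex) d"
    using W by (simp add: subspace_def)
  have Wc: "W \<subseteq> carrier_vec d" using W.subset by (simp add: module_vec_simps)
  have W0: "0\<^sub>v d \<in> W" using W.zero_closed by (simp add: module_vec_simps)
  have Wadd: "v + w \<in> W" if "v \<in> W" "w \<in> W" for v w using W.m_closed[OF that] by (simp add: module_vec_simps)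
  have Wsmult: "c \<cdot>\<^sub>v w \<in> W" if "w \<in> W" for c w
    using W.smult_closed[of c w] that by (simp add: module_vec_simps class_ring_simps)
  define good where "good J \<longleftrightarrow> J \<subseteq> {..<d} \<and> (\<exists>P Q. P \<in> carrier_mat d d \<and> Q \<in> carrier_mat d d \<and>
      P * Q = 1\<^sub>m d \<and> Q * P = 1\<^sub>m d \<and>
      (\<forall>v\<in>carrier_vec d. (\<forall>i<d. i \<notin> J \<longrightarrow> v $ i = 0) \<longrightarrow> P *\<^sub>v v \<in> W))" for J
  have "good {}"
  proof -
    have "v = 0\<^sub>v d" if "v \<in> carrier_vec d" "\<forall>i<d. v $ i = 0" for v :: "complex vec"
      using that by auto
    then show ?thesis unfolding good_def using W0 by (auto intro!: exI[of _ "1\<^sub>m d"])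
  qed
  moreover have "card J \<le> d" if "good J" for J
    using that card_mono[of "{..<d}" J] by (simp add: good_def)
  ultimately obtain J where J: "good J" and max: "\<And>J'. good J' \<Longrightarrow> card J' \<le> card J"
    using ex_has_greatest_nat[of good "{}" card "Suc d"] by (metis le_imp_less_Suc)
  obtain P Q where PQ: "J \<subseteq> {..<d}" "P \<in> carrier_mat d d" "Q \<in> carrier_mat d d" "P * Q = 1\<^sub>m d" "Q * P = 1\<^sub>m d"
    and in_W: "\<And>v. v \<in> carrier_vec d \<Longrightarrow> (\<forall>i<d. i \<notin> J \<longrightarrow> v $ i = 0) \<Longrightarrow> P *\<^sub>v v \<in> W"
    using J unfolding good_def by blast
  have supp: "(Q *\<^sub>v w) $ i = 0" if w: "w \<in> W" and i: "i < d" "i \<notin> J" for w i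
  proof (rule ccontr)
    define c where "c = Q *\<^sub>v w"
    assume "(Q *\<^sub>v w) $ i \<noteq> 0"
    then have ci: "c $ i \<noteq> 0" by (simp add: c_def)
    have c: "c \<in> carrier_vec d" using PQ Wc w by (auto simp: c_def)
    have Pc: "P *\<^sub>v c = w"
    proof -
      have "P *\<^sub>v c = (P * Q) *\<^sub>v w" unfolding c_def using PQ Wc w by (intro assoc_mult_mat_vec[symmetric]) auto
      then show ?thesis using PQ Wc w by auto
    qed
    \<comment> \<open>\<open>M\<close> is the identity matrix with column \<open>i\<close> replaced
      by \<open>c\<close>, so \<open>P * M\<close> is \<open>P\<close> with column \<open>i\<close>
      replaced by \<open>w = P c\<close>. It is invertible because \<open>c $ i\<close> is nonzero,
      and \<open>N\<close> is its inverse.\<close>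
    define M where "M = mat d d (\<lambda>(a, b). if b = i then c $ a else if a = b then 1 else 0)"
    define N where "N = mat d d (\<lambda>(a, b). if b = i then (if a = i then 1 / c $ i else - c $ a / c $ i) else if a = b then 1 else 0)"
    have MN: "M \<in> carrier_mat d d" "N \<in> carrier_mat d d" by (auto simp: M_def N_def)
    have M_vec: "M *\<^sub>v v = (v + v $ i \<cdot>\<^sub>v c) - v $ i \<cdot>\<^sub>v unit_vec d i" if v: "v \<in> carrier_vec d" for v
    proof (rule eq_vecI)
      fix a assume "a < dim_vec ((v + v $ i \<cdot>\<^sub>v c) - v $ i \<cdot>\<^sub>v unit_vec d i)"
      then have a: "a < d" by simp
      have "(M *\<^sub>v v) $ a = (\<Sum>b<d. (if b = i then c $ a else if a = b then 1 else 0) * v $ b)"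
        using a v by (auto simp: M_def scalar_prod_def atLeast0LessThan intro!: sum.cong)
      also have "\<dots> = (\<Sum>b<d. (if b = i then c $ a * v $ i - (if a = i then v $ i else 0) else 0) + (if b = a then v $ a else 0))"
        by (intro sum.cong) auto
      also have "\<dots> = c $ a * v $ i - (if a = i then v $ i else 0) + v $ a"
        using a i by (simp add: sum.distrib)
      finally show "(M *\<^sub>v v) $ a = ((v + v $ i \<cdot>\<^sub>v c) - v $ i \<cdot>\<^sub>v unit_vec d i) $ a"
        using a i c v by (simp add: mult.commute)
    qed (use MN v c in auto)
    have "M * N = 1\<^sub>m d"
    proof (rule eq_matI)
      fix a b assume "a < dim_row (1\<^sub>m d :: complex mat)" "b < dim_col (1\<^sub>m d :: complex mat)"
      then have ab: "a < d" "b < d" by auto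
      have colN: "col N b \<in> carrier_vec d" using MN ab by auto
      have "(M * N) $$ (a, b) = (M *\<^sub>v col N b) $ a" using MN ab by simp
      also have "\<dots> = (1\<^sub>m d) $$ (a, b)"
        unfolding M_vec[OF colN] using ab i c ci MN by (auto simp: N_def field_simps)
      finally show "(M * N) $$ (a, b) = (1\<^sub>m d) $$ (a, b)" .
    qed (use MN in auto)
    moreover from this have "N * M = 1\<^sub>m d" using mat_mult_left_right_inverse[OF MN] by simp
    moreover have "(P * M) * (N * Q) = P * (M * N) * Q" "(N * Q) * (P * M) = N * (Q * P) * M"
      using PQ MN by (smt (verit) assoc_mult_mat mult_carrier_mat)+
    ultimately have inv: "(P * M) * (N * Q) = 1\<^sub>m d" "(N * Q) * (P * M) = 1\<^sub>m d"
      using PQ MN by auto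
    have "\<forall>v\<in>carrier_vec d. (\<forall>a<d. a \<notin> insert i J \<longrightarrow> v $ a = 0) \<longrightarrow> (P * M) *\<^sub>v v \<in> W"
    proof (intro ballI impI)
      fix v :: "complex vec" assume v: "v \<in> carrier_vec d" "\<forall>a<d. a \<notin> insert i J \<longrightarrow> v $ a = 0"
      define v' where "v' = v - v $ i \<cdot>\<^sub>v unit_vec d i"
      have v': "v' \<in> carrier_vec d" "\<forall>a<d. a \<notin> J \<longrightarrow> v' $ a = 0" using v i by (auto simp: v'_def)
      have "M *\<^sub>v v = v' + v $ i \<cdot>\<^sub>v c" unfolding M_vec[OF v(1)] v'_def using v c i by (intro eq_vecI) auto
      then have "(P * M) *\<^sub>v v = P *\<^sub>v (v' + v $ i \<cdot>\<^sub>v c)" using PQ MN v by simp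
      also have "\<dots> = P *\<^sub>v v' + v $ i \<cdot>\<^sub>v w"
        using PQ v' c Pc by (simp add: mult_add_distrib_mat_vec mult_mat_vec)
      finally show "(P * M) *\<^sub>v v \<in> W" using Wadd[OF in_W[OF v'] Wsmult[OF w]] by simp
    qed
    then have "good (insert i J)"
      unfolding good_def using inv PQ MN i
      by (intro conjI, simp) (rule exI[of _ "P * M"], rule exI[of _ "N * Q"], simp)
    then have "card (insert i J) \<le> card J" by (rule max)
    moreover have "finite J" using PQ(1) finite_subset by blast
    ultimately show False using i by simp
  qed
  have "W = {P *\<^sub>v v | v. v \<in> carrier_vec d \<and> (\<forall>i<d. i \<notin> J \<longrightarrow> v $ i = 0)}"
  proof (intro equalityI subsetI)
    fix w assume w: "w \<in> W"
    have "P *\<^sub>v (Q *\<^sub>v w) = (P * Q) *\<^sub>v w" using PQ Wc w by (intro assoc_mult_mat_vec[symmetric]) auto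
    then have "w = P *\<^sub>v (Q *\<^sub>v w)" using PQ Wc w by auto
    then show "w \<in> {P *\<^sub>v v | v. v \<in> carrier_vec d \<and> (\<forall>i<d. i \<notin> J \<longrightarrow> v $ i = 0)}"
      using supp[OF w] PQ Wc w by (auto intro!: exI[of _ "Q *\<^sub>v w"])
  qed (use in_W in auto)
  then show ?thesis using that PQ by blast
qed

definition compress :: "(nat \<Rightarrow> nat) \<Rightarrow> nat \<Rightarrow> 'a mat \<Rightarrow> 'a mat" where
  "compress e r A = mat r r (\<lambda>(a, b). A $$ (e a, e b))"

text \<open>The disjunction covers both diagonal blocks of a block triangular representation: the
  second alternative is the subrepresentation, where the columns of \<open>J\<close> vanish in the
  other rows, the first is the quotient, where the rows of \<open>J\<close> vanish in the other
  columns.\<close>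

lemma compress_representation:
  assumes G: "group G" and rep: "representation G d \<rho>" and e: "bij_betw e {..<r} J" "J \<subseteq> {..<d}"
    and zero: "\<And>g i j l. g \<in> carrier G \<Longrightarrow> i \<in> J \<Longrightarrow> j \<in> J \<Longrightarrow> l \<in> {..<d} - J \<Longrightarrow> \<rho> g $$ (i, l) = 0 \<or> (\<forall>h\<in>carrier G. \<rho> h $$ (l, j) = 0)"
  shows "representation G r (\<lambda>g. compress e r (\<rho> g))"
    and "character_of r (\<lambda>g. compress e r (\<rho> g)) g = (\<Sum>i\<in>J. \<rho> g $$ (i, i))"
proof -
  interpret group G by fact
  note carr = representation_carrier[OF G(1) rep] and mult = representation_mult[OF G(1) rep]
  have eJ: "e a \<in> J" "e a < d" if "a < r" for a using that e by (auto simp: bij_betw_def)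
  show "representation G r (\<lambda>g. compress e r (\<rho> g))"
  proof (rule representationI[OF G])
    fix g h assume gh: "g \<in> carrier G" "h \<in> carrier G"
    show "compress e r (\<rho> (g \<otimes>\<^bsub>G\<^esub> h)) = compress e r (\<rho> g) * compress e r (\<rho> h)"
    proof (rule eq_matI)
      fix a b assume "a < dim_row (compress e r (\<rho> g) * compress e r (\<rho> h))" "b < dim_col (compress e r (\<rho> g) * compress e r (\<rho> h))"
      then have ab: "a < r" "b < r" by (auto simp: compress_def)
      have "compress e r (\<rho> (g \<otimes>\<^bsub>G\<^esub> h)) $$ (a, b) = (\<Sum>l<d. \<rho> g $$ (e a, l) * \<rho> h $$ (l, e b))"
        using ab eJ by (simp add: compress_def mult gh mult_mat_index[OF carr carr] del: index_mult_mat)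
      also have "\<dots> = (\<Sum>l\<in>J. \<rho> g $$ (e a, l) * \<rho> h $$ (l, e b))"
      proof (intro sum.mono_neutral_right ballI)
        fix l assume "l \<in> {..<d} - J"
        then show "\<rho> g $$ (e a, l) * \<rho> h $$ (l, e b) = 0"
          using zero[OF gh(1) eJ(1)[OF ab(1)] eJ(1)[OF ab(2)]] gh(2) by auto
      qed (use e in auto)
      also have "\<dots> = (\<Sum>x<r. \<rho> g $$ (e a, e x) * \<rho> h $$ (e x, e b))"
        by (rule sum.reindex_bij_betw[OF e(1), symmetric])
      also have "\<dots> = (compress e r (\<rho> g) * compress e r (\<rho> h)) $$ (a, b)"
        using ab mult_mat_index[of "compress e r (\<rho> g)" r r "compress e r (\<rho> h)" r a b] by (simp add: compress_def)
      finally show "compress e r (\<rho> (g \<otimes>\<^bsub>G\<^esub> h)) $$ (a, b) = (compress e r (\<rho> g) * compress e r (\<rho> h)) $$ (a, b)" .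
    qed (auto simp: compress_def)
  next
    have "inj_on e {..<r}" using e by (simp add: bij_betw_def)
    then show "compress e r (\<rho> \<one>\<^bsub>G\<^esub>) = 1\<^sub>m r"
      using eJ by (intro eq_matI) (auto simp: compress_def representation_one[OF G rep] inj_on_def)
  qed (simp add: compress_def)
  show "character_of r (\<lambda>g. compress e r (\<rho> g)) g = (\<Sum>i\<in>J. \<rho> g $$ (i, i))"
    using sum.reindex_bij_betw[OF e(1), of "\<lambda>i. \<rho> g $$ (i, i)"] by (simp add: character_of_def compress_def)
qed

lemma conjugate_representation:
  assumes G: "group G" and rep: "representation G d \<rho>"
    and PQ: "P \<in> carrier_mat d d" "Q \<in> carrier_mat d d" "P * Q = 1\<^sub>m d" "Q * P = 1\<^sub>m d"
  shows "representation G d (\<lambda>g. Q * \<rho> g * P)"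
proof (rule representationI[OF G])
  note carr = representation_carrier[OF G(1) rep] and mult = representation_mult[OF G(1) rep]
  fix g h assume gh: "g \<in> carrier G" "h \<in> carrier G"
  have cancel: "P * (Q * A) = A" if "A \<in> carrier_mat d d" for A
    using PQ that assoc_mult_mat[of P d d Q d A d] by simp
  show "Q * \<rho> (g \<otimes>\<^bsub>G\<^esub> h) * P = Q * \<rho> g * P * (Q * \<rho> h * P)"
    using PQ(1,2) carr[OF gh(1)] carr[OF gh(2)]
    by (simp add: mult gh assoc_mult_mat[of _ d d _ d _ d] cancel)
qed (use PQ representation_carrier[OF G(1) rep] representation_one[OF G(1) rep] in auto)

text \<open>Only traces enter, so a block triangular form is as good as a direct sum: the character
  is the sum of the characters of the two diagonal blocks, and a linear functional that is nonzero
  on the sum is nonzero on a summand of smaller dimension.\<close>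

lemma exists_irreducible_constituent:
  assumes G: "group G" and rep: "representation G d \<rho>"
    and ne: "(\<Sum>g\<in>carrier G. character_of d \<rho> g * f g) \<noteq> 0"
  obtains \<chi> where "irreducible_character G \<chi>" "(\<Sum>g\<in>carrier G. \<chi> g * f g) \<noteq> 0"
  using rep ne
proof (induction d arbitrary: \<rho> thesis rule: less_induct)
  case (less d)
  note rep = less.prems(2) and ne = less.prems(3)
  have d: "d > 0"
    using ne by (cases "d = 0") (simp_all add: character_of_def)
  show ?case
  proof (cases "irreducible_representation G d \<rho>")
    case True
    then have "irreducible_character G (character_of d \<rho>)"
      by (auto simp: irreducible_character_def character_of_def)
    then show ?thesis using less.prems(1) ne by blast
  next
    case False
    then obtain W where W: "VectorSpace.subspace class_ring W (module_vec TYPE(complex) d)"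
      and inv: "\<And>g w. g \<in> carrier G \<Longrightarrow> w \<in> W \<Longrightarrow> \<rho> g *\<^sub>v w \<in> W"
      and proper: "W \<noteq> {0\<^sub>v d}" "W \<noteq> carrier_vec d"
      using rep d by (auto simp: irreducible_representation_def)
    obtain J P Q where J: "J \<subseteq> {..<d}" and PQ: "P \<in> carrier_mat d d" "Q \<in> carrier_mat d d" "P * Q = 1\<^sub>m d" "Q * P = 1\<^sub>m d"
      and W_eq: "W = {P *\<^sub>v v | v. v \<in> carrier_vec d \<and> (\<forall>i<d. i \<notin> J \<longrightarrow> v $ i = 0)}"
      using subspace_adapted_matrix[OF W] .
    define \<sigma> where "\<sigma> g = Q * \<rho> g * P" for g
    have rep\<sigma>: "representation G d \<sigma>" unfolding \<sigma>_def by (rule conjugate_representation[OF G rep PQ])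
    note carr = representation_carrier[OF G rep] and carr\<sigma> = representation_carrier[OF G rep\<sigma>]
    have char\<sigma>: "character_of d \<rho> g = character_of d \<sigma> g" if "g \<in> carrier G" for g
      using mtrace_conjugate[OF carr[OF that] PQ(1-3)] carr[OF that] carr\<sigma>[OF that]
      by (simp add: character_of_eq_mtrace \<sigma>_def)
    have QPv: "Q *\<^sub>v (P *\<^sub>v v) = v" if "v \<in> carrier_vec d" for v
    proof -
      have "Q *\<^sub>v (P *\<^sub>v v) = (Q * P) *\<^sub>v v" using PQ that by (intro assoc_mult_mat_vec[symmetric]) auto
      then show ?thesis using PQ that by simp
    qed
    have PQv: "P *\<^sub>v (Q *\<^sub>v v) = v" if "v \<in> carrier_vec d" for v
    proof -
      have "P *\<^sub>v (Q *\<^sub>v v) = (P * Q) *\<^sub>v v" using PQ that by (intro assoc_mult_mat_vec[symmetric]) auto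
      then show ?thesis using PQ that by simp
    qed
    have block: "\<sigma> g $$ (l, j) = 0" if g: "g \<in> carrier G" and lj: "l \<in> {..<d} - J" "j \<in> J" for g l j
    proof -
      have j: "j < d" using lj J by auto
      have "P *\<^sub>v unit_vec d j \<in> W" unfolding W_eq using lj J by (auto intro!: exI[of _ "unit_vec d j"])
      then have "\<rho> g *\<^sub>v (P *\<^sub>v unit_vec d j) \<in> W" by (rule inv[OF g])
      then obtain v where v: "v \<in> carrier_vec d" "\<forall>i<d. i \<notin> J \<longrightarrow> v $ i = 0" "\<rho> g *\<^sub>v (P *\<^sub>v unit_vec d j) = P *\<^sub>v v"
        unfolding W_eq by blast
      have "\<sigma> g *\<^sub>v unit_vec d j = Q *\<^sub>v (\<rho> g *\<^sub>v (P *\<^sub>v unit_vec d j))"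
        unfolding \<sigma>_def using PQ carr[OF g] by (simp add: assoc_mult_mat_vec[of _ d d _ d])
      also have "\<dots> = v" using v QPv by simp
      finally have "(\<sigma> g *\<^sub>v unit_vec d j) $ l = 0" using v lj by auto
      then show ?thesis using carr\<sigma>[OF g] lj j by auto
    qed
    have finJ: "finite J" using J finite_subset by blast
    have J_ne: "J \<noteq> {}"
    proof
      assume "J = {}"
      then have "v = 0\<^sub>v d" if "v \<in> carrier_vec d" "\<forall>i<d. i \<notin> J \<longrightarrow> v $ i = 0" for v :: "complex vec" using that by auto
      then have "W = {P *\<^sub>v 0\<^sub>v d}" unfolding W_eq by (auto intro!: exI[of _ "0\<^sub>v d"])
      then show False using proper PQ by auto
    qed
    have J_ne': "J \<noteq> {..<d}"
    proof
      assume "J = {..<d}"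
      then have "w \<in> W" if "w \<in> carrier_vec d" for w
        unfolding W_eq using that PQ PQv[OF that] by (auto intro!: exI[of _ "Q *\<^sub>v w"])
      then show False using proper W_eq PQ by auto
    qed
    have "card J < d" using J J_ne' psubset_card_mono[of "{..<d}" J] by auto
    have "card ({..<d} - J) < d" using J J_ne finJ by (simp add: card_Diff_subset card_gt_0_iff d)
    obtain e where e: "bij_betw e {..<card J} J" using ex_bij_betw_nat_finite[OF finJ] by (auto simp: atLeast0LessThan)
    obtain e' where e': "bij_betw e' {..<card ({..<d} - J)} ({..<d} - J)"
      using ex_bij_betw_nat_finite[of "{..<d} - J"] by (auto simp: atLeast0LessThan)
    note sub = compress_representation[OF G rep\<sigma> e J]
    note quot = compress_representation[OF G rep\<sigma> e' Diff_subset]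
    have "character_of d \<rho> g = character_of (card J) (\<lambda>g. compress e (card J) (\<sigma> g)) g +
        character_of (card ({..<d} - J)) (\<lambda>g. compress e' (card ({..<d} - J)) (\<sigma> g)) g" if g: "g \<in> carrier G" for g
    proof -
      have "character_of d \<sigma> g = (\<Sum>i\<in>J. \<sigma> g $$ (i, i)) + (\<Sum>i\<in>{..<d} - J. \<sigma> g $$ (i, i))"
        unfolding character_of_def using J by (subst sum.subset_diff[of J]) (auto simp: add.commute)
      then show ?thesis using char\<sigma>[OF g] sub(2) quot(2) block by auto
    qed
    then have split: "(\<Sum>g\<in>carrier G. character_of d \<rho> g * f g) =
       (\<Sum>g\<in>carrier G. character_of (card J) (\<lambda>g. compress e (card J) (\<sigma> g)) g * f g) +
       (\<Sum>g\<in>carrier G. character_of (card ({..<d} - J)) (\<lambda>g. compress e' (card ({..<d} - J)) (\<sigma> g)) g * f g)"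
      by (simp add: distrib_right sum.distrib)
    consider "(\<Sum>g\<in>carrier G. character_of (card J) (\<lambda>g. compress e (card J) (\<sigma> g)) g * f g) \<noteq> 0"
      | "(\<Sum>g\<in>carrier G. character_of (card ({..<d} - J)) (\<lambda>g. compress e' (card ({..<d} - J)) (\<sigma> g)) g * f g) \<noteq> 0"
      using ne unfolding split by (metis (no_types, lifting) add.right_neutral)
    then show ?thesis
    proof cases
      case 1
      show ?thesis by (rule less.IH[OF \<open>card J < d\<close> less.prems(1) sub(1) 1]) (use block in auto)
    next
      case 2
      show ?thesis by (rule less.IH[OF \<open>card ({..<d} - J) < d\<close> less.prems(1) quot(1) 2]) (use block in auto)
    qed
  qed
qed

lemma permutation_representation:
  assumes G: "group G" and act: "acts_on G \<Omega> act" and fin: "finite \<Omega>"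
  obtains d \<rho> where "representation G d \<rho>" "\<And>g. g \<in> carrier G \<Longrightarrow> character_of d \<rho> g = of_nat (fixed_count \<Omega> act g)"
proof -
  obtain e where e: "bij_betw e {..<card \<Omega>} \<Omega>" using ex_bij_betw_nat_finite[OF fin] by (auto simp: atLeast0LessThan)
  define \<rho> where "\<rho> g = mat (card \<Omega>) (card \<Omega>) (\<lambda>(i, j). if act g (e j) = e i then 1 else 0 :: complex)" for g
  have e_in: "e i \<in> \<Omega>" if "i < card \<Omega>" for i using e that by (auto simp: bij_betw_def)
  have e_inj: "e i = e j \<longleftrightarrow> i = j" if "i < card \<Omega>" "j < card \<Omega>" for i j
    using e that by (auto simp: bij_betw_def inj_on_def)
  have "representation G (card \<Omega>) \<rho>"
  proof (rule representationI[OF G])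
    fix g h assume gh: "g \<in> carrier G" "h \<in> carrier G"
    show "\<rho> (g \<otimes>\<^bsub>G\<^esub> h) = \<rho> g * \<rho> h"
    proof (rule eq_matI)
      fix i j assume "i < dim_row (\<rho> g * \<rho> h)" "j < dim_col (\<rho> g * \<rho> h)"
      then have ij: "i < card \<Omega>" "j < card \<Omega>" by (auto simp: \<rho>_def)
      have "act h (e j) \<in> \<Omega>" using act gh e_in[OF ij(2)] by (auto simp: acts_on_def)
      then obtain l where l: "l < card \<Omega>" "act h (e j) = e l" using e by (auto simp: bij_betw_def image_iff)
      have "\<rho> g $$ (i, x) * \<rho> h $$ (x, j) = (if x = l then (if act g (e x) = e i then 1 else 0) else 0)"
        if x: "x < card \<Omega>" for x
        using ij l x e_inj[OF l(1) x] by (auto simp: \<rho>_def)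
      then have "(\<rho> g * \<rho> h) $$ (i, j) = (\<Sum>x<card \<Omega>. if x = l then (if act g (e x) = e i then 1 else 0) else 0)"
        using ij by (subst mult_mat_index[of _ "card \<Omega>" "card \<Omega>" _ "card \<Omega>"]) (auto simp: \<rho>_def)
      also have "\<dots> = (if act g (e l) = e i then 1 else 0)" using l by simp
      finally show "\<rho> (g \<otimes>\<^bsub>G\<^esub> h) $$ (i, j) = (\<rho> g * \<rho> h) $$ (i, j)"
        using act gh e_in[OF ij(2)] l ij by (simp add: \<rho>_def acts_on_def)
    qed (auto simp: \<rho>_def)
  next
    show "\<rho> \<one>\<^bsub>G\<^esub> = 1\<^sub>m (card \<Omega>)"
      using act e_in e_inj by (intro eq_matI) (auto simp: \<rho>_def acts_on_def)
  qed (simp add: \<rho>_def)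
  moreover have "character_of (card \<Omega>) \<rho> g = of_nat (fixed_count \<Omega> act g)" for g
  proof -
    have "character_of (card \<Omega>) \<rho> g = (\<Sum>i<card \<Omega>. if act g (e i) = e i then 1 else 0)"
      by (simp add: character_of_def \<rho>_def)
    also have "\<dots> = (\<Sum>x\<in>\<Omega>. if act g x = x then 1 else 0)" by (rule sum.reindex_bij_betw[OF e])
    also have "\<dots> = of_nat (fixed_count \<Omega> act g)"
      using fin by (simp add: fixed_count_def sum.If_cases Int_def)
    finally show ?thesis .
  qed
  ultimately show ?thesis using that by blast
qed

section \<open>Class functions of norm one and integral inner products\<close>

lemma class_inner_defect:
  fixes t :: real
  assumes G: "group G" "finite (carrier G)" and \<chi>: "class_inner G \<chi> \<chi> = 1" and \<psi>: "class_inner G \<psi> \<psi> = of_real t"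
  shows "(\<Sum>g\<in>carrier G. (cmod (\<psi> g - class_inner G \<psi> \<chi> * \<chi> g))\<^sup>2) = of_nat (card (carrier G)) * (t - (cmod (class_inner G \<psi> \<chi>))\<^sup>2)"
proof -
  interpret group G by fact
  define z where "z = class_inner G \<psi> \<chi>"
  let ?n = "of_nat (card (carrier G)) :: complex"
  have n: "?n \<noteq> 0" using G(2) one_closed by auto
  have sums: "(\<Sum>g\<in>carrier G. \<psi> g * cnj (\<psi> g)) = ?n * of_real t" "(\<Sum>g\<in>carrier G. \<chi> g * cnj (\<chi> g)) = ?n"
      "(\<Sum>g\<in>carrier G. \<psi> g * cnj (\<chi> g)) = ?n * z"
    using \<chi> \<psi> n by (auto simp: class_inner_def z_def Coset.order_def field_simps)
  then have sums': "(\<Sum>g\<in>carrier G. \<chi> g * cnj (\<psi> g)) = ?n * cnj z"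
    by (metis (no_types, lifting) cnj_sum complex_cnj_cnj complex_cnj_mult complex_cnj_of_nat mult.commute sum.cong)
  have "of_real (\<Sum>g\<in>carrier G. (cmod (\<psi> g - z * \<chi> g))\<^sup>2) = (\<Sum>g\<in>carrier G. (\<psi> g - z * \<chi> g) * cnj (\<psi> g - z * \<chi> g))"
    by (simp add: complex_norm_square[symmetric] del: complex_cnj_diff complex_cnj_mult)
  also have "\<dots> = (\<Sum>g\<in>carrier G. \<psi> g * cnj (\<psi> g)) - cnj z * (\<Sum>g\<in>carrier G. \<psi> g * cnj (\<chi> g))
      - z * (\<Sum>g\<in>carrier G. \<chi> g * cnj (\<psi> g)) + z * cnj z * (\<Sum>g\<in>carrier G. \<chi> g * cnj (\<chi> g))"
    by (simp add: algebra_simps sum.distrib sum_subtractf sum_distrib_left)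
  also have "\<dots> = ?n * (of_real t - z * cnj z)" unfolding sums sums' by (simp add: algebra_simps)
  also have "\<dots> = of_real (of_nat (card (carrier G)) * (t - (cmod z)\<^sup>2))"
    by (simp only: complex_norm_square of_real_mult of_real_diff of_real_of_nat_eq)
  finally show ?thesis unfolding z_def of_real_eq_iff .
qed

lemma
  assumes G: "group G" "finite (carrier G)" and \<chi>: "irreducible_character G \<chi>"
    and \<psi>: "class_inner G \<psi> \<psi> \<in> {0, 1}" and z: "class_inner G \<psi> \<chi> \<in> \<int>" "class_inner G \<psi> \<chi> \<noteq> 0"
    and g: "g \<in> carrier G"
  shows cmod_eq_if_integral_inner: "cmod (\<psi> g) = cmod (\<chi> g)" "class_inner G \<psi> \<psi> = 1"
    and eq_smult_if_integral_inner: "\<psi> g = class_inner G \<psi> \<chi> * \<chi> g"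
proof -
  interpret group G by fact
  define t :: real where "t = (if class_inner G \<psi> \<psi> = 0 then 0 else 1)"
  have t: "class_inner G \<psi> \<psi> = of_real t" "t \<le> 1" using \<psi> by (auto simp: t_def)
  let ?z = "class_inner G \<psi> \<chi>"
  let ?S = "\<Sum>g\<in>carrier G. (cmod (\<psi> g - ?z * \<chi> g))\<^sup>2"
  have S: "?S = of_nat (card (carrier G)) * (t - (cmod ?z)\<^sup>2)"
    by (rule class_inner_defect[OF G irreducible_character_inner_self[OF \<chi> G] t(1)])
  obtain m :: int where m: "?z = of_int m" using z(1) by (auto elim: Ints_cases)
  have m1: "(cmod ?z)\<^sup>2 = of_int (m\<^sup>2)" by (simp add: m)
  have "m \<noteq> 0" using z(2) m by auto
  then have "1 \<le> m\<^sup>2" by (simp add: int_one_le_iff_zero_less)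
  then have ge: "1 \<le> (cmod ?z)\<^sup>2" unfolding m1 by linarith
  have "0 \<le> ?S" by (intro sum_nonneg) auto
  moreover have cpos: "card (carrier G) > 0" using G(2) one_closed by (auto simp: card_gt_0_iff)
  ultimately have "0 \<le> t - (cmod ?z)\<^sup>2" unfolding S by (simp add: zero_le_mult_iff)
  then have eq: "t = 1" "(cmod ?z)\<^sup>2 = 1" using ge t(2) by linarith+
  show "class_inner G \<psi> \<psi> = 1" using t eq by simp
  have "?S = 0" using S eq by simp
  then have "cmod (\<psi> g - ?z * \<chi> g) = 0"
    using G(2) g by (subst (asm) sum_nonneg_eq_0_iff) auto
  then show smult: "\<psi> g = ?z * \<chi> g" by simp
  have "cmod ?z = 1" by (rule power2_eq_imp_eq) (use eq in auto)
  then show "cmod (\<psi> g) = cmod (\<chi> g)" using smult by (simp add: norm_mult)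
qed

section \<open>Matrices over a commutative ring\<close>

lemma poly_mapping_single_induct:
  fixes P :: "'k \<Rightarrow>\<^sub>0 'b::comm_monoid_add"
  assumes single: "\<And>k c. \<phi> (Poly_Mapping.single k c)" and add: "\<And>P Q. \<phi> P \<Longrightarrow> \<phi> Q \<Longrightarrow> \<phi> (P + Q)"
  shows "\<phi> P"
proof -
  have zero: "\<phi> 0" using single[of undefined 0] by simp
  have "\<phi> (\<Sum>k\<in>A. Poly_Mapping.single k (Poly_Mapping.lookup P k))" if "finite A" for A
    using that by (induction A rule: finite_induct) (auto intro: zero single add)
  moreover have "P = (\<Sum>k\<in>Poly_Mapping.keys P. Poly_Mapping.single k (Poly_Mapping.lookup P k))"
    by (rule poly_mapping_eqI) (auto simp: lookup_sum lookup_single when_def in_keys_iff)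
  ultimately show ?thesis by (metis finite_keys)
qed

type_synonym 'a free_ring = "('a \<Rightarrow>\<^sub>0 nat) \<Rightarrow>\<^sub>0 int"

definition free_var :: "'a \<Rightarrow> 'a free_ring" where
  "free_var a = Poly_Mapping.single (Poly_Mapping.single a 1) 1"

context cring
begin

text \<open>Elements of the type outside the carrier go to \<open>\<zero>\<close>, which makes the
  evaluation total on the free ring.\<close>

definition atom :: "'a \<Rightarrow> 'a" where
  "atom a = (if a \<in> carrier R then a else \<zero>)"

definition monom_eval :: "('a \<Rightarrow>\<^sub>0 nat) \<Rightarrow> 'a" where
  "monom_eval m = (\<Otimes>a\<in>Poly_Mapping.keys m. atom a [^] Poly_Mapping.lookup m a)"

text \<open>
  Every commutative ring is a quotient of the polynomial ring over the integers in its elements,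
  which is a type of class comm_ring_1: polynomial identities proved for types of this class hold
  for ring records.
\<close>

definition free_eval :: "'a free_ring \<Rightarrow> 'a" where
  "free_eval P = (\<Oplus>m\<in>Poly_Mapping.keys P. [Poly_Mapping.lookup P m] \<cdot> monom_eval m)"

lemma atom_closed [simp, intro]: "atom a \<in> carrier R"
  by (simp add: atom_def)

lemma monom_eval_closed [simp, intro]: "monom_eval m \<in> carrier R"
  unfolding monom_eval_def by (intro finprod_closed) auto

lemma monom_eval_superset:
  assumes "finite S" "Poly_Mapping.keys m \<subseteq> S"
  shows "monom_eval m = (\<Otimes>a\<in>S. atom a [^] Poly_Mapping.lookup m a)"
  unfolding monom_eval_def
  by (rule finprod_mono_neutral_cong_left) (use assms in \<open>auto simp: in_keys_iff\<close>)

lemma monom_eval_add: "monom_eval (m + m') = monom_eval m \<otimes> monom_eval m'"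
proof -
  let ?S = "Poly_Mapping.keys m \<union> Poly_Mapping.keys m'"
  have "monom_eval (m + m') = (\<Otimes>a\<in>?S. atom a [^] Poly_Mapping.lookup (m + m') a)"
    by (rule monom_eval_superset) (use keys_add[of m m'] in auto)
  also have "\<dots> = (\<Otimes>a\<in>?S. atom a [^] Poly_Mapping.lookup m a \<otimes> atom a [^] Poly_Mapping.lookup m' a)"
    by (rule finprod_cong') (auto simp: lookup_add nat_pow_mult)
  also have "\<dots> = (\<Otimes>a\<in>?S. atom a [^] Poly_Mapping.lookup m a) \<otimes> (\<Otimes>a\<in>?S. atom a [^] Poly_Mapping.lookup m' a)"
    by (rule finprod_multf) auto
  finally show ?thesis using monom_eval_superset[of ?S m] monom_eval_superset[of ?S m'] by simp
qed

lemma free_eval_closed [simp, intro]: "free_eval P \<in> carrier R"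
  unfolding free_eval_def by (intro finsum_closed) (auto intro: add.int_pow_closed)

lemma free_eval_superset:
  assumes "finite S" "Poly_Mapping.keys P \<subseteq> S"
  shows "free_eval P = (\<Oplus>m\<in>S. [Poly_Mapping.lookup P m] \<cdot> monom_eval m)"
  unfolding free_eval_def
proof (rule add.finprod_mono_neutral_cong_left[OF assms])
  fix m assume "m \<in> S - Poly_Mapping.keys P"
  then show "[Poly_Mapping.lookup P m] \<cdot> monom_eval m = \<zero>" by (simp add: in_keys_iff add_pow_def)
qed (auto intro: add.int_pow_closed)

lemma free_eval_single: "free_eval (Poly_Mapping.single m c) = [c] \<cdot> monom_eval m"
  by (subst free_eval_superset[of "{m}"]) (auto simp: lookup_single add.int_pow_closed)

lemma free_eval_add: "free_eval (P + Q) = free_eval P \<oplus> free_eval Q"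
proof -
  let ?S = "Poly_Mapping.keys P \<union> Poly_Mapping.keys Q"
  have "free_eval (P + Q) = (\<Oplus>m\<in>?S. [Poly_Mapping.lookup (P + Q) m] \<cdot> monom_eval m)"
    by (rule free_eval_superset) (use keys_add[of P Q] in auto)
  also have "\<dots> = (\<Oplus>m\<in>?S. [Poly_Mapping.lookup P m] \<cdot> monom_eval m \<oplus> [Poly_Mapping.lookup Q m] \<cdot> monom_eval m)"
    by (rule finsum_cong') (auto simp: lookup_add add.int_pow_mult add.int_pow_closed)
  also have "\<dots> = (\<Oplus>m\<in>?S. [Poly_Mapping.lookup P m] \<cdot> monom_eval m) \<oplus> (\<Oplus>m\<in>?S. [Poly_Mapping.lookup Q m] \<cdot> monom_eval m)"
    by (rule finsum_addf) (auto simp: add.int_pow_closed)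
  finally show ?thesis using free_eval_superset[of ?S P] free_eval_superset[of ?S Q] by simp
qed

lemma free_eval_mult: "free_eval (P * Q) = free_eval P \<otimes> free_eval Q"
proof (induction P rule: poly_mapping_single_induct)
  case (1 m c)
  show ?case
  proof (induction Q rule: poly_mapping_single_induct)
    case (1 m' c')
    have "add_pow R (c * c') (monom_eval m \<otimes> monom_eval m') = add_pow R c (monom_eval m) \<otimes> add_pow R c' (monom_eval m')"
      by (simp add: add_pow_ldistr_int add_pow_rdistr_int add.int_pow_pow add.int_pow_closed mult.commute)
    then show ?case by (simp add: mult_single free_eval_single monom_eval_add)
  next
    case (2 P Q)
    then show ?case by (simp add: distrib_left free_eval_add r_distr)
  qed
next
  case (2 P P')
  then show ?case by (simp add: distrib_right free_eval_add l_distr)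
qed

lemma free_eval_0: "free_eval 0 = \<zero>"
  by (simp add: free_eval_def)

lemma free_eval_1: "free_eval 1 = \<one>"
  using free_eval_single[of 0 1] by (simp add: monom_eval_def)

lemma free_eval_uminus: "free_eval (- P) = \<ominus> free_eval P"
  by (rule minus_equality[symmetric]) (auto simp flip: free_eval_add simp: free_eval_0)

lemma free_eval_sum: "finite A \<Longrightarrow> free_eval (\<Sum>x\<in>A. f x) = (\<Oplus>x\<in>A. free_eval (f x))"
  by (induction A rule: finite_induct) (auto simp: free_eval_0 free_eval_add)

lemma free_eval_prod: "finite A \<Longrightarrow> free_eval (\<Prod>x\<in>A. f x) = (\<Otimes>x\<in>A. free_eval (f x))"
  by (induction A rule: finite_induct) (auto simp: free_eval_1 free_eval_mult)

lemma free_eval_power: "free_eval (P ^ k) = free_eval P [^] k"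
  by (induction k) (auto simp: free_eval_1 free_eval_mult m_comm)

lemma free_eval_var: "a \<in> carrier R \<Longrightarrow> free_eval (free_var a) = a"
  by (simp add: free_var_def free_eval_single monom_eval_def atom_def)

lemma det_over_free_eval:
  assumes "M \<in> carrier_mat n n"
  shows "det_over R (map_mat free_eval M) = free_eval (det M)"
proof -
  have dim: "dim_row (map_mat free_eval M) = n" using assms by simp
  have "free_eval (signof p * x) = (if evenperm p then free_eval x else \<ominus> free_eval x)" for p :: "nat \<Rightarrow> nat" and x
    by (simp add: sign_def free_eval_uminus)
  moreover have "(\<Otimes>i\<in>{0..<n}. map_mat free_eval M $$ (i, p i)) = free_eval (\<Prod>i = 0..<n. M $$ (i, p i))"
    if "p permutes {0..<n}" for p
    unfolding free_eval_prod[OF finite_atLeastLessThan]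
    by (rule finprod_cong') (use assms permutes_in_image[OF that] in auto)
  ultimately show ?thesis
    unfolding det_over_def dim det_def'[OF assms]
    by (subst free_eval_sum) (auto simp: finite_permutations intro!: finsum_cong')
qed

lemma mat_mult_over_free_eval:
  assumes "A \<in> carrier_mat n m" "B \<in> carrier_mat m k"
  shows "mat_mult_over R (map_mat free_eval A) (map_mat free_eval B) = map_mat free_eval (A * B)"
proof (rule eq_matI)
  fix i j assume "i < dim_row (map_mat free_eval (A * B))" "j < dim_col (map_mat free_eval (A * B))"
  then have ij: "i < n" "j < k" using assms by auto
  have "(A * B) $$ (i, j) = (\<Sum>l = 0..<m. A $$ (i, l) * B $$ (l, j))"
    using assms ij by (simp add: scalar_prod_def)
  then have "free_eval ((A * B) $$ (i, j)) = (\<Oplus>l\<in>{0..<m}. free_eval (A $$ (i, l) * B $$ (l, j)))"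
    by (simp only: free_eval_sum[OF finite_atLeastLessThan])
  also have "\<dots> = (\<Oplus>l\<in>{0..<m}. map_mat free_eval A $$ (i, l) \<otimes> map_mat free_eval B $$ (l, j))"
    by (rule finsum_cong') (use assms ij in \<open>auto simp: free_eval_mult\<close>)
  finally show "mat_mult_over R (map_mat free_eval A) (map_mat free_eval B) $$ (i, j) = map_mat free_eval (A * B) $$ (i, j)"
    using assms ij by (simp add: mat_mult_over_def)
qed (use assms in \<open>auto simp: mat_mult_over_def\<close>)

end

definition mats :: "('a, 'm) ring_scheme \<Rightarrow> nat \<Rightarrow> nat \<Rightarrow> 'a mat set" where
  "mats R n m = {A \<in> carrier_mat n m. \<forall>i<n. \<forall>j<m. A $$ (i, j) \<in> carrier R}"

definition diag_over :: "('a, 'm) ring_scheme \<Rightarrow> nat \<Rightarrow> (nat \<Rightarrow> 'a) \<Rightarrow> 'a mat" where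
  "diag_over R n d = mat n n (\<lambda>(i, j). if i = j then d i else \<zero>\<^bsub>R\<^esub>)"

lemma mats_iff_elements: "A \<in> mats R n m \<longleftrightarrow> A \<in> carrier_mat n m \<and> elements_mat A \<subseteq> carrier R"
  by (fastforce simp: mats_def elements_mat_def)

lemma mats_carrier_mat: "A \<in> mats R n m \<Longrightarrow> A \<in> carrier_mat n m"
  by (simp add: mats_def)

lemma mats_index: "A \<in> mats R n m \<Longrightarrow> i < n \<Longrightarrow> j < m \<Longrightarrow> A $$ (i, j) \<in> carrier R"
  by (simp add: mats_def)

section \<open>Matrix identities transferred from the free ring\<close>

context cring
begin

lemma free_lift:
  assumes "A \<in> mats R n m"
  obtains A' where "A' \<in> carrier_mat n m" "map_mat free_eval A' = A"
proof
  show "map_mat free_var A \<in> carrier_mat n m" using assms by (simp add: mats_def)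
  show "map_mat free_eval (map_mat free_var A) = A"
    using assms by (intro eq_matI) (auto simp: mats_def free_eval_var)
qed

lemma map_free_eval_mats: "A \<in> carrier_mat n m \<Longrightarrow> map_mat free_eval A \<in> mats R n m"
  by (auto simp: mats_def)

lemma mat_mult_over_closed:
  assumes "A \<in> mats R n m" "B \<in> mats R m k"
  shows "mat_mult_over R A B \<in> mats R n k"
proof -
  obtain A' B' where "A' \<in> carrier_mat n m" "map_mat free_eval A' = A" "B' \<in> carrier_mat m k" "map_mat free_eval B' = B"
    using free_lift assms by metis
  then show ?thesis using mat_mult_over_free_eval map_free_eval_mats[of "A' * B'" n k] by auto
qed

lemma mat_mult_over_assoc:
  assumes "A \<in> mats R n m" "B \<in> mats R m k" "C \<in> mats R k l"
  shows "mat_mult_over R (mat_mult_over R A B) C = mat_mult_over R A (mat_mult_over R B C)"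
proof -
  obtain A' B' C' where lift: "A' \<in> carrier_mat n m" "map_mat free_eval A' = A" "B' \<in> carrier_mat m k" "map_mat free_eval B' = B"
    "C' \<in> carrier_mat k l" "map_mat free_eval C' = C"
    using free_lift assms by metis
  have "A' * B' * C' = A' * (B' * C')" using lift by (intro assoc_mult_mat)
  then have "mat_mult_over R (mat_mult_over R (map_mat free_eval A') (map_mat free_eval B')) (map_mat free_eval C') =
    mat_mult_over R (map_mat free_eval A') (mat_mult_over R (map_mat free_eval B') (map_mat free_eval C'))"
    unfolding mat_mult_over_free_eval[OF lift(1,3)] mat_mult_over_free_eval[OF lift(3,5)]
      mat_mult_over_free_eval[OF mult_carrier_mat[OF lift(1,3)] lift(5)]
      mat_mult_over_free_eval[OF lift(1) mult_carrier_mat[OF lift(3,5)]] by simp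
  then show ?thesis by (simp only: lift)
qed

lemma det_over_closed: "A \<in> mats R n n \<Longrightarrow> det_over R A \<in> carrier R"
  by (metis free_lift det_over_free_eval free_eval_closed)

lemma det_over_mult:
  assumes "A \<in> mats R n n" "B \<in> mats R n n"
  shows "det_over R (mat_mult_over R A B) = det_over R A \<otimes> det_over R B"
proof -
  obtain A' B' where lift: "A' \<in> carrier_mat n n" "map_mat free_eval A' = A" "B' \<in> carrier_mat n n" "map_mat free_eval B' = B"
    using free_lift assms by metis
  have "det_over R (map_mat free_eval (A' * B')) = free_eval (det A') \<otimes> free_eval (det B')"
    using lift by (simp add: det_over_free_eval[OF mult_carrier_mat] det_mult free_eval_mult)
  then show ?thesis
    using mat_mult_over_free_eval[OF lift(1,3)] det_over_free_eval[OF lift(1)] det_over_free_eval[OF lift(3)]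
    unfolding lift by simp
qed

lemma one_mat_over_eq_diag: "one_mat_over R n = diag_over R n (\<lambda>_. \<one>)"
  by (simp add: one_mat_over_def diag_over_def)

lemma diag_over_mats: "(\<And>i. i < n \<Longrightarrow> d i \<in> carrier R) \<Longrightarrow> diag_over R n d \<in> mats R n n"
  by (auto simp: mats_def diag_over_def)

lemma det_over_diag:
  assumes "\<And>i. i < n \<Longrightarrow> d i \<in> carrier R"
  shows "det_over R (diag_over R n d) = (\<Otimes>i\<in>{0..<n}. d i)"
proof -
  define D where "D = mat n n (\<lambda>(i, j). if i = j then free_var (d i) else 0)"
  have D: "D \<in> carrier_mat n n" by (simp add: D_def)
  have "map_mat free_eval D = diag_over R n d"
    by (rule eq_matI) (auto simp: D_def diag_over_def free_eval_var free_eval_0 assms)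
  then have "det_over R (diag_over R n d) = free_eval (det D)" using det_over_free_eval[OF D] by simp
  also have "det D = (\<Prod>i = 0..<n. free_var (d i))"
    by (subst det_upper_triangular[OF _ D]) (auto simp: D_def upper_triangular_def prod_list_diag_prod)
  also have "free_eval \<dots> = (\<Otimes>i\<in>{0..<n}. d i)"
    by (subst free_eval_prod) (auto intro!: finprod_cong' simp: free_eval_var assms)
  finally show ?thesis .
qed

lemma mat_mult_over_one:
  assumes "A \<in> mats R n n"
  shows "mat_mult_over R (one_mat_over R n) A = A" "mat_mult_over R A (one_mat_over R n) = A"
proof -
  obtain A' where lift: "A' \<in> carrier_mat n n" "map_mat free_eval A' = A"
    using free_lift assms by metis
  have one: "map_mat free_eval (1\<^sub>m n) = one_mat_over R n"
    by (rule eq_matI) (auto simp: one_mat_over_def free_eval_0 free_eval_1)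
  show "mat_mult_over R (one_mat_over R n) A = A" "mat_mult_over R A (one_mat_over R n) = A"
    using mat_mult_over_free_eval[OF one_carrier_mat lift(1)] mat_mult_over_free_eval[OF lift(1) one_carrier_mat] lift one
    by auto
qed

lemma exists_adjugate:
  assumes "A \<in> mats R n n"
  obtains B where "B \<in> mats R n n" "mat_mult_over R A B = diag_over R n (\<lambda>_. det_over R A)"
    "mat_mult_over R B A = diag_over R n (\<lambda>_. det_over R A)"
proof -
  obtain A' where lift: "A' \<in> carrier_mat n n" "map_mat free_eval A' = A"
    using free_lift assms by metis
  note adj = adj_mat[OF lift(1)]
  have "map_mat free_eval (det A' \<cdot>\<^sub>m 1\<^sub>m n) = diag_over R n (\<lambda>_. det_over R A)"
    unfolding lift(2)[symmetric] det_over_free_eval[OF lift(1)]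
    by (rule eq_matI) (auto simp: diag_over_def free_eval_0)
  then have "mat_mult_over R A (map_mat free_eval (adj_mat A')) = diag_over R n (\<lambda>_. det_over R A)"
    "mat_mult_over R (map_mat free_eval (adj_mat A')) A = diag_over R n (\<lambda>_. det_over R A)"
    using mat_mult_over_free_eval[OF lift(1) adj(1)] mat_mult_over_free_eval[OF adj(1) lift(1)]
    unfolding adj(2,3) lift(2) by auto
  then show ?thesis using that map_free_eval_mats[OF adj(1)] by blast
qed

text \<open>The adjugate of a matrix of determinant 1 is its inverse, and by multiplicativity it has
  determinant 1 as well.\<close>

lemma SL_group: "group (SL n R)"
proof -
  have car: "A \<in> carrier (SL n R) \<longleftrightarrow> A \<in> mats R n n \<and> det_over R A = \<one>" for A
    by (auto simp: SL_def mats_iff_elements)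
  have op: "A \<otimes>\<^bsub>SL n R\<^esub> B = mat_mult_over R A B" "\<one>\<^bsub>SL n R\<^esub> = one_mat_over R n" for A B
    by (auto simp: SL_def)
  have one: "one_mat_over R n \<in> mats R n n" "det_over R (one_mat_over R n) = \<one>"
    unfolding one_mat_over_eq_diag by (auto intro!: diag_over_mats simp: det_over_diag)
  show ?thesis
  proof (rule groupI)
    fix A assume A: "A \<in> carrier (SL n R)"
    then obtain B where B: "B \<in> mats R n n" "mat_mult_over R A B = one_mat_over R n" "mat_mult_over R B A = one_mat_over R n"
      using exists_adjugate[of A n] unfolding car one_mat_over_eq_diag by metis
    have A': "A \<in> mats R n n" "det_over R A = \<one>" using A by (auto simp: car)
    have "det_over R A \<otimes> det_over R B = \<one>"
      using det_over_mult[OF A'(1) B(1)] unfolding B(2) one(2) by simp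
    then have "det_over R B = \<one>" using det_over_closed[OF B(1)] unfolding A'(2) by simp
    then show "\<exists>B\<in>carrier (SL n R). B \<otimes>\<^bsub>SL n R\<^esub> A = \<one>\<^bsub>SL n R\<^esub>"
      using B by (auto simp: car op)
  qed (auto simp: car op mat_mult_over_closed det_over_mult det_over_closed one mat_mult_over_one mat_mult_over_assoc)
qed

end

section \<open>Flags in finite vector spaces\<close>

text \<open>Cardinality stands for dimension: a subspace of dimension \<open>d\<close> is one with
  \<open>q ^ d\<close> elements, and two subspaces agree as soon as one contains the other and they
  have equally many elements.\<close>

locale finite_space = module R M + field R for R :: "('a, 'm) ring_scheme" (structure) and M :: "('a, 'b, 'n) module_scheme" (structure) +
  assumes finite_R: "finite (carrier R)" and finite_M: "finite (carrier M)"
begin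

abbreviation "q \<equiv> card (carrier R)"

definition subsp :: "'b set \<Rightarrow> bool" where
  "subsp W \<longleftrightarrow> W \<subseteq> carrier M \<and> \<zero>\<^bsub>M\<^esub> \<in> W \<and> (\<forall>x\<in>W. \<forall>y\<in>W. x \<oplus>\<^bsub>M\<^esub> y \<in> W) \<and>
     (\<forall>c\<in>carrier R. \<forall>x\<in>W. c \<odot>\<^bsub>M\<^esub> x \<in> W)"

definition line :: "'b \<Rightarrow> 'b set" where
  "line v = (\<lambda>c. c \<odot>\<^bsub>M\<^esub> v) ` carrier R"

definition ssum :: "'b set \<Rightarrow> 'b set \<Rightarrow> 'b set" where
  "ssum A B = (\<lambda>(a, b). a \<oplus>\<^bsub>M\<^esub> b) ` (A \<times> B)"

lemma q_ge_2: "2 \<le> q"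
proof -
  have "{\<zero>, \<one>} \<subseteq> carrier R" by auto
  then have "card {\<zero>, \<one>} \<le> q" by (intro card_mono finite_R)
  then show ?thesis by simp
qed

lemma subsp_carrier: "subsp W \<Longrightarrow> x \<in> W \<Longrightarrow> x \<in> carrier M"
  by (auto simp: subsp_def)

lemma subsp_zero: "subsp W \<Longrightarrow> \<zero>\<^bsub>M\<^esub> \<in> W"
  by (auto simp: subsp_def)

lemma subsp_add: "subsp W \<Longrightarrow> x \<in> W \<Longrightarrow> y \<in> W \<Longrightarrow> x \<oplus>\<^bsub>M\<^esub> y \<in> W"
  by (auto simp: subsp_def)

lemma subsp_smult: "subsp W \<Longrightarrow> c \<in> carrier R \<Longrightarrow> x \<in> W \<Longrightarrow> c \<odot>\<^bsub>M\<^esub> x \<in> W"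
  by (auto simp: subsp_def)

lemma subsp_finite: "subsp W \<Longrightarrow> finite W"
  using finite_M finite_subset by (auto simp: subsp_def)

lemma minus_eq_smult: "x \<in> carrier M \<Longrightarrow> \<ominus>\<^bsub>M\<^esub> x = (\<ominus> \<one>) \<odot>\<^bsub>M\<^esub> x"
  using smult_l_minus[of \<one> x] by simp

lemma subsp_minus: "subsp W \<Longrightarrow> x \<in> W \<Longrightarrow> \<ominus>\<^bsub>M\<^esub> x \<in> W"
  using minus_eq_smult subsp_carrier subsp_smult by auto

lemma subsp_diff: "subsp W \<Longrightarrow> x \<in> W \<Longrightarrow> y \<in> W \<Longrightarrow> x \<ominus>\<^bsub>M\<^esub> y \<in> W"
  unfolding M.minus_eq by (intro subsp_add subsp_minus)

lemma subsp_zero_set: "subsp {\<zero>\<^bsub>M\<^esub>}"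
  by (auto simp: subsp_def)

lemma subsp_univ: "subsp (carrier M)"
  by (auto simp: subsp_def)

lemma subsp_Int: "subsp A \<Longrightarrow> subsp B \<Longrightarrow> subsp (A \<inter> B)"
  by (auto simp: subsp_def)

lemma subsp_line: "v \<in> carrier M \<Longrightarrow> subsp (line v)"
  unfolding subsp_def line_def
proof (intro conjI ballI)
  assume v: "v \<in> carrier M"
  show "\<zero>\<^bsub>M\<^esub> \<in> (\<lambda>c. c \<odot>\<^bsub>M\<^esub> v) ` carrier R" using v by (auto simp: image_iff intro!: bexI[of _ \<zero>])
  fix x assume "x \<in> (\<lambda>c. c \<odot>\<^bsub>M\<^esub> v) ` carrier R"
  then obtain c where c: "c \<in> carrier R" "x = c \<odot>\<^bsub>M\<^esub> v" by auto
  show "d \<odot>\<^bsub>M\<^esub> x \<in> (\<lambda>c. c \<odot>\<^bsub>M\<^esub> v) ` carrier R" if "d \<in> carrier R" for d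
    using that c v by (intro image_eqI[of _ _ "d \<otimes> c"]) (auto simp: smult_assoc1)
  fix y assume "y \<in> (\<lambda>c. c \<odot>\<^bsub>M\<^esub> v) ` carrier R"
  then obtain d where d: "d \<in> carrier R" "y = d \<odot>\<^bsub>M\<^esub> v" by auto
  show "x \<oplus>\<^bsub>M\<^esub> y \<in> (\<lambda>c. c \<odot>\<^bsub>M\<^esub> v) ` carrier R"
    using c d v by (intro image_eqI[of _ _ "c \<oplus> d"]) (auto simp: smult_l_distr)
qed auto

lemma line_subset: "subsp W \<Longrightarrow> v \<in> W \<Longrightarrow> line v \<subseteq> W"
  by (auto simp: line_def intro: subsp_smult)

lemma subsp_ssum:
  assumes A: "subsp A" and B: "subsp B"
  shows "subsp (ssum A B)"
  unfolding subsp_def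
proof (intro conjI ballI)
  note car = subsp_carrier[OF A] subsp_carrier[OF B]
  show "ssum A B \<subseteq> carrier M" using car by (auto simp: ssum_def)
  show "\<zero>\<^bsub>M\<^esub> \<in> ssum A B"
    unfolding ssum_def using subsp_zero[OF A] subsp_zero[OF B] by (force intro!: image_eqI[of _ _ "(\<zero>\<^bsub>M\<^esub>, \<zero>\<^bsub>M\<^esub>)"])
  fix x assume "x \<in> ssum A B"
  then obtain a b where ab: "a \<in> A" "b \<in> B" "x = a \<oplus>\<^bsub>M\<^esub> b" by (auto simp: ssum_def)
  show "c \<odot>\<^bsub>M\<^esub> x \<in> ssum A B" if "c \<in> carrier R" for c
    unfolding ssum_def using that ab car subsp_smult[OF A that] subsp_smult[OF B that]
    by (intro image_eqI[of _ _ "(c \<odot>\<^bsub>M\<^esub> a, c \<odot>\<^bsub>M\<^esub> b)"]) (auto simp: smult_r_distr)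
  fix y assume "y \<in> ssum A B"
  then obtain a' b' where ab': "a' \<in> A" "b' \<in> B" "y = a' \<oplus>\<^bsub>M\<^esub> b'" by (auto simp: ssum_def)
  have "x \<oplus>\<^bsub>M\<^esub> y = (a \<oplus>\<^bsub>M\<^esub> a') \<oplus>\<^bsub>M\<^esub> (b \<oplus>\<^bsub>M\<^esub> b')"
    using ab ab' car by (simp add: M.a_ac)
  then show "x \<oplus>\<^bsub>M\<^esub> y \<in> ssum A B"
    unfolding ssum_def using ab ab' subsp_add[OF A] subsp_add[OF B]
    by (intro image_eqI[of _ _ "(a \<oplus>\<^bsub>M\<^esub> a', b \<oplus>\<^bsub>M\<^esub> b')"]) auto
qed

lemma ssum_upper: "subsp A \<Longrightarrow> subsp B \<Longrightarrow> A \<subseteq> ssum A B" "subsp A \<Longrightarrow> subsp B \<Longrightarrow> B \<subseteq> ssum A B"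
proof -
  assume A: "subsp A" and B: "subsp B"
  show "A \<subseteq> ssum A B"
  proof
    fix a assume a: "a \<in> A"
    then have "a = a \<oplus>\<^bsub>M\<^esub> \<zero>\<^bsub>M\<^esub>" using subsp_carrier[OF A] by simp
    then show "a \<in> ssum A B" using a subsp_zero[OF B] unfolding ssum_def by (intro image_eqI[of _ _ "(a, \<zero>\<^bsub>M\<^esub>)"]) auto
  qed
  show "B \<subseteq> ssum A B"
  proof
    fix b assume b: "b \<in> B"
    then have "b = \<zero>\<^bsub>M\<^esub> \<oplus>\<^bsub>M\<^esub> b" using subsp_carrier[OF B] by simp
    then show "b \<in> ssum A B" using b subsp_zero[OF A] unfolding ssum_def by (intro image_eqI[of _ _ "(\<zero>\<^bsub>M\<^esub>, b)"]) auto
  qed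
qed

lemma ssum_least: "subsp W \<Longrightarrow> A \<subseteq> W \<Longrightarrow> B \<subseteq> W \<Longrightarrow> ssum A B \<subseteq> W"
  by (auto simp: ssum_def intro: subsp_add)

lemma card_ssum:
  assumes A: "subsp A" and B: "subsp B" and disj: "A \<inter> B = {\<zero>\<^bsub>M\<^esub>}"
  shows "card (ssum A B) = card A * card B"
proof -
  have "inj_on (\<lambda>(a, b). a \<oplus>\<^bsub>M\<^esub> b) (A \<times> B)"
  proof (rule inj_onI, clarify)
    fix a b a' b' assume ab: "a \<in> A" "b \<in> B" "a' \<in> A" "b' \<in> B" "a \<oplus>\<^bsub>M\<^esub> b = a' \<oplus>\<^bsub>M\<^esub> b'"
    note car = ab(1,3)[THEN subsp_carrier[OF A]] ab(2,4)[THEN subsp_carrier[OF B]]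
    have "a \<ominus>\<^bsub>M\<^esub> a' = b' \<ominus>\<^bsub>M\<^esub> b"
    proof -
      have "a \<ominus>\<^bsub>M\<^esub> a' = (a \<oplus>\<^bsub>M\<^esub> b) \<oplus>\<^bsub>M\<^esub> ((\<ominus>\<^bsub>M\<^esub> b) \<oplus>\<^bsub>M\<^esub> (\<ominus>\<^bsub>M\<^esub> a'))"
        using car by (simp add: M.minus_eq M.a_assoc M.r_neg2)
      also have "\<dots> = (a' \<oplus>\<^bsub>M\<^esub> b') \<oplus>\<^bsub>M\<^esub> ((\<ominus>\<^bsub>M\<^esub> a') \<oplus>\<^bsub>M\<^esub> (\<ominus>\<^bsub>M\<^esub> b))" using ab(5) car by (simp add: M.a_comm)
      also have "a' \<oplus>\<^bsub>M\<^esub> b' = b' \<oplus>\<^bsub>M\<^esub> a'" using car by (simp add: M.a_comm)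
      also have "b' \<oplus>\<^bsub>M\<^esub> a' \<oplus>\<^bsub>M\<^esub> ((\<ominus>\<^bsub>M\<^esub> a') \<oplus>\<^bsub>M\<^esub> (\<ominus>\<^bsub>M\<^esub> b)) = b' \<ominus>\<^bsub>M\<^esub> b"
        using car by (simp add: M.minus_eq M.a_assoc M.r_neg2)
      finally show ?thesis .
    qed
    moreover have "a \<ominus>\<^bsub>M\<^esub> a' \<in> A" "b' \<ominus>\<^bsub>M\<^esub> b \<in> B" using ab A B by (auto intro: subsp_diff)
    ultimately have "a \<ominus>\<^bsub>M\<^esub> a' = \<zero>\<^bsub>M\<^esub>" "b' \<ominus>\<^bsub>M\<^esub> b = \<zero>\<^bsub>M\<^esub>" using disj by auto
    then show "a = a' \<and> b = b'" using car by auto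
  qed
  then show ?thesis by (simp add: ssum_def card_image card_cartesian_product)
qed

lemma card_line:
  assumes v: "v \<in> carrier M" "v \<noteq> \<zero>\<^bsub>M\<^esub>"
  shows "card (line v) = q"
  unfolding line_def
proof (rule card_image, rule inj_onI)
  fix c d assume cd: "c \<in> carrier R" "d \<in> carrier R" "c \<odot>\<^bsub>M\<^esub> v = d \<odot>\<^bsub>M\<^esub> v"
  have "(c \<ominus> d) \<odot>\<^bsub>M\<^esub> v = \<zero>\<^bsub>M\<^esub>"
    using cd v by (simp add: R.minus_eq smult_l_distr smult_l_minus M.r_neg)
  then have *: "inv (c \<ominus> d) \<odot>\<^bsub>M\<^esub> ((c \<ominus> d) \<odot>\<^bsub>M\<^esub> v) = \<zero>\<^bsub>M\<^esub>" if "c \<ominus> d \<noteq> \<zero>"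
    using that cd field_Units by (simp add: smult_r_null)
  have "c \<ominus> d = \<zero>"
  proof (rule ccontr)
    assume ne: "c \<ominus> d \<noteq> \<zero>"
    then have U: "c \<ominus> d \<in> Units R" using cd field_Units by auto
    have "inv (c \<ominus> d) \<odot>\<^bsub>M\<^esub> ((c \<ominus> d) \<odot>\<^bsub>M\<^esub> v) = v"
      using U cd v smult_assoc1[of "inv (c \<ominus> d)" "c \<ominus> d" v] by simp
    then show False using *[OF ne] v by simp
  qed
  then show "c = d" using cd by simp
qed

lemma line_Int_subsp:
  assumes W: "subsp W" and v: "v \<in> carrier M" "v \<notin> W"
  shows "W \<inter> line v = {\<zero>\<^bsub>M\<^esub>}"
proof (intro equalityI subsetI)
  fix x assume x: "x \<in> W \<inter> line v"
  then obtain c where c: "c \<in> carrier R" "x = c \<odot>\<^bsub>M\<^esub> v" by (auto simp: line_def)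
  have "c = \<zero>"
  proof (rule ccontr)
    assume "c \<noteq> \<zero>"
    then have U: "c \<in> Units R" using c field_Units by auto
    have "inv c \<odot>\<^bsub>M\<^esub> x = v" using U c v smult_assoc1[of "inv c" c v] by simp
    moreover have "inv c \<odot>\<^bsub>M\<^esub> x \<in> W" using x U by (intro subsp_smult[OF W]) auto
    ultimately show False using v by simp
  qed
  then show "x \<in> {\<zero>\<^bsub>M\<^esub>}" using c v by simp
qed (use subsp_zero[OF W] subsp_zero[OF subsp_line[OF v(1)]] in auto)

lemma card_ssum_line:
  assumes "subsp W" "v \<in> carrier M" "v \<notin> W"
  shows "card (ssum W (line v)) = card W * q"
proof -
  have "v \<noteq> \<zero>\<^bsub>M\<^esub>" using assms subsp_zero by auto
  then show ?thesis
    using card_ssum[OF assms(1) subsp_line[OF assms(2)] line_Int_subsp[OF assms]] card_line[OF assms(2)] by simp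
qed

lemma subsp_eqI: "subsp A \<Longrightarrow> subsp B \<Longrightarrow> A \<subseteq> B \<Longrightarrow> card A = card B \<Longrightarrow> A = B"
  using card_subset_eq subsp_finite by blast

text \<open>The modular law. The cardinalities force \<open>B = ssum A (line u)\<close>, and the
  component of an element of \<open>C\<close> in \<open>line u\<close> can be subtracted because
  \<open>u\<close> is in \<open>C\<close>.\<close>

lemma subsp_Int_step:
  assumes A: "subsp A" and B: "subsp B" "A \<subseteq> B" "card B = card A * q" and C: "subsp C"
    and u: "u \<in> C" "u \<in> B" "u \<notin> A"
  shows "C \<inter> B = ssum (C \<inter> A) (line u)"
proof
  have uM: "u \<in> carrier M" using u subsp_carrier[OF C] by blast
  have B_eq: "ssum A (line u) = B"
    using A B u uM card_ssum_line[OF A uM u(3)] line_subset[OF B(1) u(2)]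
    by (intro subsp_eqI subsp_ssum subsp_line ssum_least) auto
  show "C \<inter> B \<subseteq> ssum (C \<inter> A) (line u)"
  proof
    fix x assume x: "x \<in> C \<inter> B"
    then obtain a l where al: "a \<in> A" "l \<in> line u" "x = a \<oplus>\<^bsub>M\<^esub> l" using B_eq by (auto simp: ssum_def)
    have l: "l \<in> C" using al line_subset[OF C u(1)] by auto
    have car: "a \<in> carrier M" "l \<in> carrier M" using al l subsp_carrier A C by auto
    have "a = x \<ominus>\<^bsub>M\<^esub> l" using al car by (simp add: M.minus_eq M.a_assoc M.r_neg)
    then have "a \<in> C" using x l subsp_diff[OF C] by auto
    then show "x \<in> ssum (C \<inter> A) (line u)" unfolding ssum_def using al by auto
  qed
  show "ssum (C \<inter> A) (line u) \<subseteq> C \<inter> B"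
    using B u line_subset[OF C u(1)] line_subset[OF B(1) u(2)] by (intro ssum_least subsp_Int B C) auto
qed

section \<open>Complete chains and bases adapted to two flags\<close>

fun spans :: "(nat \<Rightarrow> 'b) \<Rightarrow> nat set \<Rightarrow> nat \<Rightarrow> 'b set" where
  "spans u J 0 = {\<zero>\<^bsub>M\<^esub>}"
| "spans u J (Suc k) = (if k \<in> J then ssum (spans u J k) (line (u k)) else spans u J k)"

definition chain :: "nat \<Rightarrow> (nat \<Rightarrow> 'b set) \<Rightarrow> bool" where
  "chain N C \<longleftrightarrow> (\<forall>j\<le>N. subsp (C j) \<and> card (C j) = q ^ j) \<and> (\<forall>j<N. C j \<subseteq> C (Suc j))"

lemma chain_mono: "chain N C \<Longrightarrow> i \<le> j \<Longrightarrow> j \<le> N \<Longrightarrow> C i \<subseteq> C j"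
proof (induction j)
  case (Suc j)
  then show ?case by (cases "i = Suc j") (auto simp: chain_def, metis Suc_leD Suc_le_lessD le_SucE subsetD)
qed auto

lemma exists_chain_between:
  assumes "subsp A" "card A = q ^ x" "subsp B" "card B = q ^ y" "A \<subseteq> B" "x \<le> y"
  shows "\<exists>C. C x = A \<and> C y = B \<and> (\<forall>j. x \<le> j \<longrightarrow> j \<le> y \<longrightarrow> subsp (C j) \<and> card (C j) = q ^ j) \<and>
    (\<forall>j. x \<le> j \<longrightarrow> j < y \<longrightarrow> C j \<subseteq> C (Suc j))"
  using assms
proof (induction "y - x" arbitrary: x A)
  case 0
  then have "x = y" by simp
  moreover from this 0 have "A = B" by (intro subsp_eqI) auto
  ultimately show ?case using 0 by (intro exI[of _ "\<lambda>_. A"]) auto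
next
  case (Suc d)
  have "card A < card B" using Suc.hyps(2) Suc.prems q_ge_2 by (auto intro: power_strict_increasing)
  then obtain v where v: "v \<in> B" "v \<notin> A" using Suc.prems(5) by (metis less_irrefl subsetI subset_antisym)
  have vM: "v \<in> carrier M" using v Suc.prems(3) subsp_carrier by blast
  let ?A = "ssum A (line v)"
  have A: "subsp ?A" using Suc.prems(1) vM by (intro subsp_ssum subsp_line)
  have cardA: "card ?A = q ^ Suc x"
    using card_ssum_line[OF Suc.prems(1) vM v(2)] Suc.prems(2) by (simp add: mult.commute)
  have AB: "?A \<subseteq> B" using Suc.prems(3,5) v(1) by (intro ssum_least line_subset)
  have "d = y - Suc x" "Suc x \<le> y" using Suc.hyps(2) by auto
  from Suc.hyps(1)[OF this(1) A cardA Suc.prems(3,4) AB this(2)] obtain C where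
    C: "C (Suc x) = ?A" "C y = B" "\<And>j. Suc x \<le> j \<Longrightarrow> j \<le> y \<Longrightarrow> subsp (C j) \<and> card (C j) = q ^ j"
      "\<And>j. Suc x \<le> j \<Longrightarrow> j < y \<Longrightarrow> C j \<subseteq> C (Suc j)" by auto
  have sub: "A \<subseteq> ?A" using ssum_upper(1)[OF Suc.prems(1) subsp_line[OF vM]] .
  show ?case
  proof (intro exI[of _ "C(x := A)"] conjI allI impI)
    fix j assume j: "x \<le> j"
    show "subsp ((C(x := A)) j)" "card ((C(x := A)) j) = q ^ j" if "j \<le> y"
      using C(3)[of j] j that Suc.prems by auto
    show "(C(x := A)) j \<subseteq> (C(x := A)) (Suc j)" if "j < y"
      using C(1) C(4)[of j] j that sub by auto
  qed (use C \<open>Suc x \<le> y\<close> in auto)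
qed

text \<open>Complete chains between consecutive members are joined end to end; where a step has size
  0 the segment is empty.\<close>

lemma exists_chain_through:
  assumes "\<And>i. subsp (U i)" "\<And>i. card (U i) = q ^ N i" "\<And>i. U i \<subseteq> U (Suc i)" "N 0 = 0"
  shows "\<exists>C. chain (N s) C \<and> (\<forall>i\<le>s. C (N i) = U i)"
proof -
  have N_mono: "N i \<le> N (Suc i)" for i
  proof -
    have "q ^ N i \<le> q ^ N (Suc i)" using card_mono[OF subsp_finite[OF assms(1)] assms(3), of i] assms(2) by simp
    then show ?thesis using q_ge_2 by (simp add: power_increasing_iff)
  qed
  show ?thesis
  proof (induction s)
    case 0
    show ?case
      by (intro exI[of _ "\<lambda>_. U 0"]) (use assms(1)[of 0] assms(2)[of 0] assms(4) in \<open>auto simp: chain_def\<close>)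
  next
    case (Suc s)
    then obtain C where C: "chain (N s) C" "\<forall>i\<le>s. C (N i) = U i" by blast
    obtain D where D: "D (N s) = U s" "D (N (Suc s)) = U (Suc s)"
      "\<And>j. N s \<le> j \<Longrightarrow> j \<le> N (Suc s) \<Longrightarrow> subsp (D j) \<and> card (D j) = q ^ j"
      "\<And>j. N s \<le> j \<Longrightarrow> j < N (Suc s) \<Longrightarrow> D j \<subseteq> D (Suc j)"
      using exists_chain_between[OF assms(1) assms(2) assms(1) assms(2) assms(3) N_mono, of s] by blast
    have N_le: "N i \<le> N s" if "i \<le> s" for i using lift_Suc_mono_le[of N, OF N_mono that] .
    define E where "E j = (if j \<le> N s then C j else D j)" for j
    have E_D: "E j = D j" if "N s \<le> j" for j using that C(2) D(1) by (auto simp: E_def)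
    have "E j \<subseteq> E (Suc j)" if "j < N (Suc s)" for j
    proof (cases "j < N s")
      case True
      then show ?thesis using C(1) by (auto simp: E_def chain_def)
    next
      case False
      then show ?thesis using E_D[of j] E_D[of "Suc j"] D(4)[of j] that by auto
    qed
    moreover have "subsp (E j) \<and> card (E j) = q ^ j" if "j \<le> N (Suc s)" for j
      using C(1) D(3)[of j] that by (auto simp: E_def chain_def)
    moreover have "E (N i) = U i" if "i \<le> Suc s" for i
      using that C(2) N_le[of i] E_D[OF N_mono[of s]] D(2) by (auto simp: E_def le_Suc_eq)
    ultimately show ?case by (intro exI[of _ E]) (auto simp: chain_def)
  qed
qed

text \<open>When \<open>C j\<close> grows to \<open>C (Suc j)\<close>, the intersection with
  \<open>W\<close> either gains \<open>line (u j)\<close>, for \<open>j\<close> in \<open>J\<close>,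
  or does not change.\<close>

lemma adapted_span:
  assumes C: "chain n C" and u: "\<And>j. j < n \<Longrightarrow> u j \<in> C (Suc j) \<and> u j \<notin> C j" and W: "subsp W"
    and J: "\<And>j. j < n \<Longrightarrow> j \<in> J \<Longrightarrow> u j \<in> W" "\<And>j. j < n \<Longrightarrow> j \<notin> J \<Longrightarrow> W \<inter> C (Suc j) \<subseteq> C j"
    and k: "k \<le> n"
  shows "W \<inter> C k = spans u J k"
  using k
proof (induction k)
  case 0
  have "card (C 0) = 1" "subsp (C 0)" using C by (auto simp: chain_def)
  then have "C 0 = {\<zero>\<^bsub>M\<^esub>}" using subsp_zero by (metis card_1_singletonE singletonD)
  then show ?case using subsp_zero[OF W] by auto
next
  case (Suc k)
  then have k: "k < n" "W \<inter> C k = spans u J k" by auto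
  have Ck: "subsp (C k)" "subsp (C (Suc k))" "C k \<subseteq> C (Suc k)" "card (C (Suc k)) = card (C k) * q"
    using C k by (auto simp: chain_def)
  show ?case
  proof (cases "k \<in> J")
    case True
    then show ?thesis
      using subsp_Int_step[OF Ck W J(1)[OF k(1)]] u[OF k(1)] k(2) by simp
  next
    case False
    then have "W \<inter> C (Suc k) = W \<inter> C k" using J(2)[OF k(1)] Ck(3) by blast
    then show ?thesis using False k(2) by simp
  qed
qed

text \<open>A flag is a function on all of \<open>nat\<close> that becomes constant at
  \<open>m\<close>, so that equality of flags is equality of functions. Steps of size 0 occur, and
  the last member is the whole space only when the steps add up to its dimension.\<close>

definition flags :: "nat \<Rightarrow> (nat \<Rightarrow> nat) \<Rightarrow> (nat \<Rightarrow> 'b set) set" where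
  "flags m \<mu> = {W. (\<forall>i. subsp (W i) \<and> card (W i) = q ^ (\<Sum>l<min i m. \<mu> l) \<and> W i \<subseteq> W (Suc i))}"

lemma flags_mono: "W \<in> flags m \<mu> \<Longrightarrow> i \<le> j \<Longrightarrow> W i \<subseteq> W j"
  by (rule lift_Suc_mono_le) (auto simp: flags_def)

lemma flags_top:
  assumes "W \<in> flags m \<mu>" "card (carrier M) = q ^ (\<Sum>l<m. \<mu> l)" "m \<le> i"
  shows "W i = carrier M"
  using assms by (intro subsp_eqI subsp_univ) (auto simp: flags_def subsp_def min_absorb2)

lemma flags_0: "W \<in> flags m \<mu> \<Longrightarrow> W 0 = {\<zero>\<^bsub>M\<^esub>}"
  by (rule subsp_eqI[symmetric]) (auto simp: flags_def subsp_zero_set subsp_def)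

text \<open>The Bruhat decomposition: two flags have a common adapted basis. \<open>U\<close> is
  refined to a complete chain \<open>C\<close>, and \<open>u j\<close> is taken in
  \<open>C (Suc j) - C j\<close> from the first member of \<open>W\<close> that meets this
  difference. The numbers \<open>a l\<close> and \<open>b l\<close> are the steps at which
  \<open>u l\<close> enters the two flags.\<close>

lemma exists_adapted_basis:
  assumes n: "card (carrier M) = q ^ n" and W: "W \<in> flags m \<mu>" "(\<Sum>l<m. \<mu> l) = n"
    and U: "U \<in> flags m \<nu>" "(\<Sum>l<m. \<nu> l) = n"
  obtains u a b where "\<And>j. j < n \<Longrightarrow> u j \<in> carrier M" "\<And>J. card (spans u J n) = q ^ card (J \<inter> {..<n})"
    "\<And>i. W i = spans u {l. a l < i} n" "\<And>i. U i = spans u {l. b l < i} n"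
proof -
  define N where "N i = (\<Sum>l<min i m. \<nu> l)" for i
  obtain C where C: "chain (N m) C" "\<And>i. i \<le> m \<Longrightarrow> C (N i) = U i"
    using exists_chain_through[of U N m] U by (auto simp: flags_def N_def)
  have Nm: "N m = n" using U(2) by (simp add: N_def)
  have C: "chain n C" "\<And>i. C (N i) = U i"
  proof -
    show "chain n C" using C(1) Nm by simp
    show "C (N i) = U i" for i
    proof (cases "i \<le> m")
      case False
      then have "N i = N m" "U i = U m" using flags_top[OF U(1)] n U(2) by (auto simp: N_def min_absorb2)
      then show ?thesis using C(2)[of m] by simp
    qed (use C(2) in auto)
  qed
  have Cn: "C n = carrier M" using C(2)[of m] flags_top[OF U(1), of m] n U(2) Nm by simp
  have subC: "subsp (C j)" "card (C j) = q ^ j" if "j \<le> n" for j using C(1) that by (auto simp: chain_def)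
  have subW: "subsp (W i)" for i using W(1) by (auto simp: flags_def)
  have subU: "subsp (U i)" for i using U(1) by (auto simp: flags_def)
  \<comment> \<open>Minimality makes the basis adapted to \<open>W\<close>: no member before
    \<open>t j\<close> contains a vector of \<open>C (Suc j)\<close> that is new there.\<close>
  define t where "t j = (LEAST i. W i \<inter> (C (Suc j) - C j) \<noteq> {})" for j
  have ne: "C (Suc j) - C j \<noteq> {}" if "j < n" for j
  proof
    assume "C (Suc j) - C j = {}"
    then have "card (C (Suc j)) \<le> card (C j)" using subsp_finite[OF subC(1)] that by (intro card_mono) auto
    then show False using subC(2)[of j] subC(2)[of "Suc j"] that q_ge_2 by simp
  qed
  have t: "W (t j) \<inter> (C (Suc j) - C j) \<noteq> {}" if "j < n" for j
    unfolding t_def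
  proof (rule LeastI[of _ m])
    have "W m = carrier M" using flags_top[OF W(1)] n W(2) by simp
    then show "W m \<inter> (C (Suc j) - C j) \<noteq> {}"
      using ne[OF that] subsp_carrier[OF subC(1), of "Suc j"] that by auto
  qed
  have t_least: "W i \<inter> C (Suc j) \<subseteq> C j" if "i < t j" for i j
    using not_less_Least[of i "\<lambda>i. W i \<inter> (C (Suc j) - C j) \<noteq> {}"] that unfolding t_def by blast
  have "\<forall>j. \<exists>v. j < n \<longrightarrow> v \<in> W (t j) \<inter> (C (Suc j) - C j)" using t by blast
  then obtain u where u: "\<And>j. j < n \<Longrightarrow> u j \<in> W (t j) \<inter> (C (Suc j) - C j)" by metis
  have t_pos: "t j > 0" if "j < n" for j
  proof (rule ccontr)
    assume "\<not> t j > 0"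
    then have "u j = \<zero>\<^bsub>M\<^esub>" using u[OF that] flags_0[OF W(1)] by auto
    then show False using u[OF that] subsp_zero[OF subC(1)[of j]] that by auto
  qed
  have u': "u j \<in> C (Suc j) \<and> u j \<notin> C j" if "j < n" for j using u[OF that] by auto
  have uM: "u j \<in> carrier M" if "j < n" for j using u'[OF that] subsp_carrier[OF subC(1)[of "Suc j"]] that by auto
  \<comment> \<open>\<open>u l\<close> belongs to \<open>W i\<close> exactly for
    \<open>t l \<le> i\<close>. As \<open>t l\<close> is positive, this is the condition
    \<open>t l - 1 < i\<close>, and \<open>t l - 1\<close> becomes the number
    \<open>a l\<close>.\<close>
  have "W i \<inter> C n = spans u {l. t l - 1 < i} n" for i
  proof (rule adapted_span[OF C(1) u' subW])
    fix j assume j: "j < n"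
    show "u j \<in> W i" if "j \<in> {l. t l - 1 < i}"
    proof -
      have "t j \<le> i" using that t_pos[OF j] by auto
      then show ?thesis using u[OF j] flags_mono[OF W(1)] by blast
    qed
    show "W i \<inter> C (Suc j) \<subseteq> C j" if "j \<notin> {l. t l - 1 < i}"
      using that t_least[of i j] t_pos[OF j] by auto
  qed auto
  then have Wu: "W i = spans u {l. t l - 1 < i} n" for i
    using subW[of i] by (auto simp: Cn subsp_def Int_absorb2)
  have N_mono: "N i \<le> N j" if "i \<le> j" for i j
    unfolding N_def using that by (intro sum_mono2) auto
  \<comment> \<open>\<open>U i\<close> is the member \<open>N i\<close> of the chain, so it contains
    \<open>u l\<close> exactly when \<open>l < N i\<close>. The least such \<open>i\<close> is
    positive because \<open>N 0 = 0\<close>; the shift by 1 turns it into the number of a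
    step.\<close>
  define b where "b l = (LEAST i. l < N i) - 1" for l
  have b: "b l < i \<longleftrightarrow> l < N i" if l: "l < n" for l i
  proof -
    let ?s = "LEAST i. l < N i"
    have s: "l < N ?s" by (rule LeastI[of _ m]) (use l Nm in simp)
    then have "?s > 0" by (cases "?s") (auto simp: N_def)
    moreover have "?s \<le> i" if "l < N i" using that by (rule Least_le)
    moreover have "l < N i" if "?s \<le> i"
    proof -
      have "N ?s \<le> N i" using that by (rule N_mono)
      then show ?thesis using s by simp
    qed
    ultimately show ?thesis unfolding b_def by fastforce
  qed
  have N_le: "N i \<le> n" for i
    unfolding Nm[symmetric] N_def by (intro sum_mono2) auto
  have "U i \<inter> C n = spans u {l. b l < i} n" for i
  proof (rule adapted_span[OF C(1) u' subU])
    fix j assume j: "j < n"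
    show "u j \<in> U i" if "j \<in> {l. b l < i}"
    proof -
      have "C (Suc j) \<subseteq> C (N i)" using that b[OF j] N_le by (intro chain_mono[OF C(1)]) auto
      then show ?thesis using u'[OF j] C(2) by auto
    qed
    show "U i \<inter> C (Suc j) \<subseteq> C j" if "j \<notin> {l. b l < i}"
    proof -
      have "C (N i) \<subseteq> C j" using that b[OF j] j by (intro chain_mono[OF C(1)]) auto
      then show ?thesis using C(2) by auto
    qed
  qed auto
  then have Uu: "U i = spans u {l. b l < i} n" for i
    using subU[of i] by (auto simp: Cn subsp_def Int_absorb2)
  have "subsp (spans u J k) \<and> spans u J k \<subseteq> C k \<and> card (spans u J k) = q ^ card (J \<inter> {..<k})" if "k \<le> n" for J k
    using that
  proof (induction k)
    case 0
    then show ?case using subsp_zero_set subsp_zero[OF subC(1)] by simp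
  next
    case (Suc k)
    then have IH: "subsp (spans u J k)" "spans u J k \<subseteq> C k" "card (spans u J k) = q ^ card (J \<inter> {..<k})" and k: "k < n" by auto
    have CC: "C k \<subseteq> C (Suc k)" using C(1) k by (auto simp: chain_def)
    show ?case
    proof (cases "k \<in> J")
      case True
      then have "J \<inter> {..<Suc k} = insert k (J \<inter> {..<k})" by auto
      then have card: "card (J \<inter> {..<Suc k}) = Suc (card (J \<inter> {..<k}))" by simp
      have "u k \<notin> spans u J k" using u'[OF k] IH(2) by auto
      then have "card (ssum (spans u J k) (line (u k))) = q ^ card (J \<inter> {..<Suc k})"
        using card IH(3) card_ssum_line[OF IH(1) uM[OF k]] by (simp add: mult.commute)
      moreover have "subsp (ssum (spans u J k) (line (u k)))" using IH(1) uM[OF k] by (intro subsp_ssum subsp_line)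
      moreover have "ssum (spans u J k) (line (u k)) \<subseteq> C (Suc k)"
        using u'[OF k] k IH(2) CC by (intro ssum_least subC(1) line_subset) auto
      ultimately show ?thesis using True by simp
    next
      case False
      then have "J \<inter> {..<Suc k} = J \<inter> {..<k}" by (auto simp: less_Suc_eq)
      then show ?thesis using False IH CC by auto
    qed
  qed
  then have "card (spans u J n) = q ^ card (J \<inter> {..<n})" for J by blast
  from that[of u "\<lambda>l. t l - 1" b, OF uM this Wu Uu] show ?thesis .
qed

end

section \<open>Vectors and matrices over a finite field\<close>

definition vec_module :: "('a, 'm) ring_scheme \<Rightarrow> nat \<Rightarrow> ('a, 'a vec) module" where
  "vec_module R n = \<lparr>carrier = {v. dim_vec v = n \<and> (\<forall>i<n. v $ i \<in> carrier R)},
     monoid.mult = undefined, monoid.one = undefined, zero = vec n (\<lambda>_. \<zero>\<^bsub>R\<^esub>),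
     add = (\<lambda>u v. vec n (\<lambda>i. u $ i \<oplus>\<^bsub>R\<^esub> v $ i)), module.smult = (\<lambda>c v. vec n (\<lambda>i. c \<otimes>\<^bsub>R\<^esub> v $ i))\<rparr>"

definition mat_vec :: "('a, 'm) ring_scheme \<Rightarrow> 'a mat \<Rightarrow> 'a vec \<Rightarrow> 'a vec" where
  "mat_vec R A v = vec (dim_row A) (\<lambda>i. \<Oplus>\<^bsub>R\<^esub>k\<in>{0..<dim_vec v}. A $$ (i, k) \<otimes>\<^bsub>R\<^esub> v $ k)"

definition coord :: "('a, 'm) ring_scheme \<Rightarrow> nat \<Rightarrow> nat set \<Rightarrow> 'a vec set" where
  "coord R n J = {v \<in> carrier (vec_module R n). \<forall>i<n. i \<notin> J \<longrightarrow> v $ i = \<zero>\<^bsub>R\<^esub>}"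

definition cols_mat :: "nat \<Rightarrow> (nat \<Rightarrow> 'a vec) \<Rightarrow> 'a mat" where
  "cols_mat n u = mat n n (\<lambda>(i, j). u j $ i)"

lemma vec_module_carrier: "v \<in> carrier (vec_module R n) \<longleftrightarrow> dim_vec v = n \<and> (\<forall>i<n. v $ i \<in> carrier R)"
  by (simp add: vec_module_def)

lemma vec_module_zero: "\<zero>\<^bsub>vec_module R n\<^esub> = vec n (\<lambda>_. \<zero>\<^bsub>R\<^esub>)"
  by (simp add: vec_module_def)

lemma vec_module_add: "u \<oplus>\<^bsub>vec_module R n\<^esub> v = vec n (\<lambda>i. u $ i \<oplus>\<^bsub>R\<^esub> v $ i)"
  by (simp add: vec_module_def)

lemma vec_module_smult: "c \<odot>\<^bsub>vec_module R n\<^esub> v = vec n (\<lambda>i. c \<otimes>\<^bsub>R\<^esub> v $ i)"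
  by (simp add: vec_module_def)

lemmas vec_module_simps = vec_module_carrier vec_module_zero vec_module_add vec_module_smult

lemma mat_vec_index:
  "A \<in> mats R n m \<Longrightarrow> dim_vec v = m \<Longrightarrow> i < n \<Longrightarrow>
    mat_vec R A v $ i = (\<Oplus>\<^bsub>R\<^esub>k\<in>{0..<m}. A $$ (i, k) \<otimes>\<^bsub>R\<^esub> v $ k)"
  using mats_carrier_mat[of A R n m] by (auto simp: mat_vec_def)

lemma dim_mat_vec: "A \<in> mats R n m \<Longrightarrow> dim_vec (mat_vec R A v) = n"
  using mats_carrier_mat[of A R n m] by (auto simp: mat_vec_def)

lemma vec_module_dim: "v \<in> carrier (vec_module R n) \<Longrightarrow> dim_vec v = n"
  by (simp add: vec_module_def)

context cring
begin

lemma module_vec_module: "module R (vec_module R n)"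
proof (rule moduleI)
  show "abelian_group (vec_module R n)"
  proof (rule abelian_groupI)
    fix x assume x: "x \<in> carrier (vec_module R n)"
    then show "\<exists>y\<in>carrier (vec_module R n). y \<oplus>\<^bsub>vec_module R n\<^esub> x = \<zero>\<^bsub>vec_module R n\<^esub>"
      by (intro bexI[of _ "vec n (\<lambda>i. \<ominus> (x $ i))"]) (auto simp: vec_module_simps l_neg intro!: eq_vecI)
  qed (auto simp: vec_module_simps a_ac intro!: eq_vecI)
qed (auto simp: vec_module_simps l_distr r_distr m_assoc is_cring intro!: eq_vecI)

text \<open>Vectors as matrices with one column: the law for products acting on vectors becomes an
  instance of associativity.\<close>

lemma mat_vec_eq_mult:
  assumes "A \<in> mats R n m" "v \<in> carrier (vec_module R m)"
  shows "mat n 1 (\<lambda>(i, _). mat_vec R A v $ i) = mat_mult_over R A (mat m 1 (\<lambda>(i, _). v $ i))"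
  using assms by (intro eq_matI)
    (auto simp: mat_vec_def mat_mult_over_def mats_def vec_module_simps intro!: finsum_cong')

lemma mat_vec_closed:
  assumes "A \<in> mats R n m" "v \<in> carrier (vec_module R m)"
  shows "mat_vec R A v \<in> carrier (vec_module R n)"
  using assms by (auto simp: mat_vec_def mats_def vec_module_simps intro!: finsum_closed)

lemma mat_vec_mult:
  assumes "A \<in> mats R n m" "B \<in> mats R m k" "v \<in> carrier (vec_module R k)"
  shows "mat_vec R (mat_mult_over R A B) v = mat_vec R A (mat_vec R B v)"
proof (rule eq_vecI)
  let ?v = "mat k 1 (\<lambda>(i, _). v $ i)"
  have v: "?v \<in> mats R k 1" using assms(3) by (auto simp: mats_def vec_module_simps)
  have Bv: "mat_vec R B v \<in> carrier (vec_module R m)" using assms by (intro mat_vec_closed)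
  have "mat n 1 (\<lambda>(i, _). mat_vec R (mat_mult_over R A B) v $ i) = mat_mult_over R (mat_mult_over R A B) ?v"
    using assms by (intro mat_vec_eq_mult mat_mult_over_closed)
  also have "\<dots> = mat_mult_over R A (mat_mult_over R B ?v)" by (rule mat_mult_over_assoc[OF assms(1,2) v])
  also have "\<dots> = mat n 1 (\<lambda>(i, _). mat_vec R A (mat_vec R B v) $ i)"
    unfolding mat_vec_eq_mult[OF assms(2,3), symmetric] by (rule mat_vec_eq_mult[OF assms(1) Bv, symmetric])
  finally have eq: "mat n 1 (\<lambda>(i, _). mat_vec R (mat_mult_over R A B) v $ i) = mat n 1 (\<lambda>(i, _). mat_vec R A (mat_vec R B v) $ i)" .
  show "mat_vec R (mat_mult_over R A B) v $ i = mat_vec R A (mat_vec R B v) $ i"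
    if "i < dim_vec (mat_vec R A (mat_vec R B v))" for i
    using arg_cong[OF eq, of "\<lambda>A. A $$ (i, 0)"] that unfolding dim_mat_vec[OF assms(1)] by simp
  show "dim_vec (mat_vec R (mat_mult_over R A B) v) = dim_vec (mat_vec R A (mat_vec R B v))"
    unfolding dim_mat_vec[OF assms(1)] dim_mat_vec[OF mat_mult_over_closed[OF assms(1,2)]] ..
qed

lemma mat_vec_add:
  assumes "A \<in> mats R n m" "u \<in> carrier (vec_module R m)" "v \<in> carrier (vec_module R m)"
  shows "mat_vec R A (u \<oplus>\<^bsub>vec_module R m\<^esub> v) = mat_vec R A u \<oplus>\<^bsub>vec_module R n\<^esub> mat_vec R A v"
proof (rule eq_vecI)
  fix i assume "i < dim_vec (mat_vec R A u \<oplus>\<^bsub>vec_module R n\<^esub> mat_vec R A v)"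
  then have i: "i < n" by (simp add: vec_module_simps)
  have "(\<Oplus>k\<in>{0..<m}. A $$ (i, k) \<otimes> (u $ k \<oplus> v $ k)) = (\<Oplus>k\<in>{0..<m}. A $$ (i, k) \<otimes> u $ k \<oplus> A $$ (i, k) \<otimes> v $ k)"
    using assms i by (intro finsum_cong') (auto simp: mats_def vec_module_simps r_distr)
  also have "\<dots> = (\<Oplus>k\<in>{0..<m}. A $$ (i, k) \<otimes> u $ k) \<oplus> (\<Oplus>k\<in>{0..<m}. A $$ (i, k) \<otimes> v $ k)"
    using assms i by (intro finsum_addf) (auto simp: mats_def vec_module_simps)
  finally have *: "(\<Oplus>k\<in>{0..<m}. A $$ (i, k) \<otimes> (u $ k \<oplus> v $ k)) =
    (\<Oplus>k\<in>{0..<m}. A $$ (i, k) \<otimes> u $ k) \<oplus> (\<Oplus>k\<in>{0..<m}. A $$ (i, k) \<otimes> v $ k)" .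
  have "(\<Oplus>k\<in>{0..<m}. A $$ (i, k) \<otimes> vec m (\<lambda>i. u $ i \<oplus> v $ i) $ k) = (\<Oplus>k\<in>{0..<m}. A $$ (i, k) \<otimes> (u $ k \<oplus> v $ k))"
    using assms i by (intro finsum_cong') (auto simp: mats_def vec_module_simps)
  with * show "mat_vec R A (u \<oplus>\<^bsub>vec_module R m\<^esub> v) $ i = (mat_vec R A u \<oplus>\<^bsub>vec_module R n\<^esub> mat_vec R A v) $ i"
    using i assms(2,3)[THEN vec_module_dim] by (simp add: mat_vec_index[OF assms(1)] vec_module_add)
qed (simp add: dim_mat_vec[OF assms(1)] vec_module_add)

lemma mat_vec_smult:
  assumes "A \<in> mats R n m" "c \<in> carrier R" "v \<in> carrier (vec_module R m)"
  shows "mat_vec R A (c \<odot>\<^bsub>vec_module R m\<^esub> v) = c \<odot>\<^bsub>vec_module R n\<^esub> mat_vec R A v"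
proof (rule eq_vecI)
  fix i assume "i < dim_vec (c \<odot>\<^bsub>vec_module R n\<^esub> mat_vec R A v)"
  then have i: "i < n" by (simp add: vec_module_simps)
  have "c \<otimes> (\<Oplus>k\<in>{0..<m}. A $$ (i, k) \<otimes> v $ k) = (\<Oplus>k\<in>{0..<m}. c \<otimes> (A $$ (i, k) \<otimes> v $ k))"
    using assms i by (intro finsum_rdistr) (auto simp: mats_def vec_module_simps)
  also have "\<dots> = (\<Oplus>k\<in>{0..<m}. A $$ (i, k) \<otimes> vec m (\<lambda>i. c \<otimes> v $ i) $ k)"
    using assms i by (intro finsum_cong') (auto simp: mats_def vec_module_simps m_lcomm)
  finally show "mat_vec R A (c \<odot>\<^bsub>vec_module R m\<^esub> v) $ i = (c \<odot>\<^bsub>vec_module R n\<^esub> mat_vec R A v) $ i"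
    using i vec_module_dim[OF assms(3)] by (simp add: mat_vec_index[OF assms(1)] vec_module_smult)
qed (simp add: dim_mat_vec[OF assms(1)] vec_module_smult)

lemma mat_vec_unit:
  assumes "A \<in> mats R n m" "j < m"
  shows "mat_vec R A (vec m (\<lambda>k. if k = j then \<one> else \<zero>)) = col A j"
proof (rule eq_vecI)
  fix i assume "i < dim_vec (col A j)"
  then have i: "i < n" using mats_carrier_mat[OF assms(1)] by simp
  have "(\<Oplus>k\<in>{0..<m}. A $$ (i, k) \<otimes> (if k = j then \<one> else \<zero>)) = (\<Oplus>k\<in>{0..<m}. if k = j then A $$ (i, k) else \<zero>)"
    using assms i by (intro finsum_cong') (auto simp: mats_def)
  also have "\<dots> = (\<Oplus>k\<in>{0..<m}. if j = k then A $$ (i, k) else \<zero>)"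
    using assms i by (intro finsum_cong') (auto simp: mats_def)
  also have "\<dots> = A $$ (i, j)"
    using assms i by (intro finsum_singleton) (auto simp: mats_def)
  finally have "(\<Oplus>k\<in>{0..<m}. A $$ (i, k) \<otimes> (if k = j then \<one> else \<zero>)) = A $$ (i, j)" .
  moreover have "(\<Oplus>k\<in>{0..<m}. A $$ (i, k) \<otimes> vec m (\<lambda>k. if k = j then \<one> else \<zero>) $ k) =
    (\<Oplus>k\<in>{0..<m}. A $$ (i, k) \<otimes> (if k = j then \<one> else \<zero>))"
    using assms i by (intro finsum_cong') (auto simp: mats_def)
  ultimately show "mat_vec R A (vec m (\<lambda>k. if k = j then \<one> else \<zero>)) $ i = col A j $ i"
    using i assms(2) mats_carrier_mat[OF assms(1)] by (simp add: mat_vec_index[OF assms(1)])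
qed (use mats_carrier_mat[OF assms(1)] in \<open>simp add: dim_mat_vec[OF assms(1)]\<close>)

lemma mat_vec_diag:
  assumes "\<And>i. i < n \<Longrightarrow> d i \<in> carrier R" "v \<in> carrier (vec_module R n)"
  shows "mat_vec R (diag_over R n d) v = vec n (\<lambda>i. d i \<otimes> v $ i)"
proof (rule eq_vecI)
  fix i assume "i < dim_vec (vec n (\<lambda>i. d i \<otimes> v $ i))"
  then have i: "i < n" by simp
  have "(\<Oplus>k\<in>{0..<n}. (if i = k then d i else \<zero>) \<otimes> v $ k) = (\<Oplus>k\<in>{0..<n}. if i = k then d i \<otimes> v $ k else \<zero>)"
    using assms i by (intro finsum_cong') (auto simp: vec_module_simps)
  also have "\<dots> = d i \<otimes> v $ i"
    using assms i by (intro finsum_singleton) (auto simp: vec_module_simps)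
  finally have "(\<Oplus>k\<in>{0..<n}. (if i = k then d i else \<zero>) \<otimes> v $ k) = d i \<otimes> v $ i" .
  moreover have "(\<Oplus>k\<in>{0..<n}. diag_over R n d $$ (i, k) \<otimes> v $ k) = (\<Oplus>k\<in>{0..<n}. (if i = k then d i else \<zero>) \<otimes> v $ k)"
    using assms i by (intro finsum_cong') (auto simp: vec_module_simps diag_over_def)
  ultimately show "mat_vec R (diag_over R n d) v $ i = vec n (\<lambda>i. d i \<otimes> v $ i) $ i"
    using assms i by (simp add: mat_vec_def diag_over_def vec_module_simps)
qed (auto simp: mat_vec_def diag_over_def)

lemma mat_vec_one: "v \<in> carrier (vec_module R n) \<Longrightarrow> mat_vec R (one_mat_over R n) v = v"
  unfolding one_mat_over_eq_diag
  by (subst mat_vec_diag) (auto simp: vec_module_simps intro!: eq_vecI)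

end

locale finite_field_dim = field F for F :: "'a ring" (structure) +
  fixes n :: nat
  assumes finite_F: "finite (carrier F)" and n_pos: "0 < n"

lemma bij_betw_coord:
  assumes "ring F"
  shows "bij_betw (\<lambda>v. \<lambda>i\<in>J \<inter> {..<n}. v $ i) (coord F n J) ((J \<inter> {..<n}) \<rightarrow>\<^sub>E carrier F)"
proof -
  interpret ring F by fact
  show ?thesis
  proof (rule bij_betwI[where g = "\<lambda>f. vec n (\<lambda>i. if i \<in> J then f i else \<zero>\<^bsub>F\<^esub>)"])
    show "(\<lambda>i\<in>J \<inter> {..<n}. vec n (\<lambda>i. if i \<in> J then f i else \<zero>\<^bsub>F\<^esub>) $ i) = f" if "f \<in> (J \<inter> {..<n}) \<rightarrow>\<^sub>E carrier F" for f
      using that by (auto simp: fun_eq_iff PiE_def extensional_def restrict_def)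
  qed (auto simp: coord_def vec_module_simps PiE_def intro!: eq_vecI)
qed

context finite_field_dim
begin

lemma coord_UNIV: "coord F n UNIV = carrier (vec_module F n)"
  by (auto simp: coord_def)

lemma finite_coord: "finite (coord F n J)"
  using bij_betw_finite[OF bij_betw_coord[OF ring_axioms, of J n]] finite_F by (simp add: finite_PiE)

lemma card_coord: "card (coord F n J) = card (carrier F) ^ card (J \<inter> {..<n})"
  using bij_betw_same_card[OF bij_betw_coord[OF ring_axioms, of J n]] by (simp add: card_PiE)

lemma coord_subset: "coord F n J \<subseteq> carrier (vec_module F n)"
  by (auto simp: coord_def)

end

sublocale finite_field_dim \<subseteq> V: finite_space F "vec_module F n"
proof -
  interpret module F "vec_module F n" by (rule module_vec_module)
  show "finite_space F (vec_module F n)"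
    by unfold_locales (use finite_F finite_coord[of UNIV] in \<open>auto simp: coord_UNIV\<close>)
qed

context finite_field_dim
begin

abbreviation "VM \<equiv> vec_module F n"

lemma card_V: "card (carrier VM) = V.q ^ n"
  using card_coord[of UNIV] by (simp add: coord_UNIV)

lemma subsp_coord: "V.subsp (coord F n J)"
  by (auto simp: V.subsp_def coord_def vec_module_simps)

lemma cols_mat_mats: "(\<And>j. j < n \<Longrightarrow> u j \<in> carrier VM) \<Longrightarrow> cols_mat n u \<in> mats F n n"
  by (auto simp: cols_mat_def mats_def vec_module_simps)

lemma mat_vec_subsp:
  assumes A: "A \<in> mats F n n" and W: "V.subsp W"
  shows "V.subsp (mat_vec F A ` W)"
proof -
  have car: "x \<in> W \<Longrightarrow> x \<in> carrier VM" for x using V.subsp_carrier[OF W] .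
  have "mat_vec F A \<zero>\<^bsub>VM\<^esub> = \<zero>\<^bsub>VM\<^esub>"
    using mat_vec_smult[OF A zero_closed, of "\<zero>\<^bsub>VM\<^esub>"] mat_vec_closed[OF A, of "\<zero>\<^bsub>VM\<^esub>"] by simp
  then have "\<zero>\<^bsub>VM\<^esub> \<in> mat_vec F A ` W" using V.subsp_zero[OF W] by (metis image_eqI)
  moreover have "x \<oplus>\<^bsub>VM\<^esub> y \<in> mat_vec F A ` W" if xy: "x \<in> mat_vec F A ` W" "y \<in> mat_vec F A ` W" for x y
  proof -
    obtain x' y' where "x' \<in> W" "y' \<in> W" "x = mat_vec F A x'" "y = mat_vec F A y'" using xy by blast
    then show ?thesis using mat_vec_add[OF A, of x' y'] car V.subsp_add[OF W] by (metis image_eqI)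
  qed
  moreover have "c \<odot>\<^bsub>VM\<^esub> x \<in> mat_vec F A ` W" if cx: "c \<in> carrier F" "x \<in> mat_vec F A ` W" for c x
  proof -
    obtain x' where "x' \<in> W" "x = mat_vec F A x'" using cx(2) by blast
    then show ?thesis using mat_vec_smult[OF A cx(1), of x'] car V.subsp_smult[OF W cx(1)] by (metis image_eqI)
  qed
  ultimately show ?thesis
    using mat_vec_closed[OF A] car by (auto simp: V.subsp_def)
qed

text \<open>Connects the two descriptions of a flag, by spans of basis vectors and by images of
  coordinate subspaces under a matrix; the latter can be compared with the action of the
  group.\<close>

lemma spans_eq_coord:
  assumes u: "\<And>j. j < n \<Longrightarrow> u j \<in> carrier VM"
  shows "V.spans u J n = mat_vec F (cols_mat n u) ` coord F n J"
proof -
  let ?U = "cols_mat n u"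
  have U: "?U \<in> mats F n n" using u by (rule cols_mat_mats)
  have "V.spans u J k = mat_vec F ?U ` coord F n (J \<inter> {..<k})" if "k \<le> n" for k
    using that
  proof (induction k)
    case 0
    have "coord F n {} = {\<zero>\<^bsub>VM\<^esub>}" by (auto simp: coord_def vec_module_simps intro!: eq_vecI)
    moreover have "mat_vec F ?U \<zero>\<^bsub>VM\<^esub> = \<zero>\<^bsub>VM\<^esub>"
      using mat_vec_smult[OF U zero_closed, of "\<zero>\<^bsub>VM\<^esub>"] mat_vec_closed[OF U, of "\<zero>\<^bsub>VM\<^esub>"] by simp
    ultimately show ?case by simp
  next
    case (Suc k)
    then have k: "k < n" and IH: "V.spans u J k = mat_vec F ?U ` coord F n (J \<inter> {..<k})" by auto
    show ?case
    proof (cases "k \<in> J")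
      case False
      then have "J \<inter> {..<Suc k} = J \<inter> {..<k}" by (auto simp: less_Suc_eq)
      then show ?thesis using IH False by simp
    next
      case True
      let ?e = "vec n (\<lambda>l. if l = k then \<one> else \<zero>)"
      have e: "?e \<in> carrier VM" by (simp add: vec_module_simps)
      have Ue: "mat_vec F ?U ?e = u k"
        using mat_vec_unit[OF U k] u[OF k] k by (auto simp: cols_mat_def vec_module_simps intro!: eq_vecI)
      show ?thesis
      proof (intro equalityI subsetI)
        fix x assume "x \<in> V.spans u J (Suc k)"
        then obtain v c where v: "v \<in> coord F n (J \<inter> {..<k})" "c \<in> carrier F" "x = mat_vec F ?U v \<oplus>\<^bsub>VM\<^esub> c \<odot>\<^bsub>VM\<^esub> u k"
          using True IH by (auto simp: V.ssum_def V.line_def)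
        have vM: "v \<in> carrier VM" using v coord_subset by blast
        have "v \<oplus>\<^bsub>VM\<^esub> c \<odot>\<^bsub>VM\<^esub> ?e \<in> coord F n (J \<inter> {..<Suc k})"
          using v True by (auto simp: coord_def vec_module_simps)
        moreover have "x = mat_vec F ?U (v \<oplus>\<^bsub>VM\<^esub> c \<odot>\<^bsub>VM\<^esub> ?e)"
          using v vM e Ue mat_vec_add[OF U vM, of "c \<odot>\<^bsub>VM\<^esub> ?e"] mat_vec_smult[OF U v(2) e] by simp
        ultimately show "x \<in> mat_vec F ?U ` coord F n (J \<inter> {..<Suc k})" by blast
      next
        fix x assume "x \<in> mat_vec F ?U ` coord F n (J \<inter> {..<Suc k})"
        then obtain w where w: "w \<in> coord F n (J \<inter> {..<Suc k})" "x = mat_vec F ?U w" by blast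
        define v where "v = vec n (\<lambda>l. if l = k then \<zero> else w $ l)"
        have v: "v \<in> coord F n (J \<inter> {..<k})" using w by (auto simp: v_def coord_def vec_module_simps less_Suc_eq)
        then have vM: "v \<in> carrier VM" using coord_subset by blast
        have wk: "w $ k \<in> carrier F" using w k by (auto simp: coord_def vec_module_simps)
        have "w = v \<oplus>\<^bsub>VM\<^esub> w $ k \<odot>\<^bsub>VM\<^esub> ?e"
          using w wk by (intro eq_vecI) (auto simp: v_def coord_def vec_module_simps)
        then have "x = mat_vec F ?U v \<oplus>\<^bsub>VM\<^esub> w $ k \<odot>\<^bsub>VM\<^esub> u k"
          using w(2) vM e wk Ue mat_vec_add[OF U vM, of "w $ k \<odot>\<^bsub>VM\<^esub> ?e"] mat_vec_smult[OF U wk e] by simp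
        then show "x \<in> V.spans u J (Suc k)"
          using True IH v wk by (auto simp: V.ssum_def V.line_def intro!: image_eqI[of _ _ "(mat_vec F ?U v, w $ k \<odot>\<^bsub>VM\<^esub> u k)"])
      qed
    qed
  qed
  then have "V.spans u J n = mat_vec F ?U ` coord F n (J \<inter> {..<n})" by blast
  also have "coord F n (J \<inter> {..<n}) = coord F n J" by (auto simp: coord_def)
  finally show ?thesis .
qed

text \<open>Preimages of the unit vectors are the columns of a right inverse, and the determinant is
  multiplicative.\<close>

lemma det_unit_if_surj:
  assumes U: "U \<in> mats F n n" and surj: "mat_vec F U ` carrier VM = carrier VM"
  shows "det_over F U \<in> Units F"
proof -
  let ?e = "\<lambda>j. vec n (\<lambda>l. if l = j then \<one> else \<zero>)"
  have "\<forall>j. \<exists>b. j < n \<longrightarrow> b \<in> carrier VM \<and> mat_vec F U b = ?e j"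
  proof
    fix j have "?e j \<in> carrier VM" by (simp add: vec_module_simps)
    then have "?e j \<in> mat_vec F U ` carrier VM" using surj by simp
    then show "\<exists>b. j < n \<longrightarrow> b \<in> carrier VM \<and> mat_vec F U b = ?e j"
      unfolding image_iff by (elim bexE) (intro exI impI conjI, assumption, erule sym)
  qed
  then obtain b where b: "\<And>j. j < n \<Longrightarrow> b j \<in> carrier VM" "\<And>j. j < n \<Longrightarrow> mat_vec F U (b j) = ?e j" by metis
  have B: "cols_mat n b \<in> mats F n n" using b(1) by (rule cols_mat_mats)
  have "mat_mult_over F U (cols_mat n b) = one_mat_over F n"
  proof (rule eq_matI)
    fix i j assume "i < dim_row (one_mat_over F n)" "j < dim_col (one_mat_over F n)"
    then have ij: "i < n" "j < n" by (auto simp: one_mat_over_def)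
    have colb: "col (cols_mat n b) j = b j" using b(1)[OF ij(2)] ij by (auto simp: cols_mat_def vec_module_simps intro!: eq_vecI)
    have "mat_vec F (mat_mult_over F U (cols_mat n b)) (?e j) = ?e j"
      using mat_vec_mult[OF U B, of "?e j"] mat_vec_unit[OF B ij(2)] b(2)[OF ij(2)] colb by (simp add: vec_module_simps)
    moreover have "mat_vec F (mat_mult_over F U (cols_mat n b)) (?e j) = col (mat_mult_over F U (cols_mat n b)) j"
      by (rule mat_vec_unit[OF mat_mult_over_closed[OF U B] ij(2)])
    ultimately have "col (mat_mult_over F U (cols_mat n b)) j $ i = ?e j $ i" by simp
    then show "mat_mult_over F U (cols_mat n b) $$ (i, j) = one_mat_over F n $$ (i, j)"
      using ij mats_carrier_mat[OF mat_mult_over_closed[OF U B]] by (simp add: one_mat_over_def)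
  qed (use U in \<open>auto simp: mat_mult_over_def one_mat_over_def cols_mat_def mats_def\<close>)
  then have "det_over F U \<otimes> det_over F (cols_mat n b) = \<one>"
    using det_over_mult[OF U B] det_over_diag[of n "\<lambda>_. \<one>"] by (simp add: one_mat_over_eq_diag)
  then show ?thesis using det_over_closed[OF U] det_over_closed[OF B] m_comm[of "det_over F U" "det_over F (cols_mat n b)"]
    unfolding Units_def by auto
qed

text \<open>A diagonal factor corrects the determinant of the matrix of a basis and maps every
  coordinate subspace onto itself. Therefore passing from GL to SL does not split the orbits on
  pairs of flags.\<close>

lemma exists_SL_of_basis:
  assumes u: "\<And>j. j < n \<Longrightarrow> u j \<in> carrier VM" and card: "card (V.spans u UNIV n) = V.q ^ n"
  obtains x where "x \<in> carrier (SL n F)" "\<And>J. mat_vec F x ` coord F n J = mat_vec F (cols_mat n u) ` coord F n J"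
proof -
  let ?U = "cols_mat n u"
  have U: "?U \<in> mats F n n" using u by (rule cols_mat_mats)
  have "mat_vec F ?U ` carrier VM = carrier VM"
  proof (rule V.subsp_eqI)
    show "card (mat_vec F ?U ` carrier VM) = card (carrier VM)"
      using card spans_eq_coord[of u UNIV] u by (simp add: coord_UNIV card_V)
  qed (use mat_vec_closed[OF U] in \<open>auto intro: V.subsp_univ mat_vec_subsp[OF U]\<close>)
  then have unit: "det_over F ?U \<in> Units F" by (rule det_unit_if_surj[OF U])
  define c where "c = inv (det_over F ?U)"
  have c: "c \<in> Units F" using unit by (simp add: c_def)
  \<comment> \<open>Only the first column is rescaled; it exists because \<open>n\<close> is
    positive.\<close>
  define d where "d i = (if i = 0 then c else \<one>)" for i :: nat
  have d: "d i \<in> carrier F" for i using c by (auto simp: d_def)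
  have dU: "d i \<in> Units F" for i using c by (auto simp: d_def)
  let ?D = "diag_over F n d"
  have D: "?D \<in> mats F n n" using d by (intro diag_over_mats)
  have "(\<Otimes>i\<in>{0..<n}. d i) = d 0 \<otimes> (\<Otimes>i\<in>{1..<n}. d i)"
  proof -
    have "{0..<n} = insert 0 {1..<n}" using n_pos by auto
    then show ?thesis using d by (simp add: Pi_def)
  qed
  also have "(\<Otimes>i\<in>{1..<n}. d i) = \<one>" by (rule finprod_one_eqI) (auto simp: d_def)
  finally have "det_over F ?D = c" using det_over_diag[of n d] d c by (simp add: d_def Units_closed)
  then have det: "det_over F (mat_mult_over F ?U ?D) = \<one>"
    using det_over_mult[OF U D] unit by (simp add: c_def)
  have "mat_vec F ?D ` coord F n J = coord F n J" for J
  proof (intro equalityI subsetI)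
    fix x assume "x \<in> mat_vec F ?D ` coord F n J"
    then show "x \<in> coord F n J" using d by (auto simp: coord_def mat_vec_diag vec_module_simps)
  next
    fix x assume x: "x \<in> coord F n J"
    let ?y = "vec n (\<lambda>i. inv (d i) \<otimes> x $ i)"
    have y: "?y \<in> coord F n J" using x dU by (auto simp: coord_def vec_module_simps)
    have "mat_vec F ?D ?y = vec n (\<lambda>i. d i \<otimes> ?y $ i)"
      using y coord_subset d by (intro mat_vec_diag) auto
    also have "\<dots> = x"
    proof (rule eq_vecI)
      fix i assume "i < dim_vec x"
      then have i: "i < n" "x $ i \<in> carrier F" using x by (auto simp: coord_def vec_module_simps)
      have "d i \<otimes> (inv (d i) \<otimes> x $ i) = x $ i"
        using i dU[of i] by (simp add: m_assoc[symmetric] Units_closed)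
      then show "vec n (\<lambda>i. d i \<otimes> ?y $ i) $ i = x $ i" using i by simp
    qed (use x in \<open>auto simp: coord_def vec_module_simps\<close>)
    finally have "mat_vec F ?D ?y = x" .
    then show "x \<in> mat_vec F ?D ` coord F n J" using imageI[OF y, of "mat_vec F ?D"] by simp
  qed
  moreover have "mat_vec F (mat_mult_over F ?U ?D) ` coord F n J = mat_vec F ?U ` (mat_vec F ?D ` coord F n J)" for J
    unfolding image_image by (intro image_cong refl mat_vec_mult[OF U D]) (use coord_subset in blast)
  ultimately show ?thesis
    using that[of "mat_mult_over F ?U ?D"] det mat_mult_over_closed[OF U D] by (simp add: SL_def mats_iff_elements)
qed

lemma permuted_cols:
  assumes u: "\<And>j. j < n \<Longrightarrow> u j \<in> carrier VM" and \<pi>: "\<pi> permutes {..<n}"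
  shows "mat_vec F (cols_mat n u) ` coord F n {l. P l} \<subseteq> mat_vec F (cols_mat n (u \<circ> \<pi>)) ` coord F n {l. P (\<pi> l)}"
proof
  fix x assume "x \<in> mat_vec F (cols_mat n u) ` coord F n {l. P l}"
  then obtain c where c: "c \<in> coord F n {l. P l}" "x = mat_vec F (cols_mat n u) c" by blast
  have \<pi>n: "\<pi> l < n \<longleftrightarrow> l < n" for l using permutes_in_image[OF \<pi>] by auto
  have cF: "c $ i \<in> carrier F" if "i < n" for i using c that by (auto simp: coord_def vec_module_simps)
  let ?c = "vec n (\<lambda>l. c $ \<pi> l)"
  have "?c \<in> coord F n {l. P (\<pi> l)}"
    using c \<pi>n by (auto simp: coord_def vec_module_simps)
  moreover have "mat_vec F (cols_mat n (u \<circ> \<pi>)) ?c = mat_vec F (cols_mat n u) c"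
  proof (rule eq_vecI)
    fix i assume "i < dim_vec (mat_vec F (cols_mat n u) c)"
    then have i: "i < n" by (simp add: mat_vec_def cols_mat_def)
    have uF: "u k $ i \<in> carrier F" if "k < n" for k using u[OF that] i by (simp add: vec_module_simps)
    have img: "\<pi> ` {0..<n} = {0..<n}" using permutes_image[OF \<pi>] by (simp add: atLeast0LessThan)
    have "(\<Oplus>k\<in>{0..<n}. u (\<pi> k) $ i \<otimes> c $ \<pi> k) = (\<Oplus>k\<in>\<pi> ` {0..<n}. u k $ i \<otimes> c $ k)"
      using permutes_inj[OF \<pi>] uF cF img by (intro finsum_reindex[symmetric]) (auto simp: inj_on_def inj_def)
    then have *: "(\<Oplus>k\<in>{0..<n}. u (\<pi> k) $ i \<otimes> c $ \<pi> k) = (\<Oplus>k\<in>{0..<n}. u k $ i \<otimes> c $ k)" using img by simp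
    have "(\<Oplus>k\<in>{0..<n}. cols_mat n (u \<circ> \<pi>) $$ (i, k) \<otimes> ?c $ k) = (\<Oplus>k\<in>{0..<n}. u (\<pi> k) $ i \<otimes> c $ \<pi> k)"
      using i uF cF \<pi>n by (intro finsum_cong') (auto simp: cols_mat_def)
    moreover have "(\<Oplus>k\<in>{0..<n}. cols_mat n u $$ (i, k) \<otimes> c $ k) = (\<Oplus>k\<in>{0..<n}. u k $ i \<otimes> c $ k)"
      using i uF cF by (intro finsum_cong') (auto simp: cols_mat_def)
    moreover have "dim_vec c = n" using c by (simp add: coord_def vec_module_simps)
    ultimately show "mat_vec F (cols_mat n (u \<circ> \<pi>)) ?c $ i = mat_vec F (cols_mat n u) c $ i"
      using i * by (simp add: mat_vec_def cols_mat_def)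
  qed (auto simp: mat_vec_def cols_mat_def)
  ultimately show "x \<in> mat_vec F (cols_mat n (u \<circ> \<pi>)) ` coord F n {l. P (\<pi> l)}" using c(2) by (metis image_eqI)
qed

text \<open>The missing inclusion is the known one for the inverse permutation.\<close>

lemma permuted_cols_eq:
  assumes u: "\<And>j. j < n \<Longrightarrow> u j \<in> carrier VM" and \<pi>: "\<pi> permutes {..<n}"
  shows "mat_vec F (cols_mat n (u \<circ> \<pi>)) ` coord F n {l. P (\<pi> l)} = mat_vec F (cols_mat n u) ` coord F n {l. P l}"
proof
  let ?i = "Hilbert_Choice.inv \<pi>"
  have \<pi>n: "\<pi> l < n \<longleftrightarrow> l < n" for l using permutes_in_image[OF \<pi>] by auto
  have "mat_vec F (cols_mat n (u \<circ> \<pi>)) ` coord F n {l. P (\<pi> l)} \<subseteq>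
      mat_vec F (cols_mat n (u \<circ> \<pi> \<circ> ?i)) ` coord F n {l. P (\<pi> (?i l))}"
    by (rule permuted_cols[OF _ permutes_inv[OF \<pi>]]) (use u \<pi>n in auto)
  then show "mat_vec F (cols_mat n (u \<circ> \<pi>)) ` coord F n {l. P (\<pi> l)} \<subseteq> mat_vec F (cols_mat n u) ` coord F n {l. P l}"
    using permutes_inverses(1)[OF \<pi>] by (simp add: comp_def)
  show "mat_vec F (cols_mat n u) ` coord F n {l. P l} \<subseteq> mat_vec F (cols_mat n (u \<circ> \<pi>)) ` coord F n {l. P (\<pi> l)}"
    by (rule permuted_cols[OF u \<pi>])
qed

end

context finite_field_dim
begin

subsection \<open>Orbits on pairs of flags\<close>

definition fiber :: "(nat \<Rightarrow> 't) \<Rightarrow> 't \<Rightarrow> nat" where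
  "fiber f t = card {l. l < n \<and> f l = t}"

text \<open>Equal fiber sizes mean equal multisets of values, and lists with the same multiset
  differ by a permutation of the positions.\<close>

lemma exists_permutation_of_fibers:
  assumes "\<And>t. fiber f t = fiber f' t"
  obtains \<pi> where "\<pi> permutes {..<n}" "\<And>l. l < n \<Longrightarrow> f (\<pi> l) = f' l"
proof -
  have count: "count (mset (map h [0..<n])) t = fiber h t" for h :: "nat \<Rightarrow> 't" and t
  proof -
    have "count (mset (map h [0..<n])) t = length (filter (\<lambda>y. t = y) (map h [0..<n]))"
      by (simp only: count_mset count_list_eq_length_filter)
    also have "\<dots> = length (filter (\<lambda>l. t = h l) [0..<n])" by (simp add: filter_map comp_def)
    also have "\<dots> = card {l. l < n \<and> h l = t}"
      unfolding length_filter_conv_card by (rule arg_cong[of _ _ card]) auto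
    finally show ?thesis by (simp add: fiber_def)
  qed
  have "mset (map f' [0..<n]) = mset (map f [0..<n])"
    by (rule multiset_eqI) (simp only: count assms)
  then obtain \<pi> where \<pi>: "\<pi> permutes {..<length (map f [0..<n])}" "permute_list \<pi> (map f [0..<n]) = map f' [0..<n]"
    by (rule mset_eq_permutation)
  have "f (\<pi> l) = f' l" if l: "l < n" for l
  proof -
    have "\<pi> l < n" using permutes_in_image[OF \<pi>(1)] l by simp
    then show ?thesis using arg_cong[OF \<pi>(2), of "\<lambda>xs. xs ! l"] l permute_list_nth[OF \<pi>(1), of l] by simp
  qed
  then show ?thesis using that \<pi>(1) by simp
qed

lemma exists_fun_with_fibers:
  assumes "finite T" "(\<Sum>t\<in>T. c t) = n"
  obtains f where "\<And>l. l < n \<Longrightarrow> f l \<in> T" "\<And>t. t \<in> T \<Longrightarrow> fiber f t = c t"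
proof -
  obtain xs where xs: "mset xs = (\<Sum>t\<in>T. replicate_mset (c t) t)" using ex_mset by blast
  have count: "count (mset xs) s = (if s \<in> T then c s else 0)" for s
    using assms(1) by (simp add: xs count_sum)
  have "length xs = size (mset xs)" by simp
  also have "\<dots> = n" unfolding xs using assms by (simp add: size_multiset_sum)
  finally have len: "length xs = n" .
  have "fiber ((!) xs) t = c t" if "t \<in> T" for t
  proof -
    have "fiber ((!) xs) t = length (filter (\<lambda>x. t = x) xs)"
      unfolding fiber_def length_filter_conv_card len by (rule arg_cong[of _ _ card]) auto
    also have "\<dots> = count (mset xs) t" by (simp add: count_mset count_list_eq_length_filter)
    finally show ?thesis using count[of t] that by simp
  qed
  moreover have "xs ! l \<in> T" if "l < n" for l
  proof -
    have "count (mset xs) (xs ! l) > 0" using that len by (simp add: count_mset_gt_0)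
    then show ?thesis using count[of "xs ! l"] by (auto split: if_splits)
  qed
  ultimately show ?thesis using that by blast
qed

definition act_flag :: "'a mat \<Rightarrow> (nat \<Rightarrow> 'a vec set) \<Rightarrow> nat \<Rightarrow> 'a vec set" where
  "act_flag g W = (\<lambda>i. mat_vec F g ` W i)"

definition coord_flag :: "(nat \<Rightarrow> nat) \<Rightarrow> nat \<Rightarrow> 'a vec set" where
  "coord_flag a = (\<lambda>i. coord F n {l. a l < i})"

lemma SL_mats: "g \<in> carrier (SL n F) \<Longrightarrow> g \<in> mats F n n"
  by (simp add: SL_def mats_iff_elements)

lemma finite_SL: "finite (carrier (SL n F))"
proof -
  have "carrier (SL n F) \<subseteq> mats F n n" using SL_mats by blast
  moreover have "mats F n n \<subseteq> (\<lambda>f. mat n n f) ` (({..<n} \<times> {..<n}) \<rightarrow>\<^sub>E carrier F)"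
  proof
    fix A assume A: "A \<in> mats F n n"
    then have "A = mat n n (\<lambda>ij\<in>{..<n} \<times> {..<n}. A $$ ij)" by (intro eq_matI) (auto simp: mats_def)
    moreover have "(\<lambda>ij\<in>{..<n} \<times> {..<n}. A $$ ij) \<in> ({..<n} \<times> {..<n}) \<rightarrow>\<^sub>E carrier F" using A by (auto simp: mats_def)
    ultimately show "A \<in> (\<lambda>f. mat n n f) ` (({..<n} \<times> {..<n}) \<rightarrow>\<^sub>E carrier F)" by blast
  qed
  ultimately show ?thesis using finite_F by (meson finite_PiE finite_SigmaI finite_imageI finite_lessThan finite_subset)
qed

lemma SL_mat_vec:
  assumes "g \<in> carrier (SL n F)" "h \<in> carrier (SL n F)" "v \<in> carrier VM"
  shows "mat_vec F (g \<otimes>\<^bsub>SL n F\<^esub> h) v = mat_vec F g (mat_vec F h v)"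
proof -
  have "g \<otimes>\<^bsub>SL n F\<^esub> h = mat_mult_over F g h" by (simp add: SL_def)
  then show ?thesis using mat_vec_mult[OF SL_mats[OF assms(1)] SL_mats[OF assms(2)] assms(3)] by simp
qed

lemma SL_mat_vec_one: "v \<in> carrier VM \<Longrightarrow> mat_vec F \<one>\<^bsub>SL n F\<^esub> v = v"
  using mat_vec_one by (simp add: SL_def)

lemma SL_mat_vec_inv:
  assumes g: "g \<in> carrier (SL n F)" and v: "v \<in> carrier VM"
  shows "mat_vec F (inv\<^bsub>SL n F\<^esub> g) (mat_vec F g v) = v"
proof -
  interpret G: group "SL n F" by (rule SL_group)
  show ?thesis using SL_mat_vec[of "inv\<^bsub>SL n F\<^esub> g" g v] SL_mat_vec_one[OF v] g v by simp
qed

lemma SL_inj_on: "g \<in> carrier (SL n F) \<Longrightarrow> W \<subseteq> carrier VM \<Longrightarrow> inj_on (mat_vec F g) W"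
  by (rule inj_on_inverseI[of _ "mat_vec F (inv\<^bsub>SL n F\<^esub> g)"]) (auto intro: SL_mat_vec_inv)

lemma act_flag_flags:
  assumes g: "g \<in> carrier (SL n F)" and W: "W \<in> V.flags m \<mu>"
  shows "act_flag g W \<in> V.flags m \<mu>"
proof -
  have "W i \<subseteq> carrier VM" for i using W by (auto simp: V.flags_def V.subsp_def)
  then show ?thesis
    using W mat_vec_subsp[OF SL_mats[OF g]] SL_inj_on[OF g]
    unfolding V.flags_def act_flag_def by (simp add: card_image image_mono)
qed

lemma acts_on_flags: "acts_on (SL n F) (V.flags m \<mu>) act_flag"
  unfolding acts_on_def
proof (intro conjI ballI)
  fix W assume W: "W \<in> V.flags m \<mu>"
  have car: "x \<in> carrier VM" if "x \<in> W i" for x i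
    using W that V.subsp_carrier by (auto simp: V.flags_def)
  show "act_flag \<one>\<^bsub>SL n F\<^esub> W = W"
    unfolding act_flag_def using car by (auto simp: fun_eq_iff SL_mat_vec_one image_iff)
  show "act_flag (g \<otimes>\<^bsub>SL n F\<^esub> h) W = act_flag g (act_flag h W)"
    if "g \<in> carrier (SL n F)" "h \<in> carrier (SL n F)" for g h
    unfolding act_flag_def image_image using that car SL_mat_vec by (auto simp: fun_eq_iff image_iff)
qed (use act_flag_flags in auto)

lemma finite_flags: "(\<Sum>l<m. \<mu> l) = n \<Longrightarrow> finite (V.flags m \<mu>)"
proof -
  assume sum: "(\<Sum>l<m. \<mu> l) = n"
  have "inj_on (\<lambda>W. restrict W {..m}) (V.flags m \<mu>)"
  proof (rule inj_onI, rule ext)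
    fix W U i assume WU: "W \<in> V.flags m \<mu>" "U \<in> V.flags m \<mu>" "restrict W {..m} = restrict U {..m}"
    show "W i = U i"
    proof (cases "i \<le> m")
      case True
      then show ?thesis using fun_cong[OF WU(3), of i] by simp
    next
      case False
      then show ?thesis using V.flags_top WU(1,2) card_V sum by (metis nat_le_linear)
    qed
  qed
  moreover have "(\<lambda>W. restrict W {..m}) ` V.flags m \<mu> \<subseteq> {..m} \<rightarrow>\<^sub>E Pow (carrier VM)"
    using V.subsp_carrier by (fastforce simp: V.flags_def)
  moreover have "finite ({..m} \<rightarrow>\<^sub>E Pow (carrier VM))" using V.finite_M by (intro finite_PiE) auto
  ultimately show ?thesis by (meson finite_imageD finite_subset)
qed

text \<open>The relative position of two coordinate flags, which corresponds to a double coset of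
  two parabolic subgroups.\<close>

definition table_of :: "(nat \<Rightarrow> nat) \<Rightarrow> (nat \<Rightarrow> nat) \<Rightarrow> nat \<Rightarrow> nat \<Rightarrow> nat" where
  "table_of a b i j = card {l. l < n \<and> a l = i \<and> b l = j}"

lemma card_less_fiber:
  "card {l. l < n \<and> a l < (i::nat)} = (\<Sum>l<i. fiber a l)"
proof (induction i)
  case (Suc i)
  have "{l. l < n \<and> a l < Suc i} = {l. l < n \<and> a l < i} \<union> {l. l < n \<and> a l = i}" by auto
  then have "card {l. l < n \<and> a l < Suc i} = card {l. l < n \<and> a l < i} + card {l. l < n \<and> a l = i}"
    by (simp add: card_Un_disjoint disjoint_iff)
  then show ?case using Suc by (simp add: fiber_def)
qed simp

lemma coord_flag_flags_iff:
  "coord_flag a \<in> V.flags m \<mu> \<longleftrightarrow> (\<forall>i. card {l. l < n \<and> a l < i} = (\<Sum>l<min i m. \<mu> l))"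
proof -
  have "{l. a l < i} \<inter> {..<n} = {l. l < n \<and> a l < i}" for i by auto
  then have "card (coord_flag a i) = V.q ^ card {l. l < n \<and> a l < i}" for i
    by (simp add: coord_flag_def card_coord)
  moreover have "coord_flag a i \<subseteq> coord_flag a (Suc i)" for i
    by (auto simp: coord_flag_def coord_def)
  moreover have "V.subsp (coord_flag a i)" for i by (simp add: coord_flag_def subsp_coord)
  ultimately show ?thesis using V.q_ge_2 by (auto simp: V.flags_def)
qed

lemma fibers_of_flag:
  assumes "coord_flag a \<in> V.flags m \<mu>" "(\<Sum>l<m. \<mu> l) = n"
  shows "l < n \<Longrightarrow> a l < m" "i < m \<Longrightarrow> fiber a i = \<mu> i"
proof -
  have eq: "card {l. l < n \<and> a l < i} = (\<Sum>l<min i m. \<mu> l)" for i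
    using assms(1) unfolding coord_flag_flags_iff by blast
  show "fiber a i = \<mu> i" if "i < m"
    using eq[of i] eq[of "Suc i"] that by (simp add: card_less_fiber min_absorb1)
  show "a l < m" if "l < n"
  proof -
    have "card {l. l < n \<and> a l < m} = card {..<n}" using eq[of m] assms(2) by simp
    then have "{l. l < n \<and> a l < m} = {..<n}" by (intro card_subset_eq) auto
    then show ?thesis using that by blast
  qed
qed

lemma coord_flag_flagsI:
  assumes "\<And>l. l < n \<Longrightarrow> a l < m" "\<And>i. i < m \<Longrightarrow> fiber a i = \<mu> i"
  shows "coord_flag a \<in> V.flags m \<mu>"
  unfolding coord_flag_flags_iff
proof
  fix i
  have "{l. l < n \<and> a l < i} = {l. l < n \<and> a l < min i m}" using assms(1) by auto
  then have "card {l. l < n \<and> a l < i} = (\<Sum>l<min i m. fiber a l)" using card_less_fiber[of a "min i m"] by simp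
  also have "\<dots> = (\<Sum>l<min i m. \<mu> l)" using assms(2) by (intro sum.cong) auto
  finally show "card {l. l < n \<and> a l < i} = (\<Sum>l<min i m. \<mu> l)" .
qed

text \<open>The conclusion is stated for every pair \<open>a'\<close>, \<open>b'\<close> with the
  same table, so that a representative fixed in advance for each table can be moved to the given
  pair of flags.\<close>

lemma flag_pair_normal_form:
  assumes W: "W \<in> V.flags m \<mu>" "(\<Sum>l<m. \<mu> l) = n" and U: "U \<in> V.flags m \<nu>" "(\<Sum>l<m. \<nu> l) = n"
  obtains a b where "coord_flag a \<in> V.flags m \<mu>" "coord_flag b \<in> V.flags m \<nu>"
    "\<And>a' b'. (\<And>i j. table_of a' b' i j = table_of a b i j) \<Longrightarrow>
       \<exists>x\<in>carrier (SL n F). act_flag x (coord_flag a') = W \<and> act_flag x (coord_flag b') = U"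
proof -
  obtain u a b where u: "\<And>j. j < n \<Longrightarrow> u j \<in> carrier VM" "\<And>J. card (V.spans u J n) = V.q ^ card (J \<inter> {..<n})"
    and WU: "\<And>i. W i = V.spans u {l. a l < i} n" "\<And>i. U i = V.spans u {l. b l < i} n"
    using V.exists_adapted_basis[OF card_V W U] by metis
  have int: "{l. a l < i} \<inter> {..<n} = {l. l < n \<and> a l < i}" for a :: "nat \<Rightarrow> nat" and i by auto
  have q_inj: "V.q ^ x = V.q ^ y \<longleftrightarrow> x = y" for x y :: nat using V.q_ge_2 by simp
  have flagsa: "coord_flag a \<in> V.flags m \<mu>"
    unfolding coord_flag_flags_iff
  proof
    fix i
    have "V.q ^ card {l. l < n \<and> a l < i} = V.q ^ (\<Sum>l<min i m. \<mu> l)"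
      using W(1) u(2)[of "{l. a l < i}"] unfolding WU int V.flags_def by auto
    then show "card {l. l < n \<and> a l < i} = (\<Sum>l<min i m. \<mu> l)" unfolding q_inj .
  qed
  have flagsb: "coord_flag b \<in> V.flags m \<nu>"
    unfolding coord_flag_flags_iff
  proof
    fix i
    have "V.q ^ card {l. l < n \<and> b l < i} = V.q ^ (\<Sum>l<min i m. \<nu> l)"
      using U(1) u(2)[of "{l. b l < i}"] unfolding WU int V.flags_def by auto
    then show "card {l. l < n \<and> b l < i} = (\<Sum>l<min i m. \<nu> l)" unfolding q_inj .
  qed
  have "\<exists>x\<in>carrier (SL n F). act_flag x (coord_flag a') = W \<and> act_flag x (coord_flag b') = U"
    if table: "\<And>i j. table_of a' b' i j = table_of a b i j" for a' b'
  proof -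
    \<comment> \<open>A table counts the basis vectors of each type, that is, those entering at step
      \<open>i\<close> and step \<open>j\<close>. Equal tables therefore differ by a relabeling
      \<open>\<pi>\<close> of the basis.\<close>
    have "fiber (\<lambda>l. (a l, b l)) t = fiber (\<lambda>l. (a' l, b' l)) t" for t
      using table[of "fst t" "snd t"] by (cases t) (simp add: fiber_def table_of_def)
    then obtain \<pi> where \<pi>: "\<pi> permutes {..<n}" "\<And>l. l < n \<Longrightarrow> (a (\<pi> l), b (\<pi> l)) = (a' l, b' l)"
      using exists_permutation_of_fibers[of "\<lambda>l. (a l, b l)" "\<lambda>l. (a' l, b' l)"] by metis
    have \<pi>n: "\<pi> l < n" if "l < n" for l using permutes_in_image[OF \<pi>(1)] that by auto
    have u\<pi>: "\<And>j. j < n \<Longrightarrow> (u \<circ> \<pi>) j \<in> carrier VM" using u(1) \<pi>n by simp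
    have img: "mat_vec F (cols_mat n (u \<circ> \<pi>)) ` coord F n {l. P (\<pi> l)} = V.spans u {l. P l} n" for P
      using permuted_cols_eq[of u \<pi> P] spans_eq_coord[of u] u(1) \<pi>(1) by simp
    have "V.spans (u \<circ> \<pi>) UNIV n = V.spans u UNIV n"
      using img[of "\<lambda>_. True"] spans_eq_coord[of "u \<circ> \<pi>" UNIV] u\<pi> by simp
    then have card: "card (V.spans (u \<circ> \<pi>) UNIV n) = V.q ^ n" using u(2)[of UNIV] by simp
    obtain x where x: "x \<in> carrier (SL n F)" "\<And>J. mat_vec F x ` coord F n J = mat_vec F (cols_mat n (u \<circ> \<pi>)) ` coord F n J"
      using exists_SL_of_basis[of "u \<circ> \<pi>", OF _ card] u\<pi> by blast
    have coord_eq: "coord F n {l. f (\<pi> l) < i} = coord F n {l. f' l < i}" if "\<And>l. l < n \<Longrightarrow> f (\<pi> l) = f' l" for f f' :: "nat \<Rightarrow> nat" and i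
      using that by (auto simp: coord_def)
    have "act_flag x (coord_flag a') = W"
      unfolding act_flag_def coord_flag_def WU
      using img[of "\<lambda>l. a l < _"] x(2) coord_eq[of a a'] \<pi>(2) by (auto simp: fun_eq_iff)
    moreover have "act_flag x (coord_flag b') = U"
      unfolding act_flag_def coord_flag_def WU
      using img[of "\<lambda>l. b l < _"] x(2) coord_eq[of b b'] \<pi>(2) by (auto simp: fun_eq_iff)
    ultimately show ?thesis using x(1) by blast
  qed
  then show ?thesis using that flagsa flagsb by blast
qed

lemma table_of_tables:
  assumes "\<And>l. l < n \<Longrightarrow> a l < m" "\<And>l. l < n \<Longrightarrow> b l < m"
    and "\<And>i. i < m \<Longrightarrow> fiber a i = \<mu> i" "\<And>i. i < m \<Longrightarrow> fiber b i = \<nu> i"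
  shows "table_of a b \<in> tables m (\<lambda>i. int (\<mu> i)) (\<lambda>i. int (\<nu> i))"
proof -
  have row: "(\<Sum>j<m. table_of a b i j) = fiber a i" for i
  proof -
    have "(\<Sum>j<m. table_of a b i j) = card (\<Union>j<m. {l. l < n \<and> a l = i \<and> b l = j})"
      unfolding table_of_def by (rule card_UN_disjoint[symmetric]) auto
    also have "(\<Union>j<m. {l. l < n \<and> a l = i \<and> b l = j}) = {l. l < n \<and> a l = i}" using assms(2) by auto
    finally show ?thesis by (simp add: fiber_def)
  qed
  have col: "(\<Sum>i<m. table_of a b i j) = fiber b j" for j
  proof -
    have "(\<Sum>i<m. table_of a b i j) = card (\<Union>i<m. {l. l < n \<and> a l = i \<and> b l = j})"
      unfolding table_of_def by (rule card_UN_disjoint[symmetric]) auto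
    also have "(\<Union>i<m. {l. l < n \<and> a l = i \<and> b l = j}) = {l. l < n \<and> b l = j}" using assms(1) by auto
    finally show ?thesis by (simp add: fiber_def)
  qed
  have "table_of a b i j = 0" if "\<not> (i < m \<and> j < m)" for i j
  proof -
    have "{l. l < n \<and> a l = i \<and> b l = j} = {}" using assms(1,2) that by auto
    then show ?thesis unfolding table_of_def by (simp only: card.empty)
  qed
  then show ?thesis
    unfolding tables_def using row col assms(3,4) by (auto simp flip: of_nat_sum)
qed

lemma exists_table_functions:
  assumes M: "M \<in> tables m (\<lambda>i. int (\<mu> i)) (\<lambda>i. int (\<nu> i))" and sum: "(\<Sum>l<m. \<mu> l) = n"
  obtains a b where "table_of a b = M" "coord_flag a \<in> V.flags m \<mu>" "coord_flag b \<in> V.flags m \<nu>"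
proof -
  have row: "(\<Sum>j<m. M i j) = \<mu> i" "(\<Sum>k<m. M k i) = \<nu> i" if "i < m" for i
    using M that by (auto simp: tables_def simp flip: of_nat_sum)
  have "(\<Sum>t\<in>{..<m} \<times> {..<m}. case t of (i, j) \<Rightarrow> M i j) = n"
    using row(1) sum by (simp add: sum.cartesian_product[symmetric])
  then obtain f where f: "\<And>l. l < n \<Longrightarrow> f l \<in> {..<m} \<times> {..<m}"
    "\<And>t. t \<in> {..<m} \<times> {..<m} \<Longrightarrow> fiber f t = (case t of (i, j) \<Rightarrow> M i j)"
    using exists_fun_with_fibers[of "{..<m} \<times> {..<m}"] by (metis finite_SigmaI finite_lessThan)
  define a b where "a l = fst (f l)" and "b l = snd (f l)" for l
  have ab: "a l < m" "b l < m" if "l < n" for l using f(1)[OF that] by (auto simp: a_def b_def)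
  have tab: "table_of a b i j = M i j" for i j
  proof (cases "i < m \<and> j < m")
    case True
    have "table_of a b i j = fiber f (i, j)"
      unfolding table_of_def fiber_def a_def b_def by (rule arg_cong[of _ _ card]) (auto simp: prod_eq_iff)
    then show ?thesis using f(2)[of "(i, j)"] True by simp
  next
    case False
    then have "{l. l < n \<and> a l = i \<and> b l = j} = {}" using ab by auto
    then have "table_of a b i j = 0" unfolding table_of_def by (simp only: card.empty)
    then show ?thesis using M False by (simp add: tables_def)
  qed
  have tab': "table_of a b \<in> tables m (\<lambda>i. int (fiber a i)) (\<lambda>i. int (fiber b i))"
    using ab by (intro table_of_tables) auto
  have "fiber a i = \<mu> i" "fiber b i = \<nu> i" if "i < m" for i
    using tab' row[OF that] that tab by (auto simp: tables_def simp flip: of_nat_sum)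
  then have "coord_flag a \<in> V.flags m \<mu>" "coord_flag b \<in> V.flags m \<nu>"
    using ab by (auto intro!: coord_flag_flagsI)
  moreover have "table_of a b = M" by (intro ext tab)
  ultimately show ?thesis using that by blast
qed

text \<open>The group preserves the sizes of the intersections of members of the two flags, and
  differences in both indices recover the table from them.\<close>

lemma table_of_determined:
  assumes x: "x \<in> carrier (SL n F)" "act_flag x (coord_flag a) = coord_flag a'" "act_flag x (coord_flag b) = coord_flag b'"
  shows "table_of a b = table_of a' b'"
proof (intro ext)
  have meet: "coord_flag a i \<inter> coord_flag b j = coord F n {l. a l < i \<and> b l < j}" for a b i j
    by (auto simp: coord_flag_def coord_def)
  have card_meet: "card (coord_flag a i \<inter> coord_flag b j) = V.q ^ card {l. l < n \<and> a l < i \<and> b l < j}" for a b i j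
  proof -
    have "{l. a l < i \<and> b l < j} \<inter> {..<n} = {l. l < n \<and> a l < i \<and> b l < j}" by auto
    then show ?thesis by (simp add: meet card_coord)
  qed
  have "coord_flag a' i \<inter> coord_flag b' j = mat_vec F x ` (coord_flag a i \<inter> coord_flag b j)" for i j
    using fun_cong[OF x(2), of i] fun_cong[OF x(3), of j] SL_inj_on[OF x(1) subset_refl] coord_subset
    unfolding act_flag_def coord_flag_def
    by (subst inj_on_image_Int[of _ "carrier VM"]) auto
  then have "card (coord_flag a' i \<inter> coord_flag b' j) = card (coord_flag a i \<inter> coord_flag b j)" for i j
    using SL_inj_on[OF x(1)] coord_subset by (simp add: card_image meet)
  then have eq: "card {l. l < n \<and> a' l < i \<and> b' l < j} = card {l. l < n \<and> a l < i \<and> b l < j}" for i j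
    unfolding card_meet using V.q_ge_2 by simp
  have step: "card {l. l < n \<and> a l = i \<and> b l < j} = card {l. l < n \<and> a l < Suc i \<and> b l < j} - card {l. l < n \<and> a l < i \<and> b l < j}"
    for a b :: "nat \<Rightarrow> nat" and i j
  proof -
    have "{l. l < n \<and> a l = i \<and> b l < j} = {l. l < n \<and> a l < Suc i \<and> b l < j} - {l. l < n \<and> a l < i \<and> b l < j}" by auto
    then show ?thesis by (simp add: card_Diff_subset subset_iff)
  qed
  have step2: "table_of a b i j = card {l. l < n \<and> a l = i \<and> b l < Suc j} - card {l. l < n \<and> a l = i \<and> b l < j}"
    for a b :: "nat \<Rightarrow> nat" and i j
  proof -
    have "{l. l < n \<and> a l = i \<and> b l = j} = {l. l < n \<and> a l = i \<and> b l < Suc j} - {l. l < n \<and> a l = i \<and> b l < j}" by auto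
    then show ?thesis unfolding table_of_def by (simp add: card_Diff_subset subset_iff)
  qed
  show "table_of a b i j = table_of a' b' i j" for i j
    unfolding step2 step eq ..
qed

text \<open>Fixed points on pairs multiply, so orbit counting applies to the product action. The
  pairs \<open>r M\<close> are representatives of the orbits: each pair of flags is moved from the
  one with its table, and different tables are never in one orbit.\<close>

lemma flag_pair_inner:
  assumes \<mu>: "(\<Sum>l<m. \<mu> l) = n" and \<nu>: "(\<Sum>l<m. \<nu> l) = n"
  shows "(\<Sum>g\<in>carrier (SL n F). complex_of_nat (fixed_count (V.flags m \<mu>) act_flag g) * of_nat (fixed_count (V.flags m \<nu>) act_flag g)) =
    of_nat (card (carrier (SL n F))) * of_nat (card (tables m (\<lambda>i. int (\<mu> i)) (\<lambda>i. int (\<nu> i))))"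
proof -
  let ?G = "SL n F" and ?A = "V.flags m \<mu>" and ?B = "V.flags m \<nu>"
  let ?T = "tables m (\<lambda>i. int (\<mu> i)) (\<lambda>i. int (\<nu> i))"
  define act where "act g = map_prod (act_flag g) (act_flag g)" for g
  have act: "acts_on ?G (?A \<times> ?B) act"
    using acts_on_flags[of m \<mu>] acts_on_flags[of m \<nu>] by (auto simp: acts_on_def act_def)
  have fin: "finite (?A \<times> ?B)" using finite_flags \<mu> \<nu> by auto
  have fc: "fixed_count (?A \<times> ?B) act g = fixed_count ?A act_flag g * fixed_count ?B act_flag g" for g
  proof -
    have "{x \<in> ?A \<times> ?B. act g x = x} = {x \<in> ?A. act_flag g x = x} \<times> {x \<in> ?B. act_flag g x = x}"
      by (auto simp: act_def)
    then show ?thesis by (simp add: fixed_count_def card_cartesian_product)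
  qed
  have "\<forall>M. \<exists>p. M \<in> ?T \<longrightarrow> table_of (fst p) (snd p) = M \<and> coord_flag (fst p) \<in> ?A \<and> coord_flag (snd p) \<in> ?B"
    using exists_table_functions[OF _ \<mu>] by (metis fst_conv snd_conv)
  then obtain p where p: "\<And>M. M \<in> ?T \<Longrightarrow> table_of (fst (p M)) (snd (p M)) = M \<and> coord_flag (fst (p M)) \<in> ?A \<and> coord_flag (snd (p M)) \<in> ?B"
    by metis
  define r where "r M = (coord_flag (fst (p M)), coord_flag (snd (p M)))" for M
  have r_orbit: "M = M'" if "M \<in> ?T" "M' \<in> ?T" "g \<in> carrier ?G" "act g (r M) = r M'" for M M' g
    using table_of_determined[of g "fst (p M)" "fst (p M')" "snd (p M)" "snd (p M')"] that p[of M] p[of M']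
    by (simp add: act_def r_def)
  interpret G: group ?G by (rule SL_group)
  have r_in: "r M \<in> ?A \<times> ?B" if "M \<in> ?T" for M using p[OF that] by (simp add: r_def)
  have act_one: "act \<one>\<^bsub>?G\<^esub> x = x" if "x \<in> ?A \<times> ?B" for x using act that by (auto simp: acts_on_def)
  have inj: "inj_on r ?T"
    using r_orbit[of _ _ "\<one>\<^bsub>?G\<^esub>"] act_one[OF r_in] by (auto intro!: inj_onI)
  have reps: "\<exists>!s. s \<in> r ` ?T \<and> (\<exists>g\<in>carrier ?G. act g s = x)" if x: "x \<in> ?A \<times> ?B" for x
  proof -
    obtain W U where WU: "x = (W, U)" "W \<in> ?A" "U \<in> ?B" using x by auto
    obtain a b where ab: "coord_flag a \<in> ?A" "coord_flag b \<in> ?B"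
      and sl: "\<And>a' b'. (\<And>i j. table_of a' b' i j = table_of a b i j) \<Longrightarrow>
       \<exists>x\<in>carrier ?G. act_flag x (coord_flag a') = W \<and> act_flag x (coord_flag b') = U"
      using flag_pair_normal_form[OF WU(2) \<mu> WU(3) \<nu>] by blast
    have M: "table_of a b \<in> ?T"
      using fibers_of_flag[OF ab(1) \<mu>] fibers_of_flag[OF ab(2) \<nu>] by (intro table_of_tables) auto
    obtain g where g: "g \<in> carrier ?G" "act g (r (table_of a b)) = x"
      using sl[of "fst (p (table_of a b))" "snd (p (table_of a b))"] p[OF M] WU(1) by (auto simp: act_def r_def)
    show ?thesis
    proof (rule ex1I[of _ "r (table_of a b)"])
      show "r (table_of a b) \<in> r ` ?T \<and> (\<exists>g\<in>carrier ?G. act g (r (table_of a b)) = x)" using M g by blast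
      fix s assume s: "s \<in> r ` ?T \<and> (\<exists>g\<in>carrier ?G. act g s = x)"
      then obtain M' h where M': "M' \<in> ?T" "s = r M'" "h \<in> carrier ?G" "act h (r M') = x" by blast
      have "\<forall>k\<in>carrier ?G. \<forall>h\<in>carrier ?G. \<forall>x\<in>?A \<times> ?B. act (k \<otimes>\<^bsub>?G\<^esub> h) x = act k (act h x)"
        using act unfolding acts_on_def by (elim conjE)
      from bspec[OF bspec[OF bspec[OF this G.inv_closed[OF g(1)]] M'(3)] r_in[OF M'(1)]]
      have "act (inv\<^bsub>?G\<^esub> g \<otimes>\<^bsub>?G\<^esub> h) (r M') = act (inv\<^bsub>?G\<^esub> g) (act h (r M'))" .
      also have "\<dots> = r (table_of a b)" using act_inv_act[OF SL_group act g(1) r_in[OF M]] g(2) M'(4) by simp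
      finally have eq: "act (inv\<^bsub>?G\<^esub> g \<otimes>\<^bsub>?G\<^esub> h) (r M') = r (table_of a b)" .
      have "inv\<^bsub>?G\<^esub> g \<otimes>\<^bsub>?G\<^esub> h \<in> carrier ?G" using g(1) M'(3) by blast
      from r_orbit[OF M'(1) M this eq] have "M' = table_of a b" .
      then show "s = r (table_of a b)" using M'(2) by simp
    qed
  qed
  have "(\<Sum>g\<in>carrier ?G. complex_of_nat (fixed_count ?A act_flag g) * of_nat (fixed_count ?B act_flag g)) =
    (\<Sum>g\<in>carrier ?G. complex_of_nat (fixed_count (?A \<times> ?B) act g) * 1)"
    by (simp add: fc)
  also have "\<dots> = (\<Sum>x\<in>?A \<times> ?B. \<Sum>g\<in>stab ?G act x. 1)" by (rule sum_fixed_count[OF finite_SL fin])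
  also have "\<dots> = (\<Sum>x\<in>?A \<times> ?B. complex_of_nat (card (stab ?G act x)) * 1)" by simp
  also have "\<dots> = of_nat (card (carrier ?G)) * (\<Sum>s\<in>r ` ?T. 1)"
  proof (rule sum_stab_representatives[OF SL_group finite_SL act fin _ reps])
    show "r ` ?T \<subseteq> ?A \<times> ?B" using r_in by blast
  qed simp_all
  also have "(\<Sum>s\<in>r ` ?T. (1::complex)) = of_nat (card ?T)" by (simp add: card_image[OF inj])
  finally show ?thesis .
qed

text \<open>The upper triangular subgroup is the stabilizer of the standard flag \<open>?E\<close>,
  and the group is transitive on complete flags. Sorted by the flag \<open>act_flag x ?E\<close>,
  the elements \<open>x\<close> of the sum fall into cosets of this subgroup, one for each flag
  fixed by \<open>g\<close>.\<close>

lemma induced_function_eq_fixed_count: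
  assumes g: "g \<in> carrier (SL n F)"
  shows "induced_function (SL n F) (SL_borel n F) (\<lambda>_. 1) g = of_nat (fixed_count (V.flags n (\<lambda>_. 1)) act_flag g)"
proof -
  let ?G = "SL n F" and ?A = "V.flags n (\<lambda>_. 1)" and ?E = "coord_flag (\<lambda>l. l)"
  interpret G: group ?G by (rule SL_group)
  have sum1: "(\<Sum>l<n. 1::nat) = n" by simp
  note act = acts_on_flags[of n "\<lambda>_. 1"]
  have fin: "finite ?A" by (rule finite_flags[OF sum1])
  have E: "?E \<in> ?A"
  proof (rule coord_flag_flagsI)
    fix i assume "i < n"
    then have "{l. l < n \<and> l = i} = {i}" by auto
    then show "fiber (\<lambda>l. l) i = 1" by (simp add: fiber_def)
  qed
  \<comment> \<open>Transitivity comes from the normal form of the pair \<open>(W, W)\<close>. All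
    fibers of \<open>a\<close> over \<open>{..<n}\<close> have one element, so a reordering of the
    basis turns \<open>a\<close> into the identity; \<open>b\<close> is reordered along with it to
    keep the table.\<close>
  have trans: "\<exists>x\<in>carrier ?G. act_flag x ?E = W" if W: "W \<in> ?A" for W
  proof -
    obtain a b where ab: "coord_flag a \<in> ?A" "coord_flag b \<in> ?A"
      and sl: "\<And>a' b'. (\<And>i j. table_of a' b' i j = table_of a b i j) \<Longrightarrow>
       \<exists>x\<in>carrier ?G. act_flag x (coord_flag a') = W \<and> act_flag x (coord_flag b') = W"
      using flag_pair_normal_form[OF W sum1 W sum1] by blast
    have "fiber a i = fiber (\<lambda>l. l) i" for i
    proof (cases "i < n")
      case True
      then show ?thesis using fibers_of_flag(2)[OF ab(1) sum1] fibers_of_flag(2)[OF E sum1] by simp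
    next
      case False
      have "{l. l < n \<and> a l = i} = {}" "{l. l < n \<and> l = i} = {}" using fibers_of_flag(1)[OF ab(1) sum1] False by auto
      then show ?thesis unfolding fiber_def by (simp only:)
    qed
    then obtain \<pi> where \<pi>: "\<pi> permutes {..<n}" "\<And>l. l < n \<Longrightarrow> a (\<pi> l) = l"
      using exists_permutation_of_fibers[of a "\<lambda>l. l"] by metis
    have "table_of (\<lambda>l. l) (b \<circ> \<pi>) i j = table_of a b i j" for i j
      unfolding table_of_def
    proof (rule bij_betw_same_card[of \<pi>])
      have \<pi>n: "\<pi> l < n \<longleftrightarrow> l < n" for l using permutes_in_image[OF \<pi>(1)] by auto
      have surj: "\<exists>k. l = \<pi> k" for l using permutes_surj[OF \<pi>(1)] by (metis surjD)
      show "bij_betw \<pi> {l. l < n \<and> l = i \<and> (b \<circ> \<pi>) l = j} {l. l < n \<and> a l = i \<and> b l = j}"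
        unfolding bij_betw_def
      proof
        show "inj_on \<pi> {l. l < n \<and> l = i \<and> (b \<circ> \<pi>) l = j}" using permutes_inj[OF \<pi>(1)] by (auto simp: inj_on_def inj_def)
        show "\<pi> ` {l. l < n \<and> l = i \<and> (b \<circ> \<pi>) l = j} = {l. l < n \<and> a l = i \<and> b l = j}"
        proof (intro equalityI subsetI)
          fix l assume l: "l \<in> {l. l < n \<and> a l = i \<and> b l = j}"
          obtain k where "l = \<pi> k" using surj by blast
          then show "l \<in> \<pi> ` {l. l < n \<and> l = i \<and> (b \<circ> \<pi>) l = j}" using l \<pi>n \<pi>(2)[of k] by auto
        qed (use \<pi>n \<pi>(2) in auto)
      qed
    qed
    from sl[OF this] show ?thesis by blast
  qed
  have borel: "x \<in> SL_borel n F \<longleftrightarrow> act_flag x ?E = ?E" if x: "x \<in> carrier ?G" for x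
  proof
    have xm: "x \<in> mats F n n" by (rule SL_mats[OF x])
    let ?e = "\<lambda>j. vec n (\<lambda>l. if l = j then \<one> else \<zero>)"
    {
      assume "act_flag x ?E = ?E"
      then have img: "mat_vec F x ` coord F n {l. l < i} = coord F n {l. l < i}" for i
        by (auto simp: act_flag_def coord_flag_def fun_eq_iff)
      have "x $$ (i, j) = \<zero>" if ij: "i < n" "j < i" for i j
      proof -
        have "?e j \<in> coord F n {l. l < Suc j}" by (auto simp: coord_def vec_module_simps)
        then have "mat_vec F x (?e j) \<in> coord F n {l. l < Suc j}" using img[of "Suc j"] by blast
        then have "col x j \<in> coord F n {l. l < Suc j}" using mat_vec_unit[OF xm, of j] ij by simp
        then have "col x j $ i = \<zero>" using ij by (simp add: coord_def)
        then show ?thesis using ij mats_carrier_mat[OF xm] by simp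
      qed
      then show "x \<in> SL_borel n F" using x by (simp add: SL_borel_def)
    }
    {
      assume "x \<in> SL_borel n F"
      then have ut: "x $$ (i, j) = \<zero>" if "i < n" "j < i" for i j using that by (simp add: SL_borel_def)
      have sub: "mat_vec F x ` coord F n {l. l < i} \<subseteq> coord F n {l. l < i}" for i
      proof clarify
        fix v assume v: "v \<in> coord F n {l. l < i}"
        have vc: "v \<in> carrier VM" using v coord_subset by blast
        have "mat_vec F x v $ k = \<zero>" if k: "k < n" "\<not> k < i" for k
        proof -
          have "(\<Oplus>l\<in>{0..<n}. x $$ (k, l) \<otimes> v $ l) = (\<Oplus>l\<in>{0..<n}. \<zero>)"
          proof (rule finsum_cong')
            fix l assume l: "l \<in> {0..<n}"
            show "x $$ (k, l) \<otimes> v $ l = \<zero>"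
              using l k ut[of k l] v vc mats_index[OF xm, of k l] by (cases "l < k") (auto simp: coord_def vec_module_simps)
          qed auto
          then show ?thesis using k vec_module_dim[OF vc] by (simp add: mat_vec_index[OF xm])
        qed
        then show "mat_vec F x v \<in> coord F n {l. l < i}"
          using mat_vec_closed[OF xm vc] by (simp add: coord_def)
      qed
      have "mat_vec F x ` coord F n {l. l < i} = coord F n {l. l < i}" for i
        using SL_inj_on[OF x coord_subset] by (intro card_subset_eq finite_coord sub) (auto simp: card_image)
      then show "act_flag x ?E = ?E" by (auto simp: act_flag_def coord_flag_def)
    }
  qed
  have borel_eq: "SL_borel n F = stab ?G act_flag ?E"
    using borel by (auto simp: stab_def SL_borel_def)
  have stab_card: "card (stab ?G act_flag ?E) > 0"
    using subgroup.one_closed[OF stab_subgroup[OF SL_group act E]] finite_SL by (auto simp: card_gt_0_iff stab_def)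
  have fixes_iff: "inv\<^bsub>?G\<^esub> x \<otimes>\<^bsub>?G\<^esub> g \<otimes>\<^bsub>?G\<^esub> x \<in> SL_borel n F \<longleftrightarrow> act_flag g (act_flag x ?E) = act_flag x ?E"
    if x: "x \<in> carrier ?G" for x
  proof -
    have ax: "act_flag x ?E \<in> ?A" "act_flag g (act_flag x ?E) \<in> ?A" using act x g E by (auto simp: acts_on_def)
    have comp: "act_flag (h \<otimes>\<^bsub>?G\<^esub> k) W = act_flag h (act_flag k W)" if "h \<in> carrier ?G" "k \<in> carrier ?G" "W \<in> ?A" for h k W
      using act that unfolding acts_on_def by blast
    have "act_flag (inv\<^bsub>?G\<^esub> x \<otimes>\<^bsub>?G\<^esub> g \<otimes>\<^bsub>?G\<^esub> x) ?E = act_flag (inv\<^bsub>?G\<^esub> x) (act_flag g (act_flag x ?E))"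
      using x g E ax by (simp add: comp)
    moreover have "act_flag (inv\<^bsub>?G\<^esub> x) (act_flag g (act_flag x ?E)) = ?E \<longleftrightarrow> act_flag g (act_flag x ?E) = act_flag x ?E"
      using act_inv_act[OF SL_group act x E] act_act_inv[OF SL_group act x ax(2)] by metis
    ultimately show ?thesis unfolding borel_eq using x g by (simp add: stab_def)
  qed
  have "induced_function ?G (SL_borel n F) (\<lambda>_. 1) g =
      of_nat (card {x \<in> carrier ?G. act_flag g (act_flag x ?E) = act_flag x ?E}) / of_nat (card (SL_borel n F))"
    unfolding induced_function_def using fixes_iff by (auto intro!: arg_cong[of _ _ card] Collect_cong)
  also have "card {x \<in> carrier ?G. act_flag g (act_flag x ?E) = act_flag x ?E} =
      (\<Sum>W\<in>{W \<in> ?A. act_flag g W = W}. card {x \<in> carrier ?G. act_flag x ?E = W})"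
  proof -
    have "{x \<in> carrier ?G. act_flag g (act_flag x ?E) = act_flag x ?E} =
      (\<Union>W\<in>{W \<in> ?A. act_flag g W = W}. {x \<in> carrier ?G. act_flag x ?E = W})"
      using act E by (auto simp: acts_on_def)
    then show ?thesis
      by (simp only:) (rule card_UN_disjoint, use fin finite_SL in auto)
  qed
  also have "\<dots> = (\<Sum>W\<in>{W \<in> ?A. act_flag g W = W}. card (stab ?G act_flag ?E))"
  proof (intro sum.cong refl)
    fix W assume "W \<in> {W \<in> ?A. act_flag g W = W}"
    then obtain h where h: "h \<in> carrier ?G" "act_flag h ?E = W" using trans by blast
    have "card {x \<in> carrier ?G. act_flag x ?E = W} = card {x \<in> carrier ?G. act_flag x ?E = ?E}"
    proof (rule bij_betw_same_card[of "\<lambda>x. inv\<^bsub>?G\<^esub> h \<otimes>\<^bsub>?G\<^esub> x"], rule bij_betwI[where g = "\<lambda>x. h \<otimes>\<^bsub>?G\<^esub> x"])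
      have comp: "act_flag (k \<otimes>\<^bsub>?G\<^esub> l) ?E = act_flag k (act_flag l ?E)" if "k \<in> carrier ?G" "l \<in> carrier ?G" for k l
        using act that E unfolding acts_on_def by blast
      show "(\<lambda>x. inv\<^bsub>?G\<^esub> h \<otimes>\<^bsub>?G\<^esub> x) \<in> {x \<in> carrier ?G. act_flag x ?E = W} \<rightarrow> {x \<in> carrier ?G. act_flag x ?E = ?E}"
        using h act_inv_act[OF SL_group act h(1) E] by (auto simp: comp)
      show "(\<lambda>x. h \<otimes>\<^bsub>?G\<^esub> x) \<in> {x \<in> carrier ?G. act_flag x ?E = ?E} \<rightarrow> {x \<in> carrier ?G. act_flag x ?E = W}"
        using h by (auto simp: comp)
    qed (use h in \<open>auto simp: G.m_assoc[symmetric]\<close>)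
    then show "card {x \<in> carrier ?G. act_flag x ?E = W} = card (stab ?G act_flag ?E)" by (simp add: stab_def)
  qed
  also have "\<dots> = fixed_count ?A act_flag g * card (stab ?G act_flag ?E)" by (simp add: fixed_count_def)
  finally show ?thesis using stab_card by (simp add: borel_eq)
qed

end

section \<open>Alternants of the flag characters\<close>

text \<open>The set that \<open>fillings\<close> counts: entry \<open>j\<close> of a list is the
  row, later the step of a flag, that receives part \<open>j\<close>.\<close>

definition filling_lists :: "nat \<Rightarrow> nat list \<Rightarrow> (nat \<Rightarrow> int) \<Rightarrow> nat list set" where
  "filling_lists m ds \<mu> = {xs. length xs = length ds \<and> set xs \<subseteq> {..<m} \<and>
     (\<forall>i<m. (\<Sum>j<length ds. if xs ! j = i then int (ds ! j) else 0) = \<mu> i)}"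

lemma filling_lists_Cons:
  "filling_lists m (d # ds) \<mu> = (\<Union>x<m. (\<lambda>xs. x # xs) ` filling_lists m ds (\<mu>(x := \<mu> x - int d)))"
proof (intro equalityI subsetI)
  have split: "(\<Sum>j<length (d # ds). if (x # xs) ! j = i then int ((d # ds) ! j) else 0) =
      (if x = i then int d else 0) + (\<Sum>j<length ds. if xs ! j = i then int (ds ! j) else 0)" for x xs i
    by (simp add: sum.lessThan_Suc_shift del: sum.lessThan_Suc cong: if_cong)
  {
  fix ys assume ys: "ys \<in> filling_lists m (d # ds) \<mu>"
  then obtain x xs where x: "ys = x # xs" "x < m" by (cases ys) (auto simp: filling_lists_def)
  have "xs \<in> filling_lists m ds (\<mu>(x := \<mu> x - int d))"
  proof -
    have "(\<Sum>j<length ds. if xs ! j = i then int (ds ! j) else 0) = (\<mu>(x := \<mu> x - int d)) i" if "i < m" for i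
    proof -
      have "(\<Sum>j<length (d # ds). if ys ! j = i then int ((d # ds) ! j) else 0) = \<mu> i"
        using ys that by (simp only: filling_lists_def mem_Collect_eq)
      then have "(if x = i then int d else 0) + (\<Sum>j<length ds. if xs ! j = i then int (ds ! j) else 0) = \<mu> i"
        unfolding x(1) split .
      then show ?thesis by (auto split: if_splits)
    qed
    then show ?thesis using ys x by (simp add: filling_lists_def)
  qed
  then show "ys \<in> (\<Union>x<m. (\<lambda>xs. x # xs) ` filling_lists m ds (\<mu>(x := \<mu> x - int d)))" using x by blast
  }
  fix ys assume "ys \<in> (\<Union>x<m. (\<lambda>xs. x # xs) ` filling_lists m ds (\<mu>(x := \<mu> x - int d)))"
  then obtain x xs where x: "x < m" "ys = x # xs" "xs \<in> filling_lists m ds (\<mu>(x := \<mu> x - int d))" by blast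
  then show "ys \<in> filling_lists m (d # ds) \<mu>"
    unfolding filling_lists_def mem_Collect_eq x(2) split by auto
qed

lemma finite_filling_lists: "finite (filling_lists m ds \<mu>)"
proof -
  have "filling_lists m ds \<mu> \<subseteq> {xs. set xs \<subseteq> {..<m} \<and> length xs = length ds}" by (auto simp: filling_lists_def)
  then show ?thesis using finite_lists_length_eq[of "{..<m}"] finite_subset by blast
qed

lemma card_filling_lists: "int (card (filling_lists m ds \<mu>)) = fillings m ds \<mu>"
proof (induction ds arbitrary: \<mu>)
  case Nil
  have "filling_lists m [] \<mu> = (if \<forall>i<m. \<mu> i = 0 then {[]} else {})" by (auto simp: filling_lists_def)
  then show ?case by simp
next
  case (Cons d ds)
  have "card (filling_lists m (d # ds) \<mu>) = (\<Sum>x<m. card ((\<lambda>xs. x # xs) ` filling_lists m ds (\<mu>(x := \<mu> x - int d))))"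
    unfolding filling_lists_Cons by (rule card_UN_disjoint) (auto intro: finite_filling_lists)
  also have "\<dots> = (\<Sum>x<m. card (filling_lists m ds (\<mu>(x := \<mu> x - int d))))"
    by (intro sum.cong refl card_image) simp
  finally have "int (card (filling_lists m (d # ds) \<mu>)) = (\<Sum>x<m. int (card (filling_lists m ds (\<mu>(x := \<mu> x - int d)))))"
    by (simp only: of_nat_sum)
  then show ?case by (simp only: Cons fillings.simps)
qed

text \<open>A row with sum 1 has a single 1, so these tables are maps from rows to columns, that is,
  fillings with unit parts. Tables are square of size \<open>n\<close> whereas \<open>\<mu>\<close>
  has \<open>k\<close> entries, hence the padding by zeros; a column with sum 0 is never
  hit.\<close>

lemma card_tables_ones:
  assumes "k \<le> n"
  shows "card (tables n (\<lambda>_. 1) (\<lambda>i. if i < k then \<mu> i else 0)) = card (filling_lists k (replicate n 1) \<mu>)"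
proof -
  let ?T = "tables n (\<lambda>_. 1) (\<lambda>i. if i < k then \<mu> i else 0)" and ?L = "filling_lists k (replicate n 1) \<mu>"
  define tab where "tab xs = (\<lambda>i j. if i < n \<and> j < n \<and> xs ! i = j then 1 else 0 :: nat)" for xs :: "nat list"
  have "bij_betw tab ?L ?T"
    unfolding bij_betw_def
  proof
    show "inj_on tab ?L"
    proof (rule inj_onI)
      fix xs ys assume xy: "xs \<in> ?L" "ys \<in> ?L" "tab xs = tab ys"
      show "xs = ys"
      proof (rule nth_equalityI)
        show "length xs = length ys" using xy by (simp add: filling_lists_def)
        fix i assume "i < length xs"
        then have i: "i < n" and "xs ! i < k" using xy nth_mem by (auto simp: filling_lists_def)
        then have "tab xs i (xs ! i) = 1" using assms by (simp add: tab_def)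
        then have "tab ys i (xs ! i) = 1" using xy by simp
        then show "xs ! i = ys ! i" by (simp add: tab_def split: if_splits)
      qed
    qed
    show "tab ` ?L = ?T"
    proof (intro equalityI subsetI)
      fix M assume "M \<in> tab ` ?L"
      then obtain xs where xs: "xs \<in> ?L" "M = tab xs" by blast
      have len: "length xs = n" and lt: "xs ! i < k" if "i < n" for i using xs that nth_mem by (auto simp: filling_lists_def)
      have "(\<Sum>j<n. int (M i j)) = 1" if i: "i < n" for i
      proof -
        have "(\<Sum>j<n. int (M i j)) = (\<Sum>j<n. if j = xs ! i then 1 else 0)"
          unfolding xs(2) tab_def using i by (intro sum.cong) auto
        then show ?thesis using lt[OF i] assms by simp
      qed
      moreover have "(\<Sum>i<n. int (M i j)) = (if j < k then \<mu> j else 0)" if j: "j < n" for j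
      proof -
        have eq: "(\<Sum>i<n. int (M i j)) = (\<Sum>i<n. if xs ! i = j then 1 else 0)"
          unfolding xs(2) tab_def using j by (intro sum.cong) auto
        show ?thesis
        proof (cases "j < k")
          case True
          have "(\<Sum>i<n. if xs ! i = j then 1 else 0 :: int) =
              (\<Sum>i<length (replicate n (1::nat)). if xs ! i = j then int (replicate n 1 ! i) else 0)"
            by (intro sum.cong) auto
          also have "\<dots> = \<mu> j" using xs(1) True by (simp only: filling_lists_def mem_Collect_eq)
          finally show ?thesis using True unfolding eq by simp
        next
          case False
          then show ?thesis unfolding eq using lt by (auto intro!: sum.neutral)
        qed
      qed
      ultimately show "M \<in> ?T" unfolding tables_def xs(2) by (auto simp: tab_def)
    next
      fix M assume M: "M \<in> ?T"
      have row: "(\<Sum>j<n. M i j) = 1" if "i < n" for i using M that by (auto simp: tables_def simp flip: of_nat_sum)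
      have "\<exists>j<n. \<forall>j'<n. M i j' = (if j' = j then 1 else 0)" if i: "i < n" for i
      proof -
        obtain j where j: "j < n" "M i j \<noteq> 0" using row[OF i] by (metis lessThan_iff sum.neutral zero_neq_one)
        have s: "(\<Sum>j<n. M i j) = M i j + (\<Sum>j'\<in>{..<n} - {j}. M i j')" using j by (simp add: sum.remove)
        then have "M i j = 1" "(\<Sum>j'\<in>{..<n} - {j}. M i j') = 0" using row[OF i] j(2) by linarith+
        then show ?thesis using j(1) by auto
      qed
      then obtain c where c: "\<And>i. i < n \<Longrightarrow> c i < n" "\<And>i j. i < n \<Longrightarrow> j < n \<Longrightarrow> M i j = (if j = c i then 1 else 0)" by metis
      have ck: "c i < k" if i: "i < n" for i
      proof (rule ccontr)
        assume "\<not> c i < k"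
        then have "(\<Sum>i'<n. int (M i' (c i))) = 0" using M c(1)[OF i] by (auto simp: tables_def)
        then have "\<forall>i'\<in>{..<n}. int (M i' (c i)) = 0" by (subst (asm) sum_nonneg_eq_0_iff) auto
        then show False using c(2)[OF i c(1)[OF i]] i by simp
      qed
      have tab: "tab (map c [0..<n]) = M"
      proof (intro ext)
        fix i j show "tab (map c [0..<n]) i j = M i j"
        proof (cases "i < n \<and> j < n")
          case True
          then show ?thesis using c(2) by (auto simp: tab_def)
        next
          case False
          then show ?thesis using M by (auto simp: tab_def tables_def)
        qed
      qed
      have "map c [0..<n] \<in> ?L"
        unfolding filling_lists_def
      proof (intro CollectI conjI allI impI)
        fix j assume j: "j < k"
        then have jn: "j < n" using assms by simp
        have "(\<Sum>i<length (replicate n (1::nat)). if map c [0..<n] ! i = j then int (replicate n 1 ! i) else 0) = (\<Sum>i<n. int (M i j))"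
          using c(2) jn by (intro sum.cong) auto
        also have "\<dots> = \<mu> j" using M j jn by (auto simp: tables_def)
        finally show "(\<Sum>i<length (replicate n (1::nat)). if map c [0..<n] ! i = j then int (replicate n 1 ! i) else 0) = \<mu> j" .
      qed (use ck in auto)
      then show "M \<in> tab ` ?L" using tab by blast
    qed
  qed
  then show ?thesis by (metis bij_betw_same_card)
qed

lemma class_inner_alternate_left:
  "class_inner G (\<lambda>g. alternate m (\<lambda>\<mu>. f \<mu> g) \<beta>) \<chi> = alternate m (\<lambda>\<mu>. class_inner G (f \<mu>) \<chi>) \<beta>"
  unfolding class_inner_def alternate_def sum_distrib_right
  by (subst sum.swap) (simp add: sum_divide_distrib sum_distrib_left mult.assoc)

lemma class_inner_alternate_right:
  "class_inner G \<chi> (\<lambda>g. alternate m (\<lambda>\<mu>. f \<mu> g) \<beta>) = alternate m (\<lambda>\<mu>. class_inner G \<chi> (f \<mu>)) \<beta>"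
  unfolding class_inner_def alternate_def cnj_sum sum_distrib_left
  by (subst sum.swap) (simp add: sum_divide_distrib sum_distrib_left mult_ac)

lemma sum_minus_permutation:
  assumes "\<sigma> permutes {..<m}"
  shows "(\<Sum>i<m. \<beta> i - int (\<sigma> i)) = (\<Sum>i<m. \<beta> i) - (\<Sum>i<m. int i)"
  using sum.reindex_bij_betw[OF permutes_imp_bij[OF assms], of int] by (simp add: sum_subtractf)

context finite_field_dim
begin

text \<open>The value 0 off the compositions of \<open>n\<close> corresponds to the convention that
  complete symmetric functions of negative degree vanish. The terms of an alternant run through such
  arguments.\<close>

definition perm_char :: "nat \<Rightarrow> (nat \<Rightarrow> int) \<Rightarrow> 'a mat \<Rightarrow> complex" where
  "perm_char m \<mu> g = (if (\<forall>i<m. 0 \<le> \<mu> i) \<and> (\<Sum>i<m. \<mu> i) = int n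
     then of_nat (fixed_count (V.flags m (\<lambda>i. nat (\<mu> i))) act_flag g) else 0)"

definition alt_char :: "nat \<Rightarrow> (nat \<Rightarrow> int) \<Rightarrow> 'a mat \<Rightarrow> complex" where
  "alt_char m \<beta> g = alternate m (\<lambda>\<mu>. perm_char m \<mu> g) \<beta>"

lemma flags_cong:
  assumes "\<And>i. i < m \<Longrightarrow> \<mu> i = \<nu> i"
  shows "V.flags m \<mu> = V.flags m \<nu>"
proof -
  have "(\<Sum>l<min i m. \<mu> l) = (\<Sum>l<min i m. \<nu> l)" for i using assms by (intro sum.cong) auto
  then show ?thesis by (simp add: V.flags_def)
qed

lemma perm_char_cong: "(\<And>i. i < m \<Longrightarrow> \<mu> i = \<nu> i) \<Longrightarrow> perm_char m \<mu> g = perm_char m \<nu> g"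
proof -
  assume eq: "\<And>i. i < m \<Longrightarrow> \<mu> i = \<nu> i"
  have "V.flags m (\<lambda>i. nat (\<mu> i)) = V.flags m (\<lambda>i. nat (\<nu> i))" by (rule flags_cong) (simp add: eq)
  moreover have "(\<Sum>i<m. \<mu> i) = (\<Sum>i<m. \<nu> i)" "(\<forall>i<m. 0 \<le> \<mu> i) \<longleftrightarrow> (\<forall>i<m. 0 \<le> \<nu> i)" by (simp_all add: eq)
  ultimately show ?thesis by (simp only: perm_char_def)
qed

text \<open>A step of size 0 repeats a subspace. The padding brings characters with \<open>k\<close>
  and with \<open>n\<close> steps into one inner product.\<close>

lemma perm_char_extend:
  assumes "k \<le> m"
  shows "perm_char k \<mu> g = perm_char m (\<lambda>i. if i < k then \<mu> i else 0) g"
proof -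
  let ?\<nu> = "\<lambda>i. if i < k then \<mu> i else 0"
  have s: "(\<Sum>l<i. ?\<nu> l) = (\<Sum>l<min i k. \<mu> l)" for i
    by (rule sum.mono_neutral_cong_right) auto
  have s': "(\<Sum>l<min i m. nat (?\<nu> l)) = (\<Sum>l<min i k. nat (\<mu> l))" for i
    using assms by (intro sum.mono_neutral_cong_right) auto
  have "V.flags m (\<lambda>i. nat (?\<nu> i)) = V.flags k (\<lambda>i. nat (\<mu> i))"
    unfolding V.flags_def s' ..
  moreover have "(\<forall>i<m. 0 \<le> ?\<nu> i) \<longleftrightarrow> (\<forall>i<k. 0 \<le> \<mu> i)" using assms by auto
  moreover have "(\<Sum>i<m. ?\<nu> i) = (\<Sum>i<k. \<mu> i)" using s[of m] assms by (simp add: min_absorb2)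
  ultimately show ?thesis by (simp only: perm_char_def)
qed

lemma tables_empty:
  assumes "i < m" "\<mu> i < 0 \<or> \<nu> i < 0"
  shows "tables m \<mu> \<nu> = {}"
proof (rule equals0I)
  fix M assume M: "M \<in> tables m \<mu> \<nu>"
  then have "(\<Sum>j<m. int (M i j)) = \<mu> i" "(\<Sum>j<m. int (M j i)) = \<nu> i" using assms(1) by (auto simp: tables_def)
  moreover have "0 \<le> (\<Sum>j<m. int (M i j))" "0 \<le> (\<Sum>j<m. int (M j i))" by (auto intro: sum_nonneg)
  ultimately show False using assms(2) by linarith
qed

lemma tables_cong: "(\<And>i. i < m \<Longrightarrow> \<mu> i = \<mu>' i) \<Longrightarrow> (\<And>i. i < m \<Longrightarrow> \<nu> i = \<nu>' i) \<Longrightarrow> tables m \<mu> \<nu> = tables m \<mu>' \<nu>'"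
  by (auto simp: tables_def)

lemma order_pos: "card (carrier (SL n F)) > 0"
proof -
  interpret G: group "SL n F" by (rule SL_group)
  show ?thesis using finite_SL G.one_closed by (auto simp: card_gt_0_iff)
qed

lemma perm_char_inner:
  assumes "(\<Sum>i<m. \<mu> i) = int n" "(\<Sum>i<m. \<nu> i) = int n"
  shows "class_inner (SL n F) (perm_char m \<mu>) (perm_char m \<nu>) = of_nat (card (tables m \<mu> \<nu>))"
proof (cases "\<forall>i<m. 0 \<le> \<mu> i \<and> 0 \<le> \<nu> i")
  case False
  then have "perm_char m \<mu> = (\<lambda>_. 0) \<or> perm_char m \<nu> = (\<lambda>_. 0)" by (auto simp: perm_char_def fun_eq_iff)
  moreover have "tables m \<mu> \<nu> = {}" using False tables_empty[of _ m \<mu> \<nu>] by (auto simp: not_le)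
  ultimately show ?thesis by (auto simp: class_inner_def)
next
  case True
  have sums: "(\<Sum>i<m. nat (\<mu> i)) = n" "(\<Sum>i<m. nat (\<nu> i)) = n"
  proof -
    have "int (\<Sum>i<m. nat (\<mu> i)) = int n" "int (\<Sum>i<m. nat (\<nu> i)) = int n" using True assms by auto
    then show "(\<Sum>i<m. nat (\<mu> i)) = n" "(\<Sum>i<m. nat (\<nu> i)) = n" by linarith+
  qed
  have tab: "tables m (\<lambda>i. int (nat (\<mu> i))) (\<lambda>i. int (nat (\<nu> i))) = tables m \<mu> \<nu>"
    using True by (intro tables_cong) auto
  have "(\<Sum>g\<in>carrier (SL n F). perm_char m \<mu> g * cnj (perm_char m \<nu> g)) =
      of_nat (card (carrier (SL n F))) * of_nat (card (tables m \<mu> \<nu>))"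
    using flag_pair_inner[OF sums] True assms unfolding tab by (simp add: perm_char_def)
  then show ?thesis using order_pos by (simp add: class_inner_def Coset.order_def)
qed

lemma alt_char_eq_0:
  assumes "(\<exists>i<m. \<beta> i < 0) \<or> (\<Sum>i<m. \<beta> i) \<noteq> int n + (\<Sum>i<m. int i)"
  shows "alt_char m \<beta> g = 0"
proof -
  have "perm_char m (\<lambda>i. \<beta> i - int (\<sigma> i)) g = 0" if "\<sigma> permutes {..<m}" for \<sigma>
  proof (cases "\<exists>i<m. \<beta> i < 0")
    case True
    then obtain i where "i < m" "\<beta> i < 0" by blast
    then have "i < m \<and> \<not> 0 \<le> \<beta> i - int (\<sigma> i)" by simp
    then show ?thesis unfolding perm_char_def by meson
  next
    case False
    then have "(\<Sum>i<m. \<beta> i - int (\<sigma> i)) \<noteq> int n" using assms sum_minus_permutation[OF that, of \<beta>] by auto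
    then show ?thesis unfolding perm_char_def by meson
  qed
  then show ?thesis by (simp add: alt_char_def alternate_def)
qed

text \<open>Inner products of flag characters are numbers of tables, so the norm is the double
  alternation of these numbers. If an entry of \<open>\<beta>\<close> is negative or the sum is
  wrong, every term of the alternant is zero.\<close>

lemma alt_char_inner_self:
  "class_inner (SL n F) (alt_char m \<beta>) (alt_char m \<beta>) =
    (if (\<forall>i<m. 0 \<le> \<beta> i) \<and> (\<Sum>i<m. \<beta> i) = int n + (\<Sum>i<m. int i) \<and> inj_on \<beta> {..<m} then 1 else 0)"
proof (cases "(\<exists>i<m. \<beta> i < 0) \<or> (\<Sum>i<m. \<beta> i) \<noteq> int n + (\<Sum>i<m. int i)")
  case True
  then have "alt_char m \<beta> = (\<lambda>_. 0)" using alt_char_eq_0 by blast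
  moreover have "\<not> ((\<forall>i<m. 0 \<le> \<beta> i) \<and> (\<Sum>i<m. \<beta> i) = int n + (\<Sum>i<m. int i) \<and> inj_on \<beta> {..<m})"
    using True not_le by blast
  ultimately show ?thesis by (simp add: class_inner_def)
next
  case False
  have "class_inner (SL n F) (alt_char m \<beta>) (alt_char m \<beta>) =
      alternate m (\<lambda>\<mu>. alternate m (\<lambda>\<nu>. class_inner (SL n F) (perm_char m \<mu>) (perm_char m \<nu>)) \<beta>) \<beta>"
    unfolding alt_char_def class_inner_alternate_left class_inner_alternate_right ..
  also have "\<dots> = alternate m (\<lambda>\<mu>. alternate m (\<lambda>\<nu>. of_int (int (card (tables m \<mu> \<nu>)))) \<beta>) \<beta>"
    unfolding alternate_def using False
    by (intro sum.cong refl arg_cong2[where f = "(*)"]) (simp add: perm_char_inner sum_minus_permutation)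
  also have "\<dots> = of_int (alternate m (\<lambda>\<mu>. alternate m (\<lambda>\<nu>. int (card (tables m \<mu> \<nu>))) \<beta>) \<beta>)"
    by (simp add: alternate_def)
  also have "\<dots> = of_int (if inj_on \<beta> {..<m} then 1 else 0)"
  proof -
    have "0 \<le> \<beta> i" if "i < m" for i using False that by force
    from alternate_tables[of m \<beta>, OF this] show ?thesis by simp
  qed
  finally show ?thesis using False by (simp add: not_less)
qed

lemma perm_char_inner_irreducible:
  assumes "irreducible_character (SL n F) \<chi>"
  shows "class_inner (SL n F) (perm_char m \<mu>) \<chi> \<in> \<int>"
proof (cases "(\<forall>i<m. 0 \<le> \<mu> i) \<and> (\<Sum>i<m. \<mu> i) = int n")
  case True
  have "int (\<Sum>i<m. nat (\<mu> i)) = int n" using True by simp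
  then have fin: "finite (V.flags m (\<lambda>i. nat (\<mu> i)))" by (intro finite_flags) linarith
  have "perm_char m \<mu> = (\<lambda>g. of_nat (fixed_count (V.flags m (\<lambda>i. nat (\<mu> i))) act_flag g))"
    using True by (simp add: perm_char_def fun_eq_iff)
  then show ?thesis
    using irreducible_character_fixed_count_inner[OF assms SL_group finite_SL acts_on_flags fin] by simp
next
  case False
  then have "perm_char m \<mu> g = 0" for g unfolding perm_char_def by meson
  then show ?thesis by (simp add: class_inner_def)
qed

lemma class_inner_cong:
  "(\<And>g. g \<in> carrier G \<Longrightarrow> \<phi> g = \<phi>' g) \<Longrightarrow> class_inner G \<phi> \<chi> = class_inner G \<phi>' \<chi>"
  by (simp add: class_inner_def cong: sum.cong)

lemma induced_eq_perm_char:
  assumes "g \<in> carrier (SL n F)"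
  shows "induced_function (SL n F) (SL_borel n F) (\<lambda>_. 1) g = perm_char n (\<lambda>_. 1) g"
  using induced_function_eq_fixed_count[OF assms] by (simp add: perm_char_def)

text \<open>
  The permutations other than the identity raise \<open>\<Sum>i. i * \<mu> i\<close>, so at an extremal \<open>\<mu>\<close> with nonzero
  inner product only one term of the alternant survives.
\<close>

lemma exists_alt_char_inner:
  assumes ne: "class_inner (SL n F) (perm_char m \<mu>0) \<chi> \<noteq> 0"
  obtains \<beta> where "class_inner (SL n F) (alt_char m \<beta>) \<chi> \<noteq> 0"
proof -
  define a where "a \<mu> = class_inner (SL n F) (perm_char m \<mu>) \<chi>" for \<mu>
  define S where "S = {\<mu> \<in> exps m (int n). a \<mu> \<noteq> 0}"
  define L where "L \<mu> = (\<Sum>i<m. int i * \<mu> i)" for \<mu> :: "nat \<Rightarrow> int"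
  \<comment> \<open>A nonzero inner product forces \<open>\<mu>\<close> to be a composition of
    \<open>n\<close>, since \<open>perm_char\<close> is zero otherwise. So there are only finitely
    many candidates and a maximum exists.\<close>
  have in_S: "\<mu> \<in> S" if "a \<mu> \<noteq> 0" "\<forall>i\<ge>m. \<mu> i = 0" for \<mu>
  proof -
    have "perm_char m \<mu> \<noteq> (\<lambda>_. 0)" using that(1) by (auto simp: a_def class_inner_def)
    then have "(\<forall>i<m. 0 \<le> \<mu> i) \<and> (\<Sum>i<m. \<mu> i) = int n" by (auto simp: perm_char_def fun_eq_iff split: if_splits)
    then show ?thesis using that by (simp add: S_def exps_def)
  qed
  have finS: "finite S" unfolding S_def using finite_exps by simp
  have "(\<lambda>i. if i < m then \<mu>0 i else 0) \<in> S"
  proof (rule in_S)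
    have "perm_char m (\<lambda>i. if i < m then \<mu>0 i else 0) = perm_char m \<mu>0"
      by (rule ext, rule perm_char_cong) simp
    then show "a (\<lambda>i. if i < m then \<mu>0 i else 0) \<noteq> 0" using ne by (simp add: a_def)
  qed simp
  then have neS: "S \<noteq> {}" by blast
  define \<mu> where "\<mu> = arg_max_on L S"
  have \<mu>: "\<mu> \<in> S" "\<And>\<nu>. \<nu> \<in> S \<Longrightarrow> L \<nu> \<le> L \<mu>"
  proof -
    have fne: "finite (L ` S)" "L ` S \<noteq> {}" using finS neS by auto
    obtain \<mu>' where "\<mu>' \<in> S" "L \<mu>' = Max (L ` S)" using Max_in[OF fne] by auto
    then have "\<exists>\<mu>. is_arg_max L (\<lambda>x. x \<in> S) \<mu>" using Max_ge[OF fne(1)] by (auto simp: is_arg_max_linorder intro!: exI[of _ \<mu>'])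
    then have "is_arg_max L (\<lambda>x. x \<in> S) \<mu>" unfolding \<mu>_def arg_max_on_def arg_max_def by (rule someI_ex)
    then show "\<mu> \<in> S" "\<And>\<nu>. \<nu> \<in> S \<Longrightarrow> L \<nu> \<le> L \<mu>" by (auto simp: is_arg_max_linorder)
  qed
  have \<mu>0: "\<mu> i = 0" if "i \<ge> m" for i using \<mu>(1) that by (simp add: S_def exps_def)
  \<comment> \<open>With this shift the term of the identity is the inner product at
    \<open>\<mu>\<close> itself.\<close>
  define \<beta> where "\<beta> i = \<mu> i + int i" for i
  have zero: "a (\<lambda>i. \<beta> i - int (\<sigma> i)) = 0" if \<sigma>: "\<sigma> permutes {..<m}" "\<sigma> \<noteq> id" for \<sigma>
  proof (rule ccontr)
    assume "a (\<lambda>i. \<beta> i - int (\<sigma> i)) \<noteq> 0"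
    moreover have "\<forall>i\<ge>m. \<beta> i - int (\<sigma> i) = 0" using \<sigma>(1) \<mu>0 by (auto simp: \<beta>_def permutes_def)
    ultimately have "(\<lambda>i. \<beta> i - int (\<sigma> i)) \<in> S" by (rule in_S)
    then have "L (\<lambda>i. \<beta> i - int (\<sigma> i)) \<le> L \<mu>" by (rule \<mu>(2))
    moreover have "L (\<lambda>i. \<beta> i - int (\<sigma> i)) = L \<mu> + ((\<Sum>i<m. int i * int i) - (\<Sum>i<m. int i * int (\<sigma> i)))"
      by (simp add: L_def \<beta>_def algebra_simps sum.distrib sum_subtractf)
    ultimately show False using sum_mult_permutation_less[OF \<sigma>] by linarith
  qed
  have "class_inner (SL n F) (alt_char m \<beta>) \<chi> = alternate m a \<beta>"
    unfolding alt_char_def class_inner_alternate_left a_def ..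
  also have "\<dots> = (\<Sum>\<sigma>\<in>{id}. of_int (sign \<sigma>) * a (\<lambda>i. \<beta> i - int (\<sigma> i)))"
    unfolding alternate_def using zero by (intro sum.mono_neutral_right) (auto simp: finite_permutations permutes_id)
  also have "\<dots> = a \<mu>" by (simp add: \<beta>_def)
  also have "\<dots> \<noteq> 0" using \<mu>(1) by (simp add: S_def)
  finally show ?thesis using that by blast
qed

lemma alt_char_inner_irreducible:
  assumes "irreducible_character (SL n F) \<chi>"
  shows "class_inner (SL n F) (alt_char m \<beta>) \<chi> \<in> \<int>"
  unfolding alt_char_def class_inner_alternate_left unfolding alternate_def
  using perm_char_inner_irreducible[OF assms] by (intro Ints_sum Ints_mult) auto

text \<open>The comparison is asked only for tuples of sum \<open>n\<close>; for the others both
  sides vanish.\<close>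

lemma alt_char_eq_alternate_fillings:
  assumes "\<And>\<mu>. (\<Sum>i<m. \<mu> i) = int n \<Longrightarrow> perm_char m \<mu> g = of_int (fillings m ds \<mu>)" "sum_list ds = n"
  shows "alt_char m \<beta> g = of_int (alternate m (fillings m ds) \<beta>)"
proof -
  have "perm_char m \<mu> g = of_int (fillings m ds \<mu>)" for \<mu>
  proof (cases "(\<Sum>i<m. \<mu> i) = int n")
    case False
    then show ?thesis using fillings_eq_0_if_sum_neq[of \<mu> m ds] assms(2) by (simp add: perm_char_def)
  qed (use assms in auto)
  then show ?thesis by (simp add: alt_char_def alternate_def)
qed

text \<open>An alternant with nonzero inner product has the same absolute values as
  \<open>\<chi>\<close> and has norm 1. The norm in turn supplies what the bound on beads requires:
  nonnegative entries with the right sum.\<close>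

theorem unipotent_character_bound:
  assumes \<chi>: "unipotent_character n F \<chi>" and g: "g \<in> carrier (SL n F)"
    and fix_count: "\<And>\<mu>. (\<Sum>i<n. \<mu> i) = int n \<Longrightarrow> perm_char n \<mu> g = of_int (fillings n ds \<mu>)"
    and ds: "sum_list ds = n" "sorted_wrt (\<ge>) ds" "0 \<notin> set ds"
  shows "cmod (\<chi> g) \<le> fact (length ds)"
proof -
  have irr: "irreducible_character (SL n F) \<chi>" and "class_inner (SL n F) (perm_char n (\<lambda>_. 1)) \<chi> \<noteq> 0"
    using \<chi> class_inner_cong[of "SL n F" _ "perm_char n (\<lambda>_. 1)" \<chi>, OF induced_eq_perm_char]
    by (auto simp: unipotent_character_def irreducible_constituent_def)
  then obtain \<beta> where \<beta>: "class_inner (SL n F) (alt_char n \<beta>) \<chi> \<noteq> 0"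
    using exists_alt_char_inner by blast
  have self: "class_inner (SL n F) (alt_char n \<beta>) (alt_char n \<beta>) \<in> {0, 1}"
    unfolding alt_char_inner_self by auto
  note eq = cmod_eq_if_integral_inner[OF SL_group finite_SL irr self alt_char_inner_irreducible[OF irr] \<beta> g]
  have "\<forall>i<n. 0 \<le> \<beta> i" "(\<Sum>i<n. \<beta> i) = int n + (\<Sum>i<n. int i)"
    using eq(2) unfolding alt_char_inner_self by (auto split: if_splits)
  then have "\<bar>alternate n (fillings n ds) \<beta>\<bar> \<le> fact (length ds)"
    using ds by (intro alternate_fillings_le_fact) auto
  then have "real_of_int \<bar>alternate n (fillings n ds) \<beta>\<bar> \<le> real_of_int (fact (length ds))"
    by (simp only: of_int_le_iff)
  then show ?thesis
    using eq(1) alt_char_eq_alternate_fillings[where \<beta> = \<beta>, OF fix_count ds(1)] by simp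
qed

text \<open>The alternant of the rectangle has norm 1 and a positive inner product with the
  character on complete flags. Splitting the permutation representation gives an irreducible
  \<open>\<chi>\<close> with nonzero inner product with the alternant. The alternant is then a
  multiple of \<open>\<chi>\<close>, which passes on to \<open>\<chi>\<close> both the absolute
  value at \<open>g\<close> and the nonzero inner product with the character on complete
  flags.\<close>

theorem exists_unipotent_character_rectangle:
  assumes n: "n = k * D" and k: "0 < k" "k \<le> D" and g: "g \<in> carrier (SL n F)"
    and fix_count: "\<And>\<mu>. (\<Sum>i<k. \<mu> i) = int n \<Longrightarrow> perm_char k \<mu> g = of_int (fillings k (replicate k D) \<mu>)"
  obtains \<chi> where "unipotent_character n F \<chi>" "cmod (\<chi> g) = fact k"
proof -
  let ?G = "SL n F"
  define \<beta> where "\<beta> i = int i + (if i \<in> {..<k} then int D else 0)" for i :: nat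
  have sum: "(\<Sum>i<k. \<beta> i) = int n + (\<Sum>i<k. int i)" by (simp add: \<beta>_def sum.distrib n)
  have mono: "strict_mono_on {..<k} \<beta>" by (rule strict_mono_onI) (simp add: \<beta>_def)
  have pos: "0 \<le> \<beta> i" for i by (simp add: \<beta>_def)
  have self: "class_inner ?G (alt_char k \<beta>) (alt_char k \<beta>) = 1"
    using sum pos strict_mono_on_imp_inj_on[OF mono] by (simp add: alt_char_inner_self)
  have kn: "k \<le> n" using n k by simp
  have "class_inner ?G (perm_char n (\<lambda>_. 1)) (perm_char k \<mu>) = of_int (fillings k (replicate n 1) \<mu>)" if s: "(\<Sum>i<k. \<mu> i) = int n" for \<mu>
  proof -
    let ?\<nu> = "\<lambda>i. if i < k then \<mu> i else 0"
    have "(\<Sum>i<n. ?\<nu> i) = (\<Sum>i<k. \<mu> i)" using kn by (intro sum.mono_neutral_cong_right) auto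
    then have sn: "(\<Sum>i<n. ?\<nu> i) = int n" using s by simp
    have "perm_char k \<mu> = perm_char n ?\<nu>" using perm_char_extend[OF kn, of \<mu>] by (simp add: fun_eq_iff)
    then have "class_inner ?G (perm_char n (\<lambda>_. 1)) (perm_char k \<mu>) = of_nat (card (tables n (\<lambda>_. 1) ?\<nu>))"
      using perm_char_inner[where m = n and \<mu> = "\<lambda>_. 1" and \<nu> = ?\<nu>] sn by simp
    also have "\<dots> = of_int (int (card (filling_lists k (replicate n 1) \<mu>)))"
      unfolding card_tables_ones[OF kn] by simp
    finally show ?thesis unfolding card_filling_lists .
  qed
  then have "class_inner ?G (perm_char n (\<lambda>_. 1)) (alt_char k \<beta>) = of_int (alternate k (fillings k (replicate n 1)) \<beta>)"
    unfolding alt_char_def class_inner_alternate_right unfolding alternate_def using sum by (simp add: sum_minus_permutation)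
  moreover have "0 < alternate k (fillings k (replicate n 1)) \<beta>"
    by (rule alternate_fillings_ones_pos[OF mono pos sum])
  ultimately have ne: "class_inner ?G (perm_char n (\<lambda>_. 1)) (alt_char k \<beta>) \<noteq> 0" by simp
  have sum1: "(\<Sum>l<n. 1::nat) = n" by simp
  obtain d \<rho> where rep: "representation ?G d \<rho>"
    and \<rho>: "\<And>g. g \<in> carrier ?G \<Longrightarrow> character_of d \<rho> g = of_nat (fixed_count (V.flags n (\<lambda>_. 1)) act_flag g)"
    using permutation_representation[OF SL_group acts_on_flags finite_flags[OF sum1]] by blast
  have \<rho>': "character_of d \<rho> g = perm_char n (\<lambda>_. 1) g" if "g \<in> carrier ?G" for g
    using \<rho>[OF that] by (simp add: perm_char_def)
  have "(\<Sum>g\<in>carrier ?G. character_of d \<rho> g * cnj (alt_char k \<beta> g)) \<noteq> 0"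
    using ne \<rho>' by (auto simp: class_inner_def cong: sum.cong)
  then obtain \<chi> where irr: "irreducible_character ?G \<chi>" and ne': "(\<Sum>g\<in>carrier ?G. \<chi> g * cnj (alt_char k \<beta> g)) \<noteq> 0"
    using exists_irreducible_constituent[OF SL_group rep, where f = "\<lambda>g. cnj (alt_char k \<beta> g)"] by blast
  have "(\<Sum>g\<in>carrier ?G. alt_char k \<beta> g * cnj (\<chi> g)) = cnj (\<Sum>g\<in>carrier ?G. \<chi> g * cnj (alt_char k \<beta> g))"
    by (simp add: mult.commute)
  then have "(\<Sum>g\<in>carrier ?G. alt_char k \<beta> g * cnj (\<chi> g)) \<noteq> 0"
    using ne' by (simp only: complex_cnj_zero_iff not_False_eq_True)
  then have z: "class_inner ?G (alt_char k \<beta>) \<chi> \<noteq> 0" using order_pos by (simp add: class_inner_def Coset.order_def)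
  have self': "class_inner ?G (alt_char k \<beta>) (alt_char k \<beta>) \<in> {0, 1}" using self by simp
  note eq = cmod_eq_if_integral_inner(1)[OF SL_group finite_SL irr self' alt_char_inner_irreducible[OF irr] z]
  have "cmod (\<chi> g) = \<bar>real_of_int (alternate k (fillings k (replicate k D)) \<beta>)\<bar>"
    using eq[OF g] alt_char_eq_alternate_fillings[where \<beta> = \<beta>, OF fix_count] n by (simp add: sum_list_replicate)
  also have "alternate k (fillings k (replicate k D)) \<beta> = fact k"
  proof -
    have "\<beta> = (\<lambda>i. int i + (if i \<in> {..<k} then int D else 0))" by (simp add: fun_eq_iff \<beta>_def)
    then show ?thesis using alternate_fillings_rectangle[OF k(2), of "{..<k}"] by simp
  qed
  finally have val: "cmod (\<chi> g) = fact k" by simp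
  define z where "z = class_inner ?G (alt_char k \<beta>) \<chi>"
  have smult: "alt_char k \<beta> g = z * \<chi> g" if "g \<in> carrier ?G" for g
    unfolding z_def by (rule eq_smult_if_integral_inner[OF SL_group finite_SL irr self' alt_char_inner_irreducible[OF irr] \<open>class_inner ?G (alt_char k \<beta>) \<chi> \<noteq> 0\<close> that])
  have "class_inner ?G (perm_char n (\<lambda>_. 1)) (alt_char k \<beta>) = cnj z * class_inner ?G (perm_char n (\<lambda>_. 1)) \<chi>"
    unfolding class_inner_def using smult by (simp add: sum_distrib_left mult_ac)
  then have "class_inner ?G (perm_char n (\<lambda>_. 1)) \<chi> \<noteq> 0" using ne by auto
  then have "unipotent_character n F \<chi>"
    using irr class_inner_cong[of ?G _ "perm_char n (\<lambda>_. 1)" \<chi>, OF induced_eq_perm_char]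
    by (simp add: unipotent_character_def irreducible_constituent_def)
  then show ?thesis using that val by blast
qed

end

section \<open>Flags fixed by a linear operator\<close>

context field
begin

lemma poly_ring_domain: "domain (poly_ring R)"
  using univ_poly_is_domain[OF carrier_is_subring] .

lemma poly_ring_principal: "principal_domain (poly_ring R)"
  using univ_poly_is_principal[OF carrier_is_subfield] .

lemma irreducible_pdivides_mult:
  assumes f: "f \<in> carrier (poly_ring R)" "ring_irreducible\<^bsub>poly_ring R\<^esub> f"
    and ab: "a \<in> carrier (poly_ring R)" "b \<in> carrier (poly_ring R)"
    and dvd: "f pdivides (a \<otimes>\<^bsub>poly_ring R\<^esub> b)"
  shows "f pdivides a \<or> f pdivides b"
proof -
  interpret UP: principal_domain "poly_ring R" by (rule poly_ring_principal)
  have "Divisibility.prime (poly_ring R) f" using UP.primeness_condition[OF f(1)] f UP.ring_primeE(3) by blast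
  then show ?thesis using ab dvd unfolding pdivides_def by (auto elim!: Divisibility.primeE)
qed

lemma irreducible_not_pdivides_one:
  assumes f: "f \<in> carrier (poly_ring R)" "ring_irreducible\<^bsub>poly_ring R\<^esub> f"
  shows "\<not> f pdivides \<one>\<^bsub>poly_ring R\<^esub>"
proof -
  interpret UP: principal_domain "poly_ring R" by (rule poly_ring_principal)
  have "f \<notin> Units (poly_ring R)" using UP.ring_irreducibleE(4)[OF f] .
  then show ?thesis using UP.Unit_eq_dividesone[OF f(1)] by (simp add: pdivides_def)
qed

end

section \<open>Polynomials acting through a linear operator\<close>

locale linear_operator = finite_space R M for R :: "('a, 'm) ring_scheme" (structure) and M :: "('a, 'b, 'n) module_scheme" (structure) +
  fixes T :: "'b \<Rightarrow> 'b"
  assumes T_closed: "x \<in> carrier M \<Longrightarrow> T x \<in> carrier M"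
    and T_add: "x \<in> carrier M \<Longrightarrow> y \<in> carrier M \<Longrightarrow> T (x \<oplus>\<^bsub>M\<^esub> y) = T x \<oplus>\<^bsub>M\<^esub> T y"
    and T_smult: "c \<in> carrier R \<Longrightarrow> x \<in> carrier M \<Longrightarrow> T (c \<odot>\<^bsub>M\<^esub> x) = c \<odot>\<^bsub>M\<^esub> T x"
begin

text \<open>The vector \<open>p(T) v\<close>. A polynomial is a list that starts with the leading
  coefficient, so the length of the tail is the exponent of the head; leading zeros are
  harmless.\<close>

fun pact :: "'a list \<Rightarrow> 'b \<Rightarrow> 'b" where
  "pact [] v = \<zero>\<^bsub>M\<^esub>"
| "pact (c # p) v = c \<odot>\<^bsub>M\<^esub> (T ^^ length p) v \<oplus>\<^bsub>M\<^esub> pact p v"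

lemma T_pow_closed [simp]: "x \<in> carrier M \<Longrightarrow> (T ^^ k) x \<in> carrier M"
  by (induction k) (auto intro: T_closed)

lemma T_pow_add: "x \<in> carrier M \<Longrightarrow> y \<in> carrier M \<Longrightarrow> (T ^^ k) (x \<oplus>\<^bsub>M\<^esub> y) = (T ^^ k) x \<oplus>\<^bsub>M\<^esub> (T ^^ k) y"
  by (induction k) (auto simp: T_add)

lemma T_pow_smult: "c \<in> carrier R \<Longrightarrow> x \<in> carrier M \<Longrightarrow> (T ^^ k) (c \<odot>\<^bsub>M\<^esub> x) = c \<odot>\<^bsub>M\<^esub> (T ^^ k) x"
  by (induction k) (auto simp: T_smult)

lemma T_zero: "T \<zero>\<^bsub>M\<^esub> = \<zero>\<^bsub>M\<^esub>"
  using T_smult[of \<zero> "\<zero>\<^bsub>M\<^esub>"] T_closed[of "\<zero>\<^bsub>M\<^esub>"] by simp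

lemma T_pow_zero: "(T ^^ k) \<zero>\<^bsub>M\<^esub> = \<zero>\<^bsub>M\<^esub>"
  by (induction k) (auto simp: T_zero)

lemma pact_closed [simp]: "set p \<subseteq> carrier R \<Longrightarrow> v \<in> carrier M \<Longrightarrow> pact p v \<in> carrier M"
  by (induction p) auto

lemma pact_add:
  "set p \<subseteq> carrier R \<Longrightarrow> v \<in> carrier M \<Longrightarrow> w \<in> carrier M \<Longrightarrow> pact p (v \<oplus>\<^bsub>M\<^esub> w) = pact p v \<oplus>\<^bsub>M\<^esub> pact p w"
proof (induction p)
  case (Cons c p)
  then show ?case
    by (simp add: T_pow_add smult_r_distr M.add.m_assoc M.add.m_lcomm)
qed auto

lemma pact_smult:
  "set p \<subseteq> carrier R \<Longrightarrow> c \<in> carrier R \<Longrightarrow> v \<in> carrier M \<Longrightarrow> pact p (c \<odot>\<^bsub>M\<^esub> v) = c \<odot>\<^bsub>M\<^esub> pact p v"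
proof (induction p)
  case (Cons a p)
  have "a \<odot>\<^bsub>M\<^esub> (c \<odot>\<^bsub>M\<^esub> (T ^^ length p) v) = c \<odot>\<^bsub>M\<^esub> (a \<odot>\<^bsub>M\<^esub> (T ^^ length p) v)"
    using Cons.prems by (simp flip: smult_assoc1 add: R.m_comm)
  then show ?case using Cons by (simp add: T_pow_smult smult_r_distr)
qed (auto simp: smult_r_null)

lemma pact_zero: "set p \<subseteq> carrier R \<Longrightarrow> pact p \<zero>\<^bsub>M\<^esub> = \<zero>\<^bsub>M\<^esub>"
  by (induction p) (auto simp: T_pow_zero smult_r_null)

lemma pact_T: "set p \<subseteq> carrier R \<Longrightarrow> v \<in> carrier M \<Longrightarrow> pact p (T v) = T (pact p v)"
proof (induction p)
  case (Cons c p)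
  then show ?case by (simp add: T_add T_smult T_closed funpow_swap1)
qed (simp add: T_zero)

lemma pact_snoc:
  "set p \<subseteq> carrier R \<Longrightarrow> c \<in> carrier R \<Longrightarrow> v \<in> carrier M \<Longrightarrow> pact (p @ [c]) v = T (pact p v) \<oplus>\<^bsub>M\<^esub> c \<odot>\<^bsub>M\<^esub> v"
proof (induction p)
  case (Cons a p)
  then show ?case by (simp add: T_add T_smult T_closed M.add.m_assoc)
qed (simp add: T_zero)

lemma pact_append_zeros:
  "set p \<subseteq> carrier R \<Longrightarrow> v \<in> carrier M \<Longrightarrow> pact (p @ replicate k \<zero>) v = (T ^^ k) (pact p v)"
proof (induction k)
  case (Suc k)
  have "pact (p @ replicate (Suc k) \<zero>) v = pact ((p @ replicate k \<zero>) @ [\<zero>]) v"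
    by (simp add: replicate_append_same)
  also have "\<dots> = T (pact (p @ replicate k \<zero>) v)"
  proof -
    have "set (p @ replicate k \<zero>) \<subseteq> carrier R" using Suc.prems by auto
    then have "T (pact (p @ replicate k \<zero>) v) \<in> carrier M" using Suc.prems by (intro T_closed pact_closed)
    then show ?thesis using Suc.prems \<open>set (p @ replicate k \<zero>) \<subseteq> carrier R\<close> by (subst pact_snoc) (auto simp del: set_append)
  qed
  finally show ?case using Suc by simp
qed simp

lemma pact_prepend_zeros: "set p \<subseteq> carrier R \<Longrightarrow> v \<in> carrier M \<Longrightarrow> pact (replicate k \<zero> @ p) v = pact p v"
  by (induction k) auto

lemma pact_normalize: "set p \<subseteq> carrier R \<Longrightarrow> v \<in> carrier M \<Longrightarrow> pact (normalize p) v = pact p v"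
  by (induction p) auto

lemma pact_map2_add:
  "length p = length s \<Longrightarrow> set p \<subseteq> carrier R \<Longrightarrow> set s \<subseteq> carrier R \<Longrightarrow> v \<in> carrier M \<Longrightarrow>
    pact (map2 (\<oplus>) p s) v = pact p v \<oplus>\<^bsub>M\<^esub> pact s v"
proof (induction p s rule: list_induct2)
  case (Cons a p b s)
  then show ?case by (simp add: smult_l_distr M.add.m_assoc M.add.m_lcomm)
qed auto

lemma pact_map_mult:
  "set p \<subseteq> carrier R \<Longrightarrow> c \<in> carrier R \<Longrightarrow> v \<in> carrier M \<Longrightarrow> pact (map ((\<otimes>) c) p) v = c \<odot>\<^bsub>M\<^esub> pact p v"
  by (induction p) (auto simp: smult_r_distr smult_assoc1 smult_r_null)

lemma map2_add_carrier: "set p \<subseteq> carrier R \<Longrightarrow> set s \<subseteq> carrier R \<Longrightarrow> set (map2 (\<oplus>) p s) \<subseteq> carrier R"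
proof
  fix x assume sub: "set p \<subseteq> carrier R" "set s \<subseteq> carrier R" and "x \<in> set (map2 (\<oplus>) p s)"
  then obtain a b where "(a, b) \<in> set (zip p s)" "x = a \<oplus> b" by auto
  then show "x \<in> carrier R" using sub set_zip_leftD[of a b p s] set_zip_rightD[of a b p s] by auto
qed

lemma pact_poly_add:
  assumes "set p \<subseteq> carrier R" "set s \<subseteq> carrier R" "v \<in> carrier M"
  shows "pact (poly_add p s) v = pact p v \<oplus>\<^bsub>M\<^esub> pact s v"
proof -
  have aux: "pact (poly_add p s) v = pact p v \<oplus>\<^bsub>M\<^esub> pact s v"
    if ps: "set p \<subseteq> carrier R" "set s \<subseteq> carrier R" "length s \<le> length p" for p s
  proof -
    let ?s = "replicate (length p - length s) \<zero> @ s"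
    have s: "length p = length ?s" "set ?s \<subseteq> carrier R" using ps by auto
    have "set (map2 (\<oplus>) p ?s) \<subseteq> carrier R"
      using ps(1) s(2) by (rule map2_add_carrier)
    then show ?thesis using ps s assms(3) by (simp add: pact_normalize pact_map2_add pact_prepend_zeros)
  qed
  show ?thesis
  proof (cases "length s \<le> length p")
    case False
    then have "poly_add p s = poly_add s p" by simp
    then show ?thesis using aux[of s p] False assms by (simp add: M.a_comm del: poly_add.simps)
  qed (use aux assms in blast)
qed

lemma pact_poly_mult:
  assumes "set p \<subseteq> carrier R" "set s \<subseteq> carrier R" "v \<in> carrier M"
  shows "pact (poly_mult p s) v = pact p (pact s v)"
  using assms(1)
proof (induction p)
  case (Cons c p)
  have c: "c \<in> carrier R" "set p \<subseteq> carrier R" using Cons.prems by auto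
  have m: "set (map ((\<otimes>) c) s) \<subseteq> carrier R" using c assms by auto
  have "pact (poly_mult (c # p) s) v = pact (map ((\<otimes>) c) s @ replicate (length p) \<zero>) v \<oplus>\<^bsub>M\<^esub> pact (poly_mult p s) v"
    unfolding poly_mult.simps using m c assms poly_mult_in_carrier[of p s] by (subst pact_poly_add) auto
  also have "\<dots> = c \<odot>\<^bsub>M\<^esub> (T ^^ length p) (pact s v) \<oplus>\<^bsub>M\<^esub> pact p (pact s v)"
    using m c assms Cons.IH by (simp add: pact_append_zeros pact_map_mult T_pow_smult)
  finally show ?case by simp
qed simp

abbreviation "P \<equiv> poly_ring R"

lemma P_carrier_set: "p \<in> carrier P \<Longrightarrow> set p \<subseteq> carrier R"
  using polynomial_incl univ_poly_carrier by blast

lemma pact_P_add: "p \<in> carrier P \<Longrightarrow> s \<in> carrier P \<Longrightarrow> v \<in> carrier M \<Longrightarrow> pact (p \<oplus>\<^bsub>P\<^esub> s) v = pact p v \<oplus>\<^bsub>M\<^esub> pact s v"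
  unfolding univ_poly_add by (intro pact_poly_add P_carrier_set)

lemma pact_P_mult: "p \<in> carrier P \<Longrightarrow> s \<in> carrier P \<Longrightarrow> v \<in> carrier M \<Longrightarrow> pact (p \<otimes>\<^bsub>P\<^esub> s) v = pact p (pact s v)"
  unfolding univ_poly_mult by (intro pact_poly_mult P_carrier_set)

lemma pact_commute: "p \<in> carrier P \<Longrightarrow> s \<in> carrier P \<Longrightarrow> v \<in> carrier M \<Longrightarrow> pact p (pact s v) = pact s (pact p v)"
  using cring.cring_simprules(14)[OF domain.axioms(1)[OF poly_ring_domain]] by (simp flip: pact_P_mult)

lemma pact_P_one: "v \<in> carrier M \<Longrightarrow> pact \<one>\<^bsub>P\<^esub> v = v"
  unfolding univ_poly_one by simp

definition invariant :: "'b set \<Rightarrow> bool" where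
  "invariant W \<longleftrightarrow> subsp W \<and> (\<forall>x\<in>W. T x \<in> W)"

lemma invariant_pact:
  assumes W: "invariant W" and v: "v \<in> W" and p: "set p \<subseteq> carrier R"
  shows "pact p v \<in> W"
proof -
  have sub: "subsp W" using W by (simp add: invariant_def)
  have "(T ^^ k) v \<in> W" for k using W v by (induction k) (auto simp: invariant_def)
  then show ?thesis using p by (induction p) (auto intro: subsp_zero[OF sub] subsp_add[OF sub] subsp_smult[OF sub])
qed

lemma invariant_Int: "invariant A \<Longrightarrow> invariant B \<Longrightarrow> invariant (A \<inter> B)"
  by (auto simp: invariant_def intro: subsp_Int)

definition kern :: "'a list \<Rightarrow> 'b set" where
  "kern f = {v \<in> carrier M. pact f v = \<zero>\<^bsub>M\<^esub>}"

lemma kern_invariant: "set f \<subseteq> carrier R \<Longrightarrow> invariant (kern f)"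
  unfolding invariant_def subsp_def kern_def
  by (auto simp: pact_zero pact_add pact_smult pact_T T_zero T_closed smult_r_null)

text \<open>The polynomials annihilating \<open>v\<close> form an ideal that contains
  \<open>f\<close> but not 1. The ideal generated by an irreducible \<open>f\<close> is maximal, so
  the two ideals coincide.\<close>

lemma irreducible_divides_annihilator:
  assumes f: "f \<in> carrier P" "ring_irreducible\<^bsub>P\<^esub> f" and v: "v \<in> kern f" "v \<noteq> \<zero>\<^bsub>M\<^esub>"
    and p: "p \<in> carrier P" "pact p v = \<zero>\<^bsub>M\<^esub>"
  shows "f pdivides p"
proof -
  interpret UP: principal_domain P by (rule poly_ring_principal)
  have vM: "v \<in> carrier M" using v by (simp add: kern_def)
  define I where "I = {p \<in> carrier P. pact p v = \<zero>\<^bsub>M\<^esub>}"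
  have ann: "pact a (pact x v) = \<zero>\<^bsub>M\<^esub>" if "a \<in> carrier P" "x \<in> carrier P" "pact a v = \<zero>\<^bsub>M\<^esub>" for a x
    using that vM P_carrier_set[of x] by (subst pact_commute) (auto simp: pact_zero)
  have "ideal I P"
  proof (rule idealI[OF UP.ring_axioms])
    show "subgroup I (add_monoid P)"
    proof (rule UP.add.subgroupI)
      show "\<ominus>\<^bsub>P\<^esub> a \<in> I" if "a \<in> I" for a
      proof -
        have a: "a \<in> carrier P" "pact a v = \<zero>\<^bsub>M\<^esub>" using that by (auto simp: I_def)
        have "pact (a \<oplus>\<^bsub>P\<^esub> \<ominus>\<^bsub>P\<^esub> a) v = pact a v \<oplus>\<^bsub>M\<^esub> pact (\<ominus>\<^bsub>P\<^esub> a) v" using a vM by (intro pact_P_add) auto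
        then have "\<zero>\<^bsub>M\<^esub> = pact (\<ominus>\<^bsub>P\<^esub> a) v"
          using a vM P_carrier_set[of "\<ominus>\<^bsub>P\<^esub> a"] by (simp add: UP.r_neg univ_poly_zero)
        then show ?thesis using a by (simp add: I_def)
      qed
    qed (auto simp: I_def pact_P_add vM univ_poly_zero intro!: exI[of _ "[]"])
  qed (auto simp: I_def pact_P_mult vM pact_zero P_carrier_set ann)
  moreover have "PIdl\<^bsub>P\<^esub> f \<subseteq> I"
    using f v vM P_carrier_set by (auto simp: cgenideal_def I_def pact_P_mult pact_zero kern_def)
  moreover have "maximalideal (PIdl\<^bsub>P\<^esub> f) P" by (rule UP.irreducible_imp_maximalideal[OF f])
  ultimately have "I = PIdl\<^bsub>P\<^esub> f \<or> I = carrier P"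
    using maximalideal.I_maximal[of "PIdl\<^bsub>P\<^esub> f" P I] by (auto simp: I_def)
  moreover have "\<one>\<^bsub>P\<^esub> \<notin> I" using pact_P_one[OF vM] v by (simp add: I_def)
  then have "I \<noteq> carrier P" using UP.one_closed by blast
  moreover have "p \<in> I" using p by (simp add: I_def)
  ultimately have "p \<in> PIdl\<^bsub>P\<^esub> f" by simp
  then show ?thesis using f(1) unfolding pdivides_def factor_def cgenideal_def by (auto simp: UP.m_comm)
qed

text \<open>Coefficient lists of length \<open>length f - 1\<close>, the degree of \<open>f\<close>,
  act differently on \<open>v\<close>: the difference of two of them has smaller degree than
  \<open>f\<close> and, if it annihilates \<open>v\<close>, is divisible by \<open>f\<close>, hence
  zero. So \<open>W\<close> contains one element for each such list.\<close>

lemma card_invariant_ge: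
  assumes f: "f \<in> carrier P" "ring_irreducible\<^bsub>P\<^esub> f" and v: "v \<in> kern f" "v \<noteq> \<zero>\<^bsub>M\<^esub>"
    and W: "invariant W" "v \<in> W"
  shows "q ^ (length f - 1) \<le> card W"
proof -
  have vM: "v \<in> carrier M" using v by (simp add: kern_def)
  define A where "A = {xs. set xs \<subseteq> carrier R \<and> length xs = (length f - 1)}"
  have "inj_on (\<lambda>xs. pact xs v) A"
  proof (rule inj_onI)
    fix xs ys assume xy: "xs \<in> A" "ys \<in> A" "pact xs v = pact ys v"
    let ?ys = "map ((\<otimes>) (\<ominus> \<one>)) ys"
    let ?d = "map2 (\<oplus>) xs ?ys"
    have set: "set xs \<subseteq> carrier R" "set ys \<subseteq> carrier R" "set ?ys \<subseteq> carrier R" "length xs = length ?ys" "length xs = (length f - 1)"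
      using xy by (auto simp: A_def)
    have set_d: "set ?d \<subseteq> carrier R" using set by (intro map2_add_carrier)
    have "pact ?d v = pact xs v \<oplus>\<^bsub>M\<^esub> (\<ominus> \<one>) \<odot>\<^bsub>M\<^esub> pact ys v"
      using set vM by (subst pact_map2_add) (auto simp: pact_map_mult)
    also have "\<dots> = \<zero>\<^bsub>M\<^esub>" using xy(3) set vM by (simp add: minus_eq_smult[symmetric] M.r_neg)
    finally have "pact (normalize ?d) v = \<zero>\<^bsub>M\<^esub>" using set_d vM by (simp only: pact_normalize)
    moreover have nP: "normalize ?d \<in> carrier P"
      using normalize_gives_polynomial[OF set_d] by (simp add: univ_poly_carrier)
    ultimately have dvd: "f pdivides normalize ?d" by (intro irreducible_divides_annihilator[OF f v])
    have "normalize ?d = []"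
    proof (rule ccontr)
      assume ne: "normalize ?d \<noteq> []"
      then have "(length f - 1) \<le> length (normalize ?d) - 1"
        using pdivides_imp_degree_le[OF carrier_is_subring f(1) nP ne dvd] by simp
      moreover have "length (normalize ?d) \<le> (length f - 1)" using normalize_length_le[of ?d] set by simp
      ultimately show False using ne by (cases "normalize ?d") auto
    qed
    then have "?d = replicate (length ?d) \<zero>"
    proof -
      have "coeff ?d = coeff (replicate (length ?d) \<zero>)"
        using normalize_coeff[of ?d] \<open>normalize ?d = []\<close> by simp
      then show ?thesis using coeff_iff_length_cond[of ?d "replicate (length ?d) \<zero>"] by simp
    qed
    then have "xs ! i \<oplus> (\<ominus> \<one>) \<otimes> ys ! i = \<zero>" if "i < length xs" for i
    proof -
      have "?d ! i = replicate (length ?d) \<zero> ! i" using \<open>?d = _\<close> by (rule arg_cong)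
      moreover have "i < length ys" using that set by simp
      ultimately show ?thesis using that set(4) by simp
    qed
    moreover have "xs ! i \<in> carrier R" "ys ! i \<in> carrier R" if "i < length xs" for i using set that by (auto simp: subset_iff)
    ultimately have "xs ! i = ys ! i" if "i < length xs" for i
      using that by (metis R.add.inv_closed R.l_minus R.l_one R.minus_equality R.minus_minus R.one_closed R.a_comm)
    then show "xs = ys" using set by (intro nth_equalityI) auto
  qed
  then have "card ((\<lambda>xs. pact xs v) ` A) = q ^ (length f - 1)"
    using card_lists_length_eq[OF finite_R] by (simp add: card_image A_def)
  moreover have "(\<lambda>xs. pact xs v) ` A \<subseteq> W" using invariant_pact[OF W] by (auto simp: A_def)
  moreover have "finite W" using W(1) subsp_finite by (simp add: invariant_def)
  ultimately show ?thesis using card_mono by metis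
qed

end

context finite_space
begin

lemma subsp_cancel:
  assumes W: "subsp W" and "a \<oplus>\<^bsub>M\<^esub> b \<in> W" "b \<in> W" "a \<in> carrier M"
  shows "a \<in> W"
proof -
  have "b \<in> carrier M" using assms(3) subsp_carrier[OF W] by blast
  then have "a = (a \<oplus>\<^bsub>M\<^esub> b) \<ominus>\<^bsub>M\<^esub> b" using assms(4) by (simp add: M.minus_eq M.a_assoc M.r_neg)
  then show ?thesis using subsp_diff[OF W assms(2,3)] by simp
qed

end

context linear_operator
begin

lemma invariant_ssum: "invariant A \<Longrightarrow> invariant B \<Longrightarrow> invariant (ssum A B)"
proof -
  assume A: "invariant A" and B: "invariant B"
  then have sub: "subsp A" "subsp B" by (auto simp: invariant_def)
  have "T x \<in> ssum A B" if "x \<in> ssum A B" for x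
  proof -
    from \<open>x \<in> ssum A B\<close> obtain a b where ab: "a \<in> A" "b \<in> B" "x = a \<oplus>\<^bsub>M\<^esub> b" unfolding ssum_def by auto
    have "T x = T a \<oplus>\<^bsub>M\<^esub> T b" using ab sub T_add subsp_carrier by metis
    then show ?thesis using ab A B unfolding ssum_def invariant_def by (intro image_eqI[of _ _ "(T a, T b)"]) auto
  qed
  then show ?thesis using subsp_ssum[OF sub] by (auto simp: invariant_def)
qed

lemma invariant_zero: "invariant {\<zero>\<^bsub>M\<^esub>}"
  by (auto simp: invariant_def subsp_zero_set T_zero)

end

text \<open>The hypotheses are one-sided: the kernels are merely nonzero, and \<open>n\<close> is at
  most the sum of the degrees. Counting elements turns this into equalities and a direct sum
  decomposition. Distinctness of the irreducible factors enters in the form that none divides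
  another.\<close>

locale primary_operator = linear_operator R M T
  for R :: "('a, 'm) ring_scheme" (structure) and M :: "('a, 'b, 'n) module_scheme" (structure) and T +
  fixes fs :: "'a list list" and n :: nat
  assumes fs_closed: "j < length fs \<Longrightarrow> fs ! j \<in> carrier (poly_ring R)"
    and fs_irreducible: "j < length fs \<Longrightarrow> ring_irreducible\<^bsub>poly_ring R\<^esub> (fs ! j)"
    and fs_indivisible: "i < length fs \<Longrightarrow> j < length fs \<Longrightarrow> i \<noteq> j \<Longrightarrow> \<not> fs ! i pdivides fs ! j"
    and fs_kern: "j < length fs \<Longrightarrow> \<exists>v\<in>kern (fs ! j). v \<noteq> \<zero>\<^bsub>M\<^esub>"
    and card_M: "card (carrier M) = q ^ n"
    and n_le: "n \<le> (\<Sum>j<length fs. length (fs ! j) - 1)"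
    and T_inj: "inj_on T (carrier M)"
begin

abbreviation "k \<equiv> length fs"

definition K :: "nat \<Rightarrow> 'b set" where
  "K j = kern (fs ! j)"

definition deg :: "nat \<Rightarrow> nat" where
  "deg j = length (fs ! j) - 1"

text \<open>The second argument bounds the recursion: the indices are those of \<open>J\<close>
  below it. The product \<open>pprod\<close> with the same arguments annihilates this sum.\<close>

primrec psum :: "nat set \<Rightarrow> nat \<Rightarrow> 'b set" where
  "psum J 0 = {\<zero>\<^bsub>M\<^esub>}"
| "psum J (Suc i) = (if i \<in> J then ssum (psum J i) (K i) else psum J i)"

primrec pprod :: "nat set \<Rightarrow> nat \<Rightarrow> 'a list" where
  "pprod J 0 = \<one>\<^bsub>P\<^esub>"
| "pprod J (Suc i) = (if i \<in> J then pprod J i \<otimes>\<^bsub>P\<^esub> fs ! i else pprod J i)"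

lemma fs_set: "j < k \<Longrightarrow> set (fs ! j) \<subseteq> carrier R"
  using P_carrier_set fs_closed by blast

lemma K_invariant: "j < k \<Longrightarrow> invariant (K j)"
  unfolding K_def by (intro kern_invariant fs_set)

lemma K_subsp: "j < k \<Longrightarrow> subsp (K j)"
  using K_invariant by (auto simp: invariant_def)

lemma psum_invariant: "i \<le> k \<Longrightarrow> invariant (psum J i)"
  by (induction i) (simp_all add: invariant_zero invariant_ssum K_invariant)

lemma psum_subsp: "i \<le> k \<Longrightarrow> subsp (psum J i)"
  using psum_invariant by (auto simp: invariant_def)

lemma pprod_closed: "i \<le> k \<Longrightarrow> pprod J i \<in> carrier P"
proof (induction i)
  case (Suc i)
  interpret UP: domain P by (rule poly_ring_domain)
  show ?case using Suc fs_closed by auto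
qed (use domain.axioms(1)[OF poly_ring_domain] cring.cring_simprules(6) in auto)

lemma psum_annihilated: "i \<le> k \<Longrightarrow> v \<in> psum J i \<Longrightarrow> pact (pprod J i) v = \<zero>\<^bsub>M\<^esub>"
proof (induction i arbitrary: v)
  case 0
  then show ?case by (simp add: pact_P_one)
next
  case (Suc i)
  show ?case
  proof (cases "i \<in> J")
    case True
    then obtain a b where ab: "a \<in> psum J i" "b \<in> K i" "v = a \<oplus>\<^bsub>M\<^esub> b" using Suc.prems by (auto simp: ssum_def)
    have car: "a \<in> carrier M" "b \<in> carrier M"
      using ab Suc.prems subsp_carrier[OF psum_subsp[of i J]] subsp_carrier[OF K_subsp[of i]] by auto
    have cl: "pprod J i \<in> carrier P" "fs ! i \<in> carrier P" using Suc.prems by (auto intro: pprod_closed fs_closed)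
    have set: "set (pprod J i) \<subseteq> carrier R" "set (fs ! i) \<subseteq> carrier R" using cl P_carrier_set by auto
    have "pact (pprod J i) (pact (fs ! i) a) = \<zero>\<^bsub>M\<^esub>"
      using Suc ab set car by (subst pact_commute[OF cl]) (auto simp: pact_zero)
    moreover have "pact (fs ! i) b = \<zero>\<^bsub>M\<^esub>" using ab by (simp add: K_def kern_def)
    ultimately show ?thesis
      using True car cl set ab by (simp add: pact_P_mult pact_add pact_zero)
  qed (use Suc in auto)
qed

lemma not_pdivides_pprod:
  assumes "j < k" "j \<notin> J \<or> i \<le> j" "i \<le> k"
  shows "\<not> fs ! j pdivides pprod J i"
  using assms(2,3)
proof (induction i)
  case 0
  then show ?case using irreducible_not_pdivides_one[OF fs_closed fs_irreducible] assms(1) by simp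
next
  case (Suc i)
  have IH: "\<not> fs ! j pdivides pprod J i" using Suc by auto
  show ?case
  proof (cases "i \<in> J")
    case True
    then have "\<not> fs ! j pdivides fs ! i" using Suc.prems assms(1) by (intro fs_indivisible) auto
    then show ?thesis
      using IH True irreducible_pdivides_mult[OF fs_closed[OF assms(1)] fs_irreducible[OF assms(1)] pprod_closed[of i J] fs_closed[of i]] Suc.prems
      by auto
  qed (use IH in simp)
qed

text \<open>A common nonzero vector would be annihilated by \<open>pprod J i\<close>, so
  \<open>fs ! j\<close> would divide a product of other factors.\<close>

lemma psum_Int_K:
  assumes "j < k" "j \<notin> J \<or> i \<le> j" "i \<le> k"
  shows "psum J i \<inter> K j = {\<zero>\<^bsub>M\<^esub>}"
proof -
  have "v = \<zero>\<^bsub>M\<^esub>" if "v \<in> psum J i" "v \<in> K j" for v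
    using not_pdivides_pprod[OF assms] irreducible_divides_annihilator[OF fs_closed[OF assms(1)] fs_irreducible[OF assms(1)], of v "pprod J i"]
      psum_annihilated[OF assms(3) that(1)] pprod_closed[OF assms(3)] that by (auto simp: K_def)
  then show ?thesis using subsp_zero[OF psum_subsp[OF assms(3)]] subsp_zero[OF K_subsp[OF assms(1)]] by blast
qed

lemma card_psum: "i \<le> k \<Longrightarrow> card (psum J i) = (\<Prod>j\<in>J \<inter> {..<i}. card (K j))"
proof (induction i)
  case (Suc i)
  show ?case
  proof (cases "i \<in> J")
    case True
    have "J \<inter> {..<Suc i} = insert i (J \<inter> {..<i})" using True by auto
    then show ?thesis using Suc True card_ssum[OF psum_subsp K_subsp psum_Int_K, of i i J] by simp
  next
    case False
    then have "J \<inter> {..<Suc i} = J \<inter> {..<i}" using less_Suc_eq by auto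
    then show ?thesis using Suc False by simp
  qed
qed simp

lemma K_nontrivial: "j < k \<Longrightarrow> \<exists>v\<in>K j. v \<noteq> \<zero>\<^bsub>M\<^esub>"
  using fs_kern by (simp add: K_def)

lemma card_K_ge:
  assumes "j < k" "invariant W" "v \<in> W" "v \<in> K j" "v \<noteq> \<zero>\<^bsub>M\<^esub>"
  shows "q ^ deg j \<le> card W"
  using card_invariant_ge[OF fs_closed[OF assms(1)] fs_irreducible[OF assms(1)], of v W] assms by (simp add: K_def deg_def)

lemma prod_card_K_le: "(\<Prod>j<k. card (K j)) \<le> q ^ (\<Sum>j<k. deg j)"
proof -
  have "(\<Prod>j<k. card (K j)) = card (psum UNIV k)" by (simp add: card_psum)
  also have "\<dots> \<le> card (carrier M)"
    using psum_subsp[of k UNIV] finite_M by (intro card_mono) (auto simp: subsp_def)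
  also have "\<dots> \<le> q ^ (\<Sum>j<k. deg j)" using n_le q_ge_2 by (simp add: card_M deg_def power_increasing)
  finally show ?thesis .
qed

text \<open>Each kernel has at least \<open>q ^ deg j\<close> elements, and the product of their
  sizes is the size of a direct sum inside a space with at most
  \<open>q ^ (\<Sum>j<k. deg j)\<close> elements. So none can be larger.\<close>

lemma card_K:
  assumes "j < k"
  shows "card (K j) = q ^ deg j"
proof (rule ccontr)
  assume ne: "card (K j) \<noteq> q ^ deg j"
  have ge: "q ^ deg i \<le> card (K i)" if "i < k" for i
    using K_nontrivial[OF that] card_K_ge[OF that K_invariant[OF that]] by blast
  have "(\<Prod>i<k. q ^ deg i) < (\<Prod>i<k. card (K i))"
  proof -
    have "card (K j) > q ^ deg j" using ge[OF assms] ne by simp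
    moreover have "(\<Prod>i\<in>{..<k} - {j}. q ^ deg i) \<le> (\<Prod>i\<in>{..<k} - {j}. card (K i))"
      using ge by (intro prod_mono) auto
    moreover have "0 < (\<Prod>i\<in>{..<k} - {j}. q ^ deg i)" using q_ge_2 by (intro prod_pos) auto
    ultimately have "q ^ deg j * (\<Prod>i\<in>{..<k} - {j}. q ^ deg i) < card (K j) * (\<Prod>i\<in>{..<k} - {j}. card (K i))"
      by (intro mult_less_le_imp_less) auto
    then show ?thesis using assms by (simp add: prod.remove[of "{..<k}" j])
  qed
  then show False using prod_card_K_le by (simp add: power_sum)
qed

lemma card_psum_power: "i \<le> k \<Longrightarrow> card (psum J i) = q ^ (\<Sum>j\<in>J \<inter> {..<i}. deg j)"
  by (simp add: card_psum card_K power_sum)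

lemma psum_all: "psum UNIV k = carrier M"
proof (rule subsp_eqI[OF psum_subsp subsp_univ])
  show "psum UNIV k \<subseteq> carrier M" using psum_subsp[of k UNIV] by (simp add: subsp_def)
  have "card (carrier M) \<le> card (psum UNIV k)"
    using n_le q_ge_2 by (simp add: card_M card_psum_power deg_def power_increasing)
  moreover have "card (psum UNIV k) \<le> card (carrier M)"
    using psum_subsp[of k UNIV] finite_M by (intro card_mono) (auto simp: subsp_def)
  ultimately show "card (psum UNIV k) = card (carrier M)" by simp
qed simp

lemma sum_deg: "(\<Sum>j<k. deg j) = n"
proof -
  have "q ^ (\<Sum>j<k. deg j) = q ^ n" using card_psum_power[of k UNIV] psum_all card_M by simp
  then show ?thesis using q_ge_2 by (simp add: power_inject_exp)
qed

text \<open>\<open>K j\<close> is a simple module: the invariant subspace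
  \<open>W \<inter> K j\<close> contains a nonzero vector, hence has at least
  \<open>q ^ deg j\<close> elements, as many as \<open>K j\<close>.\<close>

lemma K_minimal:
  assumes "j < k" "invariant W" "v \<in> W" "v \<in> K j" "v \<noteq> \<zero>\<^bsub>M\<^esub>"
  shows "K j \<subseteq> W"
proof -
  have inv: "invariant (W \<inter> K j)" using assms K_invariant by (intro invariant_Int)
  have "card (K j) \<le> card (W \<inter> K j)" using card_K_ge[OF assms(1) inv, of v] assms by (simp add: card_K)
  then have "W \<inter> K j = K j" using subsp_finite[OF K_subsp[OF assms(1)]] by (intro card_seteq) auto
  then show ?thesis by auto
qed

lemma K_subset_psum: "j \<in> J \<Longrightarrow> j < i \<Longrightarrow> i \<le> k \<Longrightarrow> K j \<subseteq> psum J i"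
proof (induction i)
  case (Suc i)
  then show ?case
    using ssum_upper[OF psum_subsp K_subsp, of i i J] by (auto simp: less_Suc_eq)
qed simp

lemma K_subset_psum_iff:
  assumes "j < k"
  shows "K j \<subseteq> psum J k \<longleftrightarrow> j \<in> J"
  using K_subset_psum[of j J k] psum_Int_K[of j J k] K_nontrivial[OF assms] assms by blast

lemma psum_least: "i \<le> k \<Longrightarrow> subsp W \<Longrightarrow> (\<And>j. j \<in> J \<Longrightarrow> j < i \<Longrightarrow> K j \<subseteq> W) \<Longrightarrow> psum J i \<subseteq> W"
proof (induction i)
  case (Suc i)
  then show ?case using ssum_least[of W "psum J i" "K i"] by auto
qed (auto simp: subsp_zero)

lemma psum_mono: "J \<inter> {..<k} \<subseteq> J' \<Longrightarrow> psum J k \<subseteq> psum J' k"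
  by (rule psum_least) (auto intro: psum_subsp simp: K_subset_psum_iff)

text \<open>Induction along the partial sums of the kernels. If \<open>K i\<close> lies in
  \<open>W\<close>, the component of a vector in \<open>K i\<close> can be subtracted within
  \<open>W\<close>; otherwise \<open>W\<close> meets \<open>K i\<close> only in zero, and this
  component has to vanish.\<close>

lemma invariant_eq_psum:
  assumes W: "invariant W"
  shows "W = psum {j. j < k \<and> K j \<subseteq> W} k"
proof
  let ?J = "{j. j < k \<and> K j \<subseteq> W}"
  have sub: "subsp W" using W by (simp add: invariant_def)
  show "psum ?J k \<subseteq> W" by (rule psum_least[OF _ sub]) auto
  have "i \<le> k \<Longrightarrow> W \<inter> psum UNIV i \<subseteq> psum ?J i" for i
  proof (induction i)
    case (Suc i)
    have i: "i < k" using Suc.prems by simp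
    show ?case
    proof
      fix w assume w: "w \<in> W \<inter> psum UNIV (Suc i)"
      then obtain a b where ab: "a \<in> psum UNIV i" "b \<in> K i" "w = a \<oplus>\<^bsub>M\<^esub> b" by (auto simp: ssum_def)
      have car: "a \<in> carrier M" "b \<in> carrier M"
        using ab i subsp_carrier[OF psum_subsp[of i UNIV]] subsp_carrier[OF K_subsp[of i]] by auto
      show "w \<in> psum ?J (Suc i)"
      proof (cases "i \<in> ?J")
        case True
        then have "a \<in> W" using w ab car by (intro subsp_cancel[OF sub, of a b]) auto
        then have "a \<in> psum ?J i" using Suc ab by auto
        then show ?thesis using True ab by (auto simp: ssum_def)
      next
        case False
        \<comment> \<open>The product of the earlier factors kills \<open>a\<close>, so
          \<open>w\<close> and \<open>b\<close> have the same image, which lies in both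
          \<open>W\<close> and \<open>K i\<close> and is therefore zero. Since \<open>fs ! i\<close>
          does not divide the product, \<open>b\<close> is zero itself.\<close>
        let ?p = "pprod UNIV i"
        have p: "?p \<in> carrier P" "set ?p \<subseteq> carrier R" using i pprod_closed P_carrier_set by auto
        have "pact ?p w = pact ?p b"
          using ab car p psum_annihilated[of i a UNIV] i by (simp add: pact_add)
        then have "pact ?p b \<in> W \<inter> K i"
          using invariant_pact[OF W _ p(2), of w] invariant_pact[OF K_invariant[OF i] ab(2) p(2)] w by simp
        moreover have "W \<inter> K i \<subseteq> {\<zero>\<^bsub>M\<^esub>}" using K_minimal[OF i W] False i by blast
        ultimately have "pact ?p b = \<zero>\<^bsub>M\<^esub>" by blast
        then have "b = \<zero>\<^bsub>M\<^esub>"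
          using irreducible_divides_annihilator[OF fs_closed[OF i] fs_irreducible[OF i], of b ?p] p ab
            not_pdivides_pprod[of i UNIV i] i by (auto simp: K_def)
        then have "w = a" using ab car by simp
        then show ?thesis using Suc ab w False by auto
      qed
    qed
  qed simp
  from this[of k] show "W \<subseteq> psum ?J k" using psum_all sub by (auto simp: subsp_def)
qed

end

context primary_operator
begin

lemma fixed_iff_invariant: "subsp W \<Longrightarrow> T ` W = W \<longleftrightarrow> invariant W"
proof
  assume W: "subsp W"
  show "T ` W = W" if "invariant W"
  proof (rule card_subset_eq[OF subsp_finite[OF W]])
    show "T ` W \<subseteq> W" using that by (auto simp: invariant_def)
    show "card (T ` W) = card W"
      using T_inj W by (intro card_image inj_on_subset[OF T_inj]) (auto simp: subsp_def)
  qed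
qed (auto simp: invariant_def)

lemma K_subset_zero: "j < k \<Longrightarrow> \<not> K j \<subseteq> {\<zero>\<^bsub>M\<^esub>}"
  using K_nontrivial by auto

lemma sum_level:
  fixes xs :: "nat list"
  assumes xs: "length xs = k" "set xs \<subseteq> {..<m}"
  shows "(\<Sum>l<min i m. \<Sum>j<k. if xs ! j = l then deg j else 0) = (\<Sum>j\<in>{j. j < k \<and> xs ! j < i}. deg j)"
proof -
  have "(\<Sum>l<min i m. \<Sum>j<k. if xs ! j = l then deg j else 0) = (\<Sum>j<k. \<Sum>l<min i m. if xs ! j = l then deg j else 0)"
    by (rule sum.swap)
  also have "\<dots> = (\<Sum>j<k. if xs ! j < i then deg j else 0)"
    using xs by (intro sum.cong refl) (auto simp: sum.delta' subset_iff)
  also have "\<dots> = (\<Sum>j\<in>{j. j < k \<and> xs ! j < i}. deg j)"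
    by (simp add: sum.If_cases lessThan_def Int_def)
  finally show ?thesis .
qed

lemma psum_Collect: "card (psum {j. j < k \<and> Q j} k) = q ^ (\<Sum>j\<in>{j. j < k \<and> Q j}. deg j)"
proof -
  have "{j. j < k \<and> Q j} \<inter> {..<k} = {j. j < k \<and> Q j}" by auto
  then show ?thesis by (simp add: card_psum_power)
qed

text \<open>Invariant subspaces are determined by the kernels they contain, so a fixed flag is
  determined by the step at which each kernel enters. The sizes of the members translate into the
  row sums of the filling.\<close>

lemma bij_betw_fixed_flags:
  assumes mu: "\<And>i. i < m \<Longrightarrow> 0 \<le> \<mu> i" "(\<Sum>i<m. \<mu> i) = int n"
  shows "bij_betw (\<lambda>xs i. psum {j. j < k \<and> xs ! j < i} k)
    (filling_lists m (map (\<lambda>f. length f - 1) fs) \<mu>) {W \<in> flags m (\<lambda>i. nat (\<mu> i)). \<forall>i. T ` W i = W i}"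
proof -
  define ds where "ds = map (\<lambda>f. length f - 1) fs"
  have ds: "length ds = k" "\<And>j. j < k \<Longrightarrow> ds ! j = deg j" by (simp_all add: ds_def deg_def)
  let ?\<mu> = "\<lambda>i. nat (\<mu> i)"
  define \<Phi> where "\<Phi> xs i = psum {j. j < k \<and> xs ! j < i} k" for xs :: "nat list" and i
  have fl: "xs \<in> filling_lists m ds \<mu> \<longleftrightarrow> length xs = k \<and> set xs \<subseteq> {..<m} \<and>
    (\<forall>i<m. (\<Sum>j<k. if xs ! j = i then deg j else 0) = ?\<mu> i)" for xs
  proof -
    have "(\<Sum>j<k. if xs ! j = i then int (ds ! j) else 0) = int (\<Sum>j<k. if xs ! j = i then deg j else 0)" for i
      unfolding of_nat_sum by (rule sum.cong) (auto simp: ds)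
    then have "((\<Sum>j<k. if xs ! j = i then int (ds ! j) else 0) = \<mu> i) \<longleftrightarrow>
      ((\<Sum>j<k. if xs ! j = i then deg j else 0) = ?\<mu> i)" if "i < m" for i
      using mu(1)[OF that] by (simp only: eq_nat_nat_iff) linarith
    then show ?thesis by (simp add: filling_lists_def ds)
  qed
  have card_M': "card (carrier M) = q ^ (\<Sum>l<m. ?\<mu> l)"
  proof -
    have "int (\<Sum>l<m. ?\<mu> l) = int n" using mu by simp
    then have "(\<Sum>l<m. ?\<mu> l) = n" by (simp only: of_nat_eq_iff)
    then show ?thesis using card_M by simp
  qed
  have inj: "inj_on \<Phi> (filling_lists m ds \<mu>)"
  proof (rule inj_onI)
    fix xs ys assume xy: "xs \<in> filling_lists m ds \<mu>" "ys \<in> filling_lists m ds \<mu>" "\<Phi> xs = \<Phi> ys"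
    have len: "length xs = k" "length ys = k" using xy by (auto simp: fl)
    have "xs ! j = ys ! j" if "j < k" for j
    proof -
      have "K j \<subseteq> \<Phi> xs i \<longleftrightarrow> K j \<subseteq> \<Phi> ys i" for i using xy(3) by simp
      then have "xs ! j < i \<longleftrightarrow> ys ! j < i" for i using that by (simp add: \<Phi>_def K_subset_psum_iff)
      from this[of "xs ! j"] this[of "ys ! j"] show ?thesis by simp
    qed
    then show "xs = ys" using len by (intro nth_equalityI) auto
  qed
  have "\<Phi> xs \<in> {W \<in> flags m ?\<mu>. \<forall>i. T ` W i = W i}" if xs: "xs \<in> filling_lists m ds \<mu>" for xs
  proof -
    have inv: "invariant (\<Phi> xs i)" for i by (simp add: \<Phi>_def psum_invariant)
    then have sub: "subsp (\<Phi> xs i)" for i by (simp add: invariant_def)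
    have "\<Phi> xs i \<subseteq> \<Phi> xs (Suc i)" for i unfolding \<Phi>_def by (rule psum_mono) auto
    moreover have "card (\<Phi> xs i) = q ^ (\<Sum>l<min i m. ?\<mu> l)" for i
    proof -
      have "(\<Sum>l<min i m. ?\<mu> l) = (\<Sum>l<min i m. \<Sum>j<k. if xs ! j = l then deg j else 0)"
        using xs by (intro sum.cong refl) (auto simp: fl)
      also have "\<dots> = (\<Sum>j\<in>{j. j < k \<and> xs ! j < i}. deg j)" using xs by (intro sum_level) (auto simp: fl)
      finally show ?thesis by (simp add: \<Phi>_def psum_Collect)
    qed
    ultimately show ?thesis using sub inv fixed_iff_invariant by (auto simp: flags_def)
  qed
  moreover have "W \<in> \<Phi> ` filling_lists m ds \<mu>" if W: "W \<in> flags m ?\<mu>" "\<forall>i. T ` W i = W i" for W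
  proof -
    have sub: "subsp (W i)" for i using W(1) by (auto simp: flags_def)
    have inv: "invariant (W i)" for i using W(2) fixed_iff_invariant[OF sub] by blast
    \<comment> \<open>Step \<open>i\<close> leads from \<open>W i\<close> to
      \<open>W (Suc i)\<close>, so the step of \<open>K j\<close> is the least \<open>i\<close> for
      which \<open>W (Suc i)\<close> contains it.\<close>
    define xs where "xs = map (\<lambda>j. LEAST i. K j \<subseteq> W (Suc i)) [0..<k]"
    have len: "length xs = k" by (simp add: xs_def)
    have top: "K j \<subseteq> W m" if "j < k" for j
      using flags_top[OF W(1) card_M' order_refl] K_subsp[OF that] by (simp add: subsp_def)
    have W0: "W 0 = {\<zero>\<^bsub>M\<^esub>}" using flags_0[OF W(1)] .
    have xs_iff: "K j \<subseteq> W i \<longleftrightarrow> xs ! j < i" if j: "j < k" for i j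
    proof
      have xj: "xs ! j = (LEAST i. K j \<subseteq> W (Suc i))" using j by (simp add: xs_def)
      {
        assume "K j \<subseteq> W i"
        moreover from this have "i \<noteq> 0" using K_subset_zero[OF j] W0 by (cases i) auto
        ultimately obtain i' where "i = Suc i'" "K j \<subseteq> W (Suc i')" by (cases i) auto
        then show "xs ! j < i" using Least_le[of "\<lambda>i. K j \<subseteq> W (Suc i)" i'] xj by simp
      }
      assume i: "xs ! j < i"
      have "m \<noteq> 0" using top[OF j] W0 K_subset_zero[OF j] by (cases m) auto
      then obtain m' where "m = Suc m'" by (cases m) auto
      then have "K j \<subseteq> W (Suc (xs ! j))" using LeastI[of "\<lambda>i. K j \<subseteq> W (Suc i)" m'] top[OF j] xj by simp
      moreover have "W (Suc (xs ! j)) \<subseteq> W i" using i by (intro flags_mono[OF W(1)]) simp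
      ultimately show "K j \<subseteq> W i" by blast
    qed
    have W_eq: "W = \<Phi> xs"
    proof
      fix i
      have "W i = psum {j. j < k \<and> K j \<subseteq> W i} k" by (rule invariant_eq_psum[OF inv])
      also have "{j. j < k \<and> K j \<subseteq> W i} = {j. j < k \<and> xs ! j < i}" using xs_iff by auto
      finally show "W i = \<Phi> xs i" by (simp add: \<Phi>_def)
    qed
    have set: "set xs \<subseteq> {..<m}" using xs_iff top len by (auto simp: in_set_conv_nth)
    have level: "(\<Sum>l<i. ?\<mu> l) = (\<Sum>l<i. \<Sum>j<k. if xs ! j = l then deg j else 0)" if "i \<le> m" for i
    proof -
      have "q ^ (\<Sum>l<i. ?\<mu> l) = card (W i)" using W(1) that by (simp add: flags_def min_absorb1)
      also have "\<dots> = q ^ (\<Sum>j\<in>{j. j < k \<and> xs ! j < i}. deg j)" by (simp add: W_eq \<Phi>_def psum_Collect)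
      finally have "(\<Sum>l<i. ?\<mu> l) = (\<Sum>j\<in>{j. j < k \<and> xs ! j < i}. deg j)" using q_ge_2 by (simp add: power_inject_exp)
      then show ?thesis using sum_level[OF len set, of i] that by (simp add: min_absorb1)
    qed
    have "(\<Sum>j<k. if xs ! j = i then deg j else 0) = ?\<mu> i" if "i < m" for i
    proof -
      have "(\<Sum>l<i. ?\<mu> l) + ?\<mu> i = (\<Sum>l<i. \<Sum>j<k. if xs ! j = l then deg j else 0) + (\<Sum>j<k. if xs ! j = i then deg j else 0)"
        using level[of "Suc i"] that by (simp only: sum.lessThan_Suc Suc_leI)
      then show ?thesis using level[of i] that by linarith
    qed
    then have "xs \<in> filling_lists m ds \<mu>" using len set by (simp add: fl)
    then show ?thesis unfolding W_eq by (rule imageI)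
  qed
  ultimately have "\<Phi> ` filling_lists m ds \<mu> = {W \<in> flags m ?\<mu>. \<forall>i. T ` W i = W i}"
    by (intro equalityI image_subsetI subsetI) auto
  then show ?thesis using inj by (simp only: bij_betw_def \<Phi>_def[abs_def] ds_def simp_thms)
qed

lemma card_fixed_flags:
  assumes "\<And>i. i < m \<Longrightarrow> 0 \<le> \<mu> i" "(\<Sum>i<m. \<mu> i) = int n"
  shows "int (card {W \<in> flags m (\<lambda>i. nat (\<mu> i)). \<forall>i. T ` W i = W i}) = fillings m (map (\<lambda>f. length f - 1) fs) \<mu>"
  using bij_betw_same_card[OF bij_betw_fixed_flags[OF assms]] card_filling_lists by metis

end

context finite_field_dim
begin

lemma perm_char_eq_fillings:
  assumes "primary_operator F (vec_module F n) (mat_vec F g) fs n" "(\<Sum>i<m. \<mu> i) = int n"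
  shows "perm_char m \<mu> g = of_int (fillings m (map (\<lambda>f. length f - 1) fs) \<mu>)"
proof -
  interpret primary_operator F "vec_module F n" "mat_vec F g" fs n by fact
  show ?thesis
  proof (cases "\<forall>i<m. 0 \<le> \<mu> i")
    case True
    then have "int (card {W \<in> V.flags m (\<lambda>i. nat (\<mu> i)). \<forall>i. mat_vec F g ` W i = W i}) = fillings m (map (\<lambda>f. length f - 1) fs) \<mu>"
      using card_fixed_flags[of m \<mu>] assms(2) by blast
    then have "complex_of_int (int (card {W \<in> V.flags m (\<lambda>i. nat (\<mu> i)). \<forall>i. mat_vec F g ` W i = W i})) =
       of_int (fillings m (map (\<lambda>f. length f - 1) fs) \<mu>)" by simp
    then show ?thesis
      using True assms(2) by (simp add: perm_char_def fixed_count_def act_flag_def fun_eq_iff)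
  next
    case False
    have "filling_lists m (map (\<lambda>f. length f - 1) fs) \<mu> = {}"
    proof (rule ccontr)
      assume "filling_lists m (map (\<lambda>f. length f - 1) fs) \<mu> \<noteq> {}"
      then obtain xs where xs: "xs \<in> filling_lists m (map (\<lambda>f. length f - 1) fs) \<mu>" by blast
      have "0 \<le> \<mu> i" if "i < m" for i
      proof -
        have "\<mu> i = (\<Sum>j<k. if xs ! j = i then int (map (\<lambda>f. length f - 1) fs ! j) else 0)"
          using xs that by (simp add: filling_lists_def del: One_nat_def)
        then show ?thesis by (auto intro!: sum_nonneg)
      qed
      then show False using False by blast
    qed
    then have "fillings m (map (\<lambda>f. length f - 1) fs) \<mu> = 0"
      using card_filling_lists[of m "map (\<lambda>f. length f - 1) fs" \<mu>] by simp
    then show ?thesis using False by (auto simp: perm_char_def)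
  qed
qed

end

section \<open>Characteristic polynomials\<close>

lemma (in ring_hom_cring) det_over_hom:
  assumes "A \<in> mats R n n"
  shows "h (det_over R A) = det_over S (map_mat h A)"
proof -
  have dims: "dim_row A = n" "dim_col A = n" using mats_carrier_mat[OF assms] by auto
  have per: "\<sigma> i < n" if "\<sigma> permutes {0..<n}" "i < n" for \<sigma> i
    using permutes_in_image[OF that(1), of i] that(2) by simp
  have ent: "A $$ (i, \<sigma> i) \<in> carrier R" if "\<sigma> permutes {0..<n}" "i < n" for \<sigma> i
    using mats_index[OF assms] per that by blast
  have prods: "h (\<Otimes>i\<in>{0..<n}. A $$ (i, \<sigma> i)) = (\<Otimes>\<^bsub>S\<^esub>i\<in>{0..<n}. map_mat h A $$ (i, \<sigma> i))"
    if "\<sigma> permutes {0..<n}" for \<sigma>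
    using ent[OF that] per[OF that] dims
    by (subst hom_finprod) (auto intro!: S.finprod_cong')
  have pc: "(\<Otimes>i\<in>{0..<n}. A $$ (i, \<sigma> i)) \<in> carrier R" if "\<sigma> permutes {0..<n}" for \<sigma>
    using ent[OF that] by (intro R.finprod_closed) auto
  have pc': "(\<Otimes>\<^bsub>S\<^esub>i\<in>{0..<n}. map_mat h A $$ (i, \<sigma> i)) \<in> carrier S" if "\<sigma> permutes {0..<n}" for \<sigma>
    using prods[OF that, symmetric] pc[OF that] by simp
  show ?thesis
    unfolding det_over_def dims index_map_mat(2)
    using pc pc' prods by (subst hom_finsum) (auto intro!: S.finsum_cong')
qed

context field
begin

abbreviation "\<kappa> \<equiv> poly_of_const"

lemma const_ring_hom_cring: "ring_hom_cring R (poly_ring R) \<kappa>"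
  using canonical_embedding_ring_hom[OF carrier_is_subring] domain.axioms(1)[OF poly_ring_domain] is_cring
  by (simp add: ring_hom_cring_def ring_hom_cring_axioms_def ring_hom_ring_def ring_hom_ring_axioms_def)

lemma length_finsum_le:
  assumes "\<And>i. i \<in> I \<Longrightarrow> f i \<in> carrier (poly_ring R) \<and> length (f i) \<le> N"
  shows "length (\<Oplus>\<^bsub>poly_ring R\<^esub>i\<in>I. f i) \<le> N"
proof -
  interpret UP: domain "poly_ring R" by (rule poly_ring_domain)
  show ?thesis using assms
  proof (induction I rule: infinite_finite_induct)
    case (insert x I)
    have "length (f x \<oplus>\<^bsub>poly_ring R\<^esub> (\<Oplus>\<^bsub>poly_ring R\<^esub>i\<in>I. f i)) \<le> max (length (f x)) (length (\<Oplus>\<^bsub>poly_ring R\<^esub>i\<in>I. f i))"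
      unfolding univ_poly_add by (rule poly_add_length_le)
    also have "\<dots> \<le> N" using insert by auto
    finally show ?case using insert by (subst UP.finsum_insert) auto
  qed (auto simp: univ_poly_zero)
qed

lemma length_mult_le:
  assumes "p \<in> carrier (poly_ring R)" "s \<in> carrier (poly_ring R)"
  shows "length (p \<otimes>\<^bsub>poly_ring R\<^esub> s) \<le> length p + length s - 1"
proof (cases "p \<otimes>\<^bsub>poly_ring R\<^esub> s = []")
  case False
  have "length (p \<otimes>\<^bsub>poly_ring R\<^esub> s) - 1 = (if p = [] \<or> s = [] then 0 else (length p - 1) + (length s - 1))"
    using poly_mult_degree_eq[OF carrier_is_subring] assms by (simp add: univ_poly_mult univ_poly_carrier)
  moreover have "p \<noteq> []" "s \<noteq> []"
    using False domain.m_lcancel domain.integral_iff[OF poly_ring_domain assms] by (auto simp: univ_poly_zero)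
  ultimately show ?thesis using False by (cases p; cases s) auto
qed simp

lemma length_finprod_le:
  assumes "finite I" "\<And>i. i \<in> I \<Longrightarrow> f i \<in> carrier (poly_ring R) \<and> length (f i) \<le> 2"
  shows "length (\<Otimes>\<^bsub>poly_ring R\<^esub>i\<in>I. f i) \<le> card I + 1"
proof -
  interpret UP: domain "poly_ring R" by (rule poly_ring_domain)
  show ?thesis using assms
  proof (induction I rule: finite_induct)
    case (insert x I)
    have c: "(\<Otimes>\<^bsub>poly_ring R\<^esub>i\<in>I. f i) \<in> carrier (poly_ring R)" using insert by (intro UP.finprod_closed) auto
    have "length (f x \<otimes>\<^bsub>poly_ring R\<^esub> (\<Otimes>\<^bsub>poly_ring R\<^esub>i\<in>I. f i)) \<le> length (f x) + length (\<Otimes>\<^bsub>poly_ring R\<^esub>i\<in>I. f i) - 1"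
      using insert c by (intro length_mult_le) auto
    also have "\<dots> \<le> card (insert x I) + 1" using insert by fastforce
    finally show ?case using insert by (subst UP.finprod_insert) auto
  qed (auto simp: univ_poly_one)
qed

lemma length_det_over_le:
  assumes A: "A \<in> mats (poly_ring R) n n" and len: "\<And>i j. i < n \<Longrightarrow> j < n \<Longrightarrow> length (A $$ (i, j)) \<le> 2"
  shows "length (det_over (poly_ring R) A) \<le> n + 1"
proof -
  interpret UP: domain "poly_ring R" by (rule poly_ring_domain)
  have dims: "dim_row A = n" using mats_carrier_mat[OF A] by auto
  have per: "\<sigma> i < n" if "\<sigma> permutes {0..<n}" "i < n" for \<sigma> i
    using permutes_in_image[OF that(1), of i] that(2) by simp
  have "(\<Otimes>\<^bsub>poly_ring R\<^esub>i\<in>{0..<n}. A $$ (i, \<sigma> i)) \<in> carrier (poly_ring R)" if "\<sigma> permutes {0..<n}" for \<sigma>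
    using mats_index[OF A] per[OF that] by (intro UP.finprod_closed) auto
  moreover have "length (\<Otimes>\<^bsub>poly_ring R\<^esub>i\<in>{0..<n}. A $$ (i, \<sigma> i)) \<le> n + 1" if "\<sigma> permutes {0..<n}" for \<sigma>
    using length_finprod_le[of "{0..<n}" "\<lambda>i. A $$ (i, \<sigma> i)"] mats_index[OF A] per[OF that] len by simp
  ultimately show ?thesis
    unfolding det_over_def dims
    by (intro length_finsum_le) (auto simp: univ_poly_a_inv_length[OF carrier_is_subring])
qed

text \<open>One step of Horner's scheme; the last entry of a coefficient list is the constant
  term.\<close>

lemma poly_snoc:
  assumes "p @ [a] \<in> carrier (poly_ring R)"
  shows "p \<in> carrier (poly_ring R)" "a \<in> carrier R" "p @ [a] = (X \<otimes>\<^bsub>poly_ring R\<^esub> p) \<oplus>\<^bsub>poly_ring R\<^esub> \<kappa> a"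
proof -
  interpret UP: domain "poly_ring R" by (rule poly_ring_domain)
  interpret C: ring_hom_cring R "poly_ring R" \<kappa> by (rule const_ring_hom_cring)
  have pol: "polynomial (carrier R) (p @ [a])" using assms by (simp add: univ_poly_carrier)
  show a: "a \<in> carrier R" using polynomial_incl[OF pol] by simp
  show p: "p \<in> carrier (poly_ring R)"
    using pol unfolding univ_poly_carrier[symmetric] polynomial_def by (cases p) auto
  have sp: "set p \<subseteq> carrier R" using polynomial_incl[OF pol] by simp
  have Xc: "X \<in> carrier (poly_ring R)" by (rule var_closed(1)[OF carrier_is_subring])
  have X: "X \<otimes>\<^bsub>poly_ring R\<^esub> p = normalize (p @ [\<zero>])"
    unfolding univ_poly_mult by (rule poly_mult_var'(1)[OF sp])
  have "coeff ((X \<otimes>\<^bsub>poly_ring R\<^esub> p) \<oplus>\<^bsub>poly_ring R\<^esub> \<kappa> a) = (\<lambda>i. coeff (p @ [\<zero>]) i \<oplus> coeff [a] i)"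
    unfolding X univ_poly_add poly_of_const_def
    using sp a normalize_in_carrier[of "p @ [\<zero>]"] normalize_in_carrier[of "[a]"]
    by (subst poly_add_coeff) (auto simp del: normalize.simps simp flip: normalize_coeff)
  also have "\<dots> = coeff (p @ [a])"
    using sp a by (auto simp: append_coeff fun_eq_iff)
  finally have eq: "coeff ((X \<otimes>\<^bsub>poly_ring R\<^esub> p) \<oplus>\<^bsub>poly_ring R\<^esub> \<kappa> a) = coeff (p @ [a])" .
  have "polynomial (carrier R) ((X \<otimes>\<^bsub>poly_ring R\<^esub> p) \<oplus>\<^bsub>poly_ring R\<^esub> \<kappa> a)"
    using Xc p a unfolding univ_poly_carrier by simp
  then show "p @ [a] = (X \<otimes>\<^bsub>poly_ring R\<^esub> p) \<oplus>\<^bsub>poly_ring R\<^esub> \<kappa> a"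
    using coeff_iff_polynomial_cond[OF _ pol] eq by metis
qed

definition char_mat :: "nat \<Rightarrow> 'a mat \<Rightarrow> 'a list mat" where
  "char_mat n g = mat n n (\<lambda>(i, j). (if i = j then X else \<zero>\<^bsub>poly_ring R\<^esub>) \<ominus>\<^bsub>poly_ring R\<^esub> \<kappa> (g $$ (i, j)))"

lemma char_poly_over_eq: "g \<in> mats R n n \<Longrightarrow> char_poly_over R g = det_over (poly_ring R) (char_mat n g)"
  using mats_carrier_mat[of g R n n] by (auto simp: char_poly_over_def char_mat_def)

lemma char_mat_mats:
  assumes "g \<in> mats R n n"
  shows "char_mat n g \<in> mats (poly_ring R) n n"
proof -
  interpret UP: domain "poly_ring R" by (rule poly_ring_domain)
  interpret C: ring_hom_cring R "poly_ring R" \<kappa> by (rule const_ring_hom_cring)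
  show ?thesis
    using mats_index[OF assms] var_closed(1)[OF carrier_is_subring] by (auto simp: mats_def char_mat_def)
qed

lemma char_poly_over_closed: "g \<in> mats R n n \<Longrightarrow> char_poly_over R g \<in> carrier (poly_ring R)"
  unfolding char_poly_over_eq
  by (rule cring.det_over_closed[OF domain.axioms(1)[OF poly_ring_domain] char_mat_mats])

text \<open>This limits the sum of the degrees of the factors by \<open>n\<close>, to be played off
  against the lower bound that comes from the \<open>n\<close> distinct roots.\<close>

lemma length_char_poly_over_le:
  assumes g: "g \<in> mats R n n"
  shows "length (char_poly_over R g) \<le> n + 1"
  unfolding char_poly_over_eq[OF g]
proof (rule length_det_over_le[OF char_mat_mats[OF g]])
  interpret UP: domain "poly_ring R" by (rule poly_ring_domain)
  interpret C: ring_hom_cring R "poly_ring R" \<kappa> by (rule const_ring_hom_cring)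
  fix i j assume ij: "i < n" "j < n"
  let ?x = "if i = j then X else \<zero>\<^bsub>poly_ring R\<^esub>"
  have g': "g $$ (i, j) \<in> carrier R" using mats_index[OF g ij] .
  have l: "length (\<kappa> (g $$ (i, j))) \<le> 2" using normalize_length_le[of "[g $$ (i, j)]"] by (simp add: poly_of_const_def)
  have "length (char_mat n g $$ (i, j)) \<le> max (length ?x) (length (\<ominus>\<^bsub>poly_ring R\<^esub> \<kappa> (g $$ (i, j))))"
    using ij by (simp add: char_mat_def UP.minus_eq) (simp add: univ_poly_add poly_add_length_le del: poly_add.simps)
  also have "\<dots> \<le> 2"
    using l g' by (simp add: univ_poly_a_inv_length[OF carrier_is_subring] var_def univ_poly_zero)
  finally show "length (char_mat n g $$ (i, j)) \<le> 2" .
qed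

end

context finite_field_dim
begin

lemma mat_vec_linear_operator:
  assumes g: "g \<in> mats F n n"
  shows "linear_operator F VM (mat_vec F g)"
  by unfold_locales (use g in \<open>auto intro: mat_vec_closed simp: mat_vec_add mat_vec_smult\<close>)

abbreviation "PR \<equiv> poly_ring F"

lemma char_mat_const:
  assumes g: "g \<in> mats F n n" and w: "w \<in> carrier VM" and i: "i < n"
  shows "mat_vec PR (char_mat n g) (map_vec \<kappa> w) $ i = (X \<otimes>\<^bsub>PR\<^esub> \<kappa> (w $ i)) \<ominus>\<^bsub>PR\<^esub> \<kappa> (mat_vec F g w $ i)"
proof -
  interpret UP: domain PR by (rule poly_ring_domain)
  interpret C: ring_hom_cring F PR \<kappa> by (rule const_ring_hom_cring)
  have X: "X \<in> carrier PR" by (rule var_closed(1)[OF carrier_is_subring])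
  have wc: "dim_vec w = n" "\<And>l. l < n \<Longrightarrow> w $ l \<in> carrier F" using w by (auto simp: vec_module_simps)
  have gc: "g $$ (i, l) \<in> carrier F" if "l < n" for l using mats_index[OF g i that] .
  have "mat_vec PR (char_mat n g) (map_vec \<kappa> w) $ i =
      (\<Oplus>\<^bsub>PR\<^esub>l\<in>{0..<n}. char_mat n g $$ (i, l) \<otimes>\<^bsub>PR\<^esub> map_vec \<kappa> w $ l)"
    by (rule mat_vec_index[OF char_mat_mats[OF g]]) (use wc i in auto)
  also have "\<dots> = (\<Oplus>\<^bsub>PR\<^esub>l\<in>{0..<n}. (if i = l then X \<otimes>\<^bsub>PR\<^esub> \<kappa> (w $ l) else \<zero>\<^bsub>PR\<^esub>) \<oplus>\<^bsub>PR\<^esub> \<ominus>\<^bsub>PR\<^esub> \<kappa> (g $$ (i, l) \<otimes> w $ l))"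
    using wc gc i X
    by (intro UP.finsum_cong') (auto simp: char_mat_def UP.minus_eq UP.l_distr UP.l_minus)
  also have "\<dots> = (\<Oplus>\<^bsub>PR\<^esub>l\<in>{0..<n}. if i = l then X \<otimes>\<^bsub>PR\<^esub> \<kappa> (w $ l) else \<zero>\<^bsub>PR\<^esub>) \<oplus>\<^bsub>PR\<^esub>
      (\<Oplus>\<^bsub>PR\<^esub>l\<in>{0..<n}. \<ominus>\<^bsub>PR\<^esub> \<kappa> (g $$ (i, l) \<otimes> w $ l))"
    using wc gc X by (intro UP.finsum_addf) auto
  also have "(\<Oplus>\<^bsub>PR\<^esub>l\<in>{0..<n}. if i = l then X \<otimes>\<^bsub>PR\<^esub> \<kappa> (w $ l) else \<zero>\<^bsub>PR\<^esub>) = X \<otimes>\<^bsub>PR\<^esub> \<kappa> (w $ i)"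
    using wc X i by (intro UP.finsum_singleton) auto
  also have "(\<Oplus>\<^bsub>PR\<^esub>l\<in>{0..<n}. \<ominus>\<^bsub>PR\<^esub> \<kappa> (g $$ (i, l) \<otimes> w $ l)) = \<ominus>\<^bsub>PR\<^esub> \<kappa> (\<Oplus>l\<in>{0..<n}. g $$ (i, l) \<otimes> w $ l)"
  proof -
    have "(\<Oplus>\<^bsub>PR\<^esub>l\<in>{0..<n}. \<ominus>\<^bsub>PR\<^esub> \<kappa> (g $$ (i, l) \<otimes> w $ l)) = (\<Oplus>\<^bsub>PR\<^esub>l\<in>{0..<n}. \<kappa> (\<ominus> (g $$ (i, l) \<otimes> w $ l)))"
      using wc gc by (intro UP.finsum_cong') auto
    also have "\<dots> = \<kappa> (\<Oplus>l\<in>{0..<n}. \<ominus> (g $$ (i, l) \<otimes> w $ l))"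
      using wc gc by (subst C.hom_finsum) (auto simp: o_def)
    also have "(\<Oplus>l\<in>{0..<n}. \<ominus> (g $$ (i, l) \<otimes> w $ l)) = (\<Oplus>l\<in>{0..<n}. (\<ominus> \<one>) \<otimes> (g $$ (i, l) \<otimes> w $ l))"
      using wc gc by (intro finsum_cong') (auto simp: l_minus)
    also have "\<dots> = (\<ominus> \<one>) \<otimes> (\<Oplus>l\<in>{0..<n}. g $$ (i, l) \<otimes> w $ l)"
      using wc gc by (intro finsum_rdistr[symmetric]) auto
    also have "\<dots> = \<ominus> (\<Oplus>l\<in>{0..<n}. g $$ (i, l) \<otimes> w $ l)"
      using wc gc by (simp add: l_minus Pi_def finsum_closed)
    finally show ?thesis using wc gc by (simp add: Pi_def finsum_closed)
  qed
  also have "(\<Oplus>l\<in>{0..<n}. g $$ (i, l) \<otimes> w $ l) = mat_vec F g w $ i"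
    using mat_vec_index[OF g wc(1) i] by simp
  finally show ?thesis by (simp add: UP.minus_eq)
qed

text \<open>Division of \<open>r\<close> by \<open>t - g\<close> with remainder \<open>r(g)\<close>.\<close>

lemma char_mat_division:
  assumes g: "g \<in> mats F n n" and v: "v \<in> carrier VM" and r: "r \<in> carrier PR"
  shows "\<exists>c\<in>carrier (vec_module PR n). \<forall>i<n. r \<otimes>\<^bsub>PR\<^esub> \<kappa> (v $ i) =
    mat_vec PR (char_mat n g) c $ i \<oplus>\<^bsub>PR\<^esub> \<kappa> (linear_operator.pact VM (mat_vec F g) r v $ i)"
proof -
  interpret UP: domain PR by (rule poly_ring_domain)
  interpret C: ring_hom_cring F PR \<kappa> by (rule const_ring_hom_cring)
  interpret L: linear_operator F VM "mat_vec F g" by (rule mat_vec_linear_operator[OF g])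
  note A = char_mat_mats[OF g]
  have vc: "\<And>l. l < n \<Longrightarrow> v $ l \<in> carrier F" using v by (auto simp: vec_module_simps)
  have X: "X \<in> carrier PR" by (rule var_closed(1)[OF carrier_is_subring])
  show ?thesis using r
  \<comment> \<open>Induction from the end of the list splits off the constant term, as in Horner's
    scheme.\<close>
  proof (induction r rule: rev_induct)
    case Nil
    let ?z = "\<zero>\<^bsub>vec_module PR n\<^esub>"
    interpret PV: module PR "vec_module PR n" by (rule UP.module_vec_module)
    have "mat_vec PR (char_mat n g) ?z = \<zero>\<^bsub>PR\<^esub> \<odot>\<^bsub>vec_module PR n\<^esub> mat_vec PR (char_mat n g) ?z"
      using UP.mat_vec_smult[OF A UP.zero_closed, of ?z] by simp
    then have "mat_vec PR (char_mat n g) ?z = ?z" using UP.mat_vec_closed[OF A, of ?z] by simp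
    moreover have "[] \<otimes>\<^bsub>PR\<^esub> \<kappa> (v $ i) = \<zero>\<^bsub>PR\<^esub>" if "i < n" for i
      using UP.l_null[of "\<kappa> (v $ i)"] vc[OF that] by (simp add: univ_poly_zero)
    ultimately show ?case
      using vc by (intro bexI[of _ ?z]) (auto simp: vec_module_simps)
  next
    case (snoc a p)
    note p = poly_snoc[OF snoc.prems]
    obtain c where c: "c \<in> carrier (vec_module PR n)"
      "\<And>i. i < n \<Longrightarrow> p \<otimes>\<^bsub>PR\<^esub> \<kappa> (v $ i) = mat_vec PR (char_mat n g) c $ i \<oplus>\<^bsub>PR\<^esub> \<kappa> (L.pact p v $ i)"
      using snoc.IH[OF p(1)] by blast
    define w where "w = L.pact p v"
    have w: "w \<in> carrier VM" using L.P_carrier_set[OF p(1)] v by (simp add: w_def)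
    have wc: "dim_vec w = n" "\<And>l. l < n \<Longrightarrow> w $ l \<in> carrier F" using w by (auto simp: vec_module_simps)
    have \<kappa>w: "map_vec \<kappa> w \<in> carrier (vec_module PR n)" using wc by (auto simp: vec_module_simps)
    have gw: "mat_vec F g w \<in> carrier VM" using g w by (rule mat_vec_closed)
    \<comment> \<open>From \<open>p v = (X - g) c + w\<close> and
      \<open>X w = (X - g) w + g w\<close> one gets
      \<open>(X p + a) v = (X - g) (X c + w) + (g w + a v)\<close>, so the quotient is
      \<open>X c + w\<close>.\<close>
    define c' where "c' = X \<odot>\<^bsub>vec_module PR n\<^esub> c \<oplus>\<^bsub>vec_module PR n\<^esub> map_vec \<kappa> w"
    interpret PV: module PR "vec_module PR n" by (rule UP.module_vec_module)
    have "(p @ [a]) \<otimes>\<^bsub>PR\<^esub> \<kappa> (v $ i) = mat_vec PR (char_mat n g) c' $ i \<oplus>\<^bsub>PR\<^esub> \<kappa> (L.pact (p @ [a]) v $ i)" if i: "i < n" for i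
    proof -
      define Ac where "Ac = mat_vec PR (char_mat n g) c $ i"
      have Ac: "Ac \<in> carrier PR" using UP.mat_vec_closed[OF A c(1)] i by (simp add: Ac_def vec_module_simps)
      have gwi: "mat_vec F g w $ i \<in> carrier F" using gw i by (simp add: vec_module_simps)
      have "mat_vec PR (char_mat n g) c' = X \<odot>\<^bsub>vec_module PR n\<^esub> mat_vec PR (char_mat n g) c
          \<oplus>\<^bsub>vec_module PR n\<^esub> mat_vec PR (char_mat n g) (map_vec \<kappa> w)"
        unfolding c'_def using c(1) \<kappa>w X by (simp add: UP.mat_vec_add[OF A] UP.mat_vec_smult[OF A])
      then have 1: "mat_vec PR (char_mat n g) c' $ i = (X \<otimes>\<^bsub>PR\<^esub> Ac) \<oplus>\<^bsub>PR\<^esub> ((X \<otimes>\<^bsub>PR\<^esub> \<kappa> (w $ i)) \<ominus>\<^bsub>PR\<^esub> \<kappa> (mat_vec F g w $ i))"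
        using i char_mat_const[OF g w i] by (simp add: vec_module_simps Ac_def)
      have "L.pact (p @ [a]) v = mat_vec F g w \<oplus>\<^bsub>VM\<^esub> a \<odot>\<^bsub>VM\<^esub> v"
        using L.pact_snoc[OF L.P_carrier_set[OF p(1)] p(2) v] by (simp add: w_def)
      then have 2: "\<kappa> (L.pact (p @ [a]) v $ i) = \<kappa> (mat_vec F g w $ i) \<oplus>\<^bsub>PR\<^esub> (\<kappa> a \<otimes>\<^bsub>PR\<^esub> \<kappa> (v $ i))"
        using i gwi vc p(2) by (simp add: vec_module_simps)
      have "(p @ [a]) \<otimes>\<^bsub>PR\<^esub> \<kappa> (v $ i) = (X \<otimes>\<^bsub>PR\<^esub> (p \<otimes>\<^bsub>PR\<^esub> \<kappa> (v $ i))) \<oplus>\<^bsub>PR\<^esub> (\<kappa> a \<otimes>\<^bsub>PR\<^esub> \<kappa> (v $ i))"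
        unfolding p(3) using X p(1,2) vc[OF i] by (simp add: UP.l_distr UP.m_assoc)
      also have "p \<otimes>\<^bsub>PR\<^esub> \<kappa> (v $ i) = Ac \<oplus>\<^bsub>PR\<^esub> \<kappa> (w $ i)" using c(2)[OF i] by (simp add: Ac_def w_def)
      finally show ?thesis
        unfolding 1 2 using X Ac wc(2)[OF i] gwi p(2) vc[OF i]
        by (simp add: UP.r_distr UP.minus_eq UP.a_assoc UP.r_neg1)
    qed
    moreover have "c' \<in> carrier (vec_module PR n)" unfolding c'_def using c(1) \<kappa>w X by simp
    ultimately show ?case by blast
  qed
qed

text \<open>If \<open>f(g)\<close> were injective it would be onto, the space being finite. Solving
  \<open>f(g) v\<^sub>j = - e\<^sub>j\<close> for all unit vectors and dividing by
  \<open>X - g\<close> gives a matrix \<open>B\<close> with \<open>(X - g) B = 1 + f V\<close>.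
  Modulo the maximal ideal of \<open>f\<close> the right side has determinant 1, while the left side
  has determinant 0 because \<open>f\<close> divides the characteristic polynomial.\<close>

lemma kern_nontrivial:
  assumes g: "g \<in> mats F n n" and f: "f \<in> carrier PR" "ring_irreducible\<^bsub>PR\<^esub> f" "f pdivides char_poly_over F g"
  shows "\<exists>v\<in>linear_operator.kern VM (mat_vec F g) f. v \<noteq> \<zero>\<^bsub>VM\<^esub>"
proof (rule ccontr)
  assume triv: "\<not> ?thesis"
  interpret UP: principal_domain PR by (rule poly_ring_principal)
  interpret C: ring_hom_cring F PR \<kappa> by (rule const_ring_hom_cring)
  interpret L: linear_operator F VM "mat_vec F g" by (rule mat_vec_linear_operator[OF g])
  note A = char_mat_mats[OF g]
  have fset: "set f \<subseteq> carrier F" using L.P_carrier_set[OF f(1)] .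
  have "inj_on (L.pact f) (carrier VM)"
  proof (rule inj_onI)
    fix x y assume xy: "x \<in> carrier VM" "y \<in> carrier VM" "L.pact f x = L.pact f y"
    have "L.pact f (x \<oplus>\<^bsub>VM\<^esub> (\<ominus> \<one>) \<odot>\<^bsub>VM\<^esub> y) = L.pact f x \<oplus>\<^bsub>VM\<^esub> (\<ominus> \<one>) \<odot>\<^bsub>VM\<^esub> L.pact f y"
      using xy fset by (simp add: L.pact_add L.pact_smult)
    also have "\<dots> = \<zero>\<^bsub>VM\<^esub>" using xy(1,2) fset unfolding xy(3) by (simp add: V.minus_eq_smult[symmetric] V.M.r_neg)
    finally have "x \<oplus>\<^bsub>VM\<^esub> (\<ominus> \<one>) \<odot>\<^bsub>VM\<^esub> y = \<zero>\<^bsub>VM\<^esub>" using triv xy(1,2) by (auto simp: L.kern_def)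
    then show "x = y" using xy(1,2) by (simp add: V.minus_eq_smult[symmetric] V.M.minus_equality V.M.a_comm flip: V.M.minus_eq)
  qed
  then have "L.pact f ` carrier VM = carrier VM"
    using fset by (intro endo_inj_surj V.finite_M) auto
  \<comment> \<open>Negative unit vectors, so that the remainders become the identity matrix when
    moved to the other side.\<close>
  moreover define e where "e j = vec n (\<lambda>i. if i = j then \<ominus> \<one> else \<zero>)" for j
  have e: "e j \<in> carrier VM" for j by (auto simp: e_def vec_module_simps)
  ultimately have "\<exists>v\<in>carrier VM. L.pact f v = e j" for j by (metis imageE)
  then obtain v where v: "\<And>j. v j \<in> carrier VM" "\<And>j. L.pact f (v j) = e j" by metis
  then have "\<exists>c\<in>carrier (vec_module PR n). \<forall>i<n. f \<otimes>\<^bsub>PR\<^esub> \<kappa> (v j $ i) =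
      mat_vec PR (char_mat n g) c $ i \<oplus>\<^bsub>PR\<^esub> \<kappa> (e j $ i)" for j
    using char_mat_division[OF g v(1) f(1), of j] by simp
  then obtain c where c: "\<And>j. c j \<in> carrier (vec_module PR n)"
    "\<And>i j. i < n \<Longrightarrow> f \<otimes>\<^bsub>PR\<^esub> \<kappa> (v j $ i) = mat_vec PR (char_mat n g) (c j) $ i \<oplus>\<^bsub>PR\<^esub> \<kappa> (e j $ i)" by metis
  define B where "B = mat n n (\<lambda>(i, j). c j $ i)"
  have B: "B \<in> mats PR n n" using c(1) by (auto simp: mats_def B_def vec_module_simps)
  define D where "D = mat_mult_over PR (char_mat n g) B"
  have D: "D \<in> mats PR n n" using UP.mat_mult_over_closed[OF A B] by (simp add: D_def)
  have Dij: "D $$ (i, j) = (f \<otimes>\<^bsub>PR\<^esub> \<kappa> (v j $ i)) \<oplus>\<^bsub>PR\<^esub> (if i = j then \<one>\<^bsub>PR\<^esub> else \<zero>\<^bsub>PR\<^esub>)" if ij: "i < n" "j < n" for i j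
  proof -
    have cn: "dim_vec (c j) = n" using c(1) by (simp add: vec_module_simps)
    have cA: "mat_vec PR (char_mat n g) (c j) $ i \<in> carrier PR" using UP.mat_vec_closed[OF A c(1)] ij by (simp add: vec_module_simps)
    have "D $$ (i, j) = (\<Oplus>\<^bsub>PR\<^esub>l\<in>{0..<n}. char_mat n g $$ (i, l) \<otimes>\<^bsub>PR\<^esub> c j $ l)"
      using ij A B c(1) mats_carrier_mat[OF A] unfolding D_def mat_mult_over_def
      by (auto simp: B_def mats_def vec_module_simps intro!: UP.finsum_cong')
    also have "\<dots> = mat_vec PR (char_mat n g) (c j) $ i" using mat_vec_index[OF A cn ij(1)] by simp
    finally have "D $$ (i, j) = mat_vec PR (char_mat n g) (c j) $ i" .
    then show ?thesis
      unfolding c(2)[OF ij(1)] using cA ij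
      by (cases "i = j") (simp_all add: e_def UP.a_assoc UP.l_neg)
  qed
  let ?I = "PIdl\<^bsub>PR\<^esub> f"
  let ?Q = "PR Quot ?I"
  let ?h = "(+>\<^bsub>PR\<^esub>) ?I"
  have max: "maximalideal ?I PR" by (rule UP.irreducible_imp_maximalideal[OF f(1,2)])
  interpret Q: field ?Q by (rule maximalideal.quotient_is_field[OF max UP.is_cring])
  interpret I: ideal ?I PR using max by (rule maximalideal.axioms)
  interpret H: ring_hom_cring PR ?Q ?h
    using I.rcos_ring_hom UP.is_cring Q.is_cring by (simp add: ring_hom_cring_def ring_hom_cring_axioms_def)
  have hz: "?h x = \<zero>\<^bsub>?Q\<^esub>" if "x \<in> ?I" for x
  proof -
    have "?h x = ?I" by (rule I.a_rcos_const[OF that])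
    then show ?thesis by (simp only: FactRing_def ring.select_convs)
  qed
  have fI: "f \<in> ?I" using f(1) by (rule UP.cgenideal_self)
  have vc: "v j $ i \<in> carrier F" if "i < n" for i j using v(1)[of j] that by (simp add: vec_module_simps)
  have "map_mat ?h D = diag_over ?Q n (\<lambda>_. \<one>\<^bsub>?Q\<^esub>)"
  proof (rule eq_matI)
    fix i j assume "i < dim_row (diag_over ?Q n (\<lambda>_. \<one>\<^bsub>?Q\<^esub>))" "j < dim_col (diag_over ?Q n (\<lambda>_. \<one>\<^bsub>?Q\<^esub>))"
    then have ij: "i < n" "j < n" by (auto simp: diag_over_def)
    have "?h (D $$ (i, j)) = (?h f \<otimes>\<^bsub>?Q\<^esub> ?h (\<kappa> (v j $ i))) \<oplus>\<^bsub>?Q\<^esub> (if i = j then \<one>\<^bsub>?Q\<^esub> else \<zero>\<^bsub>?Q\<^esub>)"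
      unfolding Dij[OF ij] using f(1) vc[OF ij(1)] by simp
    also have "\<dots> = (if i = j then \<one>\<^bsub>?Q\<^esub> else \<zero>\<^bsub>?Q\<^esub>)"
      using hz[OF fI] H.hom_closed[OF C.hom_closed[OF vc[OF ij(1), of j]]] by simp
    finally show "map_mat ?h D $$ (i, j) = diag_over ?Q n (\<lambda>_. \<one>\<^bsub>?Q\<^esub>) $$ (i, j)"
      using ij mats_carrier_mat[OF D] by (simp add: diag_over_def)
  qed (use mats_carrier_mat[OF D] in \<open>auto simp: diag_over_def\<close>)
  then have "det_over ?Q (map_mat ?h D) = \<one>\<^bsub>?Q\<^esub>" by (simp add: Q.det_over_diag)
  then have "?h (det_over PR D) = \<one>\<^bsub>?Q\<^esub>" using H.det_over_hom[OF D] by simp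
  moreover have "det_over PR D = char_poly_over F g \<otimes>\<^bsub>PR\<^esub> det_over PR B"
    unfolding D_def char_poly_over_eq[OF g] by (rule UP.det_over_mult[OF A B])
  moreover have "char_poly_over F g \<in> ?I"
    using f(1,3) unfolding pdivides_def factor_def cgenideal_def by (auto simp: UP.m_comm)
  then have "?h (char_poly_over F g) = \<zero>\<^bsub>?Q\<^esub>" by (rule hz)
  ultimately have "\<zero>\<^bsub>?Q\<^esub> = \<one>\<^bsub>?Q\<^esub>"
    using char_poly_over_closed[OF g] UP.det_over_closed[OF B] H.hom_closed[OF UP.det_over_closed[OF B]] by simp
  then show False by simp
qed

end

section \<open>Regular semisimple elements\<close>

context field
begin

text \<open>In contrast to \<open>is_root\<close> the zero polynomial is not excluded; products then
  go to unions without side conditions.\<close>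

definition ext_roots :: "('c, 'd) ring_scheme \<Rightarrow> ('a \<Rightarrow> 'c) \<Rightarrow> 'a list \<Rightarrow> 'c set" where
  "ext_roots L h f = {x \<in> carrier L. ring.eval L (map h f) x = \<zero>\<^bsub>L\<^esub>}"

lemma ext_roots_mult:
  assumes L: "field L" "h \<in> Ring.ring_hom R L" and f: "f \<in> carrier (poly_ring R)" "g \<in> carrier (poly_ring R)"
  shows "ext_roots L h (f \<otimes>\<^bsub>poly_ring R\<^esub> g) = ext_roots L h f \<union> ext_roots L h g"
proof -
  interpret L: field L by fact
  interpret H: ring_hom_ring R L h using L(2) by unfold_locales
  have sets: "set f \<subseteq> carrier R" "set g \<subseteq> carrier R"
    using f polynomial_incl univ_poly_carrier by blast+
  then have sets': "set (map h f) \<subseteq> carrier L" "set (map h g) \<subseteq> carrier L" by auto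
  have sm: "set (map h (poly_mult f g)) \<subseteq> carrier L" using poly_mult_in_carrier[OF sets] by auto
  have "L.eval (map h (poly_mult f g)) x = L.eval (map h f) x \<otimes>\<^bsub>L\<^esub> L.eval (map h g) x" if x: "x \<in> carrier L" for x
    unfolding L.eval_normalize[OF sm x, symmetric] H.poly_mult_hom'[OF sets] by (rule L.eval_poly_mult[OF sets' x])
  moreover have "L.eval (map h f) x \<in> carrier L" "L.eval (map h g) x \<in> carrier L" if x: "x \<in> carrier L" for x
    using L.eval_in_carrier sets' x by auto
  ultimately show ?thesis unfolding ext_roots_def univ_poly_mult using L.integral_iff by auto
qed

lemma ext_roots_one:
  assumes "field L" "h \<in> Ring.ring_hom R L"
  shows "ext_roots L h \<one>\<^bsub>poly_ring R\<^esub> = {}"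
proof -
  interpret L: field L by fact
  show ?thesis using ring_hom_one[OF assms(2)] by (auto simp: ext_roots_def univ_poly_one)
qed

lemma ext_roots_mono:
  assumes "field L" "h \<in> Ring.ring_hom R L" "f \<in> carrier (poly_ring R)" "f pdivides g"
  shows "ext_roots L h f \<subseteq> ext_roots L h g"
  using assms ext_roots_mult[OF assms(1,2,3)] unfolding pdivides_def factor_def by auto

lemma hom_injective:
  assumes L: "field L" "h \<in> Ring.ring_hom R L"
  shows "inj_on h (carrier R)"
proof -
  interpret L: field L by fact
  interpret H: ring_hom_ring R L h using L(2) by unfold_locales
  show ?thesis
  proof (rule H.non_trivial_field_hom_imp_inj[OF field_axioms])
    have "\<one>\<^bsub>L\<^esub> \<in> h ` carrier R" using H.hom_one[symmetric] one_closed by (rule image_eqI)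
    then show "h ` carrier R \<noteq> {\<zero>\<^bsub>L\<^esub>}" using L.one_not_zero by blast
  qed
qed

lemma map_hom_closed:
  assumes L: "field L" "h \<in> Ring.ring_hom R L" and f: "f \<in> carrier (poly_ring R)" "f \<noteq> []"
  shows "map h f \<in> carrier (poly_ring L)"
proof -
  interpret L: field L by fact
  interpret H: ring_hom_ring R L h using L(2) by unfold_locales
  have sf: "set f \<subseteq> carrier R" "hd f \<noteq> \<zero>"
    using f unfolding univ_poly_carrier[symmetric] polynomial_def by auto
  have "h (hd f) \<noteq> \<zero>\<^bsub>L\<^esub>"
    using inj_onD[OF hom_injective[OF L], of "hd f" \<zero>] sf f(2) H.hom_zero by (auto dest: hd_in_set)
  then show ?thesis
    using sf f(2) unfolding univ_poly_carrier[symmetric] polynomial_def by (auto simp: hd_map)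
qed

lemma card_ext_roots:
  assumes L: "field L" "h \<in> Ring.ring_hom R L" and f: "f \<in> carrier (poly_ring R)" "f \<noteq> []"
  shows "finite (ext_roots L h f)" "card (ext_roots L h f) \<le> length f - 1"
proof -
  interpret L: field L by fact
  have hf: "map h f \<in> carrier (poly_ring L)" by (rule map_hom_closed[OF L f])
  have eq: "ext_roots L h f = set_mset (L.roots (map h f))"
    using f(2) by (auto simp: ext_roots_def L.roots_mem_iff_is_root[OF hf] L.is_root_def)
  show "finite (ext_roots L h f)" unfolding eq by simp
  have "card (ext_roots L h f) \<le> size (L.roots (map h f))"
    unfolding eq size_multiset_overloaded_eq
    using sum_mono[of "set_mset (L.roots (map h f))" "\<lambda>_. 1" "count (L.roots (map h f))"] by simp
  also have "\<dots> \<le> length f - 1" using L.size_roots_le_degree[OF hf] by simp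
  finally show "card (ext_roots L h f) \<le> length f - 1" .
qed

lemma foldr_mult_closed:
  "set fs \<subseteq> carrier (poly_ring R) \<Longrightarrow> foldr (\<otimes>\<^bsub>poly_ring R\<^esub>) fs \<one>\<^bsub>poly_ring R\<^esub> \<in> carrier (poly_ring R)"
proof -
  interpret UP: domain "poly_ring R" by (rule poly_ring_domain)
  show "set fs \<subseteq> carrier (poly_ring R) \<Longrightarrow> ?thesis" by (induction fs) auto
qed

lemma ext_roots_foldr:
  assumes "field L" "h \<in> Ring.ring_hom R L" "set fs \<subseteq> carrier (poly_ring R)"
  shows "ext_roots L h (foldr (\<otimes>\<^bsub>poly_ring R\<^esub>) fs \<one>\<^bsub>poly_ring R\<^esub>) = (\<Union>f\<in>set fs. ext_roots L h f)"
  using assms(3) by (induction fs) (auto simp: ext_roots_one[OF assms(1,2)] ext_roots_mult[OF assms(1,2)] foldr_mult_closed)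

lemma length_foldr_mult:
  assumes "set fs \<subseteq> carrier (poly_ring R) - {[]}"
  shows "foldr (\<otimes>\<^bsub>poly_ring R\<^esub>) fs \<one>\<^bsub>poly_ring R\<^esub> \<noteq> [] \<and>
    length (foldr (\<otimes>\<^bsub>poly_ring R\<^esub>) fs \<one>\<^bsub>poly_ring R\<^esub>) - 1 = (\<Sum>j<length fs. length (fs ! j) - 1)"
  using assms
proof (induction fs)
  case (Cons f fs)
  let ?r = "foldr (\<otimes>\<^bsub>poly_ring R\<^esub>) fs \<one>\<^bsub>poly_ring R\<^esub>"
  interpret UP: domain "poly_ring R" by (rule poly_ring_domain)
  have f: "f \<in> carrier (poly_ring R)" "f \<noteq> []" "set fs \<subseteq> carrier (poly_ring R)" using Cons.prems by auto
  have r: "?r \<in> carrier (poly_ring R)" by (rule foldr_mult_closed[OF f(3)])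
  have IH: "?r \<noteq> []" "length ?r - 1 = (\<Sum>j<length fs. length (fs ! j) - 1)" using Cons by auto
  have "f \<otimes>\<^bsub>poly_ring R\<^esub> ?r \<noteq> []"
    using UP.integral_iff[OF f(1) r] f(2) IH(1) by (simp add: univ_poly_zero)
  moreover have "length (f \<otimes>\<^bsub>poly_ring R\<^esub> ?r) - 1 = (length f - 1) + (length ?r - 1)"
    using poly_mult_degree_eq[OF carrier_is_subring, of f ?r] f r IH(1) by (simp add: univ_poly_mult univ_poly_carrier)
  moreover have "(\<Sum>j<length (f # fs). length ((f # fs) ! j) - 1) = (length f - 1) + (\<Sum>j<length fs. length (fs ! j) - 1)"
    by (simp add: sum.lessThan_Suc_shift del: sum.lessThan_Suc)
  ultimately show ?case unfolding IH(2) by simp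
qed (simp add: univ_poly_one)

lemma pdivides_foldr:
  assumes "f \<in> set fs" "set fs \<subseteq> carrier (poly_ring R)"
  shows "f pdivides foldr (\<otimes>\<^bsub>poly_ring R\<^esub>) fs \<one>\<^bsub>poly_ring R\<^esub>"
  using assms
proof (induction fs)
  case (Cons a fs)
  interpret UP: domain "poly_ring R" by (rule poly_ring_domain)
  let ?r = "foldr (\<otimes>\<^bsub>poly_ring R\<^esub>) fs \<one>\<^bsub>poly_ring R\<^esub>"
  have r: "?r \<in> carrier (poly_ring R)" "a \<in> carrier (poly_ring R)" using Cons.prems by (auto intro: foldr_mult_closed)
  show ?case
  proof (cases "f = a")
    case True
    then show ?thesis using r unfolding pdivides_def factor_def by auto
  next
    case False
    then obtain c where c: "c \<in> carrier (poly_ring R)" "?r = f \<otimes>\<^bsub>poly_ring R\<^esub> c"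
      using Cons unfolding pdivides_def factor_def by auto
    have f: "f \<in> carrier (poly_ring R)" using Cons.prems by auto
    have "a \<otimes>\<^bsub>poly_ring R\<^esub> ?r = f \<otimes>\<^bsub>poly_ring R\<^esub> (a \<otimes>\<^bsub>poly_ring R\<^esub> c)"
      unfolding c(2) using r c(1) f by (simp add: UP.m_lcomm)
    then show ?thesis using r c(1) unfolding pdivides_def factor_def by auto
  qed
qed simp

lemma irreducible_length:
  assumes "f \<in> carrier (poly_ring R)" "ring_irreducible\<^bsub>poly_ring R\<^esub> f"
  shows "2 \<le> length f"
  using pirreducible_degree[OF carrier_is_subfield assms] by simp

end

context finite_field_dim
begin

text \<open>The \<open>n\<close> distinct roots are covered by the root sets of the factors, which
  are at most as large as the degrees, and the degrees add up to at most \<open>n\<close>. If one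
  factor divided another, its roots could be omitted from the covering, and the remaining degrees
  would be too small.\<close>

lemma primary_operator_if_regular:
  assumes reg: "regular_semisimple n F g" and fs: "set fs \<subseteq> carrier (mult_of PR)" "factors (mult_of PR) fs (char_poly_over F g)"
  shows "primary_operator F VM (mat_vec F g) fs n"
proof -
  have gSL: "g \<in> carrier (SL n F)" using reg by (simp add: regular_semisimple_def)
  have g: "g \<in> mats F n n" by (rule SL_mats[OF gSL])
  interpret UP: principal_domain PR by (rule poly_ring_principal)
  interpret L: linear_operator F VM "mat_vec F g" by (rule mat_vec_linear_operator[OF g])
  have car: "set fs \<subseteq> carrier PR" using fs(1) by auto
  have irr: "ring_irreducible\<^bsub>PR\<^esub> f" if "f \<in> set fs" for f
    using that fs UP.irreducible_mult_imp_irreducible[of f] unfolding factors_def ring_irreducible_def by auto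
  have ne: "set fs \<subseteq> carrier PR - {[]}" using fs(1) by (auto simp: univ_poly_zero)
  have p: "foldr (\<otimes>\<^bsub>PR\<^esub>) fs \<one>\<^bsub>PR\<^esub> = char_poly_over F g" using fs(2) by (simp add: factors_def)
  have lenp: "char_poly_over F g \<noteq> []" "length (char_poly_over F g) - 1 = (\<Sum>j<length fs. length (fs ! j) - 1)"
    using length_foldr_mult[OF ne] unfolding p by auto
  have sum_le: "(\<Sum>j<length fs. length (fs ! j) - 1) \<le> n" using length_char_poly_over_le[OF g] lenp by simp
  let ?L = "alg_closure" and ?h = "indexed_const"
  have Lf: "field ?L" using alg_closureE(1) by (simp add: algebraic_closure_def)
  have h: "?h \<in> Ring.ring_hom F ?L" by (rule alg_closureE(2))
  interpret AL: field ?L by (rule Lf)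
  have "ext_roots ?L ?h (char_poly_over F g) = {x. AL.is_root (map ?h (char_poly_over F g)) x}"
    using lenp(1) by (auto simp: ext_roots_def AL.is_root_def)
  then have n_eq: "card (\<Union>f\<in>set fs. ext_roots ?L ?h f) = n"
    using reg ext_roots_foldr[OF Lf h car] unfolding p by (simp add: regular_semisimple_def)
  \<comment> \<open>Stated for any \<open>J\<close> whose root sets still cover all roots: with all
    indices it bounds \<open>n\<close> by the sum of the degrees, with one index left out it
    contradicts divisibility between factors.\<close>
  have bound: "n \<le> (\<Sum>j\<in>J. length (fs ! j) - 1)"
    if J: "J \<subseteq> {..<length fs}" "\<And>i. i < length fs \<Longrightarrow> \<exists>j\<in>J. ext_roots ?L ?h (fs ! i) \<subseteq> ext_roots ?L ?h (fs ! j)" for J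
  proof -
    have "(\<Union>f\<in>set fs. ext_roots ?L ?h f) = (\<Union>j\<in>J. ext_roots ?L ?h (fs ! j))"
      using J by (fastforce simp: in_set_conv_nth)
    then have "n = card (\<Union>j\<in>J. ext_roots ?L ?h (fs ! j))" using n_eq by simp
    also have "\<dots> \<le> (\<Sum>j\<in>J. card (ext_roots ?L ?h (fs ! j)))"
      using J(1) finite_subset by (intro card_UN_le) auto
    also have "\<dots> \<le> (\<Sum>j\<in>J. length (fs ! j) - 1)"
    proof (intro sum_mono card_ext_roots(2)[OF Lf h])
      fix j assume "j \<in> J"
      then have "fs ! j \<in> set fs" using J(1) by auto
      then show "fs ! j \<in> carrier PR" "fs ! j \<noteq> []" using ne by auto
    qed
    finally show ?thesis .
  qed
  show ?thesis
  proof (unfold_locales)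
    show "fs ! j \<in> carrier PR" "ring_irreducible\<^bsub>PR\<^esub> (fs ! j)" if "j < length fs" for j
      using that car irr by auto
    show "\<exists>v\<in>L.kern (fs ! j). v \<noteq> \<zero>\<^bsub>VM\<^esub>" if j: "j < length fs" for j
    proof (rule kern_nontrivial[OF g])
      show "fs ! j \<in> carrier PR" "ring_irreducible\<^bsub>PR\<^esub> (fs ! j)" using j car irr by auto
      show "fs ! j pdivides char_poly_over F g" using pdivides_foldr[of "fs ! j" fs] j car unfolding p by simp
    qed
    show "\<not> fs ! i pdivides fs ! j" if ij: "i < length fs" "j < length fs" "i \<noteq> j" for i j
    proof
      assume "fs ! i pdivides fs ! j"
      then have "ext_roots ?L ?h (fs ! i) \<subseteq> ext_roots ?L ?h (fs ! j)"
        using ij(1) car by (intro ext_roots_mono[OF Lf h]) auto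
      then have "n \<le> (\<Sum>l\<in>{..<length fs} - {i}. length (fs ! l) - 1)"
        using ij by (intro bound) auto
      moreover have "(\<Sum>l<length fs. length (fs ! l) - 1) = (length (fs ! i) - 1) + (\<Sum>l\<in>{..<length fs} - {i}. length (fs ! l) - 1)"
        using ij(1) by (intro sum.remove) auto
      moreover have "2 \<le> length (fs ! i)" using ij(1) car irr by (intro irreducible_length) auto
      ultimately show False using sum_le by linarith
    qed
    show "card (carrier VM) = card (carrier F) ^ n" by (rule card_V)
    show "n \<le> (\<Sum>j<length fs. length (fs ! j) - 1)" by (rule bound) auto
    show "inj_on (mat_vec F g) (carrier VM)" by (rule SL_inj_on[OF gSL order_refl])
  qed
qed

lemma regular_character_bound:
  assumes \<chi>: "unipotent_character n F \<chi>" and reg: "regular_semisimple n F g"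
    and k: "product_of_irreducibles F k (char_poly_over F g)"
  shows "cmod (\<chi> g) \<le> fact k"
proof -
  interpret UP: principal_domain PR by (rule poly_ring_principal)
  obtain fs where fs: "length fs = k" "set fs \<subseteq> carrier (mult_of PR)" "factors (mult_of PR) fs (char_poly_over F g)"
    using k by (auto simp: product_of_irreducibles_def)
  \<comment> \<open>Decreasing degrees, as the bound on the moves of beads requires; the product is
    unaffected.\<close>
  define gs where "gs = rev (sort_key length fs)"
  have gs: "length gs = k" "set gs = set fs" "mset gs = mset fs"
    using fs(1) by (auto simp: gs_def)
  have "factors (mult_of PR) gs (char_poly_over F g)"
    using fs(3) UP.mult_of.multlist_perm_cong[OF gs(3)] gs(2) fs(2) unfolding factors_def by auto
  then interpret primary_operator F VM "mat_vec F g" gs n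
    using reg fs(2) gs(2) by (intro primary_operator_if_regular) auto
  have po: "primary_operator F VM (mat_vec F g) gs n" by unfold_locales
  let ?ds = "map (\<lambda>f. length f - 1) gs"
  have "cmod (\<chi> g) \<le> fact (length ?ds)"
  proof (rule unipotent_character_bound[OF \<chi>])
    show "g \<in> carrier (SL n F)" using reg by (simp add: regular_semisimple_def)
    show "perm_char n \<mu> g = of_int (fillings n ?ds \<mu>)" if "(\<Sum>i<n. \<mu> i) = int n" for \<mu>
      by (rule perm_char_eq_fillings[OF po that])
    have "sum_list ?ds = (\<Sum>j<length gs. deg j)" by (simp add: sum_list_sum_nth deg_def atLeast0LessThan)
    then show "sum_list ?ds = n" using sum_deg by simp
    have "sorted_wrt (\<lambda>a b. length b \<le> length a) gs"
      using sorted_sort_key[of length fs] unfolding sorted_map gs_def sorted_wrt_rev .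
    then show "sorted_wrt (\<ge>) ?ds" unfolding sorted_wrt_map by (rule sorted_wrt_mono_rel[rotated]) auto
    have "2 \<le> length f" if "f \<in> set gs" for f
      using that fs_closed fs_irreducible irreducible_length by (metis in_set_conv_nth)
    then show "0 \<notin> set ?ds" by fastforce
  qed
  then show ?thesis using gs(1) by simp
qed

end

section \<open>Companion matrices and binomials\<close>

text \<open>The parameters let one formula serve twice: \<open>t = 0\<close>, \<open>s = 1\<close>
  gives a companion matrix, \<open>t = X\<close>, \<open>s = -1\<close> its characteristic matrix.
  The list fills the last column, beginning with the constant term.\<close>

definition companion :: "'a::comm_ring_1 \<Rightarrow> 'a \<Rightarrow> 'a list \<Rightarrow> 'a mat" where
  "companion t s bs = mat (length bs) (length bs)
     (\<lambda>(i, j). (if i = j then t else if i = Suc j then s else 0) + (if Suc j = length bs then bs ! i else 0))"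

text \<open>Expansion along the first row, where only \<open>t\<close> and \<open>b\<close> can be
  nonzero. Deleting the first column leaves a shorter matrix of the same form, deleting the last
  column a triangular one with \<open>s\<close> on the diagonal.\<close>

lemma det_companion_Cons:
  assumes "bs \<noteq> []"
  shows "det (companion t s (b # bs)) = t * det (companion t s bs) + (- s) ^ length bs * b"
proof -
  define n where "n = length bs"
  have n: "0 < n" using assms by (simp add: n_def)
  let ?A = "companion t s (b # bs)"
  have A: "?A \<in> carrier_mat (Suc n) (Suc n)" by (simp add: companion_def n_def)
  have row: "?A $$ (0, j) = (if j = 0 then t else if j = n then b else 0)" if "j < Suc n" for j
    using that n by (auto simp: companion_def n_def)
  have "det ?A = (\<Sum>j<Suc n. ?A $$ (0, j) * cofactor ?A 0 j)"
    by (rule laplace_expansion_row[OF A]) simp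
  also have "\<dots> = (\<Sum>j<Suc n. if j \<in> {0, n} then (if j = 0 then t else b) * cofactor ?A 0 j else 0)"
    by (rule sum.cong) (auto simp: row)
  also have "\<dots> = (\<Sum>j\<in>{0, n}. (if j = 0 then t else b) * cofactor ?A 0 j)"
    by (rule sum.mono_neutral_cong_right) auto
  also have "\<dots> = t * cofactor ?A 0 0 + b * cofactor ?A 0 n" using n by simp
  also have "cofactor ?A 0 0 = det (companion t s bs)"
  proof -
    have "mat_delete ?A 0 0 = companion t s bs"
      by (rule eq_matI) (auto simp: mat_delete_def companion_def n_def)
    then show ?thesis by (simp add: cofactor_def)
  qed
  also have "cofactor ?A 0 n = (- s) ^ n"
  proof -
    have B: "mat_delete ?A 0 n \<in> carrier_mat n n" using A by (simp add: mat_delete_def)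
    have "upper_triangular (mat_delete ?A 0 n)"
      by (auto simp: upper_triangular_def mat_delete_def companion_def n_def)
    then have "det (mat_delete ?A 0 n) = prod_list (diag_mat (mat_delete ?A 0 n))"
      by (rule det_upper_triangular[OF _ B])
    also have "diag_mat (mat_delete ?A 0 n) = replicate n s"
      using B by (auto simp: diag_mat_def mat_delete_def companion_def n_def intro!: nth_equalityI)
    finally show ?thesis by (simp add: cofactor_def power_mult_distrib[symmetric])
  qed
  finally show ?thesis by (simp add: n_def mult.commute)
qed

lemma det_companion_single: "det (companion t s [b]) = t + b"
  by (subst det_single) (auto simp: companion_def)

lemma det_companion: "det (companion t (- 1) bs) = foldr (\<lambda>b acc. b + t * acc) bs 1"
proof (induction bs)
  case (Cons b bs)
  then show ?case by (cases "bs = []") (simp_all add: det_companion_Cons det_companion_single)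
qed (simp add: companion_def)

lemma det_companion_0: "bs \<noteq> [] \<Longrightarrow> det (companion 0 s bs) = (- s) ^ (length bs - 1) * hd bs"
  by (cases bs; cases "tl bs = []") (simp_all add: det_companion_Cons det_companion_single)

context field
begin

definition companion_over :: "'a list \<Rightarrow> 'a mat" where
  "companion_over bs = mat (length bs) (length bs)
     (\<lambda>(i, j). (if i = Suc j then \<one> else \<zero>) \<oplus> (if Suc j = length bs then \<ominus> (bs ! i) else \<zero>))"

lemma companion_over_mats: "set bs \<subseteq> carrier R \<Longrightarrow> companion_over bs \<in> mats R (length bs) (length bs)"
  using nth_mem[of _ bs] by (auto simp: mats_def companion_over_def subset_iff)

lemma det_companion_over:
  assumes bs: "set bs \<subseteq> carrier R" "bs \<noteq> []"
  shows "det_over R (companion_over bs) = (\<ominus> \<one>) [^] (length bs - 1) \<otimes> \<ominus> (hd bs)"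
proof -
  let ?C = "companion 0 1 (map (\<lambda>b. - free_var b) bs)"
  have "companion_over bs = map_mat free_eval ?C"
    using bs by (intro eq_matI)
      (auto simp: companion_over_def companion_def free_eval_add free_eval_0 free_eval_1 free_eval_uminus free_eval_var subset_iff)
  then have "det_over R (companion_over bs) = free_eval (det ?C)"
    using det_over_free_eval[of ?C "length bs"] by (simp add: companion_def)
  also have "\<dots> = free_eval ((- 1) ^ (length bs - 1) * (- free_var (hd bs)))"
    using bs by (simp add: det_companion_0 hd_map)
  also have "\<dots> = (\<ominus> \<one>) [^] (length bs - 1) \<otimes> \<ominus> (hd bs)"
    using free_eval_var[of "hd bs"] bs hd_in_set[OF bs(2)]
    by (simp add: free_eval_mult free_eval_power free_eval_uminus free_eval_1 subset_iff r_minus)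
  finally show ?thesis .
qed

text \<open>The determinant comes out as a Horner scheme in \<open>X\<close>. The list
  \<open>bs\<close> begins with the constant term but a polynomial with the leading coefficient,
  hence \<open>rev\<close>.\<close>

lemma char_poly_companion_over:
  assumes bs: "set bs \<subseteq> carrier R"
  shows "char_poly_over R (companion_over bs) = \<one> # rev bs"
proof -
  interpret UP: domain "poly_ring R" by (rule poly_ring_domain)
  interpret C: ring_hom_cring R "poly_ring R" \<kappa> by (rule const_ring_hom_cring)
  have X: "X \<in> carrier (poly_ring R)" by (rule var_closed(1)[OF carrier_is_subring])
  let ?C = "companion (free_var X) (- 1) (map (\<lambda>b. free_var (\<kappa> b)) bs)"
  have nz: "\<ominus>\<^bsub>poly_ring R\<^esub> \<kappa> \<one> = \<ominus>\<^bsub>poly_ring R\<^esub> \<one>\<^bsub>poly_ring R\<^esub>" by simp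
  have "char_mat (length bs) (companion_over bs) = map_mat UP.free_eval ?C"
    using bs X nth_mem[of _ bs] by (intro eq_matI)
      (auto simp: companion_over_def companion_def char_mat_def UP.free_eval_add UP.free_eval_0 UP.free_eval_1
        UP.free_eval_uminus UP.free_eval_var UP.minus_eq subset_iff)
  then have "char_poly_over R (companion_over bs) = UP.free_eval (det ?C)"
    using UP.det_over_free_eval[of ?C "length bs"] char_poly_over_eq[OF companion_over_mats[OF bs]]
    by (simp add: companion_def)
  also have "\<dots> = UP.free_eval (foldr (\<lambda>b acc. free_var (\<kappa> b) + free_var X * acc) bs 1)"
    by (simp add: det_companion foldr_map o_def)
  also have "\<dots> = \<one> # rev bs"
    using bs
  proof (induction bs)
    case (Cons b bs)
    have "polynomial (carrier R) ((\<one> # rev bs) @ [b])"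
      using Cons.prems unfolding polynomial_def by auto
    then have "(\<one> # rev bs) @ [b] \<in> carrier (poly_ring R)" by (simp add: univ_poly_carrier)
    note s = poly_snoc[OF this]
    have "UP.free_eval (foldr (\<lambda>b acc. free_var (\<kappa> b) + free_var X * acc) (b # bs) 1) =
      \<kappa> b \<oplus>\<^bsub>poly_ring R\<^esub> (X \<otimes>\<^bsub>poly_ring R\<^esub> (\<one> # rev bs))"
      using Cons s X by (simp add: UP.free_eval_add UP.free_eval_mult UP.free_eval_var)
    also have "\<dots> = (\<one> # rev bs) @ [b]" unfolding s(3) using s X by (simp add: UP.a_comm)
    finally show ?case by simp
  qed (simp add: UP.free_eval_1 univ_poly_one)
  finally show ?thesis .
qed

end

section \<open>The Frobenius map and irreducible binomials\<close>

lemma prime_dvd_add_power: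
  fixes x y :: "'a::comm_ring_1" and p :: nat
  assumes p: "prime p"
  shows "of_nat p dvd (x + y) ^ p - (x ^ p + y ^ p)"
proof -
  have p0: "0 < p" using p prime_gt_0_nat by blast
  let ?f = "\<lambda>k. of_nat (p choose k) * x ^ k * y ^ (p - k)"
  have "(x + y) ^ p = (\<Sum>k\<le>p. ?f k)" by (rule binomial_ring)
  also have "\<dots> = (\<Sum>k\<in>{0, p}. ?f k) + (\<Sum>k\<in>{..p} - {0, p}. ?f k)" by (subst add.commute, rule sum.subset_diff) auto
  also have "(\<Sum>k\<in>{0, p}. ?f k) = x ^ p + y ^ p" using p0 by simp
  finally have eq: "(x + y) ^ p - (x ^ p + y ^ p) = (\<Sum>k\<in>{..p} - {0, p}. ?f k)" by simp
  have "of_nat p dvd ?f k" if k: "k \<in> {..p} - {0, p}" for k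
  proof -
    have "p dvd p choose k" using k by (intro dvd_choose_prime p) auto
    then obtain c where "p choose k = p * c" ..
    then show ?thesis by (simp add: mult.assoc)
  qed
  then show ?thesis unfolding eq by (rule dvd_sum)
qed

text \<open>Characteristic \<open>p\<close> is expressed by a sum of \<open>p\<close> ones being
  zero. In the free ring the difference of the two sides is a multiple of \<open>p\<close>, and
  evaluation sends \<open>p\<close> to zero.\<close>

lemma (in cring) frobenius_add:
  fixes p :: nat
  assumes p: "prime p" "(\<Oplus>i\<in>{..<p}. \<one>) = \<zero>" and xy: "x \<in> carrier R" "y \<in> carrier R"
  shows "(x \<oplus> y) [^] p = x [^] p \<oplus> y [^] p"
proof -
  let ?x = "free_var x" and ?y = "free_var y"
  obtain Q where "(?x + ?y) ^ p - (?x ^ p + ?y ^ p) = of_nat p * Q"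
    using prime_dvd_add_power[OF p(1)] by (rule dvdE)
  then have "(?x + ?y) ^ p = (?x ^ p + ?y ^ p) + (\<Sum>i<p. 1) * Q" by (simp add: algebra_simps)
  then have "free_eval ((?x + ?y) ^ p) = free_eval ((?x ^ p + ?y ^ p) + (\<Sum>i<p. 1) * Q)" by (rule arg_cong)
  moreover have "free_eval (\<Sum>i<p. 1) = \<zero>" by (subst free_eval_sum) (auto simp: free_eval_1 p(2))
  ultimately show ?thesis
    using xy by (simp add: free_eval_power free_eval_add free_eval_mult free_eval_var del: sum_constant)
qed

context field
begin

definition binom_poly :: "nat \<Rightarrow> 'a \<Rightarrow> 'a list" where
  "binom_poly D a = \<one> # replicate (D - 1) \<zero> @ [\<ominus> a]"

lemma binom_poly_closed: "a \<in> carrier R \<Longrightarrow> binom_poly D a \<in> carrier (poly_ring R)"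
  unfolding univ_poly_carrier[symmetric] polynomial_def binom_poly_def by auto

lemma length_binom_poly: "0 < D \<Longrightarrow> length (binom_poly D a) = D + 1"
  by (simp add: binom_poly_def)

lemma ext_roots_binom_poly:
  assumes L: "field L" "h \<in> Ring.ring_hom R L" and D: "0 < D" and a: "a \<in> carrier R"
  shows "ext_roots L h (binom_poly D a) = {x \<in> carrier L. x [^]\<^bsub>L\<^esub> D = h a}"
proof -
  interpret L: field L by fact
  interpret H: ring_hom_ring R L h using L(2) by unfold_locales
  have "L.eval (map h (binom_poly D a)) x = x [^]\<^bsub>L\<^esub> D \<ominus>\<^bsub>L\<^esub> h a" if x: "x \<in> carrier L" for x
  proof -
    have "L.eval (replicate k \<zero>\<^bsub>L\<^esub> @ [\<ominus>\<^bsub>L\<^esub> h a]) x = \<ominus>\<^bsub>L\<^esub> h a" for k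
      using x a by (subst L.eval_replicate) auto
    then show ?thesis using x a D by (simp add: binom_poly_def L.minus_eq)
  qed
  then show ?thesis using a by (auto simp: ext_roots_def)
qed

lemma alg_closure_root:
  assumes f: "f \<in> carrier (poly_ring R)" "2 \<le> length f"
  shows "ext_roots alg_closure indexed_const f \<noteq> {}"
proof -
  let ?L = "alg_closure" and ?h = "indexed_const"
  interpret AC: algebraic_closure ?L "?h ` carrier R" by (rule alg_closureE(1))
  have L: "field ?L" by (rule AC.field_axioms)
  have h: "?h \<in> Ring.ring_hom R ?L" by (rule alg_closureE(2))
  have hf: "map ?h f \<in> carrier (poly_ring ?L)" using f by (intro map_hom_closed[OF L h]) auto
  have "size (AC.roots (map ?h f)) = length f - 1"
    using AC.roots_over_carrier[OF hf] by (simp add: AC.splitted_def)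
  then obtain x where "x \<in># AC.roots (map ?h f)" using f(2) by (cases "AC.roots (map ?h f)") auto
  then show ?thesis using AC.roots_mem_iff_is_root[OF hf] by (auto simp: ext_roots_def AC.is_root_def)
qed

end

locale prime_field = field F for F :: "('a, 'm) ring_scheme" (structure) +
  fixes p :: nat
  assumes p: "prime p" and card_F: "card (carrier F) = p"
begin

lemma finite_carrier: "finite (carrier F)"
  using card_F prime_gt_0_nat[OF p] card_ge_0_finite by metis

lemma sum_one: "(\<Oplus>i\<in>{..<p}. \<one>) = \<zero>"
proof -
  have "(\<Oplus>i\<in>{..<p}. \<one>) = [p] \<cdot> \<one>" using add.finprod_const[of \<one> "{..<p}"] by simp
  also have "\<dots> = \<zero>" using add.pow_order_eq_1[of \<one>] by (simp add: Coset.order_def card_F)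
  finally show ?thesis .
qed

lemma pow_p_minus_1: "a \<in> carrier F \<Longrightarrow> a \<noteq> \<zero> \<Longrightarrow> a [^] (p - 1) = \<one>"
proof -
  assume a: "a \<in> carrier F" "a \<noteq> \<zero>"
  have "card (Units F) = p - 1"
    using finite_carrier card_F by (simp add: field_Units)
  then show ?thesis using units_power_order_eq_one[of a] finite_carrier a by (simp add: field_Units)
qed

lemma pow_p: "a \<in> carrier F \<Longrightarrow> a [^] p = a"
proof (cases "a = \<zero>")
  case False
  assume a: "a \<in> carrier F"
  have "a [^] p = a [^] (p - 1) \<otimes> a" using prime_gt_0_nat[OF p] by (cases p) auto
  then show ?thesis using pow_p_minus_1 a False by simp
qed (use prime_gt_0_nat[OF p] in \<open>simp add: nat_pow_zero\<close>)

text \<open>The coefficients come from the prime field and are fixed by the Frobenius map, which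
  therefore sends roots to roots.\<close>

lemma eval_frobenius:
  assumes L: "field L" "h \<in> Ring.ring_hom F L" and u: "set u \<subseteq> carrier F" and y: "y \<in> carrier L"
  shows "ring.eval L (map h u) y [^]\<^bsub>L\<^esub> p = ring.eval L (map h u) (y [^]\<^bsub>L\<^esub> p)"
proof -
  interpret L: field L by fact
  interpret H: ring_hom_cring F L h using L(2) by unfold_locales
  have hpow: "x \<in> carrier F \<Longrightarrow> h (x [^] i) = h x [^]\<^bsub>L\<^esub> i" for x and i :: nat
    by (induction i) auto
  have sum0: "(\<Oplus>\<^bsub>L\<^esub>i\<in>{..<p}. \<one>\<^bsub>L\<^esub>) = \<zero>\<^bsub>L\<^esub>"
    using arg_cong[OF sum_one, of h] by (simp add: H.hom_finsum o_def)
  show ?thesis using u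
  proof (induction u)
    case Nil
    then show ?case using prime_gt_0_nat[OF p] by (simp add: L.nat_pow_zero)
  next
    case (Cons c u)
    have ev: "L.eval (map h u) y \<in> carrier L" using Cons.prems y by (intro L.eval_in_carrier) auto
    have c: "c \<in> carrier F" "h c [^]\<^bsub>L\<^esub> p = h c"
      using Cons.prems pow_p[of c] by (auto simp: hpow[symmetric])
    have "L.eval (map h (c # u)) y [^]\<^bsub>L\<^esub> p =
        (h c \<otimes>\<^bsub>L\<^esub> y [^]\<^bsub>L\<^esub> length u) [^]\<^bsub>L\<^esub> p \<oplus>\<^bsub>L\<^esub> L.eval (map h u) y [^]\<^bsub>L\<^esub> p"
      using c y ev by (simp add: L.frobenius_add[OF p sum0])
    also have "(h c \<otimes>\<^bsub>L\<^esub> y [^]\<^bsub>L\<^esub> length u) [^]\<^bsub>L\<^esub> p = h c \<otimes>\<^bsub>L\<^esub> (y [^]\<^bsub>L\<^esub> p) [^]\<^bsub>L\<^esub> length u"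
      using c y by (simp add: L.nat_pow_distrib L.nat_pow_pow mult.commute)
    finally show ?case using Cons by simp
  qed
qed

text \<open>From \<open>\<alpha>^D = a\<close> follows \<open>\<alpha>^p = \<eta> \<alpha>\<close>
  with \<open>\<eta> = a^((p - 1) / D)\<close>, an element of order \<open>D\<close>. The Frobenius
  map sends roots of \<open>u\<close> to roots of \<open>u\<close>, so all
  \<open>\<eta>^i \<alpha>\<close> are roots, and \<open>D\<close> of them are distinct.\<close>

lemma roots_of_divisor:
  assumes L: "field L" "h \<in> Ring.ring_hom F L" and D: "prime D" "D dvd p - 1"
    and a: "a \<in> carrier F" "a [^] ((p - 1) div D) \<noteq> \<one>" "a \<noteq> \<zero>"
    and u: "u \<in> carrier (poly_ring F)" "u \<noteq> []" and \<alpha>: "\<alpha> \<in> ext_roots L h u" "\<alpha> [^]\<^bsub>L\<^esub> D = h a"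
  shows "D \<le> card (ext_roots L h u)"
proof -
  interpret L: field L by fact
  interpret H: ring_hom_cring F L h using L(2) by unfold_locales
  have hpow: "x \<in> carrier F \<Longrightarrow> h (x [^] i) = h x [^]\<^bsub>L\<^esub> i" for x and i :: nat
    by (induction i) auto
  note inj = inj_onD[OF hom_injective[OF L]]
  define e where "e = (p - 1) div D"
  have pe: "p - 1 = D * e" using D(2) by (simp add: e_def)
  define \<eta> where "\<eta> = a [^] e"
  have \<eta>: "\<eta> \<in> carrier F" "\<eta> \<noteq> \<one>" "\<eta> [^] D = \<one>"
    using a pow_p_minus_1[of a] pe by (auto simp: \<eta>_def e_def nat_pow_pow mult.commute)
  have h\<eta>: "h \<eta> \<in> carrier L" using \<eta> by simp
  have \<alpha>L: "\<alpha> \<in> carrier L" using \<alpha> by (simp add: ext_roots_def)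
  have \<alpha>p: "\<alpha> [^]\<^bsub>L\<^esub> p = h \<eta> \<otimes>\<^bsub>L\<^esub> \<alpha>"
  proof -
    have "p = D * e + 1" using pe prime_gt_0_nat[OF p] by simp
    then have "\<alpha> [^]\<^bsub>L\<^esub> p = (\<alpha> [^]\<^bsub>L\<^esub> D) [^]\<^bsub>L\<^esub> e \<otimes>\<^bsub>L\<^esub> \<alpha>" using \<alpha>L by (simp add: L.nat_pow_pow)
    then show ?thesis using a by (simp add: \<alpha>(2) \<eta>_def hpow)
  qed
  have us: "set u \<subseteq> carrier F" using u polynomial_incl univ_poly_carrier by blast
  have root: "h \<eta> [^]\<^bsub>L\<^esub> i \<otimes>\<^bsub>L\<^esub> \<alpha> \<in> ext_roots L h u" for i :: nat
  proof (induction i)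
    case 0
    then show ?case using \<alpha>(1) \<alpha>L by simp
  next
    case (Suc i)
    let ?y = "h \<eta> [^]\<^bsub>L\<^esub> i \<otimes>\<^bsub>L\<^esub> \<alpha>"
    have y: "?y \<in> carrier L" "L.eval (map h u) ?y = \<zero>\<^bsub>L\<^esub>" using Suc by (auto simp: ext_roots_def)
    have "?y [^]\<^bsub>L\<^esub> p = (h \<eta> [^]\<^bsub>L\<^esub> p) [^]\<^bsub>L\<^esub> i \<otimes>\<^bsub>L\<^esub> (h \<eta> \<otimes>\<^bsub>L\<^esub> \<alpha>)"
      using h\<eta> \<alpha>L by (simp add: L.nat_pow_distrib L.nat_pow_pow mult.commute \<alpha>p)
    also have "h \<eta> [^]\<^bsub>L\<^esub> p = h \<eta>" using \<eta>(1) pow_p[of \<eta>] by (simp flip: hpow)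
    finally have yp: "?y [^]\<^bsub>L\<^esub> p = h \<eta> [^]\<^bsub>L\<^esub> Suc i \<otimes>\<^bsub>L\<^esub> \<alpha>"
      using h\<eta> \<alpha>L by (simp add: L.m_assoc)
    have "L.eval (map h u) (?y [^]\<^bsub>L\<^esub> p) = \<zero>\<^bsub>L\<^esub>"
      using eval_frobenius[OF L us y(1)] y(2) prime_gt_0_nat[OF p] by (simp add: L.nat_pow_zero)
    then show ?case using yp h\<eta> \<alpha>L by (simp add: ext_roots_def)
  qed
  have \<alpha>0: "\<alpha> \<noteq> \<zero>\<^bsub>L\<^esub>"
  proof
    assume "\<alpha> = \<zero>\<^bsub>L\<^esub>"
    then have "h a = h \<zero>" using \<alpha>(2) prime_gt_0_nat[OF D(1)] by (simp add: L.nat_pow_zero)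
    then show False using inj[of a \<zero>] a by simp
  qed
  have "inj_on (\<lambda>i. h \<eta> [^]\<^bsub>L\<^esub> i \<otimes>\<^bsub>L\<^esub> \<alpha>) {..<D}"
  proof (rule inj_onI)
    interpret MG: group "Multiplicative_Group.mult_of F" by (rule field_mult_group)
    have \<eta>0: "\<eta> \<in> carrier (Multiplicative_Group.mult_of F)" using \<eta> prime_gt_0_nat[OF D(1)] by (auto simp: nat_pow_zero)
    \<comment> \<open>The order of \<open>\<eta>\<close> divides the prime \<open>D\<close> and is
      not 1.\<close>
    have ord: "\<eta> [^] k = \<one> \<longleftrightarrow> D dvd k" for k :: nat
    proof
      assume k: "\<eta> [^] k = \<one>"
      have pw: "\<eta> [^]\<^bsub>Multiplicative_Group.mult_of F\<^esub> k = \<eta> [^] k" for k :: nat by (simp add: Multiplicative_Group.nat_pow_mult_of)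
      have "MG.ord \<eta> dvd D" using MG.pow_eq_id[OF \<eta>0] \<eta>(3) pw by simp
      then have "MG.ord \<eta> = 1 \<or> MG.ord \<eta> = D" using D(1) by (simp add: prime_nat_iff)
      moreover have "MG.ord \<eta> \<noteq> 1" using MG.ord_eq_1[OF \<eta>0] \<eta>(2) by simp
      ultimately show "D dvd k" using MG.pow_eq_id[OF \<eta>0, of k] k pw by simp
    next
      assume "D dvd k"
      then obtain l where "k = D * l" ..
      then show "\<eta> [^] k = \<one>" using \<eta> by (simp flip: nat_pow_pow)
    qed
    have aux: "i = j" if ij: "i \<le> j" "j < D" and eq: "h \<eta> [^]\<^bsub>L\<^esub> i \<otimes>\<^bsub>L\<^esub> \<alpha> = h \<eta> [^]\<^bsub>L\<^esub> j \<otimes>\<^bsub>L\<^esub> \<alpha>" for i j :: nat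
    proof -
      have "h \<eta> [^]\<^bsub>L\<^esub> i = h \<eta> [^]\<^bsub>L\<^esub> j" using eq \<alpha>0 \<alpha>L h\<eta> by (simp add: L.m_rcancel)
      then have "h (\<eta> [^] i) = h (\<eta> [^] j)" using \<eta> by (simp add: hpow)
      then have "\<eta> [^] i = \<eta> [^] j" using \<eta> by (intro inj) auto
      also have "\<eta> [^] j = \<eta> [^] i \<otimes> \<eta> [^] (j - i)" using \<eta> ij by (simp add: nat_pow_mult)
      finally have "\<eta> [^] i \<otimes> \<one> = \<eta> [^] i \<otimes> \<eta> [^] (j - i)" using \<eta> by simp
      moreover have "\<eta> [^] i \<noteq> \<zero>" using \<eta>0 MG.nat_pow_closed[OF \<eta>0, of i] by (simp add: Multiplicative_Group.nat_pow_mult_of)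
      ultimately have "\<one> = \<eta> [^] (j - i)" using \<eta> by (subst (asm) m_lcancel) auto
      then have "D dvd j - i" using ord by metis
      then show "i = j" using ij by (auto dest: dvd_imp_le)
    qed
    fix i j assume "i \<in> {..<D}" "j \<in> {..<D}" "h \<eta> [^]\<^bsub>L\<^esub> i \<otimes>\<^bsub>L\<^esub> \<alpha> = h \<eta> [^]\<^bsub>L\<^esub> j \<otimes>\<^bsub>L\<^esub> \<alpha>"
    then show "i = j" using aux[of i j] aux[of j i] by (cases "i \<le> j") auto
  qed
  then have "card ((\<lambda>i. h \<eta> [^]\<^bsub>L\<^esub> i \<otimes>\<^bsub>L\<^esub> \<alpha>) ` {..<D}) = D" by (simp add: card_image)
  moreover have "(\<lambda>i. h \<eta> [^]\<^bsub>L\<^esub> i \<otimes>\<^bsub>L\<^esub> \<alpha>) ` {..<D} \<subseteq> ext_roots L h u" using root by auto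
  ultimately show ?thesis using card_mono[OF card_ext_roots(1)[OF L u]] by metis
qed

text \<open>Every divisor of positive degree has at least \<open>D\<close> roots, hence degree at
  least \<open>D\<close>, so the complementary factor is constant. Applied to the binomial itself,
  the same count shows that its roots are distinct.\<close>

lemma irreducible_binom_poly:
  assumes D: "prime D" "D dvd p - 1" and a: "a \<in> carrier F" "a [^] ((p - 1) div D) \<noteq> \<one>" "a \<noteq> \<zero>"
  shows "ring_irreducible\<^bsub>poly_ring F\<^esub> (binom_poly D a)"
    and "card (ext_roots alg_closure indexed_const (binom_poly D a)) = D"
proof -
  let ?b = "binom_poly D a" and ?L = "alg_closure" and ?h = "indexed_const"
  interpret UP: domain "poly_ring F" by (rule poly_ring_domain)
  have L: "field ?L" using alg_closureE(1) by (simp add: algebraic_closure_def)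
  have h: "?h \<in> Ring.ring_hom F ?L" by (rule alg_closureE(2))
  have D0: "0 < D" using D(1) prime_gt_0_nat by blast
  have b: "?b \<in> carrier (poly_ring F)" "?b \<noteq> []" "length ?b = D + 1"
    using binom_poly_closed[OF a(1)] length_binom_poly[OF D0, of a] by auto
  have ge: "D \<le> card (ext_roots ?L ?h u)"
    if u: "u \<in> carrier (poly_ring F)" "u pdivides ?b" "2 \<le> length u" for u
  proof -
    obtain x where x: "x \<in> ext_roots ?L ?h u" using alg_closure_root[OF u(1,3)] by blast
    then have "x \<in> ext_roots ?L ?h ?b" using ext_roots_mono[OF L h u(1,2)] by blast
    then have "x [^]\<^bsub>?L\<^esub> D = ?h a" by (simp add: ext_roots_binom_poly[OF L h D0 a(1)])
    then show ?thesis using u(3) by (intro roots_of_divisor[OF L h D a u(1) _ x]) auto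
  qed
  have "?b pdivides ?b" using b(1) unfolding pdivides_def by (rule UP.divides_refl)
  then have "D \<le> card (ext_roots ?L ?h ?b)" using b D0 by (intro ge) auto
  then show "card (ext_roots ?L ?h ?b) = D" using card_ext_roots(2)[OF L h b(1,2)] b(3) by simp
  show "ring_irreducible\<^bsub>poly_ring F\<^esub> ?b"
  proof (rule UP.ring_irreducibleI)
    show "?b \<in> carrier (poly_ring F) - {\<zero>\<^bsub>poly_ring F\<^esub>}" using b by (simp add: univ_poly_zero)
    show "?b \<notin> Units (poly_ring F)"
    proof
      assume "?b \<in> Units (poly_ring F)"
      then obtain c where "?b = [c]" using univ_poly_units[OF carrier_is_subfield] by blast
      then show False using b(3) D0 by simp
    qed
    fix u v assume uv: "u \<in> carrier (poly_ring F)" "v \<in> carrier (poly_ring F)" "?b = u \<otimes>\<^bsub>poly_ring F\<^esub> v"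
    have ne: "u \<noteq> []" "v \<noteq> []" using uv b(2) UP.l_null[OF uv(2)] UP.r_null[OF uv(1)] by (auto simp: univ_poly_zero)
    have deg: "length ?b - 1 = (length u - 1) + (length v - 1)"
      using poly_mult_degree_eq[OF carrier_is_subring, of u v] uv ne by (simp add: univ_poly_mult univ_poly_carrier)
    have unit: "w \<in> Units (poly_ring F)" if "w \<in> carrier (poly_ring F)" "length w = 1" for w
    proof -
      obtain c where "w = [c]" using \<open>length w = 1\<close> by (cases w) auto
      moreover from this have "c \<in> carrier F - {\<zero>}" using \<open>w \<in> carrier (poly_ring F)\<close> unfolding univ_poly_carrier[symmetric] polynomial_def by auto
      ultimately show ?thesis using univ_poly_units[OF carrier_is_subfield] by blast
    qed
    show "u \<in> Units (poly_ring F) \<or> v \<in> Units (poly_ring F)"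
    proof (cases "2 \<le> length u")
      case True
      have "u pdivides ?b" using uv unfolding pdivides_def factor_def by blast
      then have "D \<le> length u - 1"
        using ge[OF uv(1) _ True] card_ext_roots(2)[OF L h uv(1) ne(1)] by simp
      then have "length v = 1" using deg b(3) ne by (cases v) auto
      then show ?thesis using unit[OF uv(2)] by simp
    next
      case False
      then have "length u = 1" using ne by (cases u) (auto simp: not_le less_Suc_eq)
      then show ?thesis using unit[OF uv(1)] by simp
    qed
  qed
qed

end

section \<open>Sharpness\<close>

text \<open>A prime factor of \<open>1 + N + \<dots> + N\<^sup>D\<^sup>-\<^sup>1\<close>, where \<open>N = D * fact B\<close>: modulo it \<open>N\<close> has order \<open>D\<close>.\<close>

lemma exists_prime_cong_1:
  fixes D B :: nat
  assumes D: "prime D"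
  obtains p :: nat where "prime p" "D dvd p - 1" "B < p"
proof -
  define N :: nat where "N = D * fact B"
  define M where "M = (\<Sum>i<D. N ^ i)"
  have D2: "2 \<le> D" using D prime_ge_2_nat by blast
  have N: "0 < N" using D2 by (simp add: N_def)
  have M_Suc: "M = 1 + N * (\<Sum>i<D - 1. N ^ i)"
  proof -
    obtain d where d: "D = Suc d" using D2 by (cases D) auto
    show ?thesis unfolding M_def d by (simp add: sum.lessThan_Suc_shift sum_distrib_left del: sum.lessThan_Suc)
  qed
  have "M \<noteq> 1"
  proof -
    have "N ^ 0 \<le> (\<Sum>i<D - 1. N ^ i)" using D2 by (intro member_le_sum) auto
    then have "0 < (\<Sum>i<D - 1. N ^ i)" unfolding power_0 by linarith
    then have "0 < N * (\<Sum>i<D - 1. N ^ i)" using N by (intro mult_pos_pos)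
    then show ?thesis unfolding M_Suc by linarith
  qed
  then obtain p where p: "prime p" "p dvd M" using prime_factor_nat by blast
  have pN: "\<not> p dvd N"
  proof
    assume "p dvd N"
    then have "p dvd 1" using p(2) M_Suc dvd_add_left_iff[of p "N * (\<Sum>i<D - 1. N ^ i)" 1] by (simp add: dvd_mult2)
    then show False using p(1) by auto
  qed
  \<comment> \<open>All primes up to \<open>B\<close> divide \<open>N\<close>, while
    \<open>M\<close> is 1 modulo \<open>N\<close>.\<close>
  have "B < p"
  proof (rule ccontr)
    assume "\<not> B < p"
    then have "p dvd fact B" using p(1) by (simp add: prime_dvd_fact_iff)
    then show False using pN by (simp add: N_def)
  qed
  moreover have "[N ^ D = 1] (mod p)"
  proof -
    have "int N ^ D - 1 = (int N - 1) * int M" by (simp add: M_def power_diff_1_eq)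
    then have "int p dvd int N ^ D - 1" using p(2) by simp
    then have "[int N ^ D = 1] (mod int p)" by (simp add: cong_iff_dvd_diff)
    then show ?thesis by (metis cong_int_iff of_nat_1 of_nat_power)
  qed
  \<comment> \<open>If \<open>N\<close> were 1 modulo \<open>p\<close>, then \<open>M\<close> would
    be \<open>D\<close> modulo \<open>p\<close>, so \<open>p\<close> would divide \<open>D\<close>
    and with it \<open>N\<close>.\<close>
  moreover have "\<not> [N ^ 1 = 1] (mod p)"
  proof
    assume "[N ^ 1 = 1] (mod p)"
    then have "[N ^ i = 1] (mod p)" for i using cong_pow[of N 1 p i] by simp
    then have "[M = (\<Sum>i<D. 1)] (mod p)" unfolding M_def by (intro cong_sum) auto
    then have "p dvd D" using p(2) cong_dvd_iff[of M D p] by simp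
    then show False using pN by (simp add: N_def)
  qed
  ultimately have "ord p N dvd D" "ord p N \<noteq> 1" using ord_divides[of N D p] ord_divides[of N 1 p] by auto
  then have "ord p N = D" using D by (auto simp: prime_nat_iff)
  then have "D dvd p - 1" using ord_divides[of N "p - 1" p] fermat_theorem[OF p(1) pN] by simp
  then show ?thesis using that p(1) \<open>B < p\<close> by blast
qed

text \<open>The residue ring lives on \<open>int\<close>; its image under \<open>nat\<close> has the
  type \<open>nat ring\<close> of the existential claim.\<close>

definition residue_field :: "nat \<Rightarrow> nat ring" where
  "residue_field p = image_ring nat (residue_ring (int p))"

lemma prime_field_residue_field:
  assumes "prime p"
  shows "prime_field (residue_field p) p"
proof -
  interpret residues_prime p "residue_ring (int p)" by unfold_locales (use assms in auto)
  have inj: "inj_on nat (carrier (residue_ring (int p)))" by (auto simp: res_carrier_eq inj_on_def)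
  interpret F: field "residue_field p" unfolding residue_field_def by (rule inj_imp_image_ring_is_field[OF inj])
  show ?thesis
    by unfold_locales (use assms inj in \<open>auto simp: residue_field_def image_ring_carrier card_image res_carrier_eq\<close>)
qed

context prime_field
begin

lemma exists_generator: "\<exists>w\<in>carrier F. w \<noteq> \<zero> \<and> (\<forall>i::nat. w [^] i = \<one> \<longleftrightarrow> (p - 1) dvd i)"
proof -
  let ?G = "Multiplicative_Group.mult_of F"
  interpret MG: group ?G by (rule field_mult_group)
  obtain w where w: "w \<in> carrier ?G" "carrier ?G = {w [^] i | i::nat. i \<in> UNIV}"
    using finite_field_mult_group_has_gen[OF finite_carrier] by blast
  have fin: "finite (carrier ?G)" using finite_carrier by simp
  have "generate ?G {w} = carrier ?G"
    unfolding MG.generate_pow_on_finite_carrier[OF fin w(1)] w(2) by (simp add: Multiplicative_Group.nat_pow_mult_of)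
  then have "MG.ord w = p - 1"
    using MG.generate_pow_card[OF w(1)] finite_carrier by (simp add: card_F)
  then have "w [^] i = \<one> \<longleftrightarrow> (p - 1) dvd i" for i :: nat
    using MG.pow_eq_id[OF w(1), of i] by (simp add: Multiplicative_Group.nat_pow_mult_of)
  then show ?thesis using w(1) by auto
qed

text \<open>With a generator \<open>w\<close> the exponents are 1, 1 + D, ..., 1 + (k - 2) D, and a
  last one that makes the product 1. Modulo \<open>D\<close> the last is \<open>-(k - 1)\<close>: it
  is not 0 because \<open>0 < k - 1 < D\<close>, and not 1 because \<open>D\<close> does not divide
  \<open>k\<close>. So no power is a \<open>D\<close>-th power and the last differs from the others,
  which the size of \<open>p\<close> keeps distinct.\<close>

lemma exists_nonpowers:
  assumes D: "prime D" "D dvd p - 1" and k: "2 \<le> k" "k < D" and large: "1 + D * k < p - 1"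
  obtains as where "length as = k" "set as \<subseteq> carrier F - {\<zero>}" "distinct as"
    "\<And>a. a \<in> set as \<Longrightarrow> a [^] ((p - 1) div D) \<noteq> \<one>" "foldr (\<otimes>) as \<one> = \<one>"
proof -
  obtain w where w: "w \<in> carrier F" "w \<noteq> \<zero>" "\<And>i::nat. w [^] i = \<one> \<longleftrightarrow> (p - 1) dvd i" using exists_generator by blast
  define e where "e = (p - 1) div D"
  have pe: "p - 1 = D * e" using D(2) by (simp add: e_def)
  have e0: "0 < e" using large pe by (cases e) auto
  define S where "S = (\<Sum>j<k - 1. 1 + D * j)"
  \<comment> \<open>The last exponent is \<open>- S\<close> modulo \<open>p - 1\<close>, written as
    a natural number.\<close>
  define E where "E j = (if j < k - 1 then 1 + D * j else (p - 1) * S - S)" for j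
  have p2: "2 \<le> p - 1" using large k D prime_ge_2_nat[OF D(1)] by simp
  have S_mod: "S = (k - 1) + D * (\<Sum>j<k - 1. j)"
    unfolding S_def sum.distrib sum_distrib_left by simp
  have ES: "E (k - 1) + S = (p - 1) * S" using p2 by (simp add: E_def)
  have wc: "w [^] i \<in> carrier F" "w [^] i \<noteq> \<zero>" for i :: nat
    using w by (induction i) (auto simp: integral_iff)
  have pw_eq: "w [^] i = w [^] j \<longleftrightarrow> (p - 1) dvd j - i" if "i \<le> j" for i j :: nat
  proof -
    have "w [^] j = w [^] i \<otimes> w [^] (j - i)" using w that by (simp add: nat_pow_mult)
    then have "w [^] i = w [^] j \<longleftrightarrow> w [^] i \<otimes> \<one> = w [^] i \<otimes> w [^] (j - i)" using wc by simp
    also have "\<dots> \<longleftrightarrow> \<one> = w [^] (j - i)" using wc by (intro m_lcancel) auto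
    finally show ?thesis using w(3)[of "j - i"] by auto
  qed
  have small: "\<not> D dvd i" if "0 < i" "i < D" for i using that by (auto dest: dvd_imp_le)
  have DE: "\<not> D dvd E j" if "j < k" for j
  proof (cases "j < k - 1")
    case True
    have "D dvd 1 + D * j \<longleftrightarrow> D dvd 1" by (rule dvd_add_left_iff) simp
    moreover have "\<not> D dvd 1" using D(1) by auto
    ultimately show ?thesis using True by (simp only: E_def if_True simp_thms)
  next
    case False
    have j: "j = k - 1" using False that by simp
    show ?thesis
    proof
      assume "D dvd E j"
      moreover have "D dvd (p - 1) * S" using D(2) by simp
      ultimately have "D dvd S" using ES j by (metis dvd_add_right_iff)
      then have "D dvd k - 1" using S_mod by (simp add: dvd_add_left_iff)
      moreover have "0 < k - 1" "k - 1 < D" using k by linarith+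
      ultimately show False using small by blast
    qed
  qed
  have nonpow: "(w [^] E j) [^] e \<noteq> \<one>" if "j < k" for j
  proof
    assume "(w [^] E j) [^] e = \<one>"
    then have "(p - 1) dvd E j * e" using w(3)[of "E j * e"] w(1) by (simp add: nat_pow_pow)
    then have "D * e dvd E j * e" unfolding pe .
    then show False using DE[OF that] e0 by simp
  qed
  have inj: "w [^] E i \<noteq> w [^] E j" if ij: "i < j" "j < k" for i j
  proof (cases "j < k - 1")
    case True
    have "E i < E j" "E j < p - 1"
    proof -
      show "E i < E j" using True ij prime_gt_0_nat[OF D(1)] by (simp add: E_def)
      have "D * j \<le> D * k" using ij by simp
      moreover have "E j = 1 + D * j" using True by (simp add: E_def)
      ultimately show "E j < p - 1" using large by linarith
    qed
    then have "\<not> (p - 1) dvd E j - E i" by (auto dest: dvd_imp_le)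
    then show ?thesis using pw_eq[of "E i" "E j"] \<open>E i < E j\<close> by simp
  next
    case False
    have j: "j = k - 1" using False ij by simp
    show ?thesis
    proof
      assume eq: "w [^] E i = w [^] E j"
      have "w [^] (E i + S) = w [^] E j \<otimes> w [^] S" using w by (simp add: nat_pow_mult[symmetric] eq)
      also have "\<dots> = w [^] ((p - 1) * S)" using w ES j by (simp add: nat_pow_mult)
      also have "\<dots> = \<one>" using w(3) by simp
      finally have "(p - 1) dvd E i + S" using w(3) by simp
      then have "D dvd E i + S" using D(2) dvd_trans by blast
      moreover have "E i + S = k + D * (i + (\<Sum>j<k - 1. j))" using ij j S_mod k by (simp add: E_def algebra_simps)
      ultimately have "D dvd k" by (simp add: dvd_add_left_iff)
      moreover have "0 < k" "k < D" using k by linarith+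
      ultimately show False using small by blast
    qed
  qed
  define as where "as = map (\<lambda>j. w [^] E j) [0..<k]"
  show ?thesis
  proof
    show "length as = k" by (simp add: as_def)
    show "set as \<subseteq> carrier F - {\<zero>}" using wc by (auto simp: as_def)
    show "distinct as"
      unfolding as_def distinct_map using inj by (auto simp: inj_on_def) (metis linorder_neqE_nat)
    show "a [^] ((p - 1) div D) \<noteq> \<one>" if "a \<in> set as" for a
      using that nonpow by (auto simp: as_def e_def)
    have "foldr (\<otimes>) (map (\<lambda>j. w [^] E j) js) \<one> = w [^] sum_list (map E js)" for js
      using w(1) by (induction js) (auto simp: nat_pow_mult)
    then have "foldr (\<otimes>) as \<one> = w [^] (\<Sum>j<k. E j)"
      by (simp add: as_def sum_list_sum_nth atLeast0LessThan interv_sum_list_conv_sum_set_nat)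
    also have "(\<Sum>j<k. E j) = (\<Sum>j<k - 1. E j) + E (k - 1)"
      using k by (cases k) auto
    also have "(\<Sum>j<k - 1. E j) = S" by (simp add: S_def E_def)
    finally show "foldr (\<otimes>) as \<one> = \<one>" using ES w(3) by (simp add: add.commute)
  qed
qed

end

context field
begin

lemma hd_foldr_mult:
  assumes "\<forall>f\<in>set fs. f \<in> carrier (poly_ring R) \<and> f \<noteq> [] \<and> hd f = \<one>"
  shows "hd (foldr (\<otimes>\<^bsub>poly_ring R\<^esub>) fs \<one>\<^bsub>poly_ring R\<^esub>) = \<one>"
  using assms
proof (induction fs)
  case (Cons f fs)
  define r where "r = foldr (\<otimes>\<^bsub>poly_ring R\<^esub>) fs \<one>\<^bsub>poly_ring R\<^esub>"
  have r: "r \<in> carrier (poly_ring R)" "r \<noteq> []" "hd r = \<one>"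
    using Cons foldr_mult_closed[of fs] length_foldr_mult[of fs] unfolding r_def by auto
  have "hd (f \<otimes>\<^bsub>poly_ring R\<^esub> r) = hd f \<otimes> hd r"
    unfolding univ_poly_mult
    by (rule poly_mult_lead_coeff[OF carrier_is_subring]) (use Cons.prems r in \<open>auto simp: univ_poly_carrier\<close>)
  then show ?case using Cons.prems r by (simp add: r_def)
qed (simp add: univ_poly_one)

lemma const_term_foldr_mult:
  assumes "set fs \<subseteq> carrier (poly_ring R)"
  shows "const_term (foldr (\<otimes>\<^bsub>poly_ring R\<^esub>) fs \<one>\<^bsub>poly_ring R\<^esub>) = foldr (\<otimes>) (map const_term fs) \<one>"
  using assms
proof (induction fs)
  case (Cons f fs)
  then show ?case
    using const_term_simprules_shell(2)[OF carrier_is_subring, of f] foldr_mult_closed[of fs] by simp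
qed (simp add: univ_poly_one const_term_def)

lemma const_term_binom_poly: "a \<in> carrier R \<Longrightarrow> const_term (binom_poly D a) = \<ominus> a"
  using const_term_eq_last[of "\<one> # replicate (D - 1) \<zero>" "\<ominus> a"] by (auto simp: binom_poly_def set_replicate_conv_if)

lemma foldr_minus:
  assumes "set as \<subseteq> carrier R"
  shows "foldr (\<otimes>) (map (\<lambda>a. \<ominus> a) as) \<one> = (\<ominus> \<one>) [^] length as \<otimes> foldr (\<otimes>) as \<one>"
  using assms
proof (induction as)
  case (Cons a as)
  have "foldr (\<otimes>) as \<one> \<in> carrier R" using Cons.prems by (induction as) auto
  then show ?case using Cons by (simp add: l_minus r_minus m_lcomm)
qed simp

lemma minus_one_pow_even: "even m \<Longrightarrow> (\<ominus> \<one>) [^] (m::nat) = \<one>"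
proof -
  assume "even m"
  then obtain l where l: "m = 2 * l" ..
  have "(\<ominus> \<one>) [^] (2::nat) = \<one>" by (simp add: numeral_2_eq_2 l_minus)
  then have "((\<ominus> \<one>) [^] (2::nat)) [^] l = \<one>" by simp
  then show ?thesis by (simp add: nat_pow_pow l)
qed

end

context finite_field_dim
begin

text \<open>The element is the companion matrix of the product \<open>?Q\<close> of the factors. Its
  determinant is \<open>(-1)^n\<close> times the constant term of \<open>?Q\<close>, and the
  hypothesis on the constant terms makes this 1.\<close>

lemma exists_sharp_character:
  assumes k: "0 < length fs" "length fs \<le> D" "n = length fs * D"
    and fs: "\<And>f. f \<in> set fs \<Longrightarrow> f \<in> carrier PR \<and> ring_irreducible\<^bsub>PR\<^esub> f \<and> length f = D + 1 \<and> hd f = \<one>"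
    and roots: "card (\<Union>f\<in>set fs. ext_roots alg_closure indexed_const f) = n"
    and const: "foldr (\<otimes>) (map const_term fs) \<one> = (\<ominus> \<one>) [^] n"
  obtains \<chi> g where "unipotent_character n F \<chi>" "regular_semisimple n F g"
    "product_of_irreducibles F (length fs) (char_poly_over F g)" "cmod (\<chi> g) = fact (length fs)"
proof -
  interpret UP: principal_domain PR by (rule poly_ring_principal)
  let ?Q = "foldr (\<otimes>\<^bsub>PR\<^esub>) fs \<one>\<^bsub>PR\<^esub>"
  have car: "set fs \<subseteq> carrier PR" using fs by auto
  have ne: "f \<noteq> []" if "f \<in> set fs" for f using fs[OF that] by auto
  have "?Q \<noteq> []" "length ?Q - 1 = (\<Sum>j<length fs. length (fs ! j) - 1)"
    using length_foldr_mult[of fs] car ne by auto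
  moreover have "(\<Sum>j<length fs. length (fs ! j) - 1) = (\<Sum>j<length fs. D)"
    by (rule sum.cong) (use fs in auto)
  ultimately have Q: "?Q \<noteq> []" "length ?Q = n + 1" using k(3) by (auto simp: neq_Nil_conv)
  have hdQ: "hd ?Q = \<one>" using hd_foldr_mult[of fs] fs ne by blast
  have QP: "?Q \<in> carrier PR" by (rule foldr_mult_closed[OF car])
  have Qset: "set ?Q \<subseteq> carrier F" using QP polynomial_incl univ_poly_carrier by blast
  define bs where "bs = rev (tl ?Q)"
  have Qbs: "?Q = \<one> # rev bs" using Q(1) hdQ by (cases ?Q) (auto simp: bs_def)
  have bs: "length bs = n" "set bs \<subseteq> carrier F" "bs \<noteq> []"
    using Q Qset n_pos Qbs by auto
  define g where "g = companion_over bs"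
  have g: "g \<in> mats F n n" using companion_over_mats[OF bs(2)] bs(1) by (simp add: g_def)
  have cp: "char_poly_over F g = ?Q" using char_poly_companion_over[OF bs(2)] Qbs by (simp add: g_def)
  have hdbs: "hd bs = (\<ominus> \<one>) [^] n"
  proof -
    have "?Q = (\<one> # rev (tl bs)) @ [hd bs]" using Qbs bs(3) by (cases bs) auto
    then have "const_term ?Q = hd bs"
      using const_term_eq_last[of "\<one> # rev (tl bs)" "hd bs"] bs(2,3) by (cases bs) auto
    then show ?thesis using const_term_foldr_mult[OF car] const by simp
  qed
  have "det_over F g = (\<ominus> \<one>) [^] (n - 1) \<otimes> \<ominus> ((\<ominus> \<one>) [^] n)"
    using det_companion_over[OF bs(2,3)] bs(1) hdbs by (simp add: g_def)
  also have "\<dots> = (\<ominus> \<one>) [^] (n - 1) \<otimes> ((\<ominus> \<one>) \<otimes> (\<ominus> \<one>) [^] n)" by (simp add: l_minus)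
  also have "\<dots> = (\<ominus> \<one>) [^] (n + n)"
  proof -
    have "(\<ominus> \<one>) [^] (n - 1) \<otimes> ((\<ominus> \<one>) \<otimes> (\<ominus> \<one>) [^] n) = ((\<ominus> \<one>) [^] (n - 1) \<otimes> (\<ominus> \<one>)) \<otimes> (\<ominus> \<one>) [^] n"
      by (simp only: m_assoc nat_pow_closed a_inv_closed one_closed)
    also have "(\<ominus> \<one>) [^] (n - 1) \<otimes> (\<ominus> \<one>) = (\<ominus> \<one>) [^] n" using n_pos by (cases n) auto
    finally show ?thesis by (simp add: nat_pow_mult)
  qed
  also have "\<dots> = \<one>" by (rule minus_one_pow_even) simp
  finally have gSL: "g \<in> carrier (SL n F)" using g by (simp add: SL_def mats_iff_elements)
  let ?L = "alg_closure" and ?h = "indexed_const"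
  have Lf: "field ?L" using alg_closureE(1) by (simp add: algebraic_closure_def)
  have h: "?h \<in> Ring.ring_hom F ?L" by (rule alg_closureE(2))
  interpret AL: field ?L by (rule Lf)
  have "ext_roots ?L ?h ?Q = {x. AL.is_root (map ?h ?Q) x}"
    using Q(1) by (auto simp: ext_roots_def AL.is_root_def)
  then have reg: "regular_semisimple n F g"
    using gSL roots ext_roots_foldr[OF Lf h car] by (simp add: regular_semisimple_def cp)
  have facs: "set fs \<subseteq> carrier (mult_of PR)" "factors (mult_of PR) fs (char_poly_over F g)"
    using fs ne UP.ring_irreducibleE(3) by (auto simp: factors_def cp univ_poly_zero)
  have "product_of_irreducibles F (length fs) (char_poly_over F g)"
    using facs unfolding product_of_irreducibles_def by blast
  moreover have po: "primary_operator F VM (mat_vec F g) fs n"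
    by (rule primary_operator_if_regular[OF reg facs])
  have ds: "map (\<lambda>f. length f - 1) fs = replicate (length fs) D"
    using fs by (intro nth_equalityI) auto
  obtain \<chi> where "unipotent_character n F \<chi>" "cmod (\<chi> g) = fact (length fs)"
    using exists_unipotent_character_rectangle[OF k(3,1,2) gSL] perm_char_eq_fillings[OF po] unfolding ds by metis
  ultimately show ?thesis using that reg by blast
qed

end

lemma exists_sharp:
  assumes "0 < k"
  shows "\<exists>(n::nat) (q::nat) (F :: nat ring) \<chi> g.
    n \<ge> k \<and> primepow q \<and> Ring.field F \<and> card (carrier F) = q \<and>
    unipotent_character n F \<chi> \<and> regular_semisimple n F g \<and>
    product_of_irreducibles F k (char_poly_over F g) \<and> cmod (\<chi> g) = fact k"
proof (cases "k = 1")
  \<comment> \<open>A single constant with product 1 would be 1 and thus a \<open>D\<close>-th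
    power, so this case is realized separately, with \<open>n = 1\<close> over the field of two
    elements and the polynomial \<open>t - 1\<close>.\<close>
  case True
  interpret prime_field "residue_field 2" 2 by (rule prime_field_residue_field) simp
  interpret FD: finite_field_dim "residue_field 2" 1
    by unfold_locales (use finite_carrier in auto)
  let ?F = "residue_field 2" and ?b = "binom_poly 1 \<one>\<^bsub>residue_field 2\<^esub>"
  let ?L = "alg_closure" and ?h = "indexed_const"
  interpret UP: domain "poly_ring ?F" by (rule poly_ring_domain)
  have L: "field ?L" using alg_closureE(1) by (simp add: algebraic_closure_def)
  have h: "?h \<in> Ring.ring_hom ?F ?L" by (rule alg_closureE(2))
  interpret L: field ?L by (rule L)
  interpret H: ring_hom_ring ?F ?L ?h using h by unfold_locales
  have roots: "ext_roots ?L ?h ?b = {\<one>\<^bsub>?L\<^esub>}"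
  proof -
    have "ext_roots ?L ?h ?b = {x \<in> carrier ?L. x [^]\<^bsub>?L\<^esub> (1::nat) = \<one>\<^bsub>?L\<^esub>}"
      using ext_roots_binom_poly[OF L h _ one_closed, of 1] unfolding H.hom_one by (simp only: zero_less_one)
    also have "\<dots> = {x \<in> carrier ?L. x = \<one>\<^bsub>?L\<^esub>}"
      by (rule Collect_cong) (metis L.nat_pow_eone)
    also have "\<dots> = {\<one>\<^bsub>?L\<^esub>}" using L.one_closed by blast
    finally show ?thesis .
  qed
  have irr: "ring_irreducible\<^bsub>poly_ring ?F\<^esub> ?b"
    using degree_one_imp_pirreducible[OF carrier_is_subfield binom_poly_closed[OF one_closed]] length_binom_poly[of 1] by simp
  obtain \<chi> g where "unipotent_character 1 ?F \<chi>" "regular_semisimple 1 ?F g"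
    "product_of_irreducibles ?F 1 (char_poly_over ?F g)" "cmod (\<chi> g) = fact 1"
  proof -
    have "hd ?b = \<one>\<^bsub>?F\<^esub>" by (simp add: binom_poly_def)
    then show ?thesis
      using that FD.exists_sharp_character[of "[?b]" 1] roots irr binom_poly_closed[OF one_closed, of 1]
      by (auto simp: length_binom_poly const_term_binom_poly)
  qed
  then show ?thesis
    using field_axioms card_F True by (intro exI[of _ "1::nat"] exI[of _ "2::nat"] exI[of _ ?F] exI[of _ \<chi>] exI[of _ g])
      (auto simp: primepow_prime)
next
  case False
  then have k: "2 \<le> k" using assms by simp
  \<comment> \<open>\<open>D > k\<close> has two purposes: the rows of the rectangle have length at
    least \<open>k\<close>, and neither \<open>k - 1\<close> nor \<open>k\<close> is a multiple of
    \<open>D\<close> when the constants are chosen. It also makes \<open>D\<close> odd.\<close>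
  obtain D where D: "prime D" "k < D" using bigger_prime by blast
  obtain p where pr: "prime p" "D dvd p - 1" "D * k + 2 < p" using exists_prime_cong_1[OF D(1)] by blast
  interpret prime_field "residue_field p" p by (rule prime_field_residue_field[OF pr(1)])
  let ?F = "residue_field p"
  obtain as where as: "length as = k" "set as \<subseteq> carrier ?F - {\<zero>\<^bsub>?F\<^esub>}" "distinct as"
    "\<And>a. a \<in> set as \<Longrightarrow> a [^]\<^bsub>?F\<^esub> ((p - 1) div D) \<noteq> \<one>\<^bsub>?F\<^esub>" "foldr (\<otimes>\<^bsub>?F\<^esub>) as \<one>\<^bsub>?F\<^esub> = \<one>\<^bsub>?F\<^esub>"
  proof -
    have "1 + D * k < p - 1" using pr(3) by linarith
    then show ?thesis using exists_nonpowers[OF D(1) pr(2) k D(2)] that by blast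
  qed
  define n where "n = k * D"
  interpret FD: finite_field_dim ?F n
    by unfold_locales (use finite_carrier k D in \<open>auto simp: n_def\<close>)
  let ?L = "alg_closure" and ?h = "indexed_const"
  have L: "field ?L" using alg_closureE(1) by (simp add: algebraic_closure_def)
  have h: "?h \<in> Ring.ring_hom ?F ?L" by (rule alg_closureE(2))
  have D0: "0 < D" using D(2) by simp
  define fs where "fs = map (binom_poly D) as"
  have asF: "a \<in> carrier ?F" "a \<noteq> \<zero>\<^bsub>?F\<^esub>" if "a \<in> set as" for a using as(2) that by auto
  note irr = irreducible_binom_poly[OF D(1) pr(2) asF(1) as(4) asF(2)]
  have fs: "f \<in> carrier (poly_ring ?F) \<and> ring_irreducible\<^bsub>poly_ring ?F\<^esub> f \<and> length f = D + 1 \<and> hd f = \<one>\<^bsub>?F\<^esub>"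
    if f: "f \<in> set fs" for f
  proof -
    obtain a where a: "a \<in> set as" "f = binom_poly D a" using f by (auto simp: fs_def)
    show ?thesis
      unfolding a(2) using binom_poly_closed[OF asF(1)[OF a(1)]] irr(1)[of a] a(1) length_binom_poly[OF D0]
      by (auto simp: binom_poly_def)
  qed
  have "card (\<Union>f\<in>set fs. ext_roots ?L ?h f) = (\<Sum>a\<in>set as. card (ext_roots ?L ?h (binom_poly D a)))"
  proof -
    have "card (\<Union>a\<in>set as. ext_roots ?L ?h (binom_poly D a)) = (\<Sum>a\<in>set as. card (ext_roots ?L ?h (binom_poly D a)))"
    proof (rule card_UN_disjoint)
      show "\<forall>a\<in>set as. finite (ext_roots ?L ?h (binom_poly D a))"
        using card_ext_roots(1)[OF L h binom_poly_closed] asF by (auto simp: binom_poly_def)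
      show "\<forall>a\<in>set as. \<forall>b\<in>set as. a \<noteq> b \<longrightarrow> ext_roots ?L ?h (binom_poly D a) \<inter> ext_roots ?L ?h (binom_poly D b) = {}"
        using ext_roots_binom_poly[OF L h D0] asF inj_onD[OF hom_injective[OF L h]] by fastforce
    qed simp
    then show ?thesis by (simp add: fs_def)
  qed
  also have "\<dots> = n" using irr(2) as(1,3) by (simp add: n_def distinct_card)
  finally have roots: "card (\<Union>f\<in>set fs. ext_roots ?L ?h f) = n" .
  have const: "foldr (\<otimes>\<^bsub>?F\<^esub>) (map const_term fs) \<one>\<^bsub>?F\<^esub> = (\<ominus>\<^bsub>?F\<^esub> \<one>\<^bsub>?F\<^esub>) [^]\<^bsub>?F\<^esub> n"
  proof -
    have "map const_term fs = map (\<lambda>a. \<ominus>\<^bsub>?F\<^esub> a) as" using asF by (auto simp: fs_def const_term_binom_poly)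
    then have 1: "foldr (\<otimes>\<^bsub>?F\<^esub>) (map const_term fs) \<one>\<^bsub>?F\<^esub> = (\<ominus>\<^bsub>?F\<^esub> \<one>\<^bsub>?F\<^esub>) [^]\<^bsub>?F\<^esub> k"
      using foldr_minus[of as] as(1,2,5) by auto
    \<comment> \<open>The constant terms \<open>- a\<close> contribute the sign
      \<open>(-1)^k\<close>, while determinant 1 asks for \<open>(-1)^n\<close> with
      \<open>n = k * D\<close>; these agree for odd \<open>D\<close>.\<close>
    have "odd D" using D k prime_odd_nat[of D] by simp
    then obtain d where d: "D = Suc d" "even d" by (cases D) auto
    have "(\<ominus>\<^bsub>?F\<^esub> \<one>\<^bsub>?F\<^esub>) [^]\<^bsub>?F\<^esub> n = (\<ominus>\<^bsub>?F\<^esub> \<one>\<^bsub>?F\<^esub>) [^]\<^bsub>?F\<^esub> (k * d) \<otimes>\<^bsub>?F\<^esub> (\<ominus>\<^bsub>?F\<^esub> \<one>\<^bsub>?F\<^esub>) [^]\<^bsub>?F\<^esub> k"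
      by (simp add: n_def d nat_pow_mult add.commute)
    then show ?thesis using 1 minus_one_pow_even[of "k * d"] d(2) by simp
  qed
  have len: "length fs = k" by (simp add: fs_def as(1))
  obtain \<chi> g where "unipotent_character n ?F \<chi>" "regular_semisimple n ?F g"
    "product_of_irreducibles ?F (length fs) (char_poly_over ?F g)" "cmod (\<chi> g) = fact (length fs)"
  proof (rule FD.exists_sharp_character[OF _ _ _ fs roots const])
    show "0 < length fs" "length fs \<le> D" "n = length fs * D" using len k D(2) by (auto simp: n_def)
  qed (use that in auto)
  then show ?thesis
    using field_axioms card_F pr(1) D0 len
    by (intro exI[of _ n] exI[of _ p] exI[of _ ?F] exI[of _ \<chi>] exI[of _ g]) (auto simp: primepow_prime n_def)
qed

theorem corollary4:
  fixes k :: nat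
  assumes "k > 0"
  shows "(\<forall>(n::nat) (q::nat) (F :: 'f ring) \<chi> g.
            n \<ge> k \<and> primepow q \<and> Ring.field F \<and> card (carrier F) = q \<and>
            unipotent_character n F \<chi> \<and> regular_semisimple n F g \<and>
            product_of_irreducibles F k (char_poly_over F g) \<longrightarrow>
              cmod (\<chi> g) \<le> fact k) \<and>
         (\<exists>(n::nat) (q::nat) (F :: nat ring) \<chi> g.
            n \<ge> k \<and> primepow q \<and> Ring.field F \<and> card (carrier F) = q \<and>
            unipotent_character n F \<chi> \<and> regular_semisimple n F g \<and>
            product_of_irreducibles F k (char_poly_over F g) \<and>
              cmod (\<chi> g) = fact k)"
proof (intro conjI allI impI)
  fix n q and F :: "'f ring" and \<chi> g
  assume *: "n \<ge> k \<and> primepow q \<and> Ring.field F \<and> card (carrier F) = q \<and>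
    unipotent_character n F \<chi> \<and> regular_semisimple n F g \<and>
    product_of_irreducibles F k (char_poly_over F g)"
  interpret field F using * by blast
  \<comment> \<open>Positive cardinality implies that the carrier is finite, because
    \<open>card\<close> is 0 on infinite sets.\<close>
  have "0 < card (carrier F)" using * primepow_gt_0_nat by blast
  then interpret finite_field_dim F n
    by unfold_locales (use * assms card_ge_0_finite in auto)
  show "cmod (\<chi> g) \<le> fact k" using * regular_character_bound by blast
qed (rule exists_sharp[OF assms])

end
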